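(* Let $F$ be a field of characteristic zero, $k\ge 2$, and let $L=\operatorname{Der}(M_k(F))$ be the Lie algebra of all derivations of $M_k(F)$, identified with $\mathrm{sl}_k(F)$ and acting on $M_k(F)$. For $2\le p\le k$ let $c_{p,k}\in Z(U(L))$ be the $p$th Casimir element, $\lambda_{p,k}$ its eigenvalue for the adjoint representation, $z_{p,k}:=c_{p,k}-\lambda_{p,k}$, and let $$z:=e_{12}^3+e_{12}z_{2,k}+e_{13}z_{3,k}+\cdots+e_{1k}z_{k,k}\in U(L).$$ Let $\rho_{ab}\in U(L)$ be chosen preimages under $\phi$ of the endomorphisms $\varphi_{ab}$ (so $\phi(\rho_{ab})=\varphi_{ab}$) for $a,b\in\mathcal S$ or $a=b=g$, and put $\rho_{e_{12}(e_{21}+e_{31})}:=\rho_{e_{12}e_{21}}+\rho_{e_{12}e_{31}}$. Then the $T_L$-ideal $\operatorname{Id}^L(M_k(F))$ of differential identities of $M_k(F)$ is generated by the following two $L$-polynomials: (1) $x^z$; (2) $[x^{\rho_{gg}},y^{\rho_{gg}+\rho_{e_{12}e_{12}}}]+x^{\rho_{e_{12}e_{12}}}y^{\rho_{e_{12}(e_{21}+e_{31})}}-y^{\rho_{e_{12}e_{12}}}x^{\rho_{e_{12}e_{21}}}$, where the term $\rho_{e_{12}e_{31}}$ in the exponent appears only if $k\ge 3$ (for $k=2$ the exponent $\rho_{e_{12}(e_{21}+e_{31})}$ is replaced by $\rho_{e_{12}e_{21}}$). Moreover, for all $n\geq 1$, $$c_n^L(M_k(F))=k^{2(n+1)}-(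k^2-1)(n+1).$$
   Context: Algebras are associative, not necessarily unital. The identification $\mathrm{sl}_k(F)\cong\operatorname{Der}(M_k(F))$ (traceless matrices with the commutator bracket) is $c\mapsto\operatorname{ad}_c$, $\operatorname{ad}_c(x)=cx-xc$. $e_{ij}$ are the matrix units, $h_i:=e_{ii}-e_{i+1,i+1}$ ($1\le i<k$), $g:=I_k$, $\mathcal S:=\{e_{ij}\mid i\ne j\}\cup\{h_1,\dots,h_{k-1}\}$ (a basis of $\mathrm{sl}_k(F)$), $\mathcal M:=\mathcal S\cup\{g\}$ (a basis of $M_k(F)$). For $a,b\in\mathcal M$, $\varphi_{ab}$ is the linear endomorphism of $M_k(F)$ sending $a$ to $b$ and all other elements of $\mathcal M$ to $0$. $U(L)$ is the universal enveloping algebra of $L$ and $\phi:U(L)\to\operatorname{End}_F(M_k(F))$ is the unital algebra homomorphism extending the action of $L$ by derivations; its image $U$ has basis $\{\varphi_{ab}\}_{a,b\in\mathcal S}\cup\{\varphi_{gg}\}$. Casimir elements: put $x^i_j:=e_{ij}$ for $i\ne j$, and $x^i_i:=\frac1k\sum_{j=1}^{k-1}\alpha_{ij}h_j$ with $\alpha_{ij}:=k-j$ if $j\ge i$ and $\alpha_{ij}:=-j$ if $j<i$. For $2\le p\le k$, $c_{p,k}:=\sum_{i_1,\dots,i_p=1}^k x^{i_1}_{i_2}x^{i_2}_{i_3}\cdots x^{i_p}_{i_1}$ (product in $U(L)$), a central element of $U(L)$; it acts in the adjoint representation of $L$ as the scalar $\lambda_{p,k}$, where $\lambda_{p,k}=k\left(\frac{k^p-1}{k^2-1}+1\right)$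 for $p$ even and $\lambda_{p,k}=k^2\,\frac{k^{p-1}-1}{k^2-1}$ for $p$ odd. An $L$-algebra is an algebra $B$ with a Lie algebra homomorphism $L\to\operatorname{Der}(B)$; it extends to a unital homomorphism $\phi_B:U(L)\to\operatorname{End}_F(B)$, and one writes $b^u:=\phi_B(u)(b)$. Exponents are multiplied in $U(L)^{\mathrm{op}}$, i.e. $(b^u)^v=b^{uv}$ with $uv$ the opposite product. An $L$-homomorphism is an algebra homomorphism commuting with all $b\mapsto b^u$. The free $L$-algebra $F\langle X|L\rangle$ on $X=\{x_1,x_2,\dots\}$ is the (nonunital) associative algebra generated by symbols $x_i^u$ ($i\ge1$, $u\in U(L)$) that are linear in $u$, with $x_i^1=x_i$; it is free on $\{x_i^e\}$ for $e$ in a basis of $U(L)$, and $\delta\in L$ acts as the derivation with $x_i^u\mapsto (x_i^u)^\delta=x_i^{u\delta}$ (product of exponents in $U(L)^{\mathrm{op}}$). Its elements are called $L$-polynomials; $x,y$ denote two distinct variables of $X$. A $T_L$-ideal is a two-sided ideal invariant under the $L$-action and under all $L$-endomorphisms of $F\langle X|L\rangle$; "generated" means as a $T_L$-ideal. $\operatorname{Id}^L(B)$ is the set of $f\in F\langle X|L\rangle$ vanishing under every substitution $x_i\mapsto b_i\in B$ (with $x_i^u\mapsto b_i^u$). $P_n^L$ is the span of the multilinear $L$-polynomials $x_{\sigma(1)}^{u_1}\cdots x_{\sigma(n)}^{u_n}$, $\sigma\in S_n$, $u_i\in U(L)$, and $c_n^L(B):=\dim_F P_n^L/(P_n^L\cap\operatorname{Id}^L(B))$.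 $[f,h]=fh-hf$. *)

theory Defs
  imports "HOL-Analysis.Analysis" "HOL-Library.Poly_Mapping"
begin

section \<open>Free associative algebras\<close>

datatype 'x word = Word (letters: "'x list")

instantiation word :: (type) monoid_add
begin

definition zero_word :: "'a word" where "0 = Word []"
definition plus_word :: "'a word \<Rightarrow> 'a word \<Rightarrow> 'a word"
  where "v + w = Word (letters v @ letters w)"

instance by standard (auto simp: zero_word_def plus_word_def)

end

lemma letters_zero [simp]: "letters 0 = []"
  by (simp add: zero_word_def)

lemma letters_plus [simp]: "letters (v + w) = letters v @ letters w"
  by (simp add: plus_word_def)

text \<open>
  The ring \<open>'x word \<Rightarrow>\<^sub>0 'a\<close> is the free unital associative algebra on the symbols \<open>'x\<close>
  over the field \<open>'a\<close>; the scalars are the elements \<^term>\<open>Poly_Mapping.single 0 c\<close>.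
\<close>

abbreviation symb :: "'x \<Rightarrow> 'x word \<Rightarrow>\<^sub>0 'a::field"
  where "symb x \<equiv> Poly_Mapping.single (Word [x]) 1"

abbreviation const :: "'a::field \<Rightarrow> 'x word \<Rightarrow>\<^sub>0 'a"
  where "const c \<equiv> Poly_Mapping.single 0 c"

definition lin_ext ::
  "('a::field \<Rightarrow> 'b \<Rightarrow> 'b) \<Rightarrow> ('x word \<Rightarrow> 'b) \<Rightarrow> ('x word \<Rightarrow>\<^sub>0 'a) \<Rightarrow> 'b::comm_monoid_add"
  where "lin_ext sc f p =
    (\<Sum>w\<in>Poly_Mapping.keys p. sc (Poly_Mapping.lookup p w) (f w))"

lemma free_algebra_induct [case_names zero single add]:
  assumes "P 0" "\<And>w c. P (Poly_Mapping.single w c)" "\<And>p q. P p \<Longrightarrow> P q \<Longrightarrow> P (p + q)"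
  shows "P (p :: 'x word \<Rightarrow>\<^sub>0 'a::field)"
proof (induction p rule: update_induct)
  case const
  then show ?case by (rule assms)
next
  case (update f a b)
  have "Poly_Mapping.update a b f = f + Poly_Mapping.single a b"
    using update(1)
    by (intro poly_mapping_eqI)
      (auto simp: lookup_update lookup_add lookup_single when_def in_keys_iff)
  then show ?case using assms update by auto
qed

context vector_space
begin

lemma lin_ext_superset:
  assumes "finite A" "Poly_Mapping.keys p \<subseteq> A"
  shows "lin_ext scale f p = (\<Sum>w\<in>A. scale (Poly_Mapping.lookup p w) (f w))"
  unfolding lin_ext_def using assms
  by (intro sum.mono_neutral_left) (auto simp: in_keys_iff)

lemma lin_ext_add: "lin_ext scale f (p + q) = lin_ext scale f p + lin_ext scale f q"
proof -
  let ?A = "Poly_Mapping.keys p \<union> Poly_Mapping.keys q"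
  have "Poly_Mapping.keys (p + q) \<subseteq> ?A" by (rule Poly_Mapping.keys_add)
  then show ?thesis
    by (simp add: lin_ext_superset[of ?A] lookup_add scale_left_distrib sum.distrib)
qed

lemma lin_ext_zero [simp]: "lin_ext scale f 0 = 0"
  by (simp add: lin_ext_def)

lemma lin_ext_single [simp]:
  "lin_ext scale f (Poly_Mapping.single w c) = scale c (f w)"
  by (cases "c = 0") (simp_all add: lin_ext_def)

lemma lin_ext_diff: "lin_ext scale f (p - q) = lin_ext scale f p - lin_ext scale f q"
  using lin_ext_add[of f "p - q" q] by (simp add: algebra_simps)

lemma lin_ext_one [simp]: "lin_ext scale f 1 = f 0"
  using lin_ext_single[of f 0 1] by simp

lemma lin_ext_mult:
  assumes "\<And>x y z. m (x + y) z = m x z + m y z" "\<And>x y z. m x (y + z) = m x y + m x z"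
    and "\<And>c x y. m (scale c x) y = scale c (m x y)" "\<And>c x y. m x (scale c y) = scale c (m x y)"
    and "\<And>v w. f (v + w) = m (f v) (f w)"
  shows "lin_ext scale f (p * q) = m (lin_ext scale f p) (lin_ext scale f q)"
proof -
  have m0: "m 0 x = 0" "m x 0 = 0" for x
    using assms(3)[of 0 0 x] assms(4)[of x 0 0] by auto
  show ?thesis
  proof (induction p rule: free_algebra_induct)
    case (single w c)
    show ?case
      by (induction q rule: free_algebra_induct)
        (auto simp: m0 assms mult_single lin_ext_add distrib_left)
  qed (auto simp: m0 assms lin_ext_add distrib_right)
qed

end

inductive_set ring_ideal :: "'r::ring_1 set \<Rightarrow> 'r set" for G where
  zero: "0 \<in> ring_ideal G"
| gen: "g \<in> G \<Longrightarrow> a * g * b \<in> ring_ideal G"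
| add: "p \<in> ring_ideal G \<Longrightarrow> q \<in> ring_ideal G \<Longrightarrow> p + q \<in> ring_ideal G"

lemma ring_ideal_base: "g \<in> G \<Longrightarrow> g \<in> ring_ideal G"
  using ring_ideal.gen[of g G 1 1] by simp

lemma ring_ideal_left: "p \<in> ring_ideal G \<Longrightarrow> r * p \<in> ring_ideal G"
  by (induction rule: ring_ideal.induct)
    (auto intro: ring_ideal.intros simp: distrib_left mult.assoc[symmetric])

lemma ring_ideal_right: "p \<in> ring_ideal G \<Longrightarrow> p * r \<in> ring_ideal G"
proof (induction rule: ring_ideal.induct)
  case (gen g a b)
  then show ?case using ring_ideal.gen[of g G a "b * r"] by (simp add: mult.assoc)
qed (auto intro: ring_ideal.intros simp: distrib_right)

lemma ring_ideal_uminus: "p \<in> ring_ideal G \<Longrightarrow> - p \<in> ring_ideal G"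
  using ring_ideal_left[of p G "-1"] by simp

lemma ring_ideal_diff: "p \<in> ring_ideal G \<Longrightarrow> q \<in> ring_ideal G \<Longrightarrow> p - q \<in> ring_ideal G"
  using ring_ideal.add[OF _ ring_ideal_uminus] by fastforce

lemma ring_ideal_trans:
  "p - q \<in> ring_ideal G \<Longrightarrow> q - r \<in> ring_ideal G \<Longrightarrow> p - r \<in> ring_ideal G"
  using ring_ideal.add[of "p - q" G "q - r"] by simp

lemma ring_ideal_sym: "p - q \<in> ring_ideal G \<Longrightarrow> q - p \<in> ring_ideal G"
  using ring_ideal_uminus[of "p - q" G] by simp

lemma ring_ideal_equivp: "equivp (\<lambda>p q. p - q \<in> ring_ideal G)"
  by (intro equivpI reflpI sympI transpI)
    (auto intro: ring_ideal.zero ring_ideal_sym ring_ideal_trans)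

lemma ring_ideal_cong_add:
  assumes "p - p' \<in> ring_ideal G" "q - q' \<in> ring_ideal G"
  shows "(p + q) - (p' + q') \<in> ring_ideal G"
  using ring_ideal.add[OF assms] by (simp add: algebra_simps)

lemma ring_ideal_cong_diff:
  assumes "p - p' \<in> ring_ideal G" "q - q' \<in> ring_ideal G"
  shows "(p - q) - (p' - q') \<in> ring_ideal G"
  using ring_ideal_diff[OF assms] by (simp add: algebra_simps)

lemma ring_ideal_cong_uminus:
  assumes "p - p' \<in> ring_ideal G"
  shows "(- p) - (- p') \<in> ring_ideal G"
  using ring_ideal_uminus[OF assms] by (simp add: algebra_simps)

lemma ring_ideal_cong_mult:
  assumes "p - p' \<in> ring_ideal G" "q - q' \<in> ring_ideal G"
  shows "p * q - p' * q' \<in> ring_ideal G"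
proof -
  have "(p - p') * q + p' * (q - q') \<in> ring_ideal G"
    using assms by (intro ring_ideal.add ring_ideal_left ring_ideal_right)
  then show ?thesis by (simp add: algebra_simps)
qed


section \<open>The Lie algebra of derivations of a matrix algebra\<close>

text \<open>
  The product of \<open>M\<^sub>k(F)\<close> is \<open>**\<close>, the size \<open>k\<close> is \<open>CARD('n)\<close>. The class instance \<open>*\<close> on
  \<open>vec\<close> is componentwise and not used.
\<close>

definition mat_scale :: "'a::field \<Rightarrow> 'a^'n^'n \<Rightarrow> 'a^'n^'n"
  where "mat_scale c A = (\<chi> i j. c * A $ i $ j)"

interpretation mat: vector_space mat_scale
  by standard (auto simp: mat_scale_def vec_eq_iff algebra_simps)

lemma mat_mult_bilinear:
  fixes x y z :: "'a::field^'n^'n"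
  shows "(x + y) ** z = x ** z + y ** z" "x ** (y + z) = x ** y + x ** z"
    "mat_scale c x ** y = mat_scale c (x ** y)" "x ** mat_scale c y = mat_scale c (x ** y)"
    "(x - y) ** z = x ** z - y ** z" "x ** (y - z) = x ** y - x ** z"
    "(- x) ** z = - (x ** z)" "x ** (- z) = - (x ** z)" "0 ** z = 0" "x ** 0 = 0"
  by (simp_all add: matrix_matrix_mult_def mat_scale_def vec_eq_iff algebra_simps
      sum.distrib sum_distrib_left sum_subtractf sum_negf)

definition mat_derivation :: "('a::field^'n^'n \<Rightarrow> 'a^'n^'n) \<Rightarrow> bool" where
  "mat_derivation D \<longleftrightarrow> Vector_Spaces.linear mat_scale mat_scale D \<and>
     (\<forall>A B. D (A ** B) = D A ** B + A ** D B)"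

lemma mat_linear_iff:
  "Vector_Spaces.linear mat_scale mat_scale D \<longleftrightarrow>
     (\<forall>A B. D (A + B) = D A + D B) \<and> (\<forall>c A. D (mat_scale c A) = mat_scale c (D A))"
  by (auto simp: Vector_Spaces.linear_def module_hom_def module_hom_axioms_def
      mat.vector_space_axioms mat.module_axioms)

typedef (overloaded) ('a::field, 'n::finite) der =
  "{D :: 'a^'n^'n \<Rightarrow> 'a^'n^'n. mat_derivation D}"
  morphisms der_apply Abs_der
  by (rule exI[of _ "\<lambda>_. 0"]) (simp add: mat_derivation_def mat_linear_iff mat_mult_bilinear)

setup_lifting type_definition_der

lemma mat_derivationI:
  assumes "\<And>A B. D (A + B) = D A + D B" "\<And>c A. D (mat_scale c A) = mat_scale c (D A)"
    and "\<And>A B. D (A ** B) = D A ** B + A ** D B"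
  shows "mat_derivation D"
  using assms by (simp add: mat_derivation_def mat_linear_iff)

lemma mat_derivationD:
  assumes "mat_derivation D"
  shows "D (A + B) = D A + D B" "D (mat_scale c A) = mat_scale c (D A)"
    and "D (A ** B) = D A ** B + A ** D B"
    and "D (A - B) = D A - D B" "D (- A) = - D A" "D 0 = 0"
proof -
  show a: "D (A + B) = D A + D B" for A B
    using assms by (simp add: mat_derivation_def mat_linear_iff)
  show "D (mat_scale c A) = mat_scale c (D A)" "D (A ** B) = D A ** B + A ** D B"
    using assms by (simp_all add: mat_derivation_def mat_linear_iff)
  show "D (A - B) = D A - D B" using a[of "A - B" B] by (simp add: algebra_simps)
  show 0: "D 0 = 0" using a[of 0 0] by simp
  show "D (- A) = - D A" using a[of A "- A"] 0 by (simp add: add_eq_0_iff)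
qed

lemmas mat_scale_simps =
  mat.scale_right_distrib mat.scale_right_diff_distrib mat.scale_minus_right

instantiation der :: (field, finite) ab_group_add
begin

lift_definition zero_der :: "('a, 'b) der" is "\<lambda>_. 0 :: 'a^'b^'b"
  by (rule mat_derivationI) (auto simp: mat_mult_bilinear)
lift_definition plus_der :: "('a, 'b) der \<Rightarrow> ('a, 'b) der \<Rightarrow> ('a, 'b) der"
  is "\<lambda>D E (A :: 'a^'b^'b). D A + E A :: 'a^'b^'b"
  by (rule mat_derivationI) (auto simp: mat_mult_bilinear mat_derivationD mat_scale_simps)
lift_definition minus_der :: "('a, 'b) der \<Rightarrow> ('a, 'b) der \<Rightarrow> ('a, 'b) der"
  is "\<lambda>D E (A :: 'a^'b^'b). D A - E A :: 'a^'b^'b"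
  by (rule mat_derivationI) (auto simp: mat_mult_bilinear mat_derivationD mat_scale_simps)
lift_definition uminus_der :: "('a, 'b) der \<Rightarrow> ('a, 'b) der"
  is "\<lambda>D (A :: 'a^'b^'b). - D A :: 'a^'b^'b"
  by (rule mat_derivationI) (auto simp: mat_mult_bilinear mat_derivationD mat_scale_simps)

instance by standard (transfer; simp add: fun_eq_iff algebra_simps)+

end

lift_definition der_scale :: "'a::field \<Rightarrow> ('a, 'n::finite) der \<Rightarrow> ('a, 'n) der"
  is "\<lambda>c D A. mat_scale c (D A)"
  by (rule mat_derivationI)
    (auto simp: mat_mult_bilinear mat_derivationD mat_scale_simps mult.commute)

lift_definition der_bracket ::
  "('a::field, 'n::finite) der \<Rightarrow> ('a, 'n) der \<Rightarrow> ('a, 'n) der"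
  is "\<lambda>D E (A :: 'a^'n^'n). D (E A) - E (D A)"
  by (rule mat_derivationI) (auto simp: mat_mult_bilinear mat_derivationD mat_scale_simps)

lift_definition ad :: "'a::field^'n^'n \<Rightarrow> ('a, 'n::finite) der"
  is "\<lambda>C A. C ** A - A ** C"
  by (rule mat_derivationI)
    (auto simp: mat_mult_bilinear mat_scale_simps matrix_mul_assoc)

interpretation der: vector_space der_scale
  by standard (transfer; simp add: fun_eq_iff mat_scale_simps mat.scale_left_distrib)+


section \<open>The universal enveloping algebra\<close>

definition ue_relations :: "(('a::field, 'n::finite) der word \<Rightarrow>\<^sub>0 'a) set" where
  "ue_relations =
     {symb (D + E) - symb D - symb E | D E. True} \<union>
     {symb (der_scale c D) - const c * symb D | c D. True} \<union>
     {symb D * symb E - symb E * symb D - symb (der_bracket D E) | D E. True}"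

quotient_type (overloaded) ('a, 'n) uea = "('a::field, 'n::finite) der word \<Rightarrow>\<^sub>0 'a" /
  "\<lambda>p q. p - q \<in> ring_ideal ue_relations"
  by (rule ring_ideal_equivp)

instantiation uea :: (field, finite) ring
begin

lift_definition zero_uea :: "('a, 'b) uea" is 0 .
lift_definition plus_uea :: "('a, 'b) uea \<Rightarrow> ('a, 'b) uea \<Rightarrow> ('a, 'b) uea" is "(+)"
  by (rule ring_ideal_cong_add)
lift_definition minus_uea :: "('a, 'b) uea \<Rightarrow> ('a, 'b) uea \<Rightarrow> ('a, 'b) uea" is "(-)"
  by (rule ring_ideal_cong_diff)
lift_definition uminus_uea :: "('a, 'b) uea \<Rightarrow> ('a, 'b) uea" is "uminus"
  by (rule ring_ideal_cong_uminus)
lift_definition times_uea :: "('a, 'b) uea \<Rightarrow> ('a, 'b) uea \<Rightarrow> ('a, 'b) uea" is "(*)"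
  by (rule ring_ideal_cong_mult)

instance
  by standard (transfer; simp add: algebra_simps ring_ideal.zero)+

end

instantiation uea :: (field, finite) "{one, power}"
begin
lift_definition one_uea :: "('a, 'b) uea" is 1 .
instance ..
end

instance uea :: (field, finite) monoid_mult
  by standard (transfer; simp add: ring_ideal.zero)+

lift_definition ue_scale :: "'a::field \<Rightarrow> ('a, 'n::finite) uea \<Rightarrow> ('a, 'n) uea"
  is "\<lambda>c p. const c * p"
  by (auto simp flip: right_diff_distrib intro: ring_ideal_left)

definition ue_of :: "('a::field, 'n::finite) der \<Rightarrow> ('a, 'n) uea"
  where "ue_of D = abs_uea (symb D)"

lemma const_commute: "p * const c = const c * (p :: 'x word \<Rightarrow>\<^sub>0 'a::field)"
  by (induction p rule: free_algebra_induct)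
    (auto simp: mult_single distrib_left distrib_right mult.commute)

interpretation ue: vector_space ue_scale
  by standard
    (transfer; simp add: distrib_left distrib_right single_add mult_single ring_ideal.zero
      flip: mult.assoc)+

lemma ue_scale_mult_left: "ue_scale c u * v = ue_scale c (u * v)"
  by transfer (simp add: mult.assoc ring_ideal.zero)

lemma ue_scale_mult_right: "u * ue_scale c v = ue_scale c (u * v)"
  by transfer (simp add: mult.assoc[symmetric] const_commute ring_ideal.zero)

lemma ue_of_add: "ue_of (D + E) = ue_of D + ue_of E"
  unfolding ue_of_def plus_uea.abs_eq uea.abs_eq_iff
  by (rule ring_ideal_base, auto simp: ue_relations_def algebra_simps)

lemma ue_of_scale: "ue_of (der_scale c D) = ue_scale c (ue_of D)"
  unfolding ue_of_def ue_scale.abs_eq uea.abs_eq_iff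
  by (rule ring_ideal_base, auto simp: ue_relations_def)

lemma ue_of_bracket: "ue_of (der_bracket D E) = ue_of D * ue_of E - ue_of E * ue_of D"
proof -
  have "symb D * symb E - symb E * symb D - symb (der_bracket D E) \<in> ring_ideal ue_relations"
    by (rule ring_ideal_base) (auto simp: ue_relations_def)
  from ring_ideal_uminus[OF this] show ?thesis
    by (simp add: ue_of_def times_uea.abs_eq minus_uea.abs_eq uea.abs_eq_iff)
qed

text \<open>
  The action of the free algebra on a representation \<^term>\<open>act\<close>; a word acts by the composition
  of its letters, the last letter being applied first.
\<close>

definition ext_act ::
  "('a::field \<Rightarrow> 'b \<Rightarrow> 'b) \<Rightarrow> ('l \<Rightarrow> 'b \<Rightarrow> 'b) \<Rightarrow> ('l word \<Rightarrow>\<^sub>0 'a) \<Rightarrow> 'b \<Rightarrow> 'b::comm_monoid_add"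
  where "ext_act sc act p b = lin_ext sc (\<lambda>w. foldr act (letters w) b) p"

text \<open>
  The extension to \<open>U(L)\<close> of an action of \<open>L\<close>. For a representation (locale \<open>der_rep\<close>) the
  result does not depend on the representative \<open>rep_uea u\<close>.
\<close>

definition ue_rep ::
  "('a::field \<Rightarrow> 'b \<Rightarrow> 'b) \<Rightarrow> (('a, 'n) der \<Rightarrow> 'b \<Rightarrow> 'b) \<Rightarrow> ('a, 'n::finite) uea \<Rightarrow>
    'b \<Rightarrow> 'b::comm_monoid_add"
  where "ue_rep sc act u = ext_act sc act (rep_uea u)"

locale der_rep = vector_space scale
  for scale :: "'a::field \<Rightarrow> 'b::ab_group_add \<Rightarrow> 'b" +
  fixes act :: "('a, 'n::finite) der \<Rightarrow> 'b \<Rightarrow> 'b"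
  assumes act_add_right: "act D (b + c) = act D b + act D c"
    and act_scale_right: "act D (scale r b) = scale r (act D b)"
    and act_add_left: "act (D + E) b = act D b + act E b"
    and act_scale_left: "act (der_scale r D) b = scale r (act D b)"
    and act_bracket: "act (der_bracket D E) b = act D (act E b) - act E (act D b)"
begin

lemma foldr_act_add: "foldr act ws (b + c) = foldr act ws b + foldr act ws c"
  by (induction ws) (auto simp: act_add_right)

lemma foldr_act_scale: "foldr act ws (scale r b) = scale r (foldr act ws b)"
  by (induction ws) (auto simp: act_scale_right)

lemma ext_act_add_right: "ext_act scale act p (b + c) = ext_act scale act p b + ext_act scale act p c"
  by (simp add: ext_act_def lin_ext_def foldr_act_add scale_right_distrib sum.distrib)

lemma ext_act_scale_right: "ext_act scale act p (scale r b) = scale r (ext_act scale act p b)"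
  by (simp add: ext_act_def lin_ext_def foldr_act_scale scale_sum_right mult.commute)

lemma ext_act_zero_right: "ext_act scale act p 0 = 0"
  using ext_act_scale_right[of p 0 0] by simp

lemma ext_act_mult: "ext_act scale act (p * q) b = ext_act scale act p (ext_act scale act q b)"
proof (induction p rule: free_algebra_induct)
  case (single w c)
  show ?case
  proof (induction q rule: free_algebra_induct)
    case zero
    show ?case using ext_act_zero_right[of "Poly_Mapping.single w c"]
      by (simp add: ext_act_def)
  next
    case (single v d)
    show ?case
      by (simp add: ext_act_def mult_single plus_word_def foldr_act_scale)
  next
    case (add p q)
    then show ?case
      using ext_act_add_right[of "Poly_Mapping.single w c"]
      by (simp add: ext_act_def distrib_left lin_ext_add)
  qed
qed (auto simp: ext_act_def distrib_right lin_ext_add)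

lemma ext_act_cong:
  assumes "p - q \<in> ring_ideal ue_relations"
  shows "ext_act scale act p b = ext_act scale act q b"
proof -
  have rel: "ext_act scale act g b = 0" if "g \<in> ue_relations" for g b
    using that
    by (auto simp: ue_relations_def ext_act_def lin_ext_diff mult_single plus_word_def
        act_add_left act_scale_left act_bracket)
  have "ext_act scale act r b = 0" if "r \<in> ring_ideal ue_relations" for r
    using that
    by (induction rule: ring_ideal.induct)
      (auto simp: ext_act_mult rel ext_act_zero_right, auto simp: ext_act_def lin_ext_add)
  from this[OF assms] show ?thesis by (simp add: ext_act_def lin_ext_diff)
qed

lemma ue_rep_abs: "ue_rep scale act (abs_uea p) = ext_act scale act p"
proof
  fix b
  have "rep_uea (abs_uea p) - p \<in> ring_ideal ue_relations"
    using Quotient_rep_abs[OF Quotient_uea, of p] by (simp add: ring_ideal.zero)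
  then show "ue_rep scale act (abs_uea p) b = ext_act scale act p b"
    unfolding ue_rep_def by (rule ext_act_cong)
qed

lemma ue_rep_simps:
  "ue_rep scale act (u + v) b = ue_rep scale act u b + ue_rep scale act v b"
  "ue_rep scale act (ue_scale c u) b = scale c (ue_rep scale act u b)"
  "ue_rep scale act (u * v) b = ue_rep scale act u (ue_rep scale act v b)"
  "ue_rep scale act 1 b = b"
  "ue_rep scale act (ue_of D) b = act D b"
  "ue_rep scale act u (b + b') = ue_rep scale act u b + ue_rep scale act u b'"
  "ue_rep scale act u (scale r b) = scale r (ue_rep scale act u b)"
proof -
  obtain p where p: "u = abs_uea p" by (metis Quotient_abs_rep[OF Quotient_uea])
  obtain q where q: "v = abs_uea q" by (metis Quotient_abs_rep[OF Quotient_uea])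
  have const: "ext_act scale act (const c) b = scale c b" for c b
    by (simp add: ext_act_def)
  show "ue_rep scale act (u + v) b = ue_rep scale act u b + ue_rep scale act v b"
    by (simp add: p q plus_uea.abs_eq ue_rep_abs, simp add: ext_act_def lin_ext_add)
  show "ue_rep scale act (ue_scale c u) b = scale c (ue_rep scale act u b)"
    by (simp add: p ue_scale.abs_eq ue_rep_abs ext_act_mult const)
  show "ue_rep scale act (u * v) b = ue_rep scale act u (ue_rep scale act v b)"
    by (simp add: p q times_uea.abs_eq ue_rep_abs ext_act_mult)
  show "ue_rep scale act 1 b = b"
    by (simp add: one_uea.abs_eq ue_rep_abs, simp add: ext_act_def)
  show "ue_rep scale act (ue_of D) b = act D b"
    by (simp add: ue_of_def ue_rep_abs, simp add: ext_act_def)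
  show "ue_rep scale act u (b + b') = ue_rep scale act u b + ue_rep scale act u b'"
    by (simp add: p ue_rep_abs ext_act_add_right)
  show "ue_rep scale act u (scale r b) = scale r (ue_rep scale act u b)"
    by (simp add: p ue_rep_abs ext_act_scale_right)
qed

end

abbreviation mat_act :: "('a::field, 'n::finite) uea \<Rightarrow> 'a^'n^'n \<Rightarrow> 'a^'n^'n"
  where "mat_act \<equiv> ue_rep mat_scale der_apply"

abbreviation adjoint_act ::
  "('a::field, 'n::finite) uea \<Rightarrow> ('a, 'n) der \<Rightarrow> ('a, 'n) der"
  where "adjoint_act \<equiv> ue_rep der_scale der_bracket"

lemma der_apply_simps:
  fixes D :: "('a::field, 'n::finite) der"
  shows "der_apply D (A + B) = der_apply D A + der_apply D B"
    "der_apply D (mat_scale c A) = mat_scale c (der_apply D A)"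
    "der_apply D (A ** B) = der_apply D A ** B + A ** der_apply D B"
    "der_apply D (A - B) = der_apply D A - der_apply D B"
  using der_apply[of D] by (auto simp: mat_derivationD)

interpretation mat_rep: der_rep mat_scale der_apply
  by standard
    (auto simp: plus_der.rep_eq der_scale.rep_eq der_bracket.rep_eq der_apply_simps)

interpretation adjoint_rep: der_rep der_scale der_bracket
  by standard
    (auto simp: der_apply_inject[symmetric] fun_eq_iff plus_der.rep_eq der_scale.rep_eq
      der_bracket.rep_eq minus_der.rep_eq der_apply_simps mat_scale_simps algebra_simps)


section \<open>The free \<open>L\<close>-algebra\<close>

text \<open>
  The symbol \<open>(i, u)\<close> stands for \<open>x\<^sub>i\<^sup>u\<close>. The free \<open>L\<close>-algebra is not unital: it consists of the
  classes of elements without constant term, modulo linearity in \<open>u\<close>.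
\<close>

definition lp_relations :: "((nat \<times> ('a::field, 'n::finite) uea) word \<Rightarrow>\<^sub>0 'a) set" where
  "lp_relations =
     {symb (i, u + v) - symb (i, u) - symb (i, v) | i u v. True} \<union>
     {symb (i, ue_scale c u) - const c * symb (i, u) | i c u. True}"

definition lp_rel ::
  "((nat \<times> ('a::field, 'n::finite) uea) word \<Rightarrow>\<^sub>0 'a) \<Rightarrow>
   ((nat \<times> ('a, 'n) uea) word \<Rightarrow>\<^sub>0 'a) \<Rightarrow> bool"
  where "lp_rel p q \<longleftrightarrow> Poly_Mapping.lookup p 0 = 0 \<and> Poly_Mapping.lookup q 0 = 0 \<and>
    p - q \<in> ring_ideal lp_relations"

lemma lp_rel_refl: "lp_rel p p \<longleftrightarrow> Poly_Mapping.lookup p 0 = 0"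
  by (simp add: lp_rel_def ring_ideal.zero)

quotient_type (overloaded) ('a, 'n) lpoly =
  "(nat \<times> ('a::field, 'n::finite) uea) word \<Rightarrow>\<^sub>0 'a" / partial: lp_rel
proof (rule part_equivpI)
  show "\<exists>p. lp_rel p p" by (rule exI[of _ 0]) (simp add: lp_rel_refl)
  show "symp lp_rel" unfolding lp_rel_def by (blast intro: sympI ring_ideal_sym)
  show "transp lp_rel" unfolding lp_rel_def by (blast intro: transpI ring_ideal_trans)
qed

lemma word_add_eq_zero_iff: "v + w = 0 \<longleftrightarrow> v = 0 \<and> w = (0 :: 'x word)"
  by (cases v; cases w) (auto simp: plus_word_def zero_word_def)

lemma lookup_mult_zero:
  fixes p q :: "'x word \<Rightarrow>\<^sub>0 'a::field"
  shows "Poly_Mapping.lookup (p * q) 0 = Poly_Mapping.lookup p 0 * Poly_Mapping.lookup q 0"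
proof (induction p rule: free_algebra_induct)
  case (single w c)
  show ?case
    by (induction q rule: free_algebra_induct)
      (auto simp: mult_single lookup_single when_def word_add_eq_zero_iff distrib_left lookup_add)
qed (auto simp: distrib_right lookup_add)

instantiation lpoly :: (field, finite) ring
begin

lift_definition zero_lpoly :: "('a, 'b) lpoly" is 0
  by (simp add: lp_rel_refl)
lift_definition plus_lpoly :: "('a, 'b) lpoly \<Rightarrow> ('a, 'b) lpoly \<Rightarrow> ('a, 'b) lpoly" is "(+)"
  unfolding lp_rel_def by (auto simp: lookup_add intro: ring_ideal_cong_add)
lift_definition minus_lpoly :: "('a, 'b) lpoly \<Rightarrow> ('a, 'b) lpoly \<Rightarrow> ('a, 'b) lpoly" is "(-)"
  unfolding lp_rel_def by (auto simp: lookup_minus intro: ring_ideal_cong_diff)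
lift_definition uminus_lpoly :: "('a, 'b) lpoly \<Rightarrow> ('a, 'b) lpoly" is "uminus"
  unfolding lp_rel_def by (clarsimp, erule ring_ideal_sym)
lift_definition times_lpoly :: "('a, 'b) lpoly \<Rightarrow> ('a, 'b) lpoly \<Rightarrow> ('a, 'b) lpoly" is "(*)"
  unfolding lp_rel_def by (auto simp: lookup_mult_zero intro: ring_ideal_cong_mult)

instance
  by standard (transfer; simp add: algebra_simps lp_rel_def lookup_add lookup_minus
      lookup_mult_zero ring_ideal.zero)+

end

lift_definition lp_scale :: "'a::field \<Rightarrow> ('a, 'n::finite) lpoly \<Rightarrow> ('a, 'n) lpoly"
  is "\<lambda>c p. const c * p"
  by (auto simp: lp_rel_def lookup_mult_zero simp flip: right_diff_distrib intro: ring_ideal_left)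

definition lp_var :: "nat \<Rightarrow> ('a::field, 'n::finite) uea \<Rightarrow> ('a, 'n) lpoly"
  where "lp_var i u = abs_lpoly (symb (i, u))"

interpretation lp: vector_space lp_scale
  by standard
    (transfer; simp add: distrib_left distrib_right single_add mult_single ring_ideal.zero
      lp_rel_def lookup_add lookup_mult_zero flip: mult.assoc)+

lemma lp_scale_mult_left: "lp_scale c f * g = lp_scale c (f * g)"
  by transfer (simp add: mult.assoc ring_ideal.zero lp_rel_def lookup_mult_zero)

lemma lp_scale_mult_right: "f * lp_scale c g = lp_scale c (f * g)"
  by transfer
    (simp add: mult.assoc[symmetric] const_commute ring_ideal.zero lp_rel_def lookup_mult_zero)

lemma lookup_symb_zero [simp]: "Poly_Mapping.lookup (Poly_Mapping.single (Word (x # xs)) c) 0 = 0"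
  by (simp add: lookup_single when_def zero_word_def)

lemma abs_lpoly_eqI:
  assumes "Poly_Mapping.lookup p 0 = 0" "Poly_Mapping.lookup q 0 = 0"
    and "p - q \<in> ring_ideal lp_relations"
  shows "abs_lpoly p = abs_lpoly q"
  using assms Quotient_rel_abs[OF Quotient_lpoly, of p q] by (simp add: lp_rel_def)

lemma abs_rep_lpoly: "abs_lpoly (rep_lpoly f) = f"
  by (rule Quotient_abs_rep[OF Quotient_lpoly])

lemma lookup_rep_lpoly [simp]: "Poly_Mapping.lookup (rep_lpoly f) 0 = 0"
  using Quotient_rep_reflp[OF Quotient_lpoly, of f] by (simp add: lp_rel_refl)

lemma rep_abs_lpoly:
  "Poly_Mapping.lookup p 0 = 0 \<Longrightarrow> rep_lpoly (abs_lpoly p) - p \<in> ring_ideal lp_relations"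
  using Quotient_rep_abs[OF Quotient_lpoly, of p] by (simp add: lp_rel_def ring_ideal.zero)

lemma lp_var_add: "lp_var i (u + v) = lp_var i u + lp_var i v"
proof -
  have "symb (i, u + v) - (symb (i, u) + symb (i, v)) \<in> ring_ideal lp_relations"
    by (rule ring_ideal_base) (auto simp: lp_relations_def algebra_simps)
  then show ?thesis
    unfolding lp_var_def
    by (subst plus_lpoly.abs_eq) (auto simp: lp_rel_refl lookup_add intro!: abs_lpoly_eqI)
qed

lemma lp_var_scale: "lp_var i (ue_scale c u) = lp_scale c (lp_var i u)"
proof -
  have "symb (i, ue_scale c u) - const c * symb (i, u) \<in> ring_ideal lp_relations"
    by (rule ring_ideal_base, unfold lp_relations_def) blast
  then show ?thesis
    unfolding lp_var_def
    by (subst lp_scale.abs_eq) (auto simp: lp_rel_refl lookup_mult_zero intro!: abs_lpoly_eqI)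
qed

lemma lpoly_induct [case_names var add mult]:
  assumes var: "\<And>i u c. P (lp_scale c (lp_var i u))"
    and add: "\<And>f g. P f \<Longrightarrow> P g \<Longrightarrow> P (f + g)" and mult: "\<And>f g. P f \<Longrightarrow> P g \<Longrightarrow> P (f * g)"
  shows "P f"
proof -
  have zero: "P 0" using var[of 0] by simp
  have one: "P (abs_lpoly (symb x))" for x
    using var[of 1 "fst x" "snd x"] by (simp add: lp_var_def)
  have words: "P (abs_lpoly (Poly_Mapping.single (Word (x # xs)) 1))" for x xs
  proof (induction xs arbitrary: x)
    case Nil
    show ?case by (rule one)
  next
    case (Cons y ys)
    have "abs_lpoly (Poly_Mapping.single (Word (x # y # ys)) 1) =
        abs_lpoly (symb x) * abs_lpoly (Poly_Mapping.single (Word (y # ys)) 1)"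
      by (subst times_lpoly.abs_eq) (auto simp: lp_rel_refl mult_single plus_word_def)
    then show ?case using mult one Cons by auto
  qed
  have scale: "P (lp_scale c f)" if "P f" "f = abs_lpoly (Poly_Mapping.single (Word (x # xs)) 1)"
    for c f x xs
  proof (cases xs)
    case Nil
    then show ?thesis using var[of c "fst x" "snd x"] that by (simp add: lp_var_def)
  next
    case (Cons y ys)
    have "f = abs_lpoly (symb x) * abs_lpoly (Poly_Mapping.single (Word (y # ys)) 1)"
      unfolding that Cons
      by (subst times_lpoly.abs_eq) (auto simp: lp_rel_refl mult_single plus_word_def)
    then have "lp_scale c f =
        lp_scale c (lp_var (fst x) (snd x)) * abs_lpoly (Poly_Mapping.single (Word (y # ys)) 1)"
      by (simp add: lp_scale_mult_left lp_var_def)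
    then show ?thesis using mult var words by auto
  qed
  have "P (abs_lpoly (p - const (Poly_Mapping.lookup p 0)))" for p
  proof (induction p rule: free_algebra_induct)
    case zero
    show ?case using \<open>P 0\<close> by (simp add: zero_lpoly_def)
  next
    case (single w c)
    show ?case
    proof (cases "letters w")
      case Nil
      then have "w = 0" by (cases w) (simp add: zero_word_def)
      then show ?thesis using \<open>P 0\<close> by (simp add: zero_lpoly_def)
    next
      case (Cons x xs)
      then have w: "w = Word (x # xs)" by (cases w) simp
      have "abs_lpoly (Poly_Mapping.single w c) =
          lp_scale c (abs_lpoly (Poly_Mapping.single (Word (x # xs)) 1))"
        unfolding w by (subst lp_scale.abs_eq) (auto simp: lp_rel_refl mult_single)
      then show ?thesis using scale[OF words refl] by (simp add: w)
    qed
  next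
    case (add p q)
    have "abs_lpoly (p + q - const (Poly_Mapping.lookup (p + q) 0)) =
        abs_lpoly (p - const (Poly_Mapping.lookup p 0)) +
        abs_lpoly (q - const (Poly_Mapping.lookup q 0))"
      by (subst plus_lpoly.abs_eq)
        (auto simp: lp_rel_refl lookup_minus lookup_add single_add algebra_simps)
    then show ?case using add assms by auto
  qed
  from this[of "rep_lpoly f"] show ?thesis by (simp add: abs_rep_lpoly)
qed

text \<open>
  The action of \<open>\<delta> \<in> L\<close> is the derivation with \<open>x\<^sub>i\<^sup>u \<mapsto> x\<^sub>i\<^sup>v\<close>, where \<open>v\<close> is the product of \<open>u\<close> and \<open>\<delta>\<close>
  in the opposite algebra of \<open>U(L)\<close>, that is \<^term>\<open>ue_of \<delta> * u\<close>.
\<close>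

fun word_deriv ::
  "('a::field, 'n::finite) der \<Rightarrow> (nat \<times> ('a, 'n) uea) list \<Rightarrow>
   ((nat \<times> ('a, 'n) uea) word \<Rightarrow>\<^sub>0 'a)" where
  "word_deriv \<delta> [] = 0"
| "word_deriv \<delta> ((i, u) # ws) =
     Poly_Mapping.single (Word ((i, ue_of \<delta> * u) # ws)) 1 + symb (i, u) * word_deriv \<delta> ws"

interpretation free: vector_space "\<lambda>c (p :: 'x word \<Rightarrow>\<^sub>0 'a::field). const c * p"
  by standard (auto simp: distrib_left distrib_right single_add mult_single simp flip: mult.assoc)

definition free_deriv ::
  "('a::field, 'n::finite) der \<Rightarrow> ((nat \<times> ('a, 'n) uea) word \<Rightarrow>\<^sub>0 'a) \<Rightarrow>
   ((nat \<times> ('a, 'n) uea) word \<Rightarrow>\<^sub>0 'a)"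
  where "free_deriv \<delta> = lin_ext (\<lambda>c p. const c * p) (\<lambda>w. word_deriv \<delta> (letters w))"

definition lp_deriv :: "('a::field, 'n::finite) der \<Rightarrow> ('a, 'n) lpoly \<Rightarrow> ('a, 'n) lpoly"
  where "lp_deriv \<delta> f = abs_lpoly (free_deriv \<delta> (rep_lpoly f))"

lemma word_deriv_append:
  "word_deriv \<delta> (xs @ ys) =
     word_deriv \<delta> xs * Poly_Mapping.single (Word ys) 1 +
     Poly_Mapping.single (Word xs) 1 * word_deriv \<delta> ys"
proof (induction xs)
  case Nil
  then show ?case by (simp flip: zero_word_def)
next
  case (Cons x xs)
  obtain i u where x: "x = (i, u)" by (cases x)
  have "symb (i, u) * Poly_Mapping.single (Word xs) 1 =
      (Poly_Mapping.single (Word ((i, u) # xs)) 1 :: _ \<Rightarrow>\<^sub>0 'a)"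
    by (simp add: mult_single plus_word_def)
  then show ?case
    by (simp add: x Cons distrib_left distrib_right mult_single plus_word_def
        flip: mult.assoc)
qed

lemma free_deriv_add: "free_deriv \<delta> (p + q) = free_deriv \<delta> p + free_deriv \<delta> q"
  by (simp add: free_deriv_def free.lin_ext_add)

lemma free_deriv_diff: "free_deriv \<delta> (p - q) = free_deriv \<delta> p - free_deriv \<delta> q"
  by (simp add: free_deriv_def free.lin_ext_diff)

lemma free_deriv_zero [simp]: "free_deriv \<delta> 0 = 0"
  by (simp add: free_deriv_def)

lemma free_deriv_single: "free_deriv \<delta> (Poly_Mapping.single w c) = const c * word_deriv \<delta> (letters w)"
  by (simp add: free_deriv_def)

lemma free_deriv_symb: "free_deriv \<delta> (symb (i, u)) = symb (i, ue_of \<delta> * u)"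
  by (simp add: free_deriv_single)

lemma free_deriv_mult: "free_deriv \<delta> (p * q) = free_deriv \<delta> p * q + p * free_deriv \<delta> q"
proof (induction p rule: free_algebra_induct)
  case (single w c)
  show ?case
  proof (induction q rule: free_algebra_induct)
    case (single v d)
    have 1: "Poly_Mapping.single v d = const d * Poly_Mapping.single v 1"
      "Poly_Mapping.single w c = const c * Poly_Mapping.single w 1"
      by (simp_all add: mult_single)
    have comm: "X * (const d * Y) = const d * (X * Y)" for X Y :: "(nat \<times> ('a, 'b) uea) word \<Rightarrow>\<^sub>0 'a"
      by (subst (1 2) mult.assoc[symmetric]) (simp only: const_commute)
    have "free_deriv \<delta> (Poly_Mapping.single w c * Poly_Mapping.single v d) =
      const c * (const d * word_deriv \<delta> (letters w @ letters v))"
      by (simp add: mult_single free_deriv_single flip: mult.assoc)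
    also have "\<dots> = const c * (const d * (word_deriv \<delta> (letters w) * Poly_Mapping.single v 1 +
        Poly_Mapping.single w 1 * word_deriv \<delta> (letters v)))"
      by (simp add: word_deriv_append)
    also have "\<dots> = (const c * word_deriv \<delta> (letters w)) * (const d * Poly_Mapping.single v 1) +
       (const c * Poly_Mapping.single w 1) * (const d * word_deriv \<delta> (letters v))"
      by (simp only: comm distrib_left mult.assoc)
    finally show ?case unfolding free_deriv_single 1[symmetric] .
  qed (auto simp: distrib_left free_deriv_add)
qed (auto simp: distrib_right free_deriv_add)

lemma free_deriv_const: "free_deriv \<delta> (const c) = 0"
  by (simp add: free_deriv_single)

lemma lookup_word_deriv: "Poly_Mapping.lookup (word_deriv \<delta> ws) 0 = 0"
  by (induction \<delta> ws rule: word_deriv.induct) (auto simp: lookup_add lookup_mult_zero)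

lemma lookup_free_deriv [simp]: "Poly_Mapping.lookup (free_deriv \<delta> p) 0 = 0"
  by (induction p rule: free_algebra_induct)
    (auto simp: free_deriv_single free_deriv_add lookup_add lookup_mult_zero lookup_word_deriv)

lemma free_deriv_ideal:
  assumes "p \<in> ring_ideal lp_relations"
  shows "free_deriv \<delta> p \<in> ring_ideal lp_relations"
  using assms
proof (induction rule: ring_ideal.induct)
  case (gen g a b)
  from gen consider (add) i u v where "g = symb (i, u + v) - symb (i, u) - symb (i, v)"
    | (scale) i c u where "g = symb (i, ue_scale c u) - const c * symb (i, u)"
    unfolding lp_relations_def by blast
  then have "free_deriv \<delta> g \<in> lp_relations"
  proof cases
    case add
    then have "free_deriv \<delta> g =
        symb (i, ue_of \<delta> * u + ue_of \<delta> * v) - symb (i, ue_of \<delta> * u) - symb (i, ue_of \<delta> * v)"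
      by (simp add: free_deriv_diff free_deriv_symb distrib_left)
    then show ?thesis unfolding lp_relations_def by blast
  next
    case scale
    then have "free_deriv \<delta> g =
        symb (i, ue_scale c (ue_of \<delta> * u)) - const c * symb (i, ue_of \<delta> * u)"
      by (simp only: free_deriv_diff free_deriv_symb free_deriv_mult free_deriv_const
          ue_scale_mult_right mult_zero_left add_0)
    then show ?thesis unfolding lp_relations_def by blast
  qed
  then have "free_deriv \<delta> a * g * b + a * free_deriv \<delta> g * b + a * g * free_deriv \<delta> b
      \<in> ring_ideal lp_relations"
    using gen by (intro ring_ideal.add ring_ideal.gen)
  then show ?case by (simp add: free_deriv_mult distrib_left distrib_right mult.assoc add.assoc)
qed (auto simp: free_deriv_add intro: ring_ideal.intros)

lemma lp_deriv_abs:
  "Poly_Mapping.lookup p 0 = 0 \<Longrightarrow> lp_deriv \<delta> (abs_lpoly p) = abs_lpoly (free_deriv \<delta> p)"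
  unfolding lp_deriv_def
  by (rule abs_lpoly_eqI)
    (auto simp flip: free_deriv_diff intro: free_deriv_ideal rep_abs_lpoly)

lemma lpoly_cases: obtains p where "f = abs_lpoly p" "Poly_Mapping.lookup p 0 = 0"
  using abs_rep_lpoly[of f] lookup_rep_lpoly[of f] by metis

lemma lp_deriv_add: "lp_deriv \<delta> (f + g) = lp_deriv \<delta> f + lp_deriv \<delta> g"
  by (cases f rule: lpoly_cases; cases g rule: lpoly_cases)
    (simp add: plus_lpoly.abs_eq lp_rel_refl lp_deriv_abs lookup_add free_deriv_add)

lemma lp_deriv_scale: "lp_deriv \<delta> (lp_scale c f) = lp_scale c (lp_deriv \<delta> f)"
  by (cases f rule: lpoly_cases)
    (simp add: lp_scale.abs_eq lp_rel_refl lp_deriv_abs lookup_mult_zero free_deriv_mult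
      free_deriv_const)

lemma lp_deriv_mult: "lp_deriv \<delta> (f * g) = lp_deriv \<delta> f * g + f * lp_deriv \<delta> g"
  by (cases f rule: lpoly_cases; cases g rule: lpoly_cases)
    (simp add: plus_lpoly.abs_eq times_lpoly.abs_eq lp_rel_refl lp_deriv_abs lookup_mult_zero
      free_deriv_mult)

lemma lp_deriv_var: "lp_deriv \<delta> (lp_var i u) = lp_var i (ue_of \<delta> * u)"
  by (simp add: lp_var_def lp_deriv_abs free_deriv_symb)

interpretation lp_rep: der_rep lp_scale lp_deriv
proof
  fix \<delta> \<epsilon> :: "('a, 'b) der" and f g :: "('a, 'b) lpoly" and c :: 'a
  show "lp_deriv \<delta> (f + g) = lp_deriv \<delta> f + lp_deriv \<delta> g" by (rule lp_deriv_add)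
  show "lp_deriv \<delta> (lp_scale c f) = lp_scale c (lp_deriv \<delta> f)" by (rule lp_deriv_scale)
  show "lp_deriv (\<delta> + \<epsilon>) f = lp_deriv \<delta> f + lp_deriv \<epsilon> f"
    by (induction f rule: lpoly_induct)
      (simp_all add: lp_deriv_add lp_deriv_scale lp_deriv_mult lp_deriv_var ue_of_add
        distrib_right distrib_left lp_var_add lp.scale_right_distrib)
  show "lp_deriv (der_scale c \<delta>) f = lp_scale c (lp_deriv \<delta> f)"
    by (induction f rule: lpoly_induct)
      (simp_all add: lp_deriv_add lp_deriv_scale lp_deriv_mult lp_deriv_var ue_of_scale
        ue_scale_mult_left lp_var_scale lp.scale_right_distrib lp_scale_mult_left
        lp_scale_mult_right mult.commute)
  have var_diff: "lp_var i (u - v) = lp_var i u - lp_var i v" for i and u v :: "('a, 'b) uea"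
    using lp_var_add[of i "u - v" v] by (simp add: algebra_simps)
  show "lp_deriv (der_bracket \<delta> \<epsilon>) f = lp_deriv \<delta> (lp_deriv \<epsilon> f) - lp_deriv \<epsilon> (lp_deriv \<delta> f)"
    by (induction f rule: lpoly_induct)
      (simp_all add: lp_deriv_add lp_deriv_scale lp_deriv_mult lp_deriv_var ue_of_bracket
        left_diff_distrib right_diff_distrib distrib_left distrib_right mult.assoc var_diff
        lp.scale_right_diff_distrib)
qed

text \<open>\<open>f\<^sup>u\<close> for \<open>f\<close> in the free \<open>L\<close>-algebra.\<close>

abbreviation lp_act :: "('a::field, 'n::finite) uea \<Rightarrow> ('a, 'n) lpoly \<Rightarrow> ('a, 'n) lpoly"
  where "lp_act \<equiv> ue_rep lp_scale lp_deriv"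

definition L_endomorphism :: "(('a::field, 'n::finite) lpoly \<Rightarrow> ('a, 'n) lpoly) \<Rightarrow> bool" where
  "L_endomorphism h \<longleftrightarrow> Vector_Spaces.linear lp_scale lp_scale h \<and>
     (\<forall>f g. h (f * g) = h f * h g) \<and> (\<forall>u f. h (lp_act u f) = lp_act u (h f))"

definition TL_ideal :: "('a::field, 'n::finite) lpoly set \<Rightarrow> bool" where
  "TL_ideal I \<longleftrightarrow> lp.subspace I \<and> (\<forall>f\<in>I. \<forall>g. f * g \<in> I \<and> g * f \<in> I) \<and>
     (\<forall>f\<in>I. \<forall>\<delta>. lp_deriv \<delta> f \<in> I) \<and> (\<forall>h. L_endomorphism h \<longrightarrow> h ` I \<subseteq> I)"

definition TL_ideal_generated :: "('a::field, 'n::finite) lpoly set \<Rightarrow> ('a, 'n) lpoly set"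
  where "TL_ideal_generated G = \<Inter> {I. TL_ideal I \<and> G \<subseteq> I}"


section \<open>Differential identities and codimensions\<close>

text \<open>The substitution \<open>x\<^sub>i\<^sup>u \<mapsto> b\<^sub>i\<^sup>u\<close> into the matrix algebra.\<close>

definition free_subst ::
  "(nat \<Rightarrow> 'a::field^'n^'n) \<Rightarrow> ((nat \<times> ('a, 'n::finite) uea) word \<Rightarrow>\<^sub>0 'a) \<Rightarrow> 'a^'n^'n" where
  "free_subst b = lin_ext mat_scale
     (\<lambda>w. foldr (\<lambda>(i, u) A. mat_act u (b i) ** A) (letters w) (mat 1))"

definition lp_subst :: "(nat \<Rightarrow> 'a::field^'n^'n) \<Rightarrow> ('a, 'n::finite) lpoly \<Rightarrow> 'a^'n^'n"
  where "lp_subst b f = free_subst b (rep_lpoly f)"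

lemma foldr_mat_mult:
  "foldr (\<lambda>(i, u) A. F i u ** A) xs B = foldr (\<lambda>(i, u) A. F i u ** A) xs (mat 1) ** (B :: 'a::field^'n^'n)"
  by (induction xs) (auto simp: matrix_mul_assoc)

lemma free_subst_mult: "free_subst b (p * q) = free_subst b p ** free_subst b q"
  unfolding free_subst_def
proof (rule mat.lin_ext_mult, goal_cases)
  case (5 v w)
  show ?case using foldr_mat_mult by simp
qed (simp_all add: mat_mult_bilinear)

lemma free_subst_symb: "free_subst b (symb (i, u)) = mat_act u (b i)"
  by (simp add: free_subst_def)

lemma free_subst_const: "free_subst b (const c) = mat_scale c (mat 1)"
  by (simp add: free_subst_def)

lemma free_subst_add: "free_subst b (p + q) = free_subst b p + free_subst b q"
  by (simp add: free_subst_def mat.lin_ext_add)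

lemma free_subst_diff: "free_subst b (p - q) = free_subst b p - free_subst b q"
  by (simp add: free_subst_def mat.lin_ext_diff)

lemma free_subst_ideal: "p \<in> ring_ideal lp_relations \<Longrightarrow> free_subst b p = 0"
proof (induction rule: ring_ideal.induct)
  case zero
  show ?case by (simp add: free_subst_def)
next
  case (gen g a c)
  then have "free_subst b g = 0"
    by (auto simp: lp_relations_def free_subst_diff free_subst_symb free_subst_mult
        free_subst_const mat_mult_bilinear mat_rep.ue_rep_simps)
  then show ?case by (simp add: free_subst_mult mat_mult_bilinear)
qed (simp add: free_subst_add)

lemma lp_subst_abs: "Poly_Mapping.lookup p 0 = 0 \<Longrightarrow> lp_subst b (abs_lpoly p) = free_subst b p"
  using free_subst_ideal[OF rep_abs_lpoly[of p], of b] by (simp add: lp_subst_def free_subst_diff)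

lemma lp_subst_simps:
  "lp_subst b (f + g) = lp_subst b f + lp_subst b g"
  "lp_subst b (f * g) = lp_subst b f ** lp_subst b g"
  "lp_subst b (lp_scale c f) = mat_scale c (lp_subst b f)"
  "lp_subst b (lp_var i u) = mat_act u (b i)"
proof -
  obtain p where p: "f = abs_lpoly p" "Poly_Mapping.lookup p 0 = 0" by (rule lpoly_cases)
  obtain q where q: "g = abs_lpoly q" "Poly_Mapping.lookup q 0 = 0" by (rule lpoly_cases)
  show "lp_subst b (f + g) = lp_subst b f + lp_subst b g"
    "lp_subst b (f * g) = lp_subst b f ** lp_subst b g"
    "lp_subst b (lp_scale c f) = mat_scale c (lp_subst b f)"
    using p q
    by (simp_all add: plus_lpoly.abs_eq times_lpoly.abs_eq lp_scale.abs_eq lp_rel_refl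
        lp_subst_abs lookup_add lookup_mult_zero free_subst_add free_subst_mult
        free_subst_const mat_mult_bilinear)
  show "lp_subst b (lp_var i u) = mat_act u (b i)"
    by (simp add: lp_var_def lp_subst_abs free_subst_symb)
qed

definition Id_L :: "('a::field, 'n::finite) lpoly set"
  where "Id_L = {f. \<forall>b. lp_subst b f = 0}"

text \<open>
  Meaningful for \<open>n \<ge> 1\<close> only, there being no empty product. The variables are indexed by all of
  \<open>nat\<close>; the variable with index 0 does not occur here.
\<close>

definition multilinear :: "nat \<Rightarrow> ('a::field, 'n::finite) lpoly set" where
  "multilinear n = lp.span
     {foldl (*) (lp_var (\<sigma> 1) (u 1)) (map (\<lambda>i. lp_var (\<sigma> i) (u i)) [2..<Suc n]) | \<sigma> u.
      \<sigma> permutes {1..n}}"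

text \<open>\<^term>\<open>B\<close> maps bijectively onto a basis of the quotient space \<open>V / W\<close>.\<close>

definition basis_modulo ::
  "('a::field \<Rightarrow> 'v \<Rightarrow> 'v) \<Rightarrow> 'v set \<Rightarrow> 'v set \<Rightarrow> 'v::ab_group_add set \<Rightarrow> bool" where
  "basis_modulo sc V W B \<longleftrightarrow> B \<subseteq> V \<and>
     (\<forall>A c. finite A \<longrightarrow> A \<subseteq> B \<longrightarrow> (\<Sum>a\<in>A. sc (c a) a) \<in> W \<longrightarrow> (\<forall>a\<in>A. c a = 0)) \<and>
     (\<forall>v\<in>V. \<exists>A c. finite A \<and> A \<subseteq> B \<and> v - (\<Sum>a\<in>A. sc (c a) a) \<in> W)"

text \<open>As with \<open>card\<close>, the value is 0 when the quotient is infinite-dimensional.\<close>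

definition quotient_dim ::
  "('a::field \<Rightarrow> 'v \<Rightarrow> 'v) \<Rightarrow> 'v set \<Rightarrow> 'v::ab_group_add set \<Rightarrow> nat"
  where "quotient_dim sc V W = card (SOME B. basis_modulo sc V W B)"

definition codimension :: "('a::field, 'n::finite) lpoly set \<Rightarrow> nat \<Rightarrow> nat"
  where "codimension I n = quotient_dim lp_scale (multilinear n) (multilinear n \<inter> I)"


section \<open>Matrix units and Casimir elements\<close>

text \<open>
  A traceless matrix \<open>c\<close> is identified with the derivation \<^term>\<open>ad c\<close>; so the element \<open>e\<^sub>i\<^sub>j\<close> of \<open>U(L)\<close>
  is \<open>ue_of (ad (mat_unit i j))\<close>.
\<close>

text \<open>Rows and columns are numbered from 1 to \<open>k\<close> along the order of the index type.\<close>

definition idx :: "nat \<Rightarrow> 'n::{finite, linorder}"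
  where "idx i = sorted_list_of_set UNIV ! (i - 1)"

lemma bij_betw_idx: "bij_betw (idx :: nat \<Rightarrow> 'n::{finite, linorder}) {1..CARD('n)} UNIV"
proof -
  let ?l = "sorted_list_of_set (UNIV :: 'n set)"
  have "bij_betw (\<lambda>i. ?l ! i) {..<CARD('n)} UNIV"
    using bij_betw_nth[of ?l "{..<CARD('n)}" UNIV] by simp
  moreover have "bij_betw (\<lambda>i. i - 1) {1..CARD('n)} {..<CARD('n)}"
    by (rule bij_betw_byWitness[where f' = Suc]) auto
  ultimately show ?thesis
    using bij_betw_trans[of "\<lambda>i. i - 1" "{1..CARD('n)}" "{..<CARD('n)}" "\<lambda>i. ?l ! i" UNIV]
    by (simp add: idx_def[abs_def] comp_def)
qed

type_synonym ('a, 'n) sqmat = "(('a, 'n) vec, 'n) vec"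

definition mat_unit :: "nat \<Rightarrow> nat \<Rightarrow> ('a::field, 'n::{finite, linorder}) sqmat"
  where "mat_unit i j = (\<chi> r s. if r = idx i \<and> s = idx j then 1 else 0)"

definition cartan :: "nat \<Rightarrow> ('a::field, 'n::{finite, linorder}) sqmat"
  where "cartan i = mat_unit i i - mat_unit (i + 1) (i + 1)"

definition sl_basis :: "('a::field, 'n::{finite, linorder}) sqmat set" where
  "sl_basis = {mat_unit i j | i j. i \<in> {1..CARD('n)} \<and> j \<in> {1..CARD('n)} \<and> i \<noteq> j} \<union>
     cartan ` {1..<CARD('n)}"

definition mat_basis :: "('a::field, 'n::{finite, linorder}) sqmat set"
  where "mat_basis = insert (mat 1) sl_basis"

text \<open>\<open>f = \<phi>\<^sub>a\<^sub>b\<close>.\<close>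

definition is_elementary_map ::
  "('a::field, 'n::{finite, linorder}) sqmat \<Rightarrow> ('a, 'n) sqmat \<Rightarrow>
   (('a, 'n) sqmat \<Rightarrow> ('a, 'n) sqmat) \<Rightarrow> bool" where
  "is_elementary_map a b f \<longleftrightarrow> Vector_Spaces.linear mat_scale mat_scale f \<and>
     (\<forall>m\<in>mat_basis. f m = (if m = a then b else 0))"

text \<open>The elements \<open>x\<^sup>i\<^sub>j\<close>; for \<open>i = j\<close> this is \<open>e\<^sub>i\<^sub>i - (1/k) I\<^sub>k\<close> written in terms of the \<open>h\<^sub>j\<close>.\<close>

definition casimir_mat :: "nat \<Rightarrow> nat \<Rightarrow> ('a::field_char_0, 'n::{finite, linorder}) sqmat" where
  "casimir_mat i j = (if i \<noteq> j then mat_unit i j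
     else mat_scale (1 / of_nat CARD('n)) (\<Sum>l = 1..<CARD('n).
       mat_scale (if l \<ge> i then of_nat (CARD('n) - l) else - of_nat l) (cartan l)))"

definition casimir :: "nat \<Rightarrow> ('a::field_char_0, 'n::{finite, linorder}) uea" where
  "casimir p = (\<Sum>is | length is = p \<and> set is \<subseteq> {1..CARD('n)}.
     prod_list (map (\<lambda>t. ue_of (ad (casimir_mat (is ! t) (is ! (Suc t mod p))))) [0..<p]))"

definition adjoint_eigenvalue :: "('a::field, 'n::finite) uea \<Rightarrow> 'a"
  where "adjoint_eigenvalue u = (THE c. \<forall>D. adjoint_act u D = der_scale c D)"

definition z_casimir :: "nat \<Rightarrow> ('a::field_char_0, 'n::{finite, linorder}) uea"
  where "z_casimir p = casimir p - ue_scale (adjoint_eigenvalue (casimir p :: ('a, 'n) uea)) 1"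

definition z_elem :: "('a::field_char_0, 'n::{finite, linorder}) uea" where
  "z_elem = ue_of (ad (mat_unit 1 2)) ^ 3 +
     (\<Sum>p = 2..CARD('n). ue_of (ad (mat_unit 1 p)) * z_casimir p)"

definition commutator :: "'r::ring \<Rightarrow> 'r \<Rightarrow> 'r"
  where "commutator f h = f * h - h * f"

end

theory Submission
  imports Defs
begin

text \<open>
  Two facts have to be shown: the identities \<open>x\<^sup>u\<close> follow from \<open>x\<^sup>z\<close>, and modulo those all others follow from the quadratic identity.

  An exponent \<open>u\<close> with \<open>x\<^sup>u\<close> an identity is an element of the kernel of \<open>\<phi>\<close>, so the first claim is that this kernel
  is the ideal of \<open>z\<close> (\<open>kernel_generated_by_z\<close>). Brackets with diagonal matrices separate the summands of \<open>z\<close>, so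
  its ideal contains \<open>e\<^sub>1\<^sub>2\<^sup>3\<close> and \<open>L z\<^sub>2\<close>, where \<open>z\<^sub>2 = c\<^sub>2 - 2 k\<close>. The point is then that \<open>e\<^sub>1\<^sub>2\<^sup>3\<close> and \<open>z\<^sub>2\<close>
  generate the annihilator of the adjoint representation. In the quotient \<open>Q\<close> of \<open>U(L)\<close> by both, each
  \<open>h = e\<^sub>i\<^sub>i - e\<^sub>j\<^sub>j\<close> has its eigenvalues in \<open>{-2, \<dots>, 2}\<close>. A vector with eigenvalue 2 has to have a root as its weight,
  because of the eigenvalue of the Casimir element, and generates a copy of the adjoint representation; therefore
  \<open>e\<^sub>2\<^sub>1\<^sup>2 Q e\<^sub>1\<^sub>2\<^sup>2\<close> is one-dimensional (\<open>corner_one_dimensional\<close>). Moreover \<open>e\<^sub>1\<^sub>2\<^sup>2\<close> generates \<open>Q\<close> as an ideal, since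
  the Casimir eigenvalue \<open>2 k\<close> does not occur when root vectors square to zero (\<open>square_zero_collapse\<close>). Hence an
  element that acts as zero on \<open>L\<close> is zero in \<open>Q\<close>.

  For the second claim let \<open>R\<close> be the relatively free algebra, the quotient of the free \<open>L\<close>-algebra by all consequences of
  the identities. Since \<open>U(L)\<close> acts on \<open>R\<close> through \<open>\<phi>\<close>, every element is a sum of values of \<open>L\<close>-equivariant
  linear maps \<open>\<xi> : M\<^sub>k(F) \<rightarrow> R\<close>; one such map belongs to each coordinate of a generic matrix, and \<open>\<xi>(A)\<close> is to be
  thought of as that scalar coordinate times \<open>A\<close>. The quadratic identity makes invariants central and says that
  \<open>\<xi>(e\<^sub>1\<^sub>2) \<eta>(e\<^sub>2\<^sub>1) = \<eta>(e\<^sub>1\<^sub>2) \<xi>(e\<^sub>2\<^sub>1)\<close> and \<open>\<xi>(e\<^sub>1\<^sub>2) \<eta>(e\<^sub>3\<^sub>1) = 0\<close>. With the action of \<open>L\<close> this implies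
  \<open>\<xi>(A) \<eta>(B) = \<zeta>(A B) = \<eta>(A) \<xi>(B)\<close> for traceless \<open>A, B\<close> and another equivariant map \<open>\<zeta>\<close> (\<open>product_exists\<close>), and
  similarly for longer products (\<open>composite_product\<close>). So each element of \<open>R\<close> is a sum of terms \<open>v\<^sub>1 \<cdots> v\<^sub>n M\<close> with commuting
  coordinates \<open>v\<^sub>i\<close> and a matrix \<open>M\<close>, exactly as for generic matrices. If an \<open>L\<close>-polynomial is an identity of the
  matrix algebra, the matrices belonging to equal monomials sum to zero, because distinct monomials are linearly
  independent functions; hence it vanishes in \<open>R\<close> (\<open>vanishing_representation\<close>, \<open>identity_vanishes\<close>).

  The same normal form gives the codimensions. A multilinear monomial takes one of \<open>k\<^sup>2\<close> coordinates for each variable.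
  If two or more of them are coordinates of the traceless part, any of the \<open>k\<^sup>2\<close> basis matrices can accompany it; with exactly
  one only a traceless matrix, and with none only the identity matrix.
\<close>

section \<open>Nilpotent elements in algebras over the Lie algebra of 2 by 2 matrices\<close>

locale algebra_over = vector_space scale
  for scale :: "'a::field_char_0 \<Rightarrow> 'b::{ring,monoid_mult} \<Rightarrow> 'b" +
  assumes scale_mult_left: "scale c x * y = scale c (x * y)"
    and scale_mult_right: "x * scale c y = scale c (x * y)"
begin

lemma scale_numeral:
  "scale (numeral num.One) x = x"
  "scale (numeral (num.Bit0 m)) x = scale (numeral m) x + scale (numeral m) x"
  "scale (numeral (num.Bit1 m)) x = scale (numeral m) x + scale (numeral m) x + x"
  by (simp, simp_all only: numeral.simps scale_left_distrib scale_one)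

lemmas scale_mult = scale_mult_left scale_mult_right

text \<open>
  Rules that move every \<open>f\<close> to the left, then every \<open>h\<close>, with a trailing factor \<open>x\<close> so that they apply inside
  longer products. Equations between elements of \<open>U(sl\<^sub>2)\<close> are checked below by rewriting both sides with them.
\<close>

lemma sl2_normal_order:
  assumes "e * f = f * e + h" "e * h = h * e - scale 2 e" "h * f = f * h - scale 2 f"
  shows "e * (f * x) = f * (e * x) + h * x" "e * (h * x) = h * (e * x) - scale 2 (e * x)"
    "h * (f * x) = f * (h * x) - scale 2 (f * x)"
  using assms by (simp_all add: distrib_right left_diff_distrib scale_mult flip: mult.assoc)

text \<open>
  Commuting \<open>e\<^sup>3 = 0\<close> with \<open>f\<close> once gives \<open>h e\<^sup>2 = 2 e\<^sup>2\<close>, twice gives \<open>f e\<^sup>2\<close> and three times gives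
  \<open>6 f (h - 2) e\<close> as a polynomial in \<open>h\<close>; multiplying the last relation by \<open>h\<^sup>2 + 3 h + 2\<close> kills its left
  side, because \<open>e (h\<^sup>2 + 3 h + 2) = (h\<^sup>2 - h) e\<close>, so that the relation applies once more and leaves the factor
  \<open>(h - 2) e\<^sup>2 = 0\<close>. So a module on which \<open>e\<^sup>3\<close> vanishes has only the weights \<open>-2, \<dots>, 2\<close>.
\<close>

lemma sl2_cube_zero:
  assumes sl2: "e * f = f * e + h" "e * h = h * e - scale 2 e" "h * f = f * h - scale 2 f"
    and cube: "e * (e * e) = 0"
  shows "h * (e * e) = scale 2 (e * e)"
    and "h * ((h * h - 1) * (h * h - scale 4 1)) = 0"
proof -
  note nf = sl2 sl2_normal_order[OF sl2] mult.assoc distrib_left distrib_right left_diff_distrib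
    right_diff_distrib scale_mult scale_numeral scale_right_distrib scale_right_diff_distrib
  have cube': "e * (e * (e * x)) = 0" for x
    using arg_cong[OF cube, of "\<lambda>y. y * x"] by (simp add: mult.assoc)
  have "scale 3 (h * (e * e) - scale 2 (e * e)) = e * (e * e) * f - f * (e * (e * e))"
    by (simp add: nf)
  then have "scale 3 (h * (e * e) - scale 2 (e * e)) = 0" by (simp add: cube)
  then show r1: "h * (e * e) = scale 2 (e * e)" by simp
  have r1': "h * (e * (e * x)) = e * (e * x) + e * (e * x)" for x
    using arg_cong[OF r1, of "\<lambda>y. y * x"] by (simp add: mult.assoc scale_mult scale_numeral distrib_right)
  have "scale 2 (f * (e * e) - (h * (h * e) - scale 3 (h * e) + scale 2 e))
      + scale 2 (f * (e * e)) - f * (h * (e * e)) = scale 2 (e * e) * f - h * (e * e) * f"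
    by (simp add: nf)
  then have "scale 2 (f * (e * e) - (h * (h * e) - scale 3 (h * e) + scale 2 e)) = 0"
    by (simp add: r1 scale_mult)
  then have r2: "f * (e * e) = h * (h * e) - scale 3 (h * e) + scale 2 e" by simp
  have r2': "f * (e * (e * x)) = h * (h * (e * x)) - scale 3 (h * (e * x)) + scale 2 (e * x)" for x
  proof -
    have "f * (e * (e * x)) = f * (e * e) * x" by (simp add: mult.assoc)
    also have "\<dots> = h * (h * (e * x)) - scale 3 (h * (e * x)) + scale 2 (e * x)"
      unfolding r2 by (simp add: mult.assoc scale_mult distrib_right left_diff_distrib)
    finally show ?thesis .
  qed
  have "f * (f * (e * e)) + scale 2 (f * (h * e)) - scale 2 (f * e) = f * (e * e) * f"
    by (simp add: nf)
  also have "\<dots> = (h * (h * e) - scale 3 (h * e) + scale 2 e) * f" by (simp only: r2)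
  also have "\<dots> = f * (h * (h * e)) - scale 7 (f * (h * e)) + scale 12 (f * e)
      + (h * (h * h) - scale 3 (h * h) + scale 2 h)"
    by (simp add: nf)
  finally have r3: "scale 6 (f * (h * e)) - scale 12 (f * e) = h * (h * h) - scale 3 (h * h) + scale 2 h"
    unfolding r2 by (simp add: distrib_left right_diff_distrib scale_mult scale_numeral algebra_simps)
  have r1h: "h * (e * (e * x)) = scale 2 (e * (e * x))" for x
    using r1' by (simp add: scale_numeral)
  have "(scale 6 (f * (h * e)) - scale 12 (f * e)) * (h * h + scale 3 h + scale 2 1)
     = scale 6 (f * ((h * (h * h) - scale 3 (h * h) + scale 2 h) * e))"
    by (simp add: nf)
  also have "\<dots> = scale 6 (f * ((scale 6 (f * (h * e)) - scale 12 (f * e)) * e))"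
    by (simp only: r3)
  also have "\<dots> = 0"
    using r1 by (simp add: mult.assoc left_diff_distrib scale_mult)
  finally have "(h * (h * h) - scale 3 (h * h) + scale 2 h) * (h * h + scale 3 h + scale 2 1) = 0"
    by (simp only: r3)
  moreover have "(h * (h * h) - scale 3 (h * h) + scale 2 h) * (h * h + scale 3 h + scale 2 1)
    = h * ((h * h - 1) * (h * h - scale 4 1))"
    by (simp add: nf)
  ultimately show "h * ((h * h - 1) * (h * h - scale 4 1)) = 0" by simp
qed

lemma sl2_square_zero:
  assumes sl2: "e * f = f * e + h" "e * h = h * e - scale 2 e" "h * f = f * h - scale 2 f"
    and square: "e * e = 0"
  shows "scale 2 (f * e) = h * h - h" and "h * (h * h) = h"
proof -
  note nf = sl2 sl2_normal_order[OF sl2] mult.assoc distrib_left distrib_right left_diff_distrib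
    right_diff_distrib scale_mult scale_numeral scale_right_distrib scale_right_diff_distrib
  have "scale 2 (h * e - e) = e * e * f - f * (e * e)" by (simp add: nf)
  then have "scale 2 (h * e - e) = 0" by (simp add: square)
  then have r1: "h * e = e" by simp
  have r1': "h * (e * x) = e * x" for x
    using r1 by (simp flip: mult.assoc)
  have "h * (e * f) = e * f" by (rule r1')
  then have "f * (h * e) - scale 2 (f * e) + h * h = f * e + h" by (simp add: nf)
  then show r2: "scale 2 (f * e) = h * h - h"
    by (simp add: r1 scale_numeral algebra_simps)
  have "scale 2 (f * e) * (h + 1) = 0"
    using r1 by (simp add: nf)
  then have "(h * h - h) * (h + 1) = 0" by (simp only: r2)
  then show "h * (h * h) = h" by (simp add: nf)
qed

end

context algebra_over
begin

text \<open>
  The product of the factors \<open>x - t\<close>, \<open>t\<close> in the list, applied to \<open>v\<close>. The module on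
  which elements act is the algebra itself, by left multiplication.
\<close>

definition eigen_kill :: "'b \<Rightarrow> 'a list \<Rightarrow> 'b \<Rightarrow> 'b"
  where "eigen_kill x ts v = foldr (\<lambda>t v. x * v - scale t v) ts v"

lemma eigen_kill_simps [simp]:
  "eigen_kill x [] v = v"
  "eigen_kill x (t # ts) v = x * eigen_kill x ts v - scale t (eigen_kill x ts v)"
  by (simp_all add: eigen_kill_def)

lemma eigen_kill_eigenvector:
  "x * v = scale t v \<Longrightarrow> eigen_kill x ts v = scale (\<Prod>s\<leftarrow>ts. t - s) v"
  by (induction ts) (simp_all add: scale_mult_right scale_left_diff_distrib algebra_simps)

lemma eigenvalue_in_roots:
  assumes "x * v = scale t v" "v \<noteq> 0" "eigen_kill x ts v = 0"
  shows "t \<in> set ts"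
  using assms eigen_kill_eigenvector[OF assms(1), of ts] by (auto simp: prod_list_zero_iff)

text \<open>
  Apply the factors \<open>x - t\<close> to \<open>w\<close> one after the other: the last non-zero vector obtained is an eigenvector.
\<close>

lemma eigenvector_exists:
  assumes "\<And>v t. v \<in> W \<Longrightarrow> x * v - scale t v \<in> W"
    and "w \<in> W" "w \<noteq> 0" "eigen_kill x ts w = 0"
  shows "\<exists>v\<in>W. v \<noteq> 0 \<and> (\<exists>t\<in>set ts. x * v = scale t v)"
  using assms(4)
proof (induction ts)
  case (Cons t ts)
  have W: "eigen_kill x us w \<in> W" for us
    by (induction us) (simp_all add: assms)
  show ?case
  proof (cases "eigen_kill x ts w = 0")
    case False
    then show ?thesis using W[of ts] Cons.prems by (intro bexI[of _ "eigen_kill x ts w"]) auto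
  qed (use Cons in auto)
qed (use assms in simp)

text \<open>
  Commuting elements preserve each other's eigenspaces, so the eigenvector can be chosen for one element after the
  other inside the joint eigenspace found so far.
\<close>

lemma joint_eigenvector:
  assumes "finite X" "\<And>x y. x \<in> X \<Longrightarrow> y \<in> X \<Longrightarrow> x * y = y * x"
    and "\<And>x v t. x \<in> X \<Longrightarrow> v \<in> W \<Longrightarrow> x * v - scale t v \<in> W"
    and "\<And>x v. x \<in> X \<Longrightarrow> eigen_kill x ts v = 0"
    and "w \<in> W" "w \<noteq> 0"
  shows "\<exists>v\<in>W. v \<noteq> 0 \<and> (\<forall>x\<in>X. \<exists>t\<in>set ts. x * v = scale t v)"
  using assms
proof (induction X rule: finite_induct)
  case (insert x X)
  then obtain v where v: "v \<in> W" "v \<noteq> 0" "\<forall>y\<in>X. \<exists>t\<in>set ts. y * v = scale t v"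
    by auto
  then obtain \<mu> where \<mu>: "\<And>y. y \<in> X \<Longrightarrow> \<mu> y \<in> set ts \<and> y * v = scale (\<mu> y) v"
    by metis
  let ?W = "{u \<in> W. \<forall>y\<in>X. y * u = scale (\<mu> y) u}"
  have "\<exists>v\<in>?W. v \<noteq> 0 \<and> (\<exists>t\<in>set ts. x * v = scale t v)"
  proof (rule eigenvector_exists)
    fix u t assume u: "u \<in> ?W"
    have "y * (x * u - scale t u) = scale (\<mu> y) (x * u - scale t u)" if "y \<in> X" for y
    proof -
      have "y * (x * u) = x * (y * u)" using insert.prems(1)[of y x] that by (simp flip: mult.assoc)
      then show ?thesis using u that
        by (simp add: right_diff_distrib scale_mult_right scale_right_diff_distrib mult.commute)
    qed
    then show "x * u - scale t u \<in> ?W" using u insert.prems(2) by auto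
  qed (use v \<mu> insert.prems in auto)
  then show ?case using \<mu> by blast
qed auto

end

section \<open>Weights in quotients of the enveloping algebra\<close>

text \<open>
  An associative algebra with a Lie homomorphism from \<open>gl\<^sub>k\<close> that kills the identity matrix, hence factors over
  \<open>sl\<^sub>k\<close>. Working with all \<open>E i j\<close> instead of a basis of \<open>sl\<^sub>k\<close> keeps the relations uniform. The instances
  are \<open>U(L)\<close> and two of its quotients.
\<close>

locale gl_algebra = algebra_over scale
  for scale :: "'a::field_char_0 \<Rightarrow> 'b::{ring,monoid_mult} \<Rightarrow> 'b" +
  fixes E :: "'n::finite \<Rightarrow> 'n \<Rightarrow> 'b"
  assumes E_bracket: "E i j * E k l - E k l * E i j =
      (if j = k then E i l else 0) - (if i = l then E k j else 0)"
    and E_trace: "(\<Sum>i\<in>UNIV. E i i) = 0"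
begin

abbreviation H :: "'n \<Rightarrow> 'n \<Rightarrow> 'b" where "H i j \<equiv> E i i - E j j"

definition quadratic_casimir :: 'b
  where "quadratic_casimir = (\<Sum>i\<in>UNIV. \<Sum>j\<in>UNIV. E i j * E j i)"

lemma E_commute: "E i j * E k l =
    E k l * E i j + ((if j = k then E i l else 0) - (if i = l then E k j else 0))"
  using E_bracket[of i j k l] by (simp add: algebra_simps)

text \<open>
  The root \<open>\<epsilon>\<^sub>i - \<epsilon>\<^sub>j\<close> as a function of the diagonal positions.
\<close>

definition unit_weight :: "'n \<Rightarrow> 'n \<Rightarrow> 'n \<Rightarrow> int"
  where "unit_weight i j a = (if a = i then 1 else 0) - (if a = j then 1 else 0)"

lemma E_diag: "E a a * E i j = E i j * E a a + scale (of_int (unit_weight i j a)) (E i j)"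
  by (subst E_commute) (auto simp: unit_weight_def)

lemma H_E: "H a b * E i j =
    E i j * H a b + scale (of_int (unit_weight i j a - unit_weight i j b)) (E i j)"
  by (simp add: left_diff_distrib right_diff_distrib E_diag[of a] E_diag[of b] scale_left_diff_distrib)

lemma diag_commute: "E a a * E b b = E b b * E a a"
  by (subst E_commute) auto

lemma H_commute: "H a b * H c d = H c d * H a b"
  by (simp add: left_diff_distrib right_diff_distrib diag_commute[of _ c] diag_commute[of _ d])

lemma sl2_triple:
  assumes "i \<noteq> j"
  shows "E i j * E j i = E j i * E i j + H i j"
    and "E i j * H i j = H i j * E i j - scale 2 (E i j)"
    and "H i j * E j i = E j i * H i j - scale 2 (E j i)"
proof -
  show "E i j * E j i = E j i * E i j + H i j" by (subst E_commute) simp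
  show "E i j * H i j = H i j * E i j - scale 2 (E i j)"
    "H i j * E j i = E j i * H i j - scale 2 (E j i)"
    using assms by (simp_all add: H_E unit_weight_def)
qed

lemma diag_eq_sum_H: "scale (of_nat CARD('n)) (E a a) = (\<Sum>b\<in>UNIV. H a b)"
  by (simp add: sum_subtractf E_trace sum_constant_scale)

definition H_bounded :: "int \<Rightarrow> bool"
  where "H_bounded r \<longleftrightarrow> (\<forall>a b v. eigen_kill (H a b) (map of_int [-r..r]) v = 0)"

text \<open>
  Since the \<open>E a a\<close> sum to zero, their eigenvalues are in general not integral; only \<open>k\<close> times them is, and that
  integer vector is called the weight here. A root therefore has weight \<open>k * unit_weight\<close>.
\<close>

definition is_weight :: "('n \<Rightarrow> int) \<Rightarrow> 'b \<Rightarrow> bool"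
  where "is_weight m w \<longleftrightarrow> w \<noteq> 0 \<and> (\<forall>a. E a a * w = scale (of_int (m a) / of_nat CARD('n)) w)"

lemma weight_H:
  "is_weight m w \<Longrightarrow> H a b * w = scale (of_int (m a - m b) / of_nat CARD('n)) w"
  by (simp add: is_weight_def left_diff_distrib scale_left_diff_distrib diff_divide_distrib)

lemma weight_sum_zero:
  assumes "is_weight m w" shows "(\<Sum>a\<in>UNIV. m a) = 0"
proof -
  have "scale (\<Sum>a\<in>UNIV. of_int (m a) / of_nat CARD('n)) w = (\<Sum>a\<in>UNIV. E a a * w)"
    using assms by (simp add: is_weight_def scale_sum_left)
  also have "\<dots> = 0" by (simp add: E_trace flip: sum_distrib_right)
  finally have "of_int (\<Sum>a\<in>UNIV. m a) = (0 :: 'a)"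
    using assms by (simp add: is_weight_def flip: sum_divide_distrib)
  then show ?thesis by (simp only: of_int_eq_0_iff)
qed

lemma weight_difference:
  assumes "is_weight m w" "H_bounded r"
  obtains d where "-r \<le> d" "d \<le> r" "m a - m b = int CARD('n) * d"
proof -
  have "of_int (m a - m b) / of_nat CARD('n) \<in> set (map of_int [-r..r] :: 'a list)"
    using assms by (intro eigenvalue_in_roots[OF weight_H[OF assms(1), of a b]])
      (auto simp: is_weight_def H_bounded_def)
  then obtain d where d: "d \<in> {-r..r}" "of_int (m a - m b) / of_nat CARD('n) = (of_int d :: 'a)"
    by auto
  then have "of_int (m a - m b) = (of_int (int CARD('n) * d) :: 'a)"
    by (simp add: field_simps)
  then show ?thesis using that d by (simp only: of_int_eq_iff) auto
qed

text \<open>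
  \<open>k E a a\<close> is the sum of the \<open>H a b\<close>, so a joint eigenvector of the \<open>H a b\<close> with integral eigenvalues is a
  weight vector with an integral weight.
\<close>

lemma weight_exists:
  assumes "H_bounded r" and W: "\<And>a b v t. v \<in> W \<Longrightarrow> H a b * v - scale t v \<in> W"
    and w: "w \<in> W" "w \<noteq> 0"
  obtains v m where "v \<in> W" "is_weight m v"
proof -
  have "\<exists>v\<in>W. v \<noteq> 0 \<and> (\<forall>x\<in>range (case_prod H). \<exists>t\<in>set (map of_int [-r..r]). x * v = scale t v)"
    using assms by (intro joint_eigenvector) (auto simp: H_bounded_def H_commute)
  then obtain v where v: "v \<in> W" "v \<noteq> 0" "\<forall>a b. \<exists>d. H a b * v = scale (of_int d) v"
    by fastforce
  then obtain d where d: "\<And>a b. H a b * v = scale (of_int (d a b)) v" by metis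
  have "E a a * v = scale (of_int (\<Sum>b\<in>UNIV. d a b) / of_nat CARD('n)) v" for a
  proof -
    have "scale (of_nat CARD('n)) (E a a * v) = (\<Sum>b\<in>UNIV. H a b * v)"
      by (simp add: diag_eq_sum_H scale_mult_left[symmetric] sum_distrib_right)
    also have "\<dots> = scale (of_int (\<Sum>b\<in>UNIV. d a b)) v"
      by (simp add: d scale_sum_left)
    finally have "scale (1 / of_nat CARD('n)) (scale (of_nat CARD('n)) (E a a * v)) =
      scale (1 / of_nat CARD('n)) (scale (of_int (\<Sum>b\<in>UNIV. d a b)) v)" by simp
    then show ?thesis by simp
  qed
  then show ?thesis using v that[of v "\<lambda>a. \<Sum>b\<in>UNIV. d a b"] by (simp add: is_weight_def)
qed

lemma weight_shift:
  assumes "is_weight m w" "E i j * w \<noteq> 0"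
  shows "is_weight (\<lambda>a. m a + int CARD('n) * unit_weight i j a) (E i j * w)"
proof -
  have "E a a * (E i j * w) = E i j * (E a a * w) + scale (of_int (unit_weight i j a)) (E i j * w)" for a
    using arg_cong[OF E_diag[of a i j], of "\<lambda>x. x * w"]
    by (simp only: distrib_right scale_mult_left mult.assoc)
  then show ?thesis using assms
    by (auto simp: is_weight_def scale_mult_right scale_left_distrib add_divide_distrib)
qed

lemma quadratic_casimir_mult:
  "quadratic_casimir * w = (\<Sum>i\<in>UNIV. \<Sum>j\<in>UNIV. E i j * (E j i * w))"
  by (simp add: quadratic_casimir_def sum_distrib_right mult.assoc)

text \<open>
  With \<open>e\<^sup>2 = 0\<close> all \<open>E j i * E i j\<close> are polynomials in the \<open>H i j\<close>, so the Casimir element can be evaluated at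
  any weight vector. The result is \<open>(k + 1) (\<Sum>a. m(a)\<^sup>2) = 2 k\<^sup>3\<close>, and \<open>k + 1\<close> divides \<open>2 k\<^sup>3 + 2\<close>, so it
  would divide 2. Informally: no representation in which the root vectors square to zero, that is, no sum of exterior
  powers of the natural representation, has the Casimir eigenvalue of the adjoint one.
\<close>

lemma square_zero_collapse:
  assumes k: "CARD('n) \<ge> 2"
    and square: "\<And>i j. i \<noteq> j \<Longrightarrow> E i j * E i j = 0"
    and cas: "quadratic_casimir = scale (2 * of_nat CARD('n)) 1"
  shows "(1 :: 'b) = 0"
proof (rule ccontr)
  assume "(1 :: 'b) \<noteq> 0"
  let ?k = "of_nat CARD('n) :: 'a"
  have HE: "scale 2 (E j i * E i j) = H i j * H i j - H i j" "H i j * (H i j * H i j) = H i j"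
    if "i \<noteq> j" for i j
    using sl2_square_zero[OF sl2_triple[OF that] square[OF that]] by auto
  have "H_bounded 1"
    unfolding H_bounded_def
  proof (intro allI)
    fix a b and v :: 'b
    have "[-1..1] = [-1, 0, 1::int]" by (simp add: upto.simps)
    moreover have "H a b * (H a b * (H a b * v)) = H a b * v"
    proof (cases "a = b")
      case False
      have "H a b * (H a b * (H a b * v)) = (H a b * (H a b * H a b)) * v"
        by (simp only: mult.assoc)
      then show ?thesis using HE(2)[OF False] by simp
    qed simp
    ultimately show "eigen_kill (H a b) (map of_int [- 1..1]) v = 0"
      by (simp add: distrib_left right_diff_distrib)
  qed
  then obtain w m where w: "is_weight m w"
    using \<open>1 \<noteq> 0\<close> by (elim weight_exists[of 1 UNIV 1]) auto
  define x where "x a = of_int (m a) / ?k" for a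
  have H: "H a b * w = scale (x a - x b) w" for a b
    using weight_H[OF w] by (simp add: x_def diff_divide_distrib)
  have x0: "(\<Sum>a\<in>UNIV. x a) = 0"
    using arg_cong[OF weight_sum_zero[OF w], of of_int] by (simp add: x_def flip: sum_divide_distrib)
  have "scale 2 (E j i * (E i j * w)) =
      scale (2 * (if i = j then (x i)^2 else 0) + ((x i - x j)^2 - (x i - x j))) w" for i j
  proof (cases "i = j")
    case True
    then show ?thesis using w
      by (simp add: is_weight_def x_def scale_mult_right power2_eq_square)
  next
    case False
    have "scale 2 (E j i * (E i j * w)) = (H i j * H i j - H i j) * w"
      by (simp add: HE(1)[OF False, symmetric] scale_mult_left mult.assoc)
    then show ?thesis using False
      by (simp only: left_diff_distrib[of "H i j * H i j"] mult.assoc H scale_mult_right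
          scale_scale power2_eq_square flip: scale_left_diff_distrib) simp
  qed
  then have "scale 2 (quadratic_casimir * w) =
      scale (\<Sum>j\<in>UNIV. \<Sum>i\<in>UNIV. 2 * (if i = j then (x i)^2 else 0) + ((x i - x j)^2 - (x i - x j))) w"
    by (simp add: quadratic_casimir_mult scale_sum_right scale_sum_left)
  also have "scale 2 (quadratic_casimir * w) = scale (4 * ?k) w"
    by (simp add: cas scale_mult_left)
  finally have "4 * ?k = (\<Sum>j\<in>UNIV. \<Sum>i\<in>UNIV. 2 * (if i = j then (x i)^2 else 0) + ((x i - x j)^2 - (x i - x j)))"
    using w by (simp add: is_weight_def)
  also have "\<dots> = (2 * ?k + 2) * (\<Sum>i\<in>UNIV. (x i)^2)"
  proof -
    have 1: "(\<Sum>j\<in>UNIV. \<Sum>i\<in>UNIV. 2 * (if i = j then (x i)^2 else 0)) = 2 * (\<Sum>i\<in>UNIV. (x i)^2)"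
      by (simp add: sum_distrib_left if_distrib cong: if_cong)
    have 2: "(\<Sum>j\<in>UNIV. \<Sum>i\<in>UNIV. x i - x j) = 0"
      by (simp add: sum_subtractf sum_negf x0 flip: sum_distrib_left)
    have 3: "(\<Sum>j\<in>UNIV. \<Sum>i\<in>UNIV. (x i - x j)^2) = 2 * ?k * (\<Sum>i\<in>UNIV. (x i)^2)"
      by (simp add: power2_diff sum.distrib sum_subtractf x0
          flip: sum_distrib_left sum_distrib_right)
    show ?thesis unfolding sum.distrib sum_subtractf
      using 1 2 3 by (simp add: sum_subtractf algebra_simps)
  qed
  also have "(\<Sum>i\<in>UNIV. (x i)^2) = of_int (\<Sum>i\<in>UNIV. (m i)^2) / ?k^2"
    by (simp add: x_def power_divide flip: sum_divide_distrib)
  finally have "of_int (4 * int CARD('n)^3) = (of_int ((2 * int CARD('n) + 2) * (\<Sum>i\<in>UNIV. (m i)^2)) :: 'a)"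
    by (simp add: field_simps power2_eq_square power3_eq_cube)
  then have "4 * int CARD('n)^3 = (2 * int CARD('n) + 2) * (\<Sum>i\<in>UNIV. (m i)^2)"
    by (simp only: of_int_eq_iff)
  then have eq: "2 * int CARD('n)^3 = (int CARD('n) + 1) * (\<Sum>i\<in>UNIV. (m i)^2)"
    by (simp add: algebra_simps)
  \<comment> \<open>\<open>k + 1\<close> divides \<open>k\<^sup>3 + 1\<close>.\<close>
  have "2 = (int CARD('n) + 1) * (2 * int CARD('n)^2 - 2 * int CARD('n) + 2) - 2 * int CARD('n)^3"
    by (simp add: algebra_simps power2_eq_square power3_eq_cube)
  then have "int CARD('n) + 1 dvd 2" unfolding eq by (metis dvd_diff dvd_triv_left)
  then have "int CARD('n) + 1 \<le> 2" by (rule zdvd_imp_le) simp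
  then show False using k by simp
qed

lemma eigen_kill_quintic:
  "eigen_kill h (map of_int [-2..2]) v = h * ((h * h - 1) * (h * h - scale 4 1)) * v"
proof -
  have "[-2..2] = [-2, -1, 0, 1, 2::int]" by (simp add: upto.simps)
  then show ?thesis
    by (simp add: distrib_left distrib_right right_diff_distrib left_diff_distrib scale_mult
        scale_numeral mult.assoc)
qed

lemma H_bounded_cube_zero:
  assumes cube: "\<And>i j. i \<noteq> j \<Longrightarrow> E i j * (E i j * E i j) = 0"
  shows "H_bounded 2"
  unfolding H_bounded_def
proof (intro allI)
  fix a b and v :: 'b
  show "eigen_kill (H a b) (map of_int [- 2..2]) v = 0"
  proof (cases "a = b")
    case False
    then show ?thesis using sl2_cube_zero(2)[OF sl2_triple[OF False] cube]
      unfolding eigen_kill_quintic by simp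
  qed (simp only: eigen_kill_quintic, simp)
qed

lemma eigen_kill_commute:
  "eigen_kill x ts (x * v - scale t v) = x * eigen_kill x ts v - scale t (eigen_kill x ts v)"
proof (induction ts)
  case (Cons s ts)
  show ?case
    unfolding eigen_kill_simps Cons
    by (simp add: right_diff_distrib scale_mult_right scale_right_diff_distrib mult.commute[of s t])
qed simp

lemma eigen_kill_remove1:
  "t \<in> set ts \<Longrightarrow> eigen_kill x ts v = eigen_kill x (remove1 t ts) (x * v - scale t v)"
proof (induction ts)
  case (Cons s ts)
  then show ?case
    by (cases "t = s") (simp_all add: eigen_kill_commute right_diff_distrib scale_mult_right
        scale_right_diff_distrib mult.commute[of s t])
qed simp

text \<open>
  If of any two opposite root vectors the one that raises (or, at equal entries, one of them) annihilates \<open>w\<close>, each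
  summand \<open>E i j * E j i\<close> of the Casimir element acts on \<open>w\<close> by a scalar.
\<close>

lemma casimir_extremal_weight:
  assumes w: "is_weight m w" and cas: "quadratic_casimir = scale (2 * of_nat CARD('n)) 1"
    and raise: "\<And>i j. i \<noteq> j \<Longrightarrow> m i > m j \<Longrightarrow> E i j * w = 0"
    and level: "\<And>i j. i \<noteq> j \<Longrightarrow> m i = m j \<Longrightarrow> E i j * w = 0 \<or> E j i * w = 0"
  shows "(\<Sum>i\<in>UNIV. (m i)^2) + int CARD('n) * (\<Sum>i\<in>UNIV. \<Sum>j\<in>UNIV. max 0 (m i - m j)) =
    2 * int CARD('n)^3"
proof -
  let ?k = "of_nat CARD('n) :: 'a"
  have H: "H i j * w = scale (of_int (m i - m j) / ?k) w" for i j
    by (rule weight_H[OF w])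
  have "E i j * (E j i * w) =
      scale (of_int ((if i = j then (m i)^2 else 0) + int CARD('n) * max 0 (m i - m j)) / ?k^2) w" for i j
  proof (cases "i = j")
    case True
    then show ?thesis using w
      by (simp add: is_weight_def scale_mult_right power2_eq_square)
  next
    case False
    have comm: "E i j * (E j i * w) = E j i * (E i j * w) + scale (of_int (m i - m j) / ?k) w"
      using arg_cong[OF sl2_triple(1)[OF False], of "\<lambda>x. x * w"]
      by (simp only: distrib_right mult.assoc H)
    have *: "x / ?k = ?k * x / ?k^2" for x
      by (simp add: power2_eq_square)
    consider "m i > m j" | "m i = m j" | "m i < m j" by linarith
    then show ?thesis
    proof cases
      case 1
      then show ?thesis using False raise[OF False 1] comm
        by (simp add: *[of "of_int (m i) - of_int (m j)"])
    next
      case 2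
      then show ?thesis using False level[OF False 2] comm by auto
    next
      case 3
      then show ?thesis using False raise[of j i] by simp
    qed
  qed
  then have "quadratic_casimir * w = scale (\<Sum>i\<in>UNIV. \<Sum>j\<in>UNIV.
      of_int ((if i = j then (m i)^2 else 0) + int CARD('n) * max 0 (m i - m j)) / ?k^2) w"
    by (simp add: quadratic_casimir_mult scale_sum_left del: of_int_add)
  also have "quadratic_casimir * w = scale (2 * ?k) w"
    by (simp add: cas scale_mult_left)
  finally have "2 * ?k = (\<Sum>i\<in>UNIV. \<Sum>j\<in>UNIV.
      of_int ((if i = j then (m i)^2 else 0) + int CARD('n) * max 0 (m i - m j)) / ?k^2)"
    using w unfolding is_weight_def scale_right_imp_eq scale_cancel_right by blast
  then have "of_int (2 * int CARD('n)^3) = (of_int (\<Sum>i\<in>UNIV. \<Sum>j\<in>UNIV.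
      (if i = j then (m i)^2 else 0) + int CARD('n) * max 0 (m i - m j)) :: 'a)"
    by (simp add: field_simps power2_eq_square power3_eq_cube flip: sum_divide_distrib)
  then have "2 * int CARD('n)^3 = (\<Sum>i\<in>UNIV. \<Sum>j\<in>UNIV.
      (if i = j then (m i)^2 else 0) + int CARD('n) * max 0 (m i - m j))"
    by (simp only: of_int_eq_iff)
  then show ?thesis
    by (simp add: sum.distrib sum_distrib_left)
qed

text \<open>
  These root vectors raise the eigenvalue of \<open>H p q\<close> above 2, where no eigenvalue is left.
\<close>

lemma raise_eigenvector_two:
  assumes "H_bounded 2" "p \<noteq> q" "H p q * v = scale 2 v" "i = p \<or> j = q" "i \<noteq> j"
  shows "E i j * v = 0"
proof (rule ccontr)
  assume nz: "E i j * v \<noteq> 0"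
  define t where "t = 2 + unit_weight i j p - unit_weight i j q"
  have "H p q * (E i j * v) = scale (of_int t) (E i j * v)"
  proof -
    have "H p q * (E i j * v) = E i j * (H p q * v)
        + scale (of_int (unit_weight i j p - unit_weight i j q)) (E i j * v)"
      using arg_cong[OF H_E[of p q i j], of "\<lambda>x. x * v"]
      by (simp only: distrib_right scale_mult_left mult.assoc)
    then show ?thesis using assms(3)
      by (simp add: t_def scale_mult_right scale_left_distrib scale_left_diff_distrib algebra_simps)
  qed
  moreover have "eigen_kill (H p q) (map of_int [-2..2]) (E i j * v) = 0"
    using assms(1) unfolding H_bounded_def by blast
  ultimately have "(of_int t :: 'a) \<in> of_int ` {-2..2}"
    using eigenvalue_in_roots[OF _ nz] by (metis set_map set_upto)
  then have "t \<in> {-2..2}" by (simp only: image_iff of_int_eq_iff) blast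
  then show False using assms by (auto simp: t_def unit_weight_def split: if_splits)
qed

context
  fixes p q :: 'n
  assumes pq: "p \<noteq> q" and bounded: "H_bounded 2"
    and cas: "quadratic_casimir = scale (2 * of_nat CARD('n)) 1"
begin

lemma top_weight_range:
  assumes w: "is_weight m w" "H p q * w = scale 2 w"
  shows "m p - m q = 2 * int CARD('n)" "m j \<le> m p" "m q \<le> m j"
proof -
  have le: "\<bar>m a - m b\<bar> \<le> 2 * int CARD('n)" for a b
  proof -
    obtain d where "-2 \<le> d" "d \<le> 2" "m a - m b = int CARD('n) * d"
      by (rule weight_difference[OF w(1) bounded])
    then have "\<bar>m a - m b\<bar> = int CARD('n) * \<bar>d\<bar>" "\<bar>d\<bar> \<le> 2" by (auto simp: abs_mult)
    then show ?thesis by (simp add: mult.commute mult_left_mono)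
  qed
  have "scale (of_int (m p - m q) / of_nat CARD('n)) w = scale 2 w"
    using weight_H[OF w(1)] w(2) by metis
  then have "of_int (m p - m q) = (of_int (2 * int CARD('n)) :: 'a)"
    using w(1) by (simp add: is_weight_def field_simps)
  then show eq: "m p - m q = 2 * int CARD('n)" by (simp only: of_int_eq_iff)
  show "m j \<le> m p" "m q \<le> m j" using le[of p j] le[of j q] eq by linarith+
qed

text \<open>
  A weight of maximal norm on the eigenspace \<open>H p q = 2\<close> is extremal: a root vector that fixes the eigenspace and
  raises the weight would lengthen it. The Casimir eigenvalue then bounds the norm of this weight.
\<close>

lemma top_weight_norm_bound:
  assumes w: "is_weight m w" "H p q * w = scale 2 w"
  shows "(\<Sum>a\<in>UNIV. (m a)^2) \<le> 2 * int CARD('n)^2"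
proof -
  let ?k = "int CARD('n)" and ?N = "\<lambda>m::'n \<Rightarrow> int. \<Sum>a\<in>UNIV. (m a)^2"
  let ?P = "\<lambda>m. \<exists>w. is_weight m w \<and> H p q * w = scale 2 w"
  have bound: "?N m \<le> ?k * (4 * ?k^2)" if "?P m" for m
  proof -
    from that obtain w where w: "is_weight m w" "H p q * w = scale 2 w" by blast
    have "?k * m a = (\<Sum>b\<in>UNIV. m a - m b)" for a
      by (simp add: sum_subtractf weight_sum_zero[OF w(1)])
    moreover have "\<bar>m a - m b\<bar> \<le> 2 * ?k" for a b
      using top_weight_range(1)[OF w] top_weight_range(2,3)[OF w, of a]
        top_weight_range(2,3)[OF w, of b] by linarith
    ultimately have "\<bar>?k * m a\<bar> \<le> (\<Sum>b\<in>(UNIV::'n set). 2 * ?k)" for a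
      by (metis (no_types, lifting) order_trans sum_abs sum_mono)
    then have "\<bar>m a\<bar> \<le> 2 * ?k" for a
      by (simp add: abs_mult)
    then have "(m a)^2 \<le> (2 * ?k)^2" for a
      by (metis abs_ge_zero power2_abs power_mono)
    then have "?N m \<le> (\<Sum>a\<in>(UNIV::'n set). (2 * ?k)^2)" by (intro sum_mono)
    then show ?thesis by simp
  qed
  have "\<exists>m. ?P m \<and> (\<forall>m'. ?P m' \<longrightarrow> nat (?N m') \<le> nat (?N m))"
    using bound w
    by (intro ex_has_greatest_nat[where b = "nat (?k * (4 * ?k^2)) + 1" and k = m]) fastforce+
  then obtain m0 w0 where w0: "is_weight m0 w0" "H p q * w0 = scale 2 w0"
    and max: "\<And>m'. ?P m' \<Longrightarrow> ?N m' \<le> ?N m0"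
    by (smt (verit, best) nat_le_eq_zle sum_nonneg zero_le_power2)
  note range = top_weight_range[OF w0]
  have raise: "E i j * w0 = 0" if ij: "i \<noteq> j" "m0 i \<ge> m0 j" "i \<noteq> q" "j \<noteq> p" for i j
  proof (cases "i = p \<or> j = q")
    case True
    then show ?thesis using raise_eigenvector_two[OF bounded pq w0(2)] ij by blast
  next
    case False
    show ?thesis
    proof (rule ccontr)
      assume nz: "E i j * w0 \<noteq> 0"
      let ?m = "\<lambda>a. m0 a + ?k * unit_weight i j a"
      have "unit_weight i j p - unit_weight i j q = 0"
        using False ij by (auto simp: unit_weight_def)
      then have "H p q * (E i j * w0) = E i j * (H p q * w0)"
        using arg_cong[OF H_E[of p q i j], of "\<lambda>x. x * w0"]
        by (simp only: of_int_0 scale_zero_left add_0_right mult.assoc)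
      then have "?P ?m" using weight_shift[OF w0(1) nz] w0(2) by (auto simp: scale_mult_right)
      then have "?N ?m \<le> ?N m0" by (rule max)
      also have "?N ?m = ?N m0 + 2 * ?k * (m0 i - m0 j) + 2 * ?k^2"
      proof -
        have "(?m a)^2 = (m0 a)^2 + ((if a = i then 2 * ?k * m0 i + ?k^2 else 0)
            + (if a = j then - 2 * ?k * m0 j + ?k^2 else 0))" for a
          using ij(1) by (simp add: unit_weight_def power2_eq_square algebra_simps)
        then show ?thesis by (simp add: sum.distrib algebra_simps)
      qed
      moreover have "2 * ?k * (m0 i - m0 j) \<ge> 0" "?k^2 > 0" using ij(2) by simp_all
      ultimately show False by linarith
    qed
  qed
  \<comment> \<open>\<open>m0\<close> is maximal at \<open>p\<close> and minimal at \<open>q\<close>, so the pairs with \<open>i = q\<close> or \<open>j = p\<close> do not raise.\<close>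
  have eq: "?N m0 + ?k * (\<Sum>i\<in>UNIV. \<Sum>j\<in>UNIV. max 0 (m0 i - m0 j)) = 2 * ?k^3"
  proof (rule casimir_extremal_weight[OF w0(1) cas])
    fix i j assume ij: "i \<noteq> j" "m0 i > m0 j"
    then show "E i j * w0 = 0" using raise[of i j] range(2,3)[of i] range(2,3)[of j] by force
  next
    fix i j assume ij: "i \<noteq> j" "m0 i = m0 j"
    then show "E i j * w0 = 0 \<or> E j i * w0 = 0"
      using raise[of i j] raise[of j i] range(1) by force
  qed
  \<comment> \<open>Keep the pairs with \<open>i = p\<close> or \<open>j = q\<close> only.\<close>
  have "(\<Sum>i\<in>UNIV. \<Sum>j\<in>UNIV. max 0 (m0 i - m0 j)) \<ge> (?k - 1) * (2 * ?k)"
  proof -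
    have "(\<Sum>i\<in>UNIV. \<Sum>j\<in>UNIV. max 0 (m0 i - m0 j)) =
        (\<Sum>j\<in>UNIV. max 0 (m0 p - m0 j)) + (\<Sum>i\<in>UNIV - {p}. \<Sum>j\<in>UNIV. max 0 (m0 i - m0 j))"
      by (subst sum.remove[of _ p]) auto
    also have "\<dots> \<ge> (\<Sum>j\<in>UNIV. m0 p - m0 j) + (\<Sum>i\<in>UNIV - {p}. m0 i - m0 q)"
    proof (intro add_mono sum_mono)
      fix i
      show "m0 i - m0 q \<le> (\<Sum>j\<in>UNIV. max 0 (m0 i - m0 j))"
        using member_le_sum[of q UNIV "\<lambda>j. max 0 (m0 i - m0 j)"] by auto
    qed auto
    also have "(\<Sum>j\<in>UNIV. m0 p - m0 j) + (\<Sum>i\<in>UNIV - {p}. m0 i - m0 q) = (?k - 1) * (m0 p - m0 q)"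
      using sum.remove[of UNIV p m0] weight_sum_zero[OF w0(1)]
      by (simp add: sum_subtractf card_Diff_singleton algebra_simps of_nat_diff Suc_leI)
    finally show ?thesis using range(1) by simp
  qed
  then have "?k * (\<Sum>i\<in>UNIV. \<Sum>j\<in>UNIV. max 0 (m0 i - m0 j)) \<ge> ?k * ((?k - 1) * (2 * ?k))"
    by (intro mult_left_mono) auto
  then have "?N m0 \<le> 2 * ?k^2" using eq
    by (simp add: algebra_simps power2_eq_square power3_eq_cube)
  moreover have "?N m \<le> ?N m0" using max w by blast
  ultimately show ?thesis by linarith
qed

text \<open>
  The norm bound \<open>2 k\<^sup>2\<close> is attained by \<open>m p = k\<close>, \<open>m q = - k\<close> alone, given that \<open>m p - m q = 2 k\<close>: the
  weight is the root \<open>\<epsilon>\<^sub>p - \<epsilon>\<^sub>q\<close>.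
\<close>

lemma top_weight_unique:
  assumes w: "is_weight m w" "H p q * w = scale 2 w"
  shows "m a = int CARD('n) * unit_weight p q a"
proof -
  let ?k = "int CARD('n)"
  let ?R = "\<Sum>a\<in>UNIV - {p, q}. (m a)^2"
  have "(\<Sum>a\<in>UNIV. (m a)^2) = (m p)^2 + (m q)^2 + ?R"
    using pq by (simp add: sum.remove[of UNIV p] sum.remove[of "UNIV - {p}" q] insert_commute
        Diff_insert[symmetric])
  moreover have "2 * ((m p)^2 + (m q)^2) = (m p + m q)^2 + (m p - m q)^2"
    by (simp add: power2_eq_square algebra_simps)
  moreover have "m p - m q = 2 * ?k" using top_weight_range[OF w] by blast
  moreover have "?R \<ge> 0" by (intro sum_nonneg) auto
  moreover note top_weight_norm_bound[OF w]
  ultimately have "2 * ?R + (m p + m q)^2 \<le> 0" by (simp add: power_mult_distrib)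
  then have R: "?R = 0" "(m p + m q)^2 = 0"
    using \<open>?R \<ge> 0\<close> zero_le_power2[of "m p + m q"] by linarith+
  then have "\<forall>a\<in>UNIV - {p, q}. (m a)^2 = 0"
    by (subst (asm) sum_nonneg_eq_0_iff) auto
  then show ?thesis using R(2) \<open>m p - m q = 2 * ?k\<close> pq by (auto simp: unit_weight_def)
qed

text \<open>
  All joint eigenvectors in the eigenspace \<open>H p q = 2\<close> have the weight \<open>\<epsilon>\<^sub>p - \<epsilon>\<^sub>q\<close>. Any other component of
  \<open>v\<close> would, after removal of this eigenvalue from the list, produce a joint eigenvector with another weight.
\<close>

lemma top_eigenvector_H:
  assumes v: "H p q * v = scale 2 v"
  shows "H a b * v = scale (of_int (unit_weight p q a - unit_weight p q b)) v"
proof (rule ccontr)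
  let ?d = "unit_weight p q a - unit_weight p q b"
  let ?W = "{u. H p q * u = scale 2 u}"
  have W: "H c d * u - scale t u \<in> ?W" if "u \<in> ?W" for c d u t
  proof -
    have "H p q * (H c d * u) = H c d * (H p q * u)" by (simp only: H_commute flip: mult.assoc)
    then show ?thesis using that by (simp add: right_diff_distrib scale_mult_right scale_right_diff_distrib mult.commute)
  qed
  define u where "u = H a b * v - scale (of_int ?d) v"
  assume "H a b * v \<noteq> scale (of_int ?d) v"
  then have u: "u \<in> ?W" "u \<noteq> 0" using W v by (auto simp: u_def)
  have "?d \<in> {-2..2}" using pq by (auto simp: unit_weight_def)
  then have "eigen_kill (H a b) (remove1 (of_int ?d) (map of_int [-2..2])) u =
      eigen_kill (H a b) (map of_int [-2..2]) v"
    unfolding u_def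
    by (intro eigen_kill_remove1[symmetric]) (simp only: set_map set_upto imageI)
  then have "eigen_kill (H a b) (remove1 (of_int ?d) (map of_int [-2..2])) u = 0"
    using bounded by (simp add: H_bounded_def)
  from eigenvector_exists[of ?W "H a b", OF W u this]
  obtain u' t where u': "u' \<in> ?W" "u' \<noteq> 0" "H a b * u' = scale t u'"
      "t \<in> set (remove1 (of_int ?d) (map of_int [-2..2]))" by blast
  have "distinct (map of_int [-2..2] :: 'a list)"
    unfolding distinct_map by (auto simp: inj_on_def simp del: upto.simps)
  then have t: "t \<noteq> of_int ?d" using u'(4) by (simp only: set_remove1_eq) blast
  let ?W' = "{x \<in> ?W. H a b * x = scale t x}"
  have W': "H c d * x - scale s x \<in> ?W'" if "x \<in> ?W'" for c d x s
  proof -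
    have "H a b * (H c d * x) = H c d * (H a b * x)" by (simp only: H_commute flip: mult.assoc)
    then show ?thesis using that W[of x c d s]
      by (simp add: right_diff_distrib scale_mult_right scale_right_diff_distrib mult.commute)
  qed
  have "u' \<in> ?W'" using u' by simp
  from weight_exists[OF bounded W' this u'(2)]
  obtain w m where w: "w \<in> ?W'" "is_weight m w" by blast
  then have "m a - m b = int CARD('n) * ?d"
    using top_weight_unique[OF w(2)] by (simp add: right_diff_distrib)
  moreover have "scale (of_int (m a - m b) / of_nat CARD('n)) w = scale t w"
    using weight_H[OF w(2), of a b] w(1) by simp
  ultimately have "of_int (int CARD('n) * ?d) / of_nat CARD('n) = t"
    using w(2) by (metis is_weight_def scale_cancel_right)
  then show False using t by simp
qed

text \<open>
  Eigenvectors of \<open>H p q\<close> for the eigenvalue 2 behave like the highest root vector \<open>e\<^sub>p\<^sub>q\<close> of the adjoint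
  representation.
\<close>

lemma top_eigenvector:
  assumes v: "H p q * v = scale 2 v"
  shows "E a a * v = scale (of_int (unit_weight p q a)) v"
    and "a \<noteq> b \<Longrightarrow> a \<noteq> q \<Longrightarrow> b \<noteq> p \<Longrightarrow> E a b * v = 0"
proof -
  have sum0: "(\<Sum>b\<in>UNIV. unit_weight p q b) = 0"
    by (simp add: unit_weight_def sum_subtractf)
  have "scale (of_nat CARD('n)) (E a a * v) = (\<Sum>b\<in>UNIV. H a b * v)"
    by (simp add: diag_eq_sum_H scale_mult_left[symmetric] sum_distrib_right)
  also have "\<dots> = scale (of_int (\<Sum>b\<in>UNIV. unit_weight p q a - unit_weight p q b)) v"
    by (simp only: top_eigenvector_H[OF v] of_int_sum scale_sum_left)
  also have "\<dots> = scale (of_nat CARD('n)) (scale (of_int (unit_weight p q a)) v)"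
    by (simp add: sum_subtractf sum0)
  finally show "E a a * v = scale (of_int (unit_weight p q a)) v"
    by (subst (asm) scale_cancel_left) auto
  assume ab: "a \<noteq> b" "a \<noteq> q" "b \<noteq> p"
  show "E a b * v = 0"
  proof (cases "a = p \<or> b = q")
    case True
    then show ?thesis using raise_eigenvector_two[OF bounded pq v] ab by blast
  next
    case False
    have "H c d * (E a b * v) = E a b * (H c d * v)
        + scale (of_int (unit_weight a b c - unit_weight a b d)) (E a b * v)" for c d
      using arg_cong[OF H_E[of c d a b], of "\<lambda>x. x * v"]
      by (simp only: distrib_right scale_mult_left mult.assoc)
    from this[of p q] this[of a b] have "H p q * (E a b * v) = scale 2 (E a b * v)"
        "H a b * (E a b * v) = scale 2 (E a b * v)"
      using False ab v top_eigenvector_H[OF v, of a b]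
      by (auto simp: unit_weight_def scale_mult_right)
    then have "scale 2 (E a b * v) = 0"
      using top_eigenvector_H[of "E a b * v" a b] False ab by (simp add: unit_weight_def)
    then show ?thesis by simp
  qed
qed

end

text \<open>
  The submodule generated by a highest root vector is obtained with those root vectors alone that lower it, the ones in
  column \<open>p\<close> and in row \<open>q\<close>.
\<close>

inductive_set lowered :: "'n \<Rightarrow> 'n \<Rightarrow> 'b \<Rightarrow> 'b set" for p q v where
  base: "v \<in> lowered p q v"
| add: "x \<in> lowered p q v \<Longrightarrow> y \<in> lowered p q v \<Longrightarrow> x + y \<in> lowered p q v"
| scale: "x \<in> lowered p q v \<Longrightarrow> scale c x \<in> lowered p q v"
| column: "x \<in> lowered p q v \<Longrightarrow> a \<noteq> p \<Longrightarrow> E a p * x \<in> lowered p q v"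
| row: "x \<in> lowered p q v \<Longrightarrow> b \<noteq> q \<Longrightarrow> E q b * x \<in> lowered p q v"

lemma lowered_if:
  assumes "x \<in> lowered p q v" "y \<in> lowered p q v" "z \<in> lowered p q v"
  shows "x + ((if P then y else 0) - (if Q then z else 0)) \<in> lowered p q v"
  using assms lowered.add[of x p q v] lowered.add[of _ p q v "scale (-1) z"]
    lowered.scale[of z p q v "-1"]
  by (auto simp: add.assoc[symmetric] diff_conv_add_uminus simp del: add_uminus_conv_diff)

text \<open>
  Every root vector is moved past the lowering ones by the bracket relations until it reaches \<open>v\<close>.
\<close>

lemma lowered_closed:
  assumes base: "\<And>a b. a \<noteq> q \<or> b = q \<Longrightarrow> b \<noteq> p \<or> a = p \<Longrightarrow> \<exists>c. E a b * v = scale c v"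
  shows "x \<in> lowered p q v \<Longrightarrow> E a b * x \<in> lowered p q v"
proof (induction arbitrary: a b rule: lowered.induct)
  case base
  then show ?case using assms[of a b] lowered.base lowered.scale lowered.column lowered.row by metis
next
  case (column x c)
  have "E a b * (E c p * x) =
      E c p * (E a b * x) + ((if b = c then E a p * x else 0) - (if a = p then E c b * x else 0))"
    by (subst mult.assoc[symmetric], subst E_commute)
      (simp add: distrib_right left_diff_distrib mult.assoc)
  then show ?case using column by (simp only:) (rule lowered_if[OF lowered.column])
next
  case (row x c)
  have "E a b * (E q c * x) =
      E q c * (E a b * x) + ((if b = q then E a c * x else 0) - (if a = c then E q b * x else 0))"
    by (subst mult.assoc[symmetric], subst E_commute)
      (simp add: distrib_right left_diff_distrib mult.assoc)
  then show ?case using row by (simp only:) (rule lowered_if[OF lowered.row])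
qed (auto simp: distrib_left scale_mult_right intro: lowered.intros)

inductive_set generated :: "'b set" where
  one: "1 \<in> generated"
| add: "x \<in> generated \<Longrightarrow> y \<in> generated \<Longrightarrow> x + y \<in> generated"
| scale: "x \<in> generated \<Longrightarrow> scale c x \<in> generated"
| mult: "x \<in> generated \<Longrightarrow> E a b * x \<in> generated"

text \<open>
  \<open>E p q\<^sup>2\<close> generates a highest weight module with the highest weight of the adjoint representation, and
  \<open>E q p\<^sup>2\<close> projects it onto its lowest weight space: it annihilates everything that was lowered in column \<open>p\<close>
  or row \<open>q\<close>, because \<open>E q p\<^sup>2\<close> commutes with those root vectors and is itself annihilated by them.
\<close>

lemma corner_one_dimensional:
  assumes pq: "p \<noteq> q"
    and cube: "\<And>i j. i \<noteq> j \<Longrightarrow> E i j * (E i j * E i j) = 0"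
    and cas: "quadratic_casimir = scale (2 * of_nat CARD('n)) 1"
    and x: "x \<in> generated"
  shows "\<exists>c. E q p * E q p * x * (E p q * E p q) = scale c (E q p * E q p * (E p q * E p q))"
proof -
  note bounded = H_bounded_cube_zero[OF cube]
  let ?v = "E p q * E p q" and ?u = "E q p * E q p"
  have v: "H p q * ?v = scale 2 ?v"
    using sl2_cube_zero(1)[OF sl2_triple[OF pq] cube[OF pq]] by simp
  have u: "H q p * ?u = scale 2 ?u"
    using sl2_cube_zero(1)[OF sl2_triple[OF pq[symmetric]] cube[OF pq[symmetric]]] by simp
  have base: "\<exists>c. E a b * ?v = scale c ?v" if "a \<noteq> q \<or> b = q" "b \<noteq> p \<or> a = p" for a b
    using top_eigenvector(1)[OF pq bounded cas v, of a] top_eigenvector(2)[OF pq bounded cas v, of a b]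
      that scale_zero_left[of ?v]
    by (cases "a = b") (metis, metis)
  have "x * ?v \<in> lowered p q ?v"
    using x by (induction rule: generated.induct)
      (auto simp: distrib_right scale_mult_left mult.assoc[of "E _ _" _ ?v]
        intro: lowered.base lowered.add lowered.scale lowered_closed[OF base])
  moreover have "\<exists>c. ?u * y = scale c (?u * ?v)" if "y \<in> lowered p q ?v" for y
    using that
  proof (induction rule: lowered.induct)
    case base
    show ?case by (rule exI[of _ 1]) simp
  next
    case (add x y)
    then show ?case by (auto simp: distrib_left simp flip: scale_left_distrib)
  next
    case (scale x c)
    then show ?case by (metis scale_mult_right scale_scale)
  next
    case (column x a)
    have "E q p * E a p = E a p * E q p" using column(2) pq by (subst E_commute) auto
    then have "?u * (E a p * x) = E a p * ?u * x" by (metis mult.assoc)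
    moreover have "E a p * ?u = 0"
      using column(2) by (intro raise_eigenvector_two[OF bounded pq[symmetric] u]) auto
    ultimately show ?case by (auto intro: exI[of _ 0])
  next
    case (row x b)
    have "E q p * E q b = E q b * E q p" using row(2) pq by (subst E_commute) auto
    then have "?u * (E q b * x) = E q b * ?u * x" by (metis mult.assoc)
    moreover have "E q b * ?u = 0"
      using row(2) by (intro raise_eigenvector_two[OF bounded pq[symmetric] u]) auto
    ultimately show ?case by (auto intro: exI[of _ 0])
  qed
  ultimately show ?thesis by (simp add: mult.assoc)
qed

end

section \<open>Matrix units and inner derivations\<close>

definition munit :: "'n \<Rightarrow> 'n \<Rightarrow> 'a::field^'n^'n"
  where "munit a b = (\<chi> i j. if i = a \<and> j = b then 1 else 0)"

lemma mat_unit_munit: "mat_unit i j = munit (idx i) (idx j)"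
  by (simp add: mat_unit_def munit_def)

lemma mat_scale_nth [simp]: "mat_scale c A $ i $ j = c * A $ i $ j"
  by (simp add: mat_scale_def)

lemma munit_nth: "munit a b $ i $ j = (if i = a \<and> j = b then 1 else 0)"
  by (simp add: munit_def)

lemma munit_mult_nth:
  fixes A :: "'a::field^'n^'n"
  shows "(munit a b ** A) $ i $ j = (if i = a then A $ b $ j else 0)"
    "(A ** munit a b) $ i $ j = (if j = b then A $ i $ a else 0)"
proof -
  have "(munit a b ** A) $ i $ j = (\<Sum>l\<in>UNIV. munit a b $ i $ l * A $ l $ j)"
    by (simp add: matrix_matrix_mult_def)
  also have "\<dots> = (\<Sum>l\<in>UNIV. if l = b then (if i = a then A $ b $ j else 0) else 0)"
    by (intro sum.cong) (auto simp: munit_nth)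
  finally show "(munit a b ** A) $ i $ j = (if i = a then A $ b $ j else 0)" by simp
  have "(A ** munit a b) $ i $ j = (\<Sum>l\<in>UNIV. A $ i $ l * munit a b $ l $ j)"
    by (simp add: matrix_matrix_mult_def)
  also have "\<dots> = (\<Sum>l\<in>UNIV. if l = a then (if j = b then A $ i $ a else 0) else 0)"
    by (intro sum.cong) (auto simp: munit_nth)
  finally show "(A ** munit a b) $ i $ j = (if j = b then A $ i $ a else 0)" by simp
qed

lemma munit_mult: "munit a b ** munit c d = (if b = c then munit a d else (0 :: 'a::field^'n^'n))"
  by (auto simp: vec_eq_iff munit_mult_nth munit_nth)

lemma munit_neq_0 [simp]: "munit a b \<noteq> (0 :: 'a::field^'n^'n)"
  by (metis munit_nth zero_index zero_neq_one)

lemma matrix_expansion: "A = (\<Sum>i\<in>UNIV. \<Sum>j\<in>UNIV. mat_scale (A $ i $ j) (munit i j))"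
  for A :: "'a::field^'n^'n"
proof -
  have "(\<Sum>i\<in>UNIV. \<Sum>j\<in>UNIV. mat_scale (A $ i $ j) (munit i j)) $ r $ s =
      (\<Sum>i\<in>UNIV. \<Sum>j\<in>UNIV. if j = s then if i = r then A $ r $ s else 0 else 0)" for r s
    unfolding sum_component by (intro sum.cong) (auto simp: munit_nth)
  then show ?thesis by (simp add: vec_eq_iff)
qed

lemma mat_one_expansion: "(mat 1 :: 'a::field^'n^'n) = (\<Sum>i\<in>UNIV. munit i i)"
proof -
  have "(\<Sum>l\<in>UNIV. munit l l $ i $ j) = (\<Sum>l\<in>UNIV. if l = i then (if i = j then 1 else 0) else 0 :: 'a)" for i j :: 'n
    by (intro sum.cong) (auto simp: munit_nth)
  then show ?thesis by (simp add: vec_eq_iff mat_def sum_component)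
qed

lemma trace_munit: "trace (munit a b :: 'a::field^'n^'n) = (if a = b then 1 else 0)"
proof -
  have "(\<Sum>l\<in>UNIV. munit a b $ l $ l) = (\<Sum>l\<in>UNIV. if l = a then (if a = b then 1 else 0) else 0 :: 'a)"
    by (intro sum.cong) (auto simp: munit_nth)
  then show ?thesis by (simp add: trace_def)
qed

lemma trace_simps:
  "trace (A + B) = trace A + trace B" "trace (A - B) = trace A - trace B"
  "trace (mat_scale c A) = c * trace A" "trace (mat 1 :: 'a^'n^'n) = of_nat CARD('n)"
  for A B :: "'a::field^'n^'n"
  by (simp_all add: trace_def sum.distrib sum_subtractf sum_distrib_left mat_def)

lemma mat_scale_mat_one_mult [simp]: "mat_scale c (mat 1) ** A = mat_scale c A"
  for A :: "'a::field^'n^'n"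
  by (simp add: mat_mult_bilinear)

lemma traceless_in_span:
  fixes S :: "('a::field_char_0^'n^'n) set"
  assumes S: "mat.subspace S" and off: "\<And>a b. a \<noteq> b \<Longrightarrow> munit a b \<in> S"
    and diag: "\<And>a. munit a a - munit p p \<in> S" and tr: "trace A = 0"
  shows "A \<in> S"
proof -
  have "A = (\<Sum>i\<in>UNIV. \<Sum>j\<in>UNIV. mat_scale (A $ i $ j) (munit i j - (if i = j then munit p p else 0)))"
  proof -
    have "(\<Sum>i\<in>UNIV. \<Sum>j\<in>UNIV. mat_scale (A $ i $ j) (if i = j then munit p p else 0 :: 'a^'n^'n)) =
        mat_scale (trace A) (munit p p)"
      by (simp add: trace_def mat.scale_sum_left if_distrib cong: if_cong)
    then show ?thesis using tr matrix_expansion[of A]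
      by (simp add: mat.scale_right_diff_distrib sum_subtractf)
  qed
  also have "\<dots> \<in> S"
    using off diag by (auto intro!: mat.subspace_sum[OF S] mat.subspace_scale[OF S])
  finally show ?thesis .
qed

text \<open>
  A traceless matrix is a combination of off-diagonal units and differences of diagonal units, and
  all of these are obtained from one off-diagonal unit by repeated brackets. This is the
  irreducibility of the adjoint module in the form in which it is used.
\<close>

lemma traceless_in_bracket_closed:
  fixes S :: "('a::field_char_0^'n^'n) set"
  assumes S: "mat.subspace S" and bracket: "\<And>A D. A \<in> S \<Longrightarrow> der_apply D A \<in> S"
    and pq: "munit p q \<in> S" "p \<noteq> q" and tr: "trace A = 0"
  shows "A \<in> S"
proof -
  note sub = mat.subspace_add[OF S] mat.subspace_diff[OF S] mat.subspace_neg[OF S]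
    mat.subspace_scale[OF S]
  have br: "(if b = c then munit a d else 0) - (if d = a then munit c b else 0) \<in> S"
    if "munit c d \<in> S" for a b c d
    using bracket[OF that, of "ad (munit a b)"] by (simp add: ad.rep_eq munit_mult)
  have row: "munit c b \<in> S" if "munit a b \<in> S" "c \<noteq> b" for a b c
    using br[OF that(1), of a c] that(2) by simp
  have col: "munit a c \<in> S" if "munit a b \<in> S" "c \<noteq> a" for a b c
    using sub(3)[OF br[OF that(1), of c b]] that(2) by simp
  have "munit q q - munit p p \<in> S" using br[OF pq(1), of p q] by simp
  from bracket[OF this, of "ad (munit q p)"]
  have "- munit q p - munit q p \<in> S"
    using pq(2) by (simp add: ad.rep_eq munit_mult mat_mult_bilinear)
  from sub(4)[OF this, of "- (1/2)"] have qp: "munit q p \<in> S"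
  proof -
    have "mat_scale (- (1/2)) (- munit q p - munit q p :: 'a^'n^'n) = munit q p"
      by (simp add: vec_eq_iff)
    then show ?thesis using \<open>mat_scale (- (1/2)) (- munit q p - munit q p) \<in> S\<close> by simp
  qed
  have off: "munit a b \<in> S" if "a \<noteq> b" for a b
  proof (cases "a = q")
    case True
    then show ?thesis using col[OF qp] that by simp
  next
    case False
    then show ?thesis using col[OF row[OF pq(1)]] that by simp
  qed
  have diag: "munit a a - munit p p \<in> S" for a
  proof (cases "a = p")
    case False
    then show ?thesis using br[OF off[of p a], of p a] by auto
  qed (use mat.subspace_0[OF S] in simp)
  show ?thesis by (rule traceless_in_span[OF S off diag tr])
qed

lemma ad_linear:
  "ad (A + B) = ad A + ad B" "ad (A - B) = ad A - ad B" "ad (mat_scale c A) = der_scale c (ad A)"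
  "ad (mat 1 :: 'a^'n^'n) = 0" "ad 0 = (0 :: ('a, 'n) der)" for A B :: "'a::field^'n^'n"
  by (simp_all add: der_apply_inject[symmetric] fun_eq_iff ad.rep_eq plus_der.rep_eq minus_der.rep_eq
      der_scale.rep_eq zero_der.rep_eq mat_mult_bilinear mat_scale_simps)

lemma ad_sum: "ad (\<Sum>i\<in>I. A i) = (\<Sum>i\<in>I. ad (A i))" for A :: "'i \<Rightarrow> 'a::field^'n^'n"
  by (induction I rule: infinite_finite_induct) (auto simp: ad_linear)

lemma der_bracket_ad: "der_bracket D (ad A) = ad (der_apply D A)"
  by (simp add: der_apply_inject[symmetric] fun_eq_iff ad.rep_eq der_bracket.rep_eq der_apply_simps)

lemma der_apply_sum: "der_apply D (\<Sum>i\<in>I. A i) = (\<Sum>i\<in>I. der_apply D (A i))"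
  using der_apply[of D]
  by (induction I rule: infinite_finite_induct) (auto simp: der_apply_simps mat_derivationD(6))

lemma mat_mult_sum: "(\<Sum>i\<in>I. A i) ** B = (\<Sum>i\<in>I. A i ** B)" "B ** (\<Sum>i\<in>I. A i) = (\<Sum>i\<in>I. B ** A i)"
  for B :: "'a::field^'n^'n"
  by (induction I rule: infinite_finite_induct) (auto simp: mat_mult_bilinear)

text \<open>
  With a fixed index \<open>z\<close>, the matrix \<open>C = \<Sum>i. D(e\<^sub>i\<^sub>z) e\<^sub>z\<^sub>i\<close> satisfies \<open>A C = \<Sum>i. D(A e\<^sub>i\<^sub>z) e\<^sub>z\<^sub>i - D(A)\<close>, by
  the Leibniz rule, and the sum equals \<open>C A\<close>, by expanding \<open>A e\<^sub>i\<^sub>z\<close> in its column.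
\<close>

lemma derivation_inner: "\<exists>C. D = ad C" for D :: "('a::field, 'n::finite) der"
proof -
  fix z :: 'n
  define C where "C = (\<Sum>i\<in>UNIV. der_apply D (munit i z) ** munit z i)"
  have "der_apply D A = C ** A - A ** C" for A
  proof -
    have 1: "A ** munit i z = (\<Sum>j\<in>UNIV. mat_scale (A $ j $ i) (munit j z))" for i
      by (auto simp: vec_eq_iff munit_mult_nth munit_nth sum_component if_distrib cong: if_cong)
    have 2: "munit z j ** A = (\<Sum>i\<in>UNIV. mat_scale (A $ j $ i) (munit z i))" for j
      by (auto simp: vec_eq_iff munit_mult_nth munit_nth sum_component if_distrib cong: if_cong)
    have "A ** C = (\<Sum>i\<in>UNIV. A ** der_apply D (munit i z) ** munit z i)"
      by (simp add: C_def mat_mult_sum matrix_mul_assoc)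
    also have "\<dots> = (\<Sum>i\<in>UNIV. der_apply D (A ** munit i z) ** munit z i
        - der_apply D A ** munit i i)"
      by (intro sum.cong) (simp_all add: der_apply_simps mat_mult_bilinear munit_mult
          flip: matrix_mul_assoc)
    also have "\<dots> = (\<Sum>i\<in>UNIV. der_apply D (A ** munit i z) ** munit z i) - der_apply D A"
      by (simp add: sum_subtractf flip: mat_mult_sum mat_one_expansion)
    also have "(\<Sum>i\<in>UNIV. der_apply D (A ** munit i z) ** munit z i) =
        (\<Sum>i\<in>UNIV. \<Sum>j\<in>UNIV. mat_scale (A $ j $ i) (der_apply D (munit j z) ** munit z i))"
      by (simp add: 1 der_apply_sum der_apply_simps mat_mult_sum mat_mult_bilinear)
    also have "\<dots> = (\<Sum>j\<in>UNIV. der_apply D (munit j z) ** (munit z j ** A))"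
      by (subst sum.swap) (simp add: 2 mat_mult_sum mat_mult_bilinear)
    also have "\<dots> = C ** A" by (simp add: C_def mat_mult_sum matrix_mul_assoc)
    finally show ?thesis by simp
  qed
  then have "D = ad C"
    by (simp add: der_apply_inject[symmetric] fun_eq_iff ad.rep_eq)
  then show ?thesis ..
qed

definition ue_E :: "'n \<Rightarrow> 'n \<Rightarrow> ('a::field_char_0, 'n::finite) uea"
  where "ue_E i j = ue_of (ad (munit i j))"

lemma ue_of_diff: "ue_of (D - E) = ue_of D - ue_of E"
  using ue_of_add[of "D - E" E] by (simp add: algebra_simps)

lemma ue_of_zero [simp]: "ue_of 0 = 0"
  using ue_of_add[of 0 0] by simp

lemma ue_of_sum: "ue_of (\<Sum>i\<in>I. D i) = (\<Sum>i\<in>I. ue_of (D i))"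
  by (induction I rule: infinite_finite_induct) (auto simp: ue_of_add)

lemma ue_of_ad: "ue_of (ad C) = (\<Sum>i\<in>UNIV. \<Sum>j\<in>UNIV. ue_scale (C $ i $ j) (ue_E i j))"
  by (subst matrix_expansion[of C]) (simp add: ad_sum ad_linear ue_of_sum ue_of_scale ue_E_def)

interpretation ue_algebra: algebra_over ue_scale
  by standard (rule ue_scale_mult_left, rule ue_scale_mult_right)

interpretation ue_gl: gl_algebra ue_scale "ue_E :: 'n::finite \<Rightarrow> 'n \<Rightarrow> ('a::field_char_0, 'n) uea"
proof
  fix i j k l :: "'n::finite"
  have "ue_E i j * ue_E k l - ue_E k l * ue_E i j = ue_of (der_bracket (ad (munit i j)) (ad (munit k l)))"
    by (simp add: ue_E_def ue_of_bracket)
  also have "\<dots> = ue_of (ad ((if j = k then munit i l else 0) - (if i = l then munit k j else 0)))"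
    by (simp add: der_bracket_ad ad.rep_eq munit_mult eq_commute)
  also have "\<dots> = (if j = k then ue_E i l else 0) - (if i = l then ue_E k j else 0)"
    by (auto simp: ad_linear ue_of_diff ue_E_def)
  finally show "ue_E i j * ue_E k l - ue_E k l * ue_E i j =
      (if j = k then ue_E i l else 0) - (if i = l then ue_E k j else (0 :: ('a, 'n) uea))" .
next
  show "(\<Sum>i\<in>UNIV. ue_E i i) = (0 :: ('a, 'n) uea)"
    by (simp add: ue_E_def mat_one_expansion[symmetric] ad_linear flip: ue_of_sum ad_sum)
qed

lemma uea_generated: "u \<in> ue_gl.generated" for u :: "('a::field_char_0, 'n::finite) uea"
proof -
  have sum: "(\<Sum>i\<in>I. f i) \<in> ue_gl.generated" if "\<And>i. f i \<in> ue_gl.generated"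
    for f :: "'i \<Rightarrow> ('a, 'n) uea" and I
    using that ue_gl.generated.scale[OF ue_gl.generated.one, of 0]
    by (induction I rule: infinite_finite_induct) (auto intro: ue_gl.generated.add)
  have mult: "ue_of D * u \<in> ue_gl.generated" if "u \<in> ue_gl.generated"
    for D and u :: "('a, 'n) uea"
  proof -
    obtain C where "D = ad C" using derivation_inner by blast
    then have "ue_of D * u = (\<Sum>i\<in>UNIV. \<Sum>j\<in>UNIV. ue_scale (C $ i $ j) (ue_E i j * u))"
      by (simp add: ue_of_ad sum_distrib_right ue_scale_mult_left)
    then show ?thesis using that by (auto intro!: sum ue_gl.generated.scale ue_gl.generated.mult)
  qed
  have word: "abs_uea (Poly_Mapping.single (Word ws) 1) \<in> (ue_gl.generated :: ('a, 'n) uea set)" for ws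
  proof (induction ws)
    case Nil
    then show ?case using ue_gl.generated.one by (simp add: one_uea_def flip: zero_word_def)
  next
    case (Cons D ws)
    have "abs_uea (Poly_Mapping.single (Word (D # ws)) 1) =
        ue_of D * abs_uea (Poly_Mapping.single (Word ws) 1)"
      by (simp add: ue_of_def times_uea.abs_eq mult_single plus_word_def)
    then show ?case using mult[OF Cons] by simp
  qed
  have "abs_uea p \<in> ue_gl.generated" for p :: "('a, 'n) der word \<Rightarrow>\<^sub>0 'a"
  proof (induction p rule: free_algebra_induct)
    case zero
    then show ?case using ue_gl.generated.scale[OF ue_gl.generated.one, of 0]
      by (simp add: zero_uea_def)
  next
    case (single w c)
    have "abs_uea (Poly_Mapping.single w c) = ue_scale c (abs_uea (Poly_Mapping.single w 1))"
      by (simp add: ue_scale.abs_eq mult_single)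
    then show ?case using word[of "letters w"] by (auto intro: ue_gl.generated.scale)
  next
    case (add p q)
    then show ?case by (simp add: ue_gl.generated.add flip: plus_uea.abs_eq)
  qed
  then show ?thesis by (metis Quotient_abs_rep[OF Quotient_uea])
qed

text \<open>
  \<open>U(L)\<close> is spanned by words in the \<open>ue_E a b\<close>, since every derivation is inner. Facts about the action of \<open>U(L)\<close>
  are proved with this rule.
\<close>

lemma uea_induct [case_names one add scale mult]:
  assumes "P 1" "\<And>u v. P u \<Longrightarrow> P v \<Longrightarrow> P (u + v)" "\<And>c u. P u \<Longrightarrow> P (ue_scale c u)"
    and "\<And>a b u. P u \<Longrightarrow> P (ue_E a b * u)"
  shows "P (u :: ('a::field_char_0, 'n::finite) uea)"
  using uea_generated[of u] by (induction rule: ue_gl.generated.induct) (auto intro: assms)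

context gl_algebra
begin

primrec E_power :: "nat \<Rightarrow> 'n \<Rightarrow> 'n \<Rightarrow> 'b" where
  "E_power 0 i j = (if i = j then 1 else 0)"
| "E_power (Suc p) i j = (\<Sum>l\<in>UNIV. E i l * E_power p l j)"

text \<open>
  The entries of the powers of the matrix \<open>(E i j)\<close> transform under the bracket like matrix units; their traces
  are therefore central.
\<close>

lemma E_power_bracket: "E a b * E_power p i j - E_power p i j * E a b =
    (if b = i then E_power p a j else 0) - (if a = j then E_power p i b else 0)"
proof (induction p arbitrary: i j)
  case (Suc p)
  have "E a b * (E i l * E_power p l j) - (E i l * E_power p l j) * E a b =
      (E a b * E i l - E i l * E a b) * E_power p l j
      + E i l * (E a b * E_power p l j - E_power p l j * E a b)" for l
    by (simp add: left_diff_distrib right_diff_distrib mult.assoc)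
  also have "\<dots> l = (if b = i then E a l * E_power p l j else 0)
      - (if a = l then E i b * E_power p l j else 0)
      + (if b = l then E i l * E_power p a j else 0)
      - (if a = j then E i l * E_power p l b else 0)" for l
    unfolding E_bracket Suc by (auto simp: left_diff_distrib right_diff_distrib)
  finally have step: "E a b * (E i l * E_power p l j) - (E i l * E_power p l j) * E a b =
      (if b = i then E a l * E_power p l j else 0)
      - (if a = l then E i b * E_power p l j else 0)
      + (if b = l then E i l * E_power p a j else 0)
      - (if a = j then E i l * E_power p l b else 0)" for l .
  have "E a b * E_power (Suc p) i j - E_power (Suc p) i j * E a b =
      (\<Sum>l\<in>UNIV. E a b * (E i l * E_power p l j) - (E i l * E_power p l j) * E a b)"
    by (simp add: sum_distrib_left sum_distrib_right sum_subtractf)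
  also have "\<dots> = (if b = i then E_power (Suc p) a j else 0) - (if a = j then E_power (Suc p) i b else 0)"
    unfolding step by (simp add: sum.distrib sum_subtractf)
  finally show ?case .
qed auto

lemma E_power_trace_central: "E a b * (\<Sum>i\<in>UNIV. E_power p i i) = (\<Sum>i\<in>UNIV. E_power p i i) * E a b"
proof -
  have "E a b * (\<Sum>i\<in>UNIV. E_power p i i) - (\<Sum>i\<in>UNIV. E_power p i i) * E a b =
     (\<Sum>i\<in>UNIV. E a b * E_power p i i - E_power p i i * E a b)"
    by (simp add: sum_distrib_left sum_distrib_right sum_subtractf)
  also have "\<dots> = 0" unfolding E_power_bracket by (simp add: sum_subtractf)
  finally show ?thesis by simp
qed

lemma quadratic_casimir_E_power: "quadratic_casimir = (\<Sum>i\<in>UNIV. E_power 2 i i)"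
  by (simp add: quadratic_casimir_def numeral_2_eq_2 if_distrib cong: if_cong)

end

section \<open>Equivariant maps from matrices\<close>

locale sl_module = der_rep scale act
  for scale :: "'a::field_char_0 \<Rightarrow> 'b::ab_group_add \<Rightarrow> 'b"
    and act :: "('a, 'n::finite) der \<Rightarrow> 'b \<Rightarrow> 'b"
begin

definition equivariant :: "('a^'n^'n \<Rightarrow> 'b) \<Rightarrow> bool" where
  "equivariant \<xi> \<longleftrightarrow> (\<forall>A B. \<xi> (A + B) = \<xi> A + \<xi> B) \<and>
     (\<forall>c A. \<xi> (mat_scale c A) = scale c (\<xi> A)) \<and> (\<forall>D A. act D (\<xi> A) = \<xi> (der_apply D A))"

lemma equivariantD:
  assumes "equivariant \<xi>"
  shows "\<xi> (A + B) = \<xi> A + \<xi> B" "\<xi> (mat_scale c A) = scale c (\<xi> A)"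
    "act D (\<xi> A) = \<xi> (der_apply D A)" "\<xi> 0 = 0" "\<xi> (A - B) = \<xi> A - \<xi> B"
    "\<xi> (- A) = - \<xi> A" "\<xi> (\<Sum>i\<in>I. f i) = (\<Sum>i\<in>I. \<xi> (f i))"
proof -
  show add: "\<xi> (A + B) = \<xi> A + \<xi> B" for A B using assms by (simp add: equivariant_def)
  show "\<xi> (mat_scale c A) = scale c (\<xi> A)" "act D (\<xi> A) = \<xi> (der_apply D A)"
    using assms by (simp_all add: equivariant_def)
  show zero: "\<xi> 0 = 0" using add[of 0 0] by simp
  show "\<xi> (A - B) = \<xi> A - \<xi> B" using add[of "A - B" B] by (simp add: algebra_simps)
  show "\<xi> (- A) = - \<xi> A" using add[of A "- A"] zero by (simp add: add_eq_0_iff)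
  show "\<xi> (\<Sum>i\<in>I. f i) = (\<Sum>i\<in>I. \<xi> (f i))"
    by (induction I rule: infinite_finite_induct) (simp_all add: zero add)
qed

text \<open>
  This is what makes equivariant maps from matrices useful: on their values an exponent acts through the matrix algebra.
\<close>

lemma equivariant_ue_rep:
  assumes "equivariant \<xi>"
  shows "ue_rep scale act u (\<xi> A) = \<xi> (mat_act u A)"
  by (induction u arbitrary: A rule: uea_induct)
    (simp_all add: ue_rep_simps mat_rep.ue_rep_simps equivariantD[OF assms] ue_E_def)

text \<open>
  The set on which both maps agree is a submodule, and traceless matrices are generated by one off-diagonal unit.
\<close>

lemma equivariant_eq_on_traceless:
  assumes "equivariant \<xi>" "equivariant \<eta>" "\<xi> (munit p q) = \<eta> (munit p q)" "p \<noteq> q" "trace A = 0"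
  shows "\<xi> A = \<eta> A"
proof -
  have "A \<in> {A. \<xi> A = \<eta> A}"
  proof (rule traceless_in_bracket_closed)
    show "mat.subspace {A. \<xi> A = \<eta> A}"
      by (auto simp: mat.subspace_def equivariantD[OF assms(1)] equivariantD[OF assms(2)])
    show "der_apply D A \<in> {A. \<xi> A = \<eta> A}" if "A \<in> {A. \<xi> A = \<eta> A}" for A D
      using that equivariantD(3)[OF assms(1), of D A] equivariantD(3)[OF assms(2), of D A] by simp
  qed (use assms in auto)
  then show ?thesis by simp
qed

lemma ue_rep_more:
  "ue_rep scale act (u - v) b = ue_rep scale act u b - ue_rep scale act v b"
  "ue_rep scale act 0 b = 0" "ue_rep scale act u 0 = 0"
  "ue_rep scale act u (b - b') = ue_rep scale act u b - ue_rep scale act u b'"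
  "ue_rep scale act (\<Sum>i\<in>I. f i) b = (\<Sum>i\<in>I. ue_rep scale act (f i) b)"
  "ue_rep scale act u (\<Sum>i\<in>I. g i) = (\<Sum>i\<in>I. ue_rep scale act u (g i))"
proof -
  show "ue_rep scale act (u - v) b = ue_rep scale act u b - ue_rep scale act v b"
    using ue_rep_simps(1)[of "u - v" v b] by (simp add: algebra_simps)
  show 1: "ue_rep scale act 0 b = 0" for b using ue_rep_simps(2)[of 0 0 b] by simp
  show 2: "ue_rep scale act u 0 = 0" using ue_rep_simps(7)[of u 0 0] by simp
  show "ue_rep scale act u (b - b') = ue_rep scale act u b - ue_rep scale act u b'"
    using ue_rep_simps(6)[of u "b - b'" b'] by (simp add: algebra_simps)
  show "ue_rep scale act (\<Sum>i\<in>I. f i) b = (\<Sum>i\<in>I. ue_rep scale act (f i) b)"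
    by (induction I rule: infinite_finite_induct) (simp_all add: 1 ue_rep_simps(1))
  show "ue_rep scale act u (\<Sum>i\<in>I. g i) = (\<Sum>i\<in>I. ue_rep scale act u (g i))"
    by (induction I rule: infinite_finite_induct) (simp_all add: 2 ue_rep_simps(6))
qed

end

interpretation mat_module: sl_module mat_scale der_apply ..
interpretation adjoint_module: sl_module der_scale der_bracket ..

lemma mat_act_ue_E: "mat_act (ue_E a b) A = munit a b ** A - A ** munit a b"
  by (simp add: ue_E_def mat_rep.ue_rep_simps ad.rep_eq)

lemma adjoint_act_ad: "adjoint_act u (ad A) = ad (mat_act u A)"
  for A :: "'a::field_char_0^'n^'n"
  by (rule adjoint_module.equivariant_ue_rep[where \<xi> = ad])
    (simp add: adjoint_module.equivariant_def ad_linear der_bracket_ad)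

lemma trace_mult_commute: "trace (A ** B) = trace (B ** A)" for A B :: "'a::field^'n^'n"
  unfolding trace_def matrix_matrix_mult_def vec_lambda_beta
  by (subst sum.swap) (simp add: mult.commute)

lemma trace_der_apply: "trace (der_apply D A) = 0" for A :: "'a::field^'n^'n"
proof -
  obtain C where "D = ad C" using derivation_inner by blast
  then show ?thesis by (simp add: ad.rep_eq trace_simps trace_mult_commute)
qed

lemma der_apply_mat_one [simp]: "der_apply D (mat 1) = (0 :: 'a::field^'n^'n)"
  using der_apply_simps(3)[of D "mat 1" "mat 1"] by simp

lemma mat_act_mat_one: "\<exists>t. mat_act u (mat 1 :: 'a::field_char_0^'n^'n) = mat_scale t (mat 1)"
proof (induction u rule: uea_induct)
  case one
  show ?case by (rule exI[of _ 1]) (simp add: mat_rep.ue_rep_simps)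
next
  case (add u v)
  then show ?case by (auto simp: mat_rep.ue_rep_simps simp flip: mat.scale_left_distrib)
next
  case (scale c u)
  then show ?case by (auto simp: mat_rep.ue_rep_simps)
next
  case (mult a b u)
  then show ?case by (auto simp: mat_rep.ue_rep_simps ue_E_def der_apply_simps intro: exI[of _ 0])
qed

lemma trace_mat_act: "trace A = 0 \<Longrightarrow> trace (mat_act u A) = 0" for A :: "'a::field_char_0^'n^'n"
  by (induction u rule: uea_induct)
    (simp_all add: mat_rep.ue_rep_simps trace_simps ue_E_def trace_der_apply)

definition traceless_part :: "'a::field_char_0^'n^'n \<Rightarrow> 'a^'n^'n"
  where "traceless_part A = A - mat_scale (trace A / of_nat CARD('n)) (mat 1)"

lemma trace_traceless_part [simp]: "trace (traceless_part A) = 0"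
  by (simp add: traceless_part_def trace_simps)

lemma traceless_part_plus:
  "A = traceless_part A + mat_scale (trace A / of_nat CARD('n)) (mat 1)"
  for A :: "'a::field_char_0^'n^'n"
  by (simp add: traceless_part_def)

text \<open>
  Schur's lemma: the image of \<open>e\<^sub>p\<^sub>q\<close> has the same weight, so it is a multiple of \<open>e\<^sub>p\<^sub>q\<close>.
\<close>

lemma equivariant_endo_scalar:
  fixes T :: "'a::field_char_0^'n^'n \<Rightarrow> 'a^'n^'n" and p q :: 'n
  assumes T: "mat_module.equivariant T" and pq: "p \<noteq> q"
  obtains c where "\<And>A. trace A = 0 \<Longrightarrow> T A = mat_scale c A"
proof -
  let ?Y = "T (munit p q)"
  have br: "der_apply (ad (munit a a)) ?Y = mat_scale ((if a = p then 1 else 0) - (if a = q then 1 else 0)) ?Y"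
    for a
  proof -
    have "der_apply (ad (munit a a)) (munit p q :: 'a^'n^'n) =
        mat_scale ((if a = p then 1 else 0) - (if a = q then 1 else 0)) (munit p q)"
      using pq by (auto simp: ad.rep_eq munit_mult mat.scale_left_diff_distrib)
    then show ?thesis by (metis mat_module.equivariantD(2,3)[OF T])
  qed
  have Y: "?Y $ i $ j = 0" if "(i, j) \<noteq> (p, q)" for i j
  proof -
    have eq: "(if i = a then ?Y $ a $ j else 0) - (if j = a then ?Y $ i $ a else 0) =
       ((if a = p then 1 else 0) - (if a = q then 1 else 0)) * ?Y $ i $ j" for a
      using arg_cong[OF br[of a], of "\<lambda>M. M $ i $ j"] by (simp add: ad.rep_eq munit_mult_nth)
    show ?thesis using eq[of i] eq[of j] eq[of p] eq[of q] that pq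
      by (auto split: if_splits)
  qed
  define c where "c = ?Y $ p $ q"
  have "?Y = mat_scale c (munit p q)"
    using Y by (auto simp: vec_eq_iff munit_nth c_def)
  moreover have "mat_module.equivariant (mat_scale c)"
    by (simp add: mat_module.equivariant_def der_apply_simps mat.scale_right_distrib mult.commute)
  ultimately show ?thesis
    using that mat_module.equivariant_eq_on_traceless[OF T _ _ pq] by blast
qed

section \<open>Casimir elements as traces of powers\<close>

lemma idx_eq_iff:
  "i \<in> {1..CARD('n)} \<Longrightarrow> j \<in> {1..CARD('n)} \<Longrightarrow> (idx i :: 'n::{finite, linorder}) = idx j \<longleftrightarrow> i = j"
proof -
  have "inj_on (idx :: nat \<Rightarrow> 'n) {1..CARD('n)}"
    using bij_betw_idx by (rule bij_betw_imp_inj_on)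
  then show "i \<in> {1..CARD('n)} \<Longrightarrow> j \<in> {1..CARD('n)} \<Longrightarrow> (idx i :: 'n) = idx j \<longleftrightarrow> i = j"
    by (rule inj_on_eq_iff)
qed

lemma idx_neq: "CARD('n) \<ge> 2 \<Longrightarrow> (idx 1 :: 'n::{finite, linorder}) \<noteq> idx 2"
  using idx_eq_iff[of 1 2, where 'n = 'n] by simp

lemma sum_idx: "(\<Sum>i\<in>{1..CARD('n)}. f (idx i)) = (\<Sum>a\<in>(UNIV :: 'n::{finite, linorder} set). f a)"
  by (rule sum.reindex_bij_betw[OF bij_betw_idx])

text \<open>
  The defining combination of the \<open>h\<^sub>l\<close> is \<open>e\<^sub>i\<^sub>i - I/k\<close>: Abel summation. Its image in \<open>L\<close> is that of \<open>e\<^sub>i\<^sub>i\<close>.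
\<close>

lemma casimir_mat_diag:
  assumes "i \<in> {1..CARD('n)}"
  shows "(casimir_mat i i :: ('a::field_char_0, 'n::{finite, linorder}) sqmat) =
    mat_unit i i - mat_scale (1 / of_nat CARD('n)) (mat 1)"
proof -
  let ?k = "CARD('n)" and ?f = "\<lambda>l. mat_unit l l :: ('a, 'n) sqmat"
  have A: "(\<Sum>l = 1..<Suc m. mat_scale (of_nat l) (?f l - ?f (Suc l))) =
      (\<Sum>l = 1..<Suc m. ?f l) - mat_scale (of_nat m) (?f (Suc m))" for m
    by (induction m) (simp_all add: mat_scale_simps mat.scale_left_distrib algebra_simps)
  obtain m where m: "?k = Suc m" by (cases ?k) auto
  have "(\<Sum>l = 1..<?k. mat_scale (if l \<ge> i then of_nat (?k - l) else - of_nat l) (cartan l)) =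
    (\<Sum>l = 1..<?k. (if l \<ge> i then mat_scale (of_nat ?k) (?f l - ?f (Suc l)) else 0)
        - mat_scale (of_nat l) (?f l - ?f (Suc l)))"
    by (intro sum.cong) (auto simp: cartan_def of_nat_diff mat.scale_left_diff_distrib)
  also have "\<dots> = (\<Sum>l = i..<?k. mat_scale (of_nat ?k) (?f l - ?f (Suc l)))
      - (\<Sum>l = 1..<?k. mat_scale (of_nat l) (?f l - ?f (Suc l)))"
  proof -
    have "{l \<in> {1..<?k}. i \<le> l} = {i..<?k}" using assms by auto
    then show ?thesis by (simp add: sum_subtractf sum.inter_filter[symmetric])
  qed
  also have "(\<Sum>l = i..<?k. mat_scale (of_nat ?k) (?f l - ?f (Suc l))) = mat_scale (of_nat ?k) (?f i - ?f ?k)"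
    using assms sum_Suc_diff'[of i ?k "\<lambda>l. - ?f l"]
    by (simp flip: mat.scale_sum_right)
  also have "(\<Sum>l = 1..<?k. mat_scale (of_nat l) (?f l - ?f (Suc l))) =
      (\<Sum>l = 1..?k. ?f l) - mat_scale (of_nat ?k) (?f ?k)"
    unfolding m A by (simp add: mat.scale_left_distrib atLeastLessThanSuc_atLeastAtMost)
  also have "(\<Sum>l = 1..?k. ?f l) = mat 1"
    unfolding mat_unit_munit mat_one_expansion by (rule sum_idx)
  finally show ?thesis
    by (simp add: casimir_mat_def mat.scale_right_diff_distrib)
qed

lemma ue_of_casimir_mat:
  assumes "i \<in> {1..CARD('n)}"
  shows "ue_of (ad (casimir_mat i j)) = (ue_E (idx i) (idx j) :: ('a::field_char_0, 'n::{finite, linorder}) uea)"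
proof (cases "i = j")
  case True
  then show ?thesis using casimir_mat_diag[OF assms, where 'a = 'a]
    by (simp add: ue_E_def ad_linear mat_unit_munit)
qed (simp add: casimir_mat_def ue_E_def mat_unit_munit)

context gl_algebra
begin

text \<open>
  The summand of the Casimir element for the index list \<open>as\<close> closed up by \<open>j\<close>; summing over all lists gives an
  entry of the matrix power.
\<close>

fun path_product :: "'n list \<Rightarrow> 'n \<Rightarrow> 'b" where
  "path_product [] j = 1"
| "path_product (a # as) j = E a (hd (as @ [j])) * path_product as j"

lemma path_product_nth:
  "path_product as j = prod_list (map (\<lambda>t. E ((as @ [j]) ! t) ((as @ [j]) ! Suc t)) [0..<length as])"
proof (induction as)
  case (Cons a as)
  have "[0..<length (a # as)] = 0 # map Suc [0..<length as]"
    by (simp add: map_Suc_upt upt_conv_Cons del: upt_Suc)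
  then show ?case by (simp add: Cons comp_def hd_conv_nth del: upt_Suc)
qed simp

lemma cyclic_product:
  assumes "as \<noteq> []"
  shows "prod_list (map (\<lambda>t. E (as ! t) (as ! (Suc t mod length as))) [0..<length as]) =
    path_product as (hd as)"
  unfolding path_product_nth
proof (intro arg_cong[of _ _ prod_list] map_cong refl)
  fix t assume "t \<in> set [0..<length as]"
  then have t: "t < length as" by simp
  show "E (as ! t) (as ! (Suc t mod length as)) = E ((as @ [hd as]) ! t) ((as @ [hd as]) ! Suc t)"
    using t assms by (cases "Suc t = length as") (auto simp: nth_append hd_conv_nth)
qed

lemma E_power_paths:
  "(\<Sum>as | length as = m. path_product (i # as) j) = E_power (Suc m) i j"
proof (induction m arbitrary: i)
  case 0
  show ?case by (simp add: if_distrib cong: if_cong)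
next
  case (Suc m)
  have "{as :: 'n list. length as = Suc m} = (\<lambda>(as, a). a # as) ` ({as. length as = m} \<times> UNIV)"
    using lists_length_Suc_eq[of "UNIV :: 'n set" m] by simp
  then have "(\<Sum>as | length as = Suc m. path_product (i # as) j) =
      (\<Sum>(as, a)\<in>{as. length as = m} \<times> UNIV. path_product (i # a # as) j)"
    by (simp add: sum.reindex inj_on_def split_def)
  also have "\<dots> = (\<Sum>a\<in>UNIV. \<Sum>as | length as = m. E i a * path_product (a # as) j)"
    by (simp add: sum.cartesian_product[symmetric] sum.swap[of _ UNIV])
  also have "\<dots> = (\<Sum>a\<in>UNIV. E i a * E_power (Suc m) a j)"
    by (simp only: Suc flip: sum_distrib_left)
  finally show ?case by simp
qed

end

lemma casimir_E_power:
  assumes "p \<ge> 1"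
  shows "(casimir p :: ('a::field_char_0, 'n::{finite, linorder}) uea) = (\<Sum>i\<in>UNIV. ue_gl.E_power p i i)"
proof -
  let ?I = "{1..CARD('n)}"
  obtain m where m: "p = Suc m" using assms by (cases p) auto
  have term_eq: "prod_list (map (\<lambda>t. ue_of (ad (casimir_mat (is ! t) (is ! (Suc t mod p))))) [0..<p]) =
      (ue_gl.path_product (map idx is) (hd (map idx is)) :: ('a, 'n) uea)"
    if "length is = p" "set is \<subseteq> ?I" for "is"
  proof -
    have "prod_list (map (\<lambda>t. ue_of (ad (casimir_mat (is ! t) (is ! (Suc t mod p))))) [0..<p]) =
      prod_list (map (\<lambda>t. ue_E (map idx is ! t) (map idx is ! (Suc t mod p)) :: ('a, 'n) uea) [0..<p])"
      using that assms
      by (intro arg_cong[of _ _ prod_list] map_cong refl)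
        (auto simp: ue_of_casimir_mat subset_iff)
    also have "\<dots> = ue_gl.path_product (map idx is) (hd (map idx is))"
    proof -
      have "is \<noteq> []" using that assms by auto
      then show ?thesis using ue_gl.cyclic_product[of "map idx is"] that by simp
    qed
    finally show ?thesis .
  qed
  let ?S = "{is. length is = p \<and> set is \<subseteq> ?I}"
  have bij: "bij_betw (map idx) ?S {as :: 'n list. length as = p}"
  proof (rule bij_betw_byWitness[where f' = "map (inv_into ?I (idx :: nat \<Rightarrow> 'n))"])
    have inj: "inj_on (idx :: nat \<Rightarrow> 'n) ?I" and img: "(idx :: nat \<Rightarrow> 'n) ` ?I = UNIV"
      using bij_betw_idx[where 'n = 'n] by (auto simp: bij_betw_def)
    show "\<forall>is\<in>?S. map (inv_into ?I (idx :: nat \<Rightarrow> 'n)) (map idx is) = is"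
      using inj by (auto intro!: map_idI simp: inv_into_f_f subset_iff)
    show "\<forall>as\<in>{as :: 'n list. length as = p}. map idx (map (inv_into ?I idx) as) = as"
      using img by (auto intro!: map_idI simp: f_inv_into_f)
    show "map (inv_into ?I (idx :: nat \<Rightarrow> 'n)) ` {as. length as = p} \<subseteq> ?S"
      using inv_into_into[of _ "idx :: nat \<Rightarrow> 'n" ?I] img by auto
  qed auto
  have "casimir p = (\<Sum>is\<in>?S. ue_gl.path_product (map idx is) (hd (map idx is)) :: ('a, 'n) uea)"
    unfolding casimir_def by (intro sum.cong refl term_eq) auto
  also have "\<dots> = (\<Sum>as | length as = p. ue_gl.path_product as (hd as))"
    by (rule sum.reindex_bij_betw[OF bij])
  also have "\<dots> = (\<Sum>(as, a)\<in>{as. length as = m} \<times> UNIV. ue_gl.path_product (a # as) a)"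
  proof -
    have "{as :: 'n list. length as = p} = (\<lambda>(as, a). a # as) ` ({as. length as = m} \<times> UNIV)"
      using lists_length_Suc_eq[of "UNIV :: 'n set" m] by (simp add: m)
    then show ?thesis by (simp add: sum.reindex inj_on_def split_def)
  qed
  also have "\<dots> = (\<Sum>a\<in>UNIV. \<Sum>as | length as = m. ue_gl.path_product (a # as) a)"
    by (simp only: sum.cartesian_product[symmetric] sum.swap[of _ UNIV])
  finally show ?thesis by (simp only: ue_gl.E_power_paths m)
qed

section \<open>Truncated enveloping algebras\<close>

text \<open>
  \<open>U(L)\<close> is a ring and a multiplicative monoid with 1 on the level of type classes, but not an instance of
  \<open>ring_1\<close>, so \<^const>\<open>ring_ideal\<close> does not apply to it.
\<close>

inductive_set two_sided_ideal :: "'b::{ring,monoid_mult} set \<Rightarrow> 'b set" for G where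
  zero: "0 \<in> two_sided_ideal G"
| gen: "g \<in> G \<Longrightarrow> a * g * b \<in> two_sided_ideal G"
| add: "x \<in> two_sided_ideal G \<Longrightarrow> y \<in> two_sided_ideal G \<Longrightarrow> x + y \<in> two_sided_ideal G"

lemma two_sided_ideal_base: "g \<in> G \<Longrightarrow> g \<in> two_sided_ideal G"
  using two_sided_ideal.gen[of g G 1 1] by simp

lemma two_sided_ideal_mult:
  assumes "x \<in> two_sided_ideal G"
  shows "r * x \<in> two_sided_ideal G" "x * r \<in> two_sided_ideal G"
proof -
  show "r * x \<in> two_sided_ideal G" using assms
  proof (induction rule: two_sided_ideal.induct)
    case (gen g a b)
    then show ?case using two_sided_ideal.gen[of g G "r * a" b] by (simp add: mult.assoc)
  qed (auto intro: two_sided_ideal.intros simp: distrib_left)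
  show "x * r \<in> two_sided_ideal G" using assms
  proof (induction rule: two_sided_ideal.induct)
    case (gen g a b)
    then show ?case using two_sided_ideal.gen[of g G a "b * r"] by (simp add: mult.assoc)
  qed (auto intro: two_sided_ideal.intros simp: distrib_right)
qed

lemma two_sided_ideal_uminus: "x \<in> two_sided_ideal G \<Longrightarrow> - x \<in> two_sided_ideal G"
  using two_sided_ideal_mult(1)[of x G "- 1"] by simp

lemma two_sided_ideal_diff:
  "x \<in> two_sided_ideal G \<Longrightarrow> y \<in> two_sided_ideal G \<Longrightarrow> x - y \<in> two_sided_ideal G"
  using two_sided_ideal.add[OF _ two_sided_ideal_uminus, of x G y] by simp

lemma two_sided_ideal_sum:
  "(\<And>i. i \<in> I \<Longrightarrow> f i \<in> two_sided_ideal G) \<Longrightarrow> (\<Sum>i\<in>I. f i) \<in> two_sided_ideal G"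
  by (induction I rule: infinite_finite_induct) (auto intro: two_sided_ideal.intros)

lemma two_sided_ideal_least:
  assumes "x \<in> two_sided_ideal G" "G \<subseteq> two_sided_ideal G'"
  shows "x \<in> two_sided_ideal G'"
  using assms(1)
  by induction (use assms(2) in \<open>auto intro: two_sided_ideal.intros two_sided_ideal_mult\<close>)

lemma two_sided_ideal_equivp: "equivp (\<lambda>x y. x - y \<in> two_sided_ideal G)"
proof (intro equivpI reflpI sympI transpI)
  show "y - x \<in> two_sided_ideal G" if "x - y \<in> two_sided_ideal G" for x y
    using two_sided_ideal_uminus[OF that] by simp
  show "x - z \<in> two_sided_ideal G" if "x - y \<in> two_sided_ideal G" "y - z \<in> two_sided_ideal G" for x y z
    using two_sided_ideal.add[OF that] by simp
qed (simp add: two_sided_ideal.zero)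

lemma two_sided_ideal_sym: "x - y \<in> two_sided_ideal G \<Longrightarrow> y - x \<in> two_sided_ideal G"
  using two_sided_ideal_uminus[of "x - y"] by simp

lemma two_sided_ideal_cong:
  assumes "x - x' \<in> two_sided_ideal G" "y - y' \<in> two_sided_ideal G"
  shows "(x + y) - (x' + y') \<in> two_sided_ideal G" "(x - y) - (x' - y') \<in> two_sided_ideal G"
    "x * y - x' * y' \<in> two_sided_ideal G"
proof -
  show "(x + y) - (x' + y') \<in> two_sided_ideal G"
    using two_sided_ideal.add[OF assms] by (simp add: algebra_simps)
  show "(x - y) - (x' - y') \<in> two_sided_ideal G"
    using two_sided_ideal_diff[OF assms] by (simp add: algebra_simps)
  have "(x - x') * y + x' * (y - y') \<in> two_sided_ideal G"
    using assms by (intro two_sided_ideal.add two_sided_ideal_mult)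
  then show "x * y - x' * y' \<in> two_sided_ideal G" by (simp add: algebra_simps)
qed

context algebra_over
begin

lemma two_sided_ideal_scale: "x \<in> two_sided_ideal G \<Longrightarrow> scale c x \<in> two_sided_ideal G"
  using two_sided_ideal_mult(1)[of x G "scale c 1"] by (simp add: scale_mult_left)

lemma two_sided_ideal_unscale:
  "scale c x \<in> two_sided_ideal G \<Longrightarrow> c \<noteq> 0 \<Longrightarrow> x \<in> two_sided_ideal G"
  using two_sided_ideal_scale[of "scale c x" G "1 / c"] by simp

lemma ideal_inner_derivation:
  fixes x :: 'b
  defines "d \<equiv> \<lambda>a. x * a - a * x"
  shows "d (a * b) = d a * b + a * d b" "d (a + b) = d a + d b" "d (scale c a) = scale c (d a)"
    "d (- a) = - d a" "d (a - b) = d a - d b" "a \<in> two_sided_ideal G \<Longrightarrow> d a \<in> two_sided_ideal G"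
  by (simp_all add: d_def algebra_simps scale_mult two_sided_ideal_diff two_sided_ideal_mult)

text \<open>
  The commutator with \<open>x\<close> is a derivation \<open>d\<close> with \<open>d y = w\<close> and \<open>d w = 0\<close>; hence
  \<open>d\<^sup>m (y\<^sup>m) = m! w\<^sup>m\<close>, and \<open>d\<close> preserves ideals.
\<close>

lemma ideal_commutator_power:
  fixes x y w :: 'b
  assumes xy: "x * y - y * x = w" and xw: "x * w = w * x"
  shows "y * y \<in> two_sided_ideal G \<Longrightarrow> w * w \<in> two_sided_ideal G"
    and "y * (y * y) \<in> two_sided_ideal G \<Longrightarrow> w * (w * w) \<in> two_sided_ideal G"
proof -
  define d where "d a = x * a - a * x" for a
  note d = ideal_inner_derivation[where x = x, folded d_def]
  have dd: "d y = w" "d w = 0" using assms by (simp_all add: d_def)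
  have d0: "d 0 = 0" by (simp add: d_def)
  show "w * w \<in> two_sided_ideal G" if "y * y \<in> two_sided_ideal G"
  proof (rule two_sided_ideal_unscale)
    have "d (d (y * y)) = scale 2 (w * w)" by (simp add: d dd d0 scale_numeral)
    then show "scale 2 (w * w) \<in> two_sided_ideal G" using d(6)[OF d(6)[OF that]] by simp
  qed simp
  show "w * (w * w) \<in> two_sided_ideal G" if "y * (y * y) \<in> two_sided_ideal G"
  proof (rule two_sided_ideal_unscale)
    have "d (d (d (y * (y * y)))) = scale 6 (w * (w * w))"
      by (simp add: d dd d0 scale_numeral algebra_simps)
    then show "scale 6 (w * (w * w)) \<in> two_sided_ideal G" using d(6)[OF d(6)[OF d(6)[OF that]]] by simp
  qed simp
qed

text \<open>
  As before, now with \<open>f\<close> in place of \<open>x\<close>: \<open>d e = - h\<close> and \<open>d h = 2 f\<close>, so \<open>2 m\<close> commutators turn \<open>e\<^sup>m\<close>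
  into a non-zero multiple of \<open>f\<^sup>m\<close>.
\<close>

lemma ideal_sl2_swap:
  assumes ef: "e * f = f * e + h" and hf: "h * f = f * h - scale 2 f"
  shows "e * e \<in> two_sided_ideal G \<Longrightarrow> f * f \<in> two_sided_ideal G"
    and "e * (e * e) \<in> two_sided_ideal G \<Longrightarrow> f * (f * f) \<in> two_sided_ideal G"
proof -
  define d where "d a = f * a - a * f" for a
  note d = ideal_inner_derivation[where x = f, folded d_def]
  define b where "b = scale (- 2) f"
  have dd: "d e = - h" "d h = - b" "d b = 0" using assms by (simp_all add: d_def b_def scale_mult)
  have d0: "d 0 = 0" by (simp add: d_def)
  show "f * f \<in> two_sided_ideal G" if "e * e \<in> two_sided_ideal G"
  proof (rule two_sided_ideal_unscale)
    have "d (d (d (d (e * e)))) = scale 6 (b * b)" by (simp add: d dd d0 scale_numeral algebra_simps)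
    also have "\<dots> = scale 24 (f * f)" by (simp add: b_def scale_mult)
    finally show "scale 24 (f * f) \<in> two_sided_ideal G"
      using d(6)[OF d(6)[OF d(6)[OF d(6)[OF that]]]] by simp
  qed simp
  show "f * (f * f) \<in> two_sided_ideal G" if "e * (e * e) \<in> two_sided_ideal G"
  proof (rule two_sided_ideal_unscale)
    have "d (d (d (d (d (d (e * (e * e))))))) = scale 90 (b * (b * b))"
      by (simp add: d dd d0 scale_numeral algebra_simps)
    also have "\<dots> = scale (- 720) (f * (f * f))" by (simp add: b_def scale_mult)
    finally show "scale (- 720) (f * (f * f)) \<in> two_sided_ideal G"
      using d(6)[OF d(6)[OF d(6)[OF d(6)[OF d(6)[OF d(6)[OF that]]]]]] by simp
  qed simp
qed

end

context gl_algebra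
begin

text \<open>
  All root vectors are obtained from one of them by brackets of the two kinds just considered.
\<close>

lemma ideal_all_powers:
  assumes pq: "p \<noteq> q" and ij: "i \<noteq> j" and m: "m = 2 \<or> m = 3"
    and mem: "E p q ^ m \<in> two_sided_ideal G"
  shows "E i j ^ m \<in> two_sided_ideal G"
proof -
  have shift: "w ^ m \<in> two_sided_ideal G"
    if "y ^ m \<in> two_sided_ideal G" "x * y - y * x = w" "x * w = w * x" for x y w
    using ideal_commutator_power[OF that(2,3)] that(1) m
    by (auto simp: power2_eq_square power3_eq_cube mult.assoc)
  have row: "E c b ^ m \<in> two_sided_ideal G" if "E a b ^ m \<in> two_sided_ideal G" "a \<noteq> b" "c \<noteq> b" for a b c
  proof (cases "c = a")
    case False
    show ?thesis
    proof (rule shift[OF that(1), of "E c a"])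
      show "E c a * E a b - E a b * E c a = E c b" using E_bracket[of c a a b] that by simp
      show "E c a * E c b = E c b * E c a" using E_bracket[of c a c b] that False by simp
    qed
  qed (use that in simp)
  have col: "E a c ^ m \<in> two_sided_ideal G" if "E a b ^ m \<in> two_sided_ideal G" "a \<noteq> b" "c \<noteq> a" for a b c
  proof (cases "c = b")
    case False
    show ?thesis
    proof (rule shift[OF that(1), of "- E b c"])
      show "- E b c * E a b - E a b * - E b c = E a c" using E_bracket[of a b b c] that by simp
      show "- E b c * E a c = E a c * - E b c" using E_bracket[of b c a c] that False by simp
    qed
  qed (use that in simp)
  have swap: "E q p ^ m \<in> two_sided_ideal G"
    using ideal_sl2_swap[OF sl2_triple(1,3)[OF pq]] mem m
    by (auto simp: power2_eq_square power3_eq_cube mult.assoc)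
  show ?thesis
  proof (cases "i = q")
    case True
    then show ?thesis using col[OF swap, of j] pq ij by auto
  next
    case False
    then show ?thesis using col[OF row[OF mem pq, of i], of j] ij by auto
  qed
qed

lemma central_commute:
  assumes "\<And>a b. E a b * c = c * E a b" "x \<in> generated"
  shows "x * c = c * x"
  using assms(2)
proof (induction rule: generated.induct)
  case (mult x a b)
  have "E a b * x * c = E a b * c * x" using mult by (simp add: mult.assoc)
  then show ?case by (simp add: assms(1) mult.assoc)
qed (auto simp: distrib_left distrib_right scale_mult)

end

text \<open>
  For \<open>'m\<close> = 3 these relators turn out to generate the annihilator of the adjoint representation, and for \<open>'m\<close> = 2
  the whole of \<open>U(L)\<close>. The exponent is the cardinality of a phantom type so that both quotients arise from one type
  definition.
\<close>

definition truncation_relators :: "'m itself \<Rightarrow> ('a::field_char_0, 'n::{finite, linorder}) uea set" where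
  "truncation_relators _ = {ue_gl.quadratic_casimir - ue_scale (2 * of_nat CARD('n)) 1,
     ue_E (idx 1) (idx 2) ^ CARD('m)}"

quotient_type (overloaded) ('a, 'n, 'm) trunc = "('a::field_char_0, 'n::{finite, linorder}) uea" /
  "\<lambda>u v. u - v \<in> two_sided_ideal (truncation_relators TYPE('m))"
  by (rule two_sided_ideal_equivp)

instantiation trunc :: (field_char_0, "{finite, linorder}", type) ring
begin

lift_definition zero_trunc :: "('a, 'b, 'c) trunc" is 0 .
lift_definition plus_trunc :: "('a, 'b, 'c) trunc \<Rightarrow> ('a, 'b, 'c) trunc \<Rightarrow> ('a, 'b, 'c) trunc" is "(+)"
  by (rule two_sided_ideal_cong(1))
lift_definition minus_trunc :: "('a, 'b, 'c) trunc \<Rightarrow> ('a, 'b, 'c) trunc \<Rightarrow> ('a, 'b, 'c) trunc" is "(-)"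
  by (rule two_sided_ideal_cong(2))
lift_definition uminus_trunc :: "('a, 'b, 'c) trunc \<Rightarrow> ('a, 'b, 'c) trunc" is "uminus"
  by (simp add: minus_diff_commute two_sided_ideal_sym)
lift_definition times_trunc :: "('a, 'b, 'c) trunc \<Rightarrow> ('a, 'b, 'c) trunc \<Rightarrow> ('a, 'b, 'c) trunc" is "(*)"
  by (rule two_sided_ideal_cong(3))

instance
  by standard (transfer; simp add: algebra_simps two_sided_ideal.zero)+

end

instantiation trunc :: (field_char_0, "{finite, linorder}", type) "{one, power}"
begin
lift_definition one_trunc :: "('a, 'b, 'c) trunc" is 1 .
instance ..
end

instance trunc :: (field_char_0, "{finite, linorder}", type) monoid_mult
  by standard (transfer; simp add: two_sided_ideal.zero)+

lift_definition trunc_scale ::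
  "'a::field_char_0 \<Rightarrow> ('a, 'n::{finite, linorder}, 'm) trunc \<Rightarrow> ('a, 'n, 'm) trunc" is ue_scale
  by (metis ue_algebra.two_sided_ideal_scale ue.scale_right_diff_distrib)

lift_definition trunc_E :: "'n \<Rightarrow> 'n \<Rightarrow> ('a::field_char_0, 'n::{finite, linorder}, 'm) trunc" is ue_E .

interpretation trunc_gl: gl_algebra trunc_scale
  "trunc_E :: 'n \<Rightarrow> 'n \<Rightarrow> ('a::field_char_0, 'n::{finite, linorder}, 'm) trunc"
proof
  fix i j k l :: 'n
  have E: "trunc_E i j = (abs_trunc (ue_E i j) :: ('a, 'n, 'm) trunc)" for i j
    by (rule trunc_E.abs_eq)
  show "trunc_E i j * trunc_E k l - trunc_E k l * trunc_E i j =
      (if j = k then trunc_E i l else 0) - (if i = l then trunc_E k j else (0 :: ('a, 'n, 'm) trunc))"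
    using arg_cong[OF ue_gl.E_bracket[of i j k l, where 'a = 'a], of "abs_trunc :: _ \<Rightarrow> ('a, 'n, 'm) trunc"]
    by (auto simp: E zero_trunc_def minus_trunc.abs_eq times_trunc.abs_eq split: if_splits)
  have "abs_trunc (\<Sum>i\<in>I. ue_E i i) = (\<Sum>i\<in>I. trunc_E i i :: ('a, 'n, 'm) trunc)" for I :: "'n set"
    by (induction I rule: infinite_finite_induct)
      (auto simp: E zero_trunc_def simp flip: plus_trunc.abs_eq)
  from this[of UNIV] show "(\<Sum>i\<in>UNIV. trunc_E i i) = (0 :: ('a, 'n, 'm) trunc)"
    by (simp add: ue_gl.E_trace zero_trunc_def)
qed (transfer; simp add: two_sided_ideal.zero ue.scale_right_distrib ue.scale_left_distrib
    ue_scale_mult_left ue_scale_mult_right)+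

lemma (in sl_module) ue_rep_uminus: "ue_rep scale act u (- b) = - ue_rep scale act u b"
  using ue_rep_more(4)[of u 0 b] by (simp add: ue_rep_more(3))

lemma ue_central_commute:
  fixes c :: "('a::field_char_0, 'n::finite) uea"
  assumes "\<And>a b. ue_E a b * c = c * ue_E a b"
  shows "u * c = c * u"
  by (rule ue_gl.central_commute[OF assms uea_generated])

lemma equivariant_central_action:
  fixes c :: "('a::field_char_0, 'n::finite) uea"
  assumes "\<And>a b. ue_E a b * c = c * ue_E a b"
  shows "mat_module.equivariant (mat_act c)"
proof -
  have "der_apply D (mat_act c A) = mat_act c (der_apply D A)" for D and A :: "'a^'n^'n"
    using ue_central_commute[OF assms, of "ue_of D"]
    by (metis mat_rep.ue_rep_simps(3,5))
  then show ?thesis by (simp add: mat_module.equivariant_def mat_rep.ue_rep_simps)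
qed

lemma quadratic_casimir_central: "u * ue_gl.quadratic_casimir = ue_gl.quadratic_casimir * u"
  for u :: "('a::field_char_0, 'n::finite) uea"
  by (rule ue_central_commute) (simp add: ue_gl.quadratic_casimir_E_power ue_gl.E_power_trace_central)

text \<open>
  By equivariance it suffices to evaluate the Casimir element at one off-diagonal unit.
\<close>

lemma quadratic_casimir_action:
  fixes A :: "'a::field_char_0^'n^'n" and p q :: 'n
  assumes pq: "p \<noteq> q" and "trace A = 0"
  shows "mat_act ue_gl.quadratic_casimir A = mat_scale (2 * of_nat CARD('n)) A"
proof (rule mat_module.equivariant_eq_on_traceless[OF _ _ _ assms])
  show "mat_module.equivariant (mat_act ue_gl.quadratic_casimir :: 'a^'n^'n \<Rightarrow> _)"
    by (rule equivariant_central_action) (rule quadratic_casimir_central)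
  show "mat_module.equivariant (mat_scale (2 * of_nat CARD('n)) :: 'a^'n^'n \<Rightarrow> _)"
    by (simp add: mat_module.equivariant_def der_apply_simps mat.scale_right_distrib mult.commute)
  have "mat_act (ue_E i j) (mat_act (ue_E j i) (munit p q)) =
      (if i = p then munit p q else 0) + (if j = q then munit p q else 0 :: 'a^'n^'n)" for i j
    using pq by (auto simp: mat_act_ue_E munit_mult mat_mult_bilinear)
  then have "mat_act ue_gl.quadratic_casimir (munit p q) = (\<Sum>i\<in>UNIV. \<Sum>j\<in>UNIV.
      (if i = p then munit p q else 0) + (if j = q then munit p q else 0 :: 'a^'n^'n))"
    by (simp add: ue_gl.quadratic_casimir_def mat_module.ue_rep_more mat_rep.ue_rep_simps)
  also have "\<dots> = (\<Sum>i\<in>(UNIV :: 'n set). munit p q) + (\<Sum>i\<in>(UNIV :: 'n set). munit p q)"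
  proof -
    have "(\<Sum>i\<in>UNIV. \<Sum>j\<in>(UNIV :: 'n set). if i = p then munit p q else 0 :: 'a^'n^'n) =
        (\<Sum>j\<in>(UNIV :: 'n set). munit p q)"
      by (subst sum.swap) (simp del: sum_constant)
    then show ?thesis by (simp add: sum.distrib del: sum_constant)
  qed
  also have "\<dots> = mat_scale (2 * of_nat CARD('n)) (munit p q)"
    by (simp only: mat.sum_constant_scale mult_2 mat.scale_left_distrib)
  finally show "mat_act ue_gl.quadratic_casimir (munit p q) =
      (mat_scale (2 * of_nat CARD('n)) (munit p q) :: 'a^'n^'n)" .
qed

text \<open>
  Membership in the annihilator of the adjoint representation; the identity matrix spans the other summand of
  \<open>M\<^sub>k(F)\<close>.
\<close>

definition acts_trivially :: "('a::field_char_0, 'n::finite) uea \<Rightarrow> bool"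
  where "acts_trivially u \<longleftrightarrow> (\<forall>A. trace A = 0 \<longrightarrow> mat_act u A = 0)"

lemma acts_trivially_ideal:
  assumes "\<And>g. g \<in> G \<Longrightarrow> acts_trivially g" "u \<in> two_sided_ideal G"
  shows "acts_trivially u"
  using assms(2)
  by induction (use assms(1) in \<open>auto simp: acts_trivially_def mat_rep.ue_rep_simps trace_mat_act
      mat_module.ue_rep_more\<close>)

text \<open>
  \<open>ad(e)\<^sup>3\<close> is a combination of terms with a factor \<open>e\<^sup>2 = 0\<close> on one side.
\<close>

lemma cube_acts_trivially:
  assumes "p \<noteq> q"
  shows "mat_act (ue_E p q ^ 3) A = (0 :: 'a::field_char_0^'n^'n)"
proof -
  have z: "X ** munit p q ** munit p q = (0 :: 'a^'n^'n)" "munit p q ** (munit p q ** X) = (0 :: 'a^'n^'n)" for X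
    using assms by (simp_all add: munit_mult mat_mult_bilinear flip: matrix_mul_assoc)
      (simp add: matrix_mul_assoc munit_mult mat_mult_bilinear)
  let ?Y = "munit p q ** A ** munit p q"
  have "mat_act (ue_E p q) (mat_act (ue_E p q) A) = mat_scale (- 2) ?Y"
    using z(1)[of A] z(2)[of A]
    by (simp add: mat_act_ue_E mat_mult_bilinear matrix_mul_assoc) (simp add: vec_eq_iff)
  moreover have "mat_act (ue_E p q) ?Y = 0"
    using z(1)[of "munit p q ** A"] z(2)[of "A ** munit p q"]
    by (simp add: mat_act_ue_E matrix_mul_assoc)
  ultimately show ?thesis
    by (simp add: power3_eq_cube mat_rep.ue_rep_simps mat_module.ue_rep_uminus mult.assoc)
qed

lemma abs_trunc_sum: "abs_trunc (\<Sum>i\<in>I. f i) = (\<Sum>i\<in>I. abs_trunc (f i))"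
  by (induction I rule: infinite_finite_induct) (auto simp: zero_trunc_def simp flip: plus_trunc.abs_eq)

lemma abs_trunc_quadratic_casimir: "abs_trunc ue_gl.quadratic_casimir = trunc_gl.quadratic_casimir"
  by (simp add: ue_gl.quadratic_casimir_def trunc_gl.quadratic_casimir_def abs_trunc_sum trunc_E.abs_eq
      times_trunc.abs_eq)

lemma one_in_truncation_ideal:
  assumes "CARD('n) \<ge> 2"
  shows "(1 :: ('a::field_char_0, 'n::{finite, linorder}) uea) \<in> two_sided_ideal (truncation_relators TYPE(2))"
proof -
  let ?G = "truncation_relators TYPE(2) :: ('a, 'n) uea set"
  have pq: "(idx 1 :: 'n) \<noteq> idx 2" using assms by (rule idx_neq)
  have eqI: "abs_trunc u = (abs_trunc v :: ('a, 'n, 2) trunc)" if "u - v \<in> two_sided_ideal ?G" for u v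
    using that by (simp add: trunc.abs_eq_iff)
  have "ue_E (idx 1) (idx 2) ^ 2 \<in> two_sided_ideal ?G"
    by (rule two_sided_ideal_base) (simp add: truncation_relators_def)
  then have sq: "ue_E i j ^ 2 \<in> two_sided_ideal ?G" if "i \<noteq> j" for i j
    using ue_gl.ideal_all_powers[OF pq that, of 2] by simp
  have "(1 :: ('a, 'n, 2) trunc) = 0"
  proof (rule trunc_gl.square_zero_collapse[OF assms])
    show "trunc_E i j * trunc_E i j = (0 :: ('a, 'n, 2) trunc)" if "i \<noteq> j" for i j
      using eqI[of "ue_E i j * ue_E i j" 0] sq[OF that]
      by (simp add: trunc_E.abs_eq times_trunc.abs_eq zero_trunc_def power2_eq_square)
    have "abs_trunc ue_gl.quadratic_casimir = (abs_trunc (ue_scale (2 * of_nat CARD('n)) 1) :: ('a, 'n, 2) trunc)"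
      by (intro eqI two_sided_ideal_base) (simp add: truncation_relators_def)
    then show "trunc_gl.quadratic_casimir = trunc_scale (2 * of_nat CARD('n)) (1 :: ('a, 'n, 2) trunc)"
      by (simp add: one_trunc_def trunc_scale.abs_eq abs_trunc_quadratic_casimir)
  qed
  then show ?thesis by (simp add: one_trunc_def zero_trunc_def trunc.abs_eq_iff)
qed

lemma trunc_generated: "u \<in> trunc_gl.generated" for u :: "('a::field_char_0, 'n::{finite, linorder}, 'm) trunc"
proof -
  have "abs_trunc v \<in> (trunc_gl.generated :: ('a, 'n, 'm) trunc set)" for v
  proof (induction v rule: uea_induct)
    case one
    show ?case using trunc_gl.generated.one by (simp add: one_trunc_def)
  next
    case (add u v)
    then show ?case by (simp add: trunc_gl.generated.add flip: plus_trunc.abs_eq)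
  next
    case (scale c u)
    then show ?case by (simp add: trunc_gl.generated.scale flip: trunc_scale.abs_eq)
  next
    case (mult a b u)
    then show ?case by (simp add: trunc_gl.generated.mult flip: times_trunc.abs_eq trunc_E.abs_eq)
  qed
  then show ?thesis by (metis Quotient_abs_rep[OF Quotient_trunc])
qed

text \<open>
  Put \<open>e = E p q\<^sup>2\<close>, \<open>f = E q p\<^sup>2\<close> and let \<open>Q\<close> be the quotient by the Casimir and cube relators. The corner
  \<open>f Q e\<close> is spanned by \<open>f e\<close>, which acts non-trivially, so \<open>f (b w a) e = 0\<close> in \<open>Q\<close> when \<open>w\<close> acts
  trivially. But \<open>Q e Q = Q = Q f Q\<close>, since a further relation \<open>e = 0\<close> makes the algebra collapse; so both
  outer factors can be removed and \<open>w = 0\<close> in \<open>Q\<close>.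
\<close>

lemma acts_trivially_in_truncation_ideal:
  fixes w :: "('a::field_char_0, 'n::{finite, linorder}) uea"
  assumes card: "CARD('n) \<ge> 2" and w: "acts_trivially w"
  shows "w \<in> two_sided_ideal (truncation_relators TYPE(3))"
proof -
  let ?G = "truncation_relators TYPE(3) :: ('a, 'n) uea set"
  let ?c = "ue_gl.quadratic_casimir - ue_scale (2 * of_nat CARD('n)) 1 :: ('a, 'n) uea"
  define p q :: 'n where "p = idx 1" and "q = idx 2"
  have pq: "p \<noteq> q" using card unfolding p_def q_def by (rule idx_neq)
  define e f :: "('a, 'n) uea" where "e = ue_E p q * ue_E p q" and "f = ue_E q p * ue_E q p"
  have eqI: "abs_trunc u = (abs_trunc v :: ('a, 'n, 3) trunc) \<longleftrightarrow> u - v \<in> two_sided_ideal ?G" for u v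
    by (simp add: trunc.abs_eq_iff)
  have c: "?c \<in> two_sided_ideal ?G"
    by (rule two_sided_ideal_base) (simp add: truncation_relators_def)
  have cube: "ue_E i j ^ 3 \<in> two_sided_ideal ?G" if "i \<noteq> j" for i j
    using ue_gl.ideal_all_powers[OF pq that, of 3] two_sided_ideal_base[of "ue_E p q ^ 3" ?G]
    by (simp add: truncation_relators_def p_def q_def)
  have trivial: "acts_trivially g" if "g \<in> two_sided_ideal ?G" for g
  proof (rule acts_trivially_ideal[OF _ that])
    fix g assume "g \<in> ?G"
    then show "acts_trivially g"
      using quadratic_casimir_action[OF pq] cube_acts_trivially[OF pq]
      by (auto simp: truncation_relators_def p_def q_def acts_trivially_def mat_module.ue_rep_more
          mat_rep.ue_rep_simps)
  qed
  have corner: "f * u * e \<in> two_sided_ideal ?G" if u: "acts_trivially u" for u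
  proof -
    have "\<exists>c. trunc_E q p * trunc_E q p * abs_trunc u * (trunc_E p q * trunc_E p q) =
       (trunc_scale c (trunc_E q p * trunc_E q p * (trunc_E p q * trunc_E p q)) :: ('a, 'n, 3) trunc)"
    proof (rule trunc_gl.corner_one_dimensional[OF pq _ _ trunc_generated])
      show "trunc_E i j * (trunc_E i j * trunc_E i j) = (0 :: ('a, 'n, 3) trunc)" if "i \<noteq> j" for i j
        using eqI[of "ue_E i j * (ue_E i j * ue_E i j)" 0] cube[OF that]
        by (simp add: trunc_E.abs_eq times_trunc.abs_eq zero_trunc_def power3_eq_cube mult.assoc)
      show "trunc_gl.quadratic_casimir = trunc_scale (2 * of_nat CARD('n)) (1 :: ('a, 'n, 3) trunc)"
        using c unfolding abs_trunc_quadratic_casimir[symmetric] one_trunc_def trunc_scale.abs_eq eqI .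
    qed
    then obtain c where "f * u * e - ue_scale c (f * e) \<in> two_sided_ideal ?G"
      by (auto simp: trunc_E.abs_eq times_trunc.abs_eq trunc_scale.abs_eq eqI e_def f_def)
    moreover from trivial[OF this] have "c = 0"
    proof -
      assume "acts_trivially (f * u * e - ue_scale c (f * e))"
      then have "mat_act (f * u * e - ue_scale c (f * e)) (munit q p) = 0"
        using pq by (simp add: acts_trivially_def trace_munit)
      moreover have "mat_act (f * u * e) (munit q p) = 0"
        using u pq by (simp add: acts_trivially_def mat_rep.ue_rep_simps trace_mat_act trace_munit
            mat_module.ue_rep_more)
      moreover have "mat_act (f * e) (munit q p) = mat_scale 4 (munit q p)"
      proof -
        have "mat_act (ue_E p q) (mat_act (ue_E p q) (munit q p)) = mat_scale (- 2) (munit p q :: ('a, 'n) sqmat)"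
          "mat_act (ue_E q p) (mat_act (ue_E q p) (munit p q)) = mat_scale (- 2) (munit q p :: ('a, 'n) sqmat)"
          using pq by (simp_all add: mat_act_ue_E munit_mult mat_mult_bilinear) (simp_all add: vec_eq_iff)
        then show ?thesis by (simp add: e_def f_def mat_rep.ue_rep_simps mat_module.ue_rep_uminus)
      qed
      ultimately show "c = 0"
        by (simp add: mat_module.ue_rep_more mat_rep.ue_rep_simps)
    qed
    ultimately show ?thesis by simp
  qed
  let ?Ge = "truncation_relators TYPE(2) :: ('a, 'n) uea set" and ?Gf = "{?c, f}"
  have "e = ue_E p q ^ 2" by (simp add: e_def power2_eq_square)
  then have Ge: "?Ge = {?c, e}" by (simp add: truncation_relators_def p_def q_def)
  \<comment> \<open>1 lies in the ideal of \<open>?c\<close> and \<open>e\<close>; insert that expression of 1 to the right of \<open>u\<close>.\<close>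
  have left: "f * u \<in> two_sided_ideal ?G" if u: "acts_trivially u" for u
  proof -
    have "f * (u * v) \<in> two_sided_ideal ?G" if "v \<in> two_sided_ideal ?Ge" for v
      using that
    proof induction
      case (gen g a b)
      have "acts_trivially (u * a)"
        using u by (simp add: acts_trivially_def mat_rep.ue_rep_simps trace_mat_act)
      from two_sided_ideal_mult(2)[OF corner[OF this], of b]
      have "f * (u * (a * e * b)) \<in> two_sided_ideal ?G" by (simp add: mult.assoc)
      moreover have "f * (u * (a * ?c * b)) \<in> two_sided_ideal ?G"
        using c by (intro two_sided_ideal_mult)
      ultimately show ?case using gen unfolding Ge by auto
    qed (auto simp: distrib_left intro: two_sided_ideal.intros)
    from this[OF one_in_truncation_ideal[OF card]] show ?thesis by simp
  qed
  have "f = ue_E q p ^ 2" by (simp add: f_def power2_eq_square)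
  then have "ue_E q p ^ 2 \<in> two_sided_ideal ?Gf" by (simp add: two_sided_ideal_base)
  then have "e \<in> two_sided_ideal ?Gf"
    using ue_gl.ideal_all_powers[OF pq[symmetric] pq, of 2] by (simp add: \<open>e = ue_E p q ^ 2\<close>)
  then have "1 \<in> two_sided_ideal ?Gf"
    by (intro two_sided_ideal_least[OF one_in_truncation_ideal[OF card]])
      (auto simp: Ge intro: two_sided_ideal_base)
  moreover have "v * w \<in> two_sided_ideal ?G" if "v \<in> two_sided_ideal ?Gf" for v
    using that
  proof induction
    case (gen g a b)
    have "acts_trivially (b * w)"
      using w by (simp add: acts_trivially_def mat_rep.ue_rep_simps mat_module.ue_rep_more)
    from two_sided_ideal_mult(1)[OF left[OF this], of a]
    have "a * f * b * w \<in> two_sided_ideal ?G" by (simp add: mult.assoc)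
    moreover have "a * ?c * b * w \<in> two_sided_ideal ?G"
      using c by (intro two_sided_ideal_mult)
    ultimately show ?case using gen by auto
  qed (auto simp: distrib_right intro: two_sided_ideal.intros)
  \<comment> \<open>The instance \<open>v = 1\<close> of the last fact.\<close>
  ultimately show ?thesis by fastforce
qed

section \<open>The kernel of the action on matrices\<close>

lemma casimir_central:
  assumes "p \<ge> 1"
  shows "u * casimir p = casimir p * (u :: ('a::field_char_0, 'n::{finite, linorder}) uea)"
  by (rule ue_central_commute) (simp add: casimir_E_power[OF assms] ue_gl.E_power_trace_central)

text \<open>
  The defining description of the eigenvalue is unique because \<open>L\<close> is not zero.
\<close>

lemma adjoint_eigenvalue_eqI:
  fixes u :: "('a::field_char_0, 'n::finite) uea" and p q :: 'n
  assumes pq: "p \<noteq> q" and u: "\<And>A. trace A = 0 \<Longrightarrow> mat_act u A = mat_scale c A"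
  shows "adjoint_eigenvalue u = c"
  unfolding adjoint_eigenvalue_def
proof (rule the_equality)
  show "\<forall>D. adjoint_act u D = der_scale c D"
  proof
    fix D :: "('a, 'n) der"
    obtain A where A: "D = ad A" using derivation_inner by blast
    have "ad A = ad (traceless_part A)"
      by (simp add: traceless_part_def ad_linear)
    then show "adjoint_act u D = der_scale c D"
      using u[of "traceless_part A"] by (simp add: A adjoint_act_ad ad_linear)
  qed
next
  fix c' assume "\<forall>D. adjoint_act u D = der_scale c' D"
  then have "der_scale c' (ad (munit p q)) = ad (mat_act u (munit p q))"
    by (metis adjoint_act_ad)
  also have "\<dots> = der_scale c (ad (munit p q))"
    using u pq by (simp add: trace_munit ad_linear)
  finally have eq: "der_scale c' (ad (munit p q :: 'a^'n^'n)) = der_scale c (ad (munit p q))" .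
  have "der_apply (ad (munit p q)) (munit q p) = (munit p p - munit q q :: 'a^'n^'n)"
    by (simp add: ad.rep_eq munit_mult)
  moreover have "(munit p p - munit q q :: 'a^'n^'n) $ p $ p = 1"
    using pq by (simp add: munit_nth)
  ultimately have "ad (munit p q :: 'a^'n^'n) \<noteq> 0"
    by (metis zero_der.rep_eq zero_index zero_neq_one)
  then show "c' = c" using eq by (simp add: der.scale_cancel_right)
qed

lemma z_casimir_acts_trivially:
  assumes "CARD('n) \<ge> 2" "p \<ge> 1"
  shows "acts_trivially (z_casimir p :: ('a::field_char_0, 'n::{finite, linorder}) uea)"
proof -
  have "(idx 1 :: 'n) \<noteq> idx 2" using assms(1) by (rule idx_neq)
  moreover have "mat_module.equivariant (mat_act (casimir p :: ('a, 'n) uea))"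
    by (rule equivariant_central_action) (rule casimir_central[OF assms(2)])
  ultimately obtain c where c: "\<And>A. trace A = 0 \<Longrightarrow> mat_act (casimir p :: ('a, 'n) uea) A = mat_scale c A"
    by (metis equivariant_endo_scalar)
  then have "adjoint_eigenvalue (casimir p :: ('a, 'n) uea) = c"
    using \<open>idx 1 \<noteq> idx 2\<close> by (metis adjoint_eigenvalue_eqI)
  then show ?thesis
    using c by (simp add: z_casimir_def acts_trivially_def mat_module.ue_rep_more mat_rep.ue_rep_simps)
qed

lemma z_casimir_two:
  assumes "CARD('n) \<ge> 2"
  shows "(z_casimir 2 :: ('a::field_char_0, 'n::{finite, linorder}) uea) =
    ue_gl.quadratic_casimir - ue_scale (2 * of_nat CARD('n)) 1"
proof -
  have "casimir 2 = (ue_gl.quadratic_casimir :: ('a, 'n) uea)"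
    by (simp add: casimir_E_power ue_gl.quadratic_casimir_E_power)
  then show ?thesis
    using adjoint_eigenvalue_eqI[OF idx_neq[OF assms] quadratic_casimir_action[OF idx_neq[OF assms], where 'a = 'a]]
    by (simp add: z_casimir_def)
qed

lemma z_casimir_central:
  "p \<ge> 1 \<Longrightarrow> u * z_casimir p = z_casimir p * (u :: ('a::field_char_0, 'n::{finite, linorder}) uea)"
  by (simp add: z_casimir_def left_diff_distrib right_diff_distrib casimir_central
      ue_scale_mult_left ue_scale_mult_right)

lemma z_elem_ue_E: "z_elem = ue_E (idx 1) (idx 2) ^ 3 +
    (\<Sum>p = 2..CARD('n). ue_E (idx 1) (idx p) * (z_casimir p :: ('a::field_char_0, 'n::{finite, linorder}) uea))"
  by (simp add: z_elem_def ue_E_def mat_unit_munit)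

lemma mat_act_split: "mat_act u A = mat_act u (traceless_part A) +
    mat_scale (trace A / of_nat CARD('n)) (mat_act u (mat 1))"
  for A :: "'a::field_char_0^'n^'n"
  by (subst traceless_part_plus[of A]) (simp only: mat_rep.ue_rep_simps)

lemma z_elem_acts_zero:
  fixes A :: "('a::field_char_0, 'n::{finite, linorder}) sqmat"
  assumes card: "CARD('n) \<ge> 2"
  shows "mat_act z_elem A = 0"
proof -
  have "mat_act (ue_E (idx 1) (idx p) * z_casimir p) A = 0" if "p \<ge> 1" for p
  proof -
    obtain t where t: "mat_act (z_casimir p) (mat 1) = mat_scale t (mat 1 :: ('a, 'n) sqmat)"
      using mat_act_mat_one by blast
    have "mat_act (z_casimir p) (traceless_part A) = 0"
      using z_casimir_acts_trivially[OF card that, where 'a = 'a] by (simp add: acts_trivially_def)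
    then show ?thesis
      by (simp add: mat_rep.ue_rep_simps mat_act_split[of "z_casimir p" A] t)
        (simp add: mat_act_ue_E)
  qed
  then show ?thesis
    by (simp add: z_elem_ue_E mat_rep.ue_rep_simps mat_module.ue_rep_more
        cube_acts_trivially[OF idx_neq[OF card]] del: One_nat_def)
qed

text \<open>
  The summands of \<open>z\<close> lie in different weight spaces. Bracketing with \<open>e\<^sub>1\<^sub>1\<close> multiplies the cube by 3 and the
  other summands by 1, which isolates the cube; bracketing the rest with \<open>e\<^sub>2\<^sub>2\<close> isolates the summand of \<open>e\<^sub>1\<^sub>2\<close>.
\<close>

lemma cube_and_casimir_in_z_ideal:
  assumes card: "CARD('n) \<ge> 2"
  defines "K \<equiv> two_sided_ideal {z_elem :: ('a::field_char_0, 'n::{finite, linorder}) uea}"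
  shows "ue_E (idx 1) (idx 2) ^ 3 \<in> K" and "ue_E (idx 1) (idx 2) * z_casimir 2 \<in> K"
proof -
  let ?e = "ue_E (idx 1) (idx 2) :: ('a, 'n) uea"
  let ?E = "\<lambda>p. ue_E (idx 1) (idx p) :: ('a, 'n) uea"
  define S where "S = (\<Sum>p = 2..CARD('n). ?E p * z_casimir p)"
  have z: "z_elem \<in> K" unfolding K_def by (rule two_sided_ideal_base) simp
  have zS: "z_elem = ?e ^ 3 + S" by (simp add: z_elem_ue_E S_def)
  have neq: "(idx p :: 'n) = idx q \<longleftrightarrow> p = q" if "p \<in> {1..CARD('n)}" "q \<in> {1..CARD('n)}" for p q
    using that by (rule idx_eq_iff)
  define d where "d a x = ue_E (idx a) (idx a) * x - x * ue_E (idx a) (idx a)" for a and x :: "('a, 'n) uea"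
  have d_mult: "d a (x * y) = d a x * y + x * d a y" and d_ideal: "x \<in> K \<Longrightarrow> d a x \<in> K" for a x y
    unfolding d_def K_def by (fact ue_algebra.ideal_inner_derivation)+
  have d_E: "d a (?E p) = ue_scale (of_int (ue_gl.unit_weight (idx 1 :: 'n) (idx p) (idx a))) (?E p)" for a p
    unfolding d_def by (subst ue_gl.E_diag) simp
  have d_z: "d a (z_casimir p) = 0" if "p \<ge> 1" for a p
    using z_casimir_central[OF that] by (simp add: d_def)
  have d_S: "d a S = (\<Sum>p = 2..CARD('n). ue_scale (of_int (ue_gl.unit_weight (idx 1 :: 'n) (idx p) (idx a))) (?E p * z_casimir p))" for a
  proof -
    have "d a S = (\<Sum>p = 2..CARD('n). d a (?E p * z_casimir p))"
      by (simp add: d_def S_def sum_distrib_left sum_distrib_right sum_subtractf)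
    then show ?thesis by (simp add: d_mult d_E d_z ue_scale_mult_left del: One_nat_def)
  qed
  have "d 1 S = S" unfolding d_S unfolding S_def
    using neq[of 1] by (intro sum.cong) (auto simp: ue_gl.unit_weight_def)
  moreover have "d 1 ?e = ?e" unfolding d_E using neq[of 1 2] card by (simp add: ue_gl.unit_weight_def)
  then have "d 1 (?e ^ 3) = ue_scale 3 (?e ^ 3)"
    by (simp add: power3_eq_cube d_mult ue_algebra.scale_numeral distrib_right add.assoc)
  moreover have "d 1 z_elem = d 1 (?e ^ 3) + d 1 S"
    unfolding zS d_def by (simp add: algebra_simps)
  ultimately have "d 1 z_elem - z_elem = ue_scale 2 (?e ^ 3)"
    by (simp add: zS ue_algebra.scale_numeral)
  then have "ue_scale 2 (?e ^ 3) \<in> K"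
    using two_sided_ideal_diff[OF d_ideal[OF z, of 1, unfolded K_def] z[unfolded K_def]]
    by (simp add: K_def)
  then show cube: "?e ^ 3 \<in> K"
    unfolding K_def by (rule ue_algebra.two_sided_ideal_unscale) simp
  have "S \<in> K"
    using two_sided_ideal_diff[OF z[unfolded K_def] cube[unfolded K_def]] by (simp add: zS K_def)
  then have "d 2 S \<in> K" by (rule d_ideal)
  also have "d 2 S = (\<Sum>p = 2..CARD('n). if p = 2 then - (?e * z_casimir 2) else 0)"
    unfolding d_S using neq[of 2] neq[of 1 2] card
    by (intro sum.cong) (auto simp: ue_gl.unit_weight_def)
  also have "\<dots> = - (?e * z_casimir 2)" using card by simp
  finally show "?e * z_casimir 2 \<in> K"
    using two_sided_ideal_uminus[of "- (?e * z_casimir 2)" "{z_elem}"] by (simp add: K_def)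
qed

text \<open>
  Let \<open>K\<close> be the ideal of \<open>z\<close>. From \<open>e\<^sub>1\<^sub>2 z\<^sub>2 \<in> K\<close> one gets \<open>L z\<^sub>2 \<subseteq> K\<close>. If \<open>u\<close> acts as zero, its
  constant term vanishes because \<open>u\<close> kills the identity matrix, so \<open>u z\<^sub>2 \<in> K\<close>. On the other hand \<open>u\<close> lies in
  the ideal of \<open>z\<^sub>2\<close> and \<open>e\<^sub>1\<^sub>2\<^sup>3\<close>, and \<open>c\<^sub>2\<close> times either of them is in \<open>K\<close>, so \<open>c\<^sub>2 u \<in> K\<close>. The
  difference is \<open>2 k u\<close>.
\<close>

theorem kernel_generated_by_z:
  fixes u :: "('a::field_char_0, 'n::{finite, linorder}) uea"
  assumes card: "CARD('n) \<ge> 2" and u: "\<And>A. mat_act u A = 0"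
  shows "u \<in> two_sided_ideal {z_elem}"
proof -
  let ?K = "two_sided_ideal {z_elem :: ('a, 'n) uea}"
  let ?c = "ue_gl.quadratic_casimir :: ('a, 'n) uea" and ?z = "z_casimir 2 :: ('a, 'n) uea"
  have z: "?z = ?c - ue_scale (2 * of_nat CARD('n)) 1" by (rule z_casimir_two[OF card])
  have zc: "v * ?z = ?z * v" for v by (rule z_casimir_central) simp
  have ad: "ue_of (ad A) * ?z \<in> ?K" if "trace A = 0" for A
  proof -
    have "A \<in> {A. ue_of (ad A) * ?z \<in> ?K}"
    proof (rule traceless_in_bracket_closed[OF _ _ _ idx_neq[OF card] that])
      show "mat.subspace {A. ue_of (ad A) * ?z \<in> ?K}"
        by (auto simp: mat.subspace_def ad_linear ue_of_add ue_of_scale distrib_right ue_scale_mult_left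
            intro: two_sided_ideal.intros ue_algebra.two_sided_ideal_scale)
      show "munit (idx 1) (idx 2) \<in> {A. ue_of (ad A) * ?z \<in> ?K}"
        using cube_and_casimir_in_z_ideal(2)[OF card] by (simp add: ue_E_def)
      show "der_apply D A \<in> {A. ue_of (ad A) * ?z \<in> ?K}" if "A \<in> {A. ue_of (ad A) * ?z \<in> ?K}" for A D
      proof -
        have "ue_of (ad (der_apply D A)) * ?z =
            ue_of D * (ue_of (ad A) * ?z) - (ue_of (ad A) * ?z) * ue_of D"
          using zc[of "ue_of D"]
          by (simp add: der_bracket_ad[symmetric] ue_of_bracket left_diff_distrib mult.assoc)
        also have "\<dots> \<in> ?K"
          using that by (auto intro: two_sided_ideal_diff two_sided_ideal_mult(1)[of "ue_of (ad A) * ?z"]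
              two_sided_ideal_mult(2)[of "ue_of (ad A) * ?z"])
        finally show ?thesis by simp
      qed
    qed
    then show ?thesis by simp
  qed
  have E: "ue_E a b * ?z \<in> ?K" for a b
  proof -
    have "ad (munit a b) = ad (traceless_part (munit a b) :: ('a, 'n) sqmat)"
      by (simp add: traceless_part_def ad_linear)
    then show ?thesis using ad[of "traceless_part (munit a b)"] by (simp add: ue_E_def)
  qed
  \<comment> \<open>The scalar \<open>t\<close> is the constant term of \<open>v\<close>, read off from the action on the trivial submodule.\<close>
  have "\<exists>t. (v - ue_scale t 1) * ?z \<in> ?K \<and> mat_act v (mat 1) = mat_scale t (mat 1)" for v
  proof (induction v rule: uea_induct)
    case one
    show ?case by (rule exI[of _ 1]) (simp add: two_sided_ideal.zero mat_rep.ue_rep_simps)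
  next
    case (add v w)
    then obtain s t where "(v - ue_scale s 1) * ?z \<in> ?K" "mat_act v (mat 1) = mat_scale s (mat 1)"
      "(w - ue_scale t 1) * ?z \<in> ?K" "mat_act w (mat 1) = mat_scale t (mat 1)" by blast
    then show ?case
      using two_sided_ideal.add[of "(v - ue_scale s 1) * ?z" _ "(w - ue_scale t 1) * ?z"]
      by (intro exI[of _ "s + t"])
        (simp add: mat_rep.ue_rep_simps mat.scale_left_distrib ue.scale_left_distrib algebra_simps)
  next
    case (scale c v)
    then obtain t where t: "(v - ue_scale t 1) * ?z \<in> ?K" "mat_act v (mat 1) = mat_scale t (mat 1)"
      by blast
    from ue_algebra.two_sided_ideal_scale[OF t(1), of c] t(2) show ?case
      by (intro exI[of _ "c * t"])
        (simp add: mat_rep.ue_rep_simps ue.scale_right_diff_distrib left_diff_distrib ue_scale_mult_left)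
  next
    case (mult a b v)
    then obtain t where "mat_act v (mat 1) = mat_scale t (mat 1 :: ('a, 'n) sqmat)" by blast
    then have "mat_act (ue_E a b * v) (mat 1) = (0 :: ('a, 'n) sqmat)"
      by (simp add: mat_rep.ue_rep_simps) (simp add: mat_act_ue_E)
    moreover have "ue_E a b * v * ?z = ue_E a b * ?z * v"
      by (simp add: zc mult.assoc)
    moreover have "ue_E a b * ?z * v \<in> ?K" by (rule two_sided_ideal_mult(2)[OF E])
    ultimately show ?case by (intro exI[of _ 0]) simp
  qed
  then obtain t where t: "(u - ue_scale t 1) * ?z \<in> ?K" "mat_act u (mat 1) = mat_scale t (mat 1 :: ('a, 'n) sqmat)"
    by blast
  have "(mat 1 :: ('a, 'n) sqmat) $ idx 1 $ idx 1 = 1" by (simp add: mat_def)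
  then have "(mat 1 :: ('a, 'n) sqmat) \<noteq> 0" by (metis zero_index zero_neq_one)
  then have "t = 0" using t(2) u by (metis mat.scale_eq_0_iff)
  then have uz: "u * ?z \<in> ?K" using t(1) by simp
  have "acts_trivially u" using u by (simp add: acts_trivially_def)
  then have "u \<in> two_sided_ideal (truncation_relators TYPE(3))"
    by (rule acts_trivially_in_truncation_ideal[OF card])
  then have "?c * u \<in> ?K"
  proof induction
    case (gen g a b)
    have c: "?c * (a * g * b) = a * (?c * g) * b" for g
      by (simp add: quadratic_casimir_central flip: mult.assoc)
    have "?c * ?z \<in> ?K"
      unfolding ue_gl.quadratic_casimir_mult
      by (intro two_sided_ideal_sum two_sided_ideal_mult(1) E)
    moreover have "?c * ue_E (idx 1) (idx 2) ^ 3 \<in> ?K"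
      using cube_and_casimir_in_z_ideal(1)[OF card] by (rule two_sided_ideal_mult)
    ultimately have "?c * g \<in> ?K" using gen z by (auto simp: truncation_relators_def)
    then show ?case unfolding c by (rule two_sided_ideal_mult(2)[OF two_sided_ideal_mult(1)])
  qed (auto simp: distrib_left intro: two_sided_ideal.intros)
  from two_sided_ideal_diff[OF this uz] have "ue_scale (2 * of_nat CARD('n)) u \<in> ?K"
    by (simp add: zc) (simp add: z left_diff_distrib ue_scale_mult_left)
  then show ?thesis by (rule ue_algebra.two_sided_ideal_unscale) simp
qed

section \<open>Substitution into L-polynomials\<close>

definition free_hom :: "('x \<Rightarrow> 'y word \<Rightarrow>\<^sub>0 'a::field) \<Rightarrow> ('x word \<Rightarrow>\<^sub>0 'a) \<Rightarrow> ('y word \<Rightarrow>\<^sub>0 'a)"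
  where "free_hom \<sigma> = lin_ext (\<lambda>c p. const c * p) (\<lambda>w. prod_list (map \<sigma> (letters w)))"

lemma free_hom_simps:
  "free_hom \<sigma> (p + q) = free_hom \<sigma> p + free_hom \<sigma> q"
  "free_hom \<sigma> (p - q) = free_hom \<sigma> p - free_hom \<sigma> q"
  "free_hom \<sigma> (symb x) = \<sigma> x" "free_hom \<sigma> (const c) = const c" "free_hom \<sigma> 0 = 0"
  "free_hom \<sigma> (p * q) = free_hom \<sigma> p * free_hom \<sigma> q"
proof -
  show "free_hom \<sigma> (p * q) = free_hom \<sigma> p * free_hom \<sigma> q"
    unfolding free_hom_def
  proof (rule free.lin_ext_mult, goal_cases)
    case (4 c x y)
    show ?case by (simp add: const_commute flip: mult.assoc)
  qed (simp_all add: distrib_left distrib_right mult.assoc)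
qed (simp_all add: free_hom_def free.lin_ext_add free.lin_ext_diff)

lemma lookup_free_hom_zero:
  assumes "\<And>x. Poly_Mapping.lookup (\<sigma> x) 0 = 0"
  shows "Poly_Mapping.lookup (free_hom \<sigma> p) 0 = Poly_Mapping.lookup p 0"
proof (induction p rule: free_algebra_induct)
  case (single w c)
  show ?case
  proof (cases "letters w")
    case Nil
    then have "w = 0" by (cases w) (simp add: zero_word_def)
    then show ?thesis by (simp add: free_hom_simps)
  next
    case (Cons x xs)
    then have "w \<noteq> 0" by auto
    with Cons show ?thesis
      by (simp add: free_hom_def lookup_mult_zero assms lookup_single)
  qed
qed (simp_all add: free_hom_simps lookup_add)

lemma ring_ideal_hom:
  assumes "\<And>a b. h (a + b) = h a + h b" "\<And>a b. h (a * b) = h a * h b" "h 0 = 0"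
    and "\<And>g. g \<in> G \<Longrightarrow> h g \<in> ring_ideal G'" "p \<in> ring_ideal G"
  shows "h p \<in> ring_ideal G'"
  using assms(5)
  by induction (auto simp: assms(1-3) intro: ring_ideal.intros ring_ideal_left ring_ideal_right assms(4))

lemma rep_lpoly_cong:
  "rep_lpoly (f + g) - (rep_lpoly f + rep_lpoly g) \<in> ring_ideal lp_relations"
  "rep_lpoly (lp_scale c f) - const c * rep_lpoly f \<in> ring_ideal lp_relations"
proof -
  have "f + g = abs_lpoly (rep_lpoly f + rep_lpoly g)"
    by (subst (1 2) abs_rep_lpoly[symmetric]) (simp add: plus_lpoly.abs_eq lp_rel_refl)
  then show "rep_lpoly (f + g) - (rep_lpoly f + rep_lpoly g) \<in> ring_ideal lp_relations"
    using rep_abs_lpoly[of "rep_lpoly f + rep_lpoly g"] by (simp add: lookup_add)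
  have "lp_scale c f = abs_lpoly (const c * rep_lpoly f)"
    by (subst (1) abs_rep_lpoly[symmetric]) (simp add: lp_scale.abs_eq lp_rel_refl)
  then show "rep_lpoly (lp_scale c f) - const c * rep_lpoly f \<in> ring_ideal lp_relations"
    using rep_abs_lpoly[of "const c * rep_lpoly f"] by (simp add: lookup_mult_zero)
qed

text \<open>
  The \<open>L\<close>-endomorphism with \<open>x\<^sub>i \<mapsto> s i\<close>, by the universal property of the free algebra.
\<close>

definition lp_endo ::
  "(nat \<Rightarrow> ('a, 'n) lpoly) \<Rightarrow> ('a::field_char_0, 'n::finite) lpoly \<Rightarrow> ('a, 'n) lpoly"
  where "lp_endo s f = abs_lpoly (free_hom (\<lambda>(i, u). rep_lpoly (lp_act u (s i))) (rep_lpoly f))"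

lemma lp_endo_simps:
  fixes s :: "nat \<Rightarrow> ('a::field_char_0, 'n::finite) lpoly"
  shows "lp_endo s (f + g) = lp_endo s f + lp_endo s g"
    "lp_endo s (f * g) = lp_endo s f * lp_endo s g"
    "lp_endo s (lp_scale c f) = lp_scale c (lp_endo s f)"
    "lp_endo s (lp_var i u) = lp_act u (s i)"
proof -
  define \<sigma> where "\<sigma> = (\<lambda>(i, u). rep_lpoly (lp_act u (s i)))"
  have \<sigma>0: "Poly_Mapping.lookup (\<sigma> x) 0 = 0" for x by (cases x) (simp add: \<sigma>_def)
  note look = lookup_free_hom_zero[of \<sigma>, OF \<sigma>0]
  have rel: "free_hom \<sigma> g \<in> ring_ideal lp_relations" if "g \<in> lp_relations" for g
  proof -
    have "free_hom \<sigma> (symb (i, u + v) - symb (i, u) - symb (i, v)) \<in> ring_ideal lp_relations" for i u v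
      using rep_lpoly_cong(1)[of "lp_act u (s i)" "lp_act v (s i)"]
      by (simp add: free_hom_simps \<sigma>_def lp_rep.ue_rep_simps algebra_simps)
    moreover have "free_hom \<sigma> (symb (i, ue_scale c u) - const c * symb (i, u)) \<in> ring_ideal lp_relations" for i c u
      using rep_lpoly_cong(2)[of c "lp_act u (s i)"]
      by (simp add: free_hom_simps \<sigma>_def lp_rep.ue_rep_simps)
    ultimately show ?thesis using that by (auto simp: lp_relations_def)
  qed
  have abs: "lp_endo s (abs_lpoly p) = abs_lpoly (free_hom \<sigma> p)" if "Poly_Mapping.lookup p 0 = 0" for p
    unfolding lp_endo_def \<sigma>_def[symmetric]
  proof (rule abs_lpoly_eqI)
    have "free_hom \<sigma> (rep_lpoly (abs_lpoly p) - p) \<in> ring_ideal lp_relations"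
      by (rule ring_ideal_hom[OF _ _ _ rel rep_abs_lpoly[OF that]]) (simp_all add: free_hom_simps)
    then show "free_hom \<sigma> (rep_lpoly (abs_lpoly p)) - free_hom \<sigma> p \<in> ring_ideal lp_relations"
      by (simp add: free_hom_simps)
  qed (simp_all add: look that)
  obtain p where p: "f = abs_lpoly p" "Poly_Mapping.lookup p 0 = 0" by (rule lpoly_cases)
  obtain q where q: "g = abs_lpoly q" "Poly_Mapping.lookup q 0 = 0" by (rule lpoly_cases)
  show "lp_endo s (f + g) = lp_endo s f + lp_endo s g"
    "lp_endo s (f * g) = lp_endo s f * lp_endo s g"
    "lp_endo s (lp_scale c f) = lp_scale c (lp_endo s f)"
    using p q by (simp_all add: plus_lpoly.abs_eq times_lpoly.abs_eq lp_scale.abs_eq lp_rel_refl abs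
        lookup_add lookup_mult_zero free_hom_simps look)
  show "lp_endo s (lp_var i u) = lp_act u (s i)"
    by (simp add: lp_var_def abs free_hom_simps) (simp add: \<sigma>_def abs_rep_lpoly)
qed

lemma lp_endo_deriv: "lp_endo s (lp_deriv D f) = lp_deriv D (lp_endo s f)"
  for f :: "('a::field_char_0, 'n::finite) lpoly"
  by (induction f rule: lpoly_induct)
    (simp_all add: lp_deriv_add lp_deriv_scale lp_deriv_mult lp_deriv_var lp_endo_simps
      lp_rep.ue_rep_simps)

interpretation lp_module: sl_module lp_scale lp_deriv ..

lemma L_endomorphism_lp_endo: "L_endomorphism (lp_endo s)"
  for s :: "nat \<Rightarrow> ('a::field_char_0, 'n::finite) lpoly"
proof -
  have "lp_endo s (lp_act u f) = lp_act u (lp_endo s f)" for u f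
    by (induction u arbitrary: f rule: uea_induct)
      (simp_all add: lp_rep.ue_rep_simps lp_endo_simps lp_endo_deriv ue_E_def)
  then show ?thesis
    by (simp add: L_endomorphism_def lp_endo_simps Vector_Spaces.linear_def module_hom_def
        module_hom_axioms_def lp.vector_space_axioms lp.module_axioms)
qed

lemma lp_act_var: "lp_act u (lp_var i v) = lp_var i (u * v)"
  for u v :: "('a::field_char_0, 'n::finite) uea"
  by (induction u arbitrary: v rule: uea_induct)
    (simp_all add: lp_rep.ue_rep_simps distrib_right lp_var_add ue_scale_mult_left lp_var_scale
      ue_E_def lp_deriv_var mult.assoc)

lemma TL_idealD:
  assumes "TL_ideal I"
  shows "0 \<in> I" "f \<in> I \<Longrightarrow> g \<in> I \<Longrightarrow> f + g \<in> I" "f \<in> I \<Longrightarrow> g \<in> I \<Longrightarrow> f - g \<in> I" "f \<in> I \<Longrightarrow> - f \<in> I"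
    "f \<in> I \<Longrightarrow> lp_scale c f \<in> I" "f \<in> I \<Longrightarrow> f * h \<in> I" "f \<in> I \<Longrightarrow> h * f \<in> I"
    "f \<in> I \<Longrightarrow> lp_deriv D f \<in> I"
    "f \<in> I \<Longrightarrow> L_endomorphism \<phi> \<Longrightarrow> \<phi> f \<in> I"
  using assms unfolding TL_ideal_def
  by (auto intro: lp.subspace_0 lp.subspace_add lp.subspace_diff lp.subspace_neg lp.subspace_scale)
    blast

lemma TL_ideal_endo: "TL_ideal I \<Longrightarrow> f \<in> I \<Longrightarrow> lp_endo s f \<in> I"
  for I :: "('a::field_char_0, 'n::finite) lpoly set"
  by (rule TL_idealD(9)[OF _ _ L_endomorphism_lp_endo])

lemma TL_ideal_act: "TL_ideal I \<Longrightarrow> f \<in> I \<Longrightarrow> lp_act u f \<in> I"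
  for I :: "('a::field_char_0, 'n::finite) lpoly set"
  by (induction u arbitrary: f rule: uea_induct)
    (simp_all add: lp_rep.ue_rep_simps TL_idealD ue_E_def)

lemma TL_ideal_generated: "TL_ideal (TL_ideal_generated G)"
proof -
  have "TL_ideal (\<Inter> {I. TL_ideal I \<and> G \<subseteq> I})"
    unfolding TL_ideal_def[of "\<Inter> _"]
    by (auto simp: lp.subspace_def TL_idealD)
  then show ?thesis by (simp add: TL_ideal_generated_def)
qed

lemma TL_ideal_generated_base: "g \<in> G \<Longrightarrow> g \<in> TL_ideal_generated G"
  by (auto simp: TL_ideal_generated_def)

lemma TL_ideal_generated_least: "TL_ideal I \<Longrightarrow> G \<subseteq> I \<Longrightarrow> TL_ideal_generated G \<subseteq> I"
  by (auto simp: TL_ideal_generated_def)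

text \<open>
  Substituting \<open>x\<^sub>i\<^sup>b\<close> for the variable and then acting by \<open>a\<close> turns \<open>x\<^sup>z\<close> into \<open>x\<^sub>i\<close> with exponent \<open>a z b\<close>.
\<close>

lemma TL_ideal_exponents:
  fixes I :: "('a::field_char_0, 'n::finite) lpoly set"
  assumes I: "TL_ideal I" and x: "lp_var x z \<in> I" and u: "u \<in> two_sided_ideal {z}"
  shows "lp_var i u \<in> I"
  using u
proof induction
  case zero
  have "lp_var i 0 = (0 :: ('a, 'n) lpoly)" using lp_var_add[of i 0 0] by simp
  then show ?case using TL_idealD(1)[OF I] by simp
next
  case (gen g a b)
  have "lp_act a (lp_endo (\<lambda>_. lp_var i b) (lp_var x z)) \<in> I"
    by (intro TL_ideal_act TL_ideal_endo I x)
  then show ?case using gen by (simp add: lp_endo_simps lp_act_var mult.assoc)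
next
  case (add u v)
  then show ?case by (simp add: lp_var_add TL_idealD[OF I])
qed

lemma lp_subst_more:
  "lp_subst b 0 = 0" "lp_subst b (f - g) = lp_subst b f - lp_subst b g"
proof -
  show "lp_subst b 0 = 0" using lp_subst_simps(3)[of b 0 0] by simp
  show "lp_subst b (f - g) = lp_subst b f - lp_subst b g"
    using lp_subst_simps(1)[of b "f - g" g] by (simp add: algebra_simps)
qed

lemma lp_subst_deriv: "lp_subst b (lp_deriv D f) = der_apply D (lp_subst b f)"
  for f :: "('a::field_char_0, 'n::finite) lpoly"
  by (induction f rule: lpoly_induct)
    (simp_all add: lp_deriv_add lp_deriv_scale lp_deriv_mult lp_deriv_var lp_subst_simps
      der_apply_simps mat_rep.ue_rep_simps)

lemma lp_subst_act: "lp_subst b (lp_act u f) = mat_act u (lp_subst b f)"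
  for f :: "('a::field_char_0, 'n::finite) lpoly"
  by (induction u arbitrary: f rule: uea_induct)
    (simp_all add: lp_rep.ue_rep_simps mat_rep.ue_rep_simps lp_subst_simps lp_subst_deriv ue_E_def)

lemma lp_subst_endomorphism:
  fixes h :: "('a::field_char_0, 'n::finite) lpoly \<Rightarrow> ('a, 'n) lpoly"
  assumes h: "L_endomorphism h"
  shows "lp_subst b (h f) = lp_subst (\<lambda>i. lp_subst b (h (lp_var i 1))) f"
proof -
  have lin: "h (f + g) = h f + h g" "h (lp_scale c f) = lp_scale c (h f)" "h (f * g) = h f * h g"
    "h (lp_act u f) = lp_act u (h f)" for f g c u
    using h by (auto simp: L_endomorphism_def Vector_Spaces.linear_def module_hom_def module_hom_axioms_def)
  show ?thesis
  proof (induction f rule: lpoly_induct)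
    case (var i u c)
    have "h (lp_var i u) = lp_act u (h (lp_var i 1))"
      using lin(4)[of u "lp_var i 1"] by (simp add: lp_act_var)
    then show ?case by (simp add: lin lp_subst_simps lp_subst_act)
  qed (simp_all add: lin lp_subst_simps)
qed

lemma TL_ideal_Id_L: "TL_ideal (Id_L :: ('a::field_char_0, 'n::finite) lpoly set)"
proof -
  have zero: "der_apply D 0 = (0 :: 'a^'n^'n)" for D
    using der_apply_simps(4)[of D 0 0] by simp
  have "h ` Id_L \<subseteq> (Id_L :: ('a, 'n) lpoly set)" if "L_endomorphism h" for h
  proof (rule image_subsetI)
    fix f :: "('a, 'n) lpoly" assume f: "f \<in> Id_L"
    have "lp_subst b (h f) = 0" for b
      using f by (subst lp_subst_endomorphism[OF that]) (simp add: Id_L_def)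
    then show "h f \<in> Id_L" by (simp add: Id_L_def)
  qed
  then show ?thesis
    by (auto simp: TL_ideal_def Id_L_def lp.subspace_def lp_subst_simps lp_subst_more
        lp_subst_deriv zero mat_mult_bilinear)
qed

lemma TL_ideal_cong_mult:
  fixes I :: "('a::field_char_0, 'n::finite) lpoly set"
  assumes I: "TL_ideal I" and "f - f' \<in> I" "g - g' \<in> I"
  shows "f * g - f' * g' \<in> I"
proof -
  have "(f - f') * g + f' * (g - g') \<in> I" using assms by (intro TL_idealD(2,6,7)[OF I])
  then show ?thesis by (simp add: algebra_simps)
qed

section \<open>Algebras satisfying the two identities\<close>

text \<open>
  Linear functionals that vanish on the identity matrix, that is, functionals on \<open>sl\<^sub>k(F)\<close>.
\<close>

definition is_functional :: "('a::field^'n^'n \<Rightarrow> 'a) \<Rightarrow> bool" where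
  "is_functional l \<longleftrightarrow> (\<forall>A B. l (A + B) = l A + l B) \<and> (\<forall>c A. l (mat_scale c A) = c * l A)
     \<and> l (mat 1) = 0"

text \<open>
  An algebra \<open>R\<close> with an action of \<open>L\<close> that satisfies both identities; \<open>p, q, t\<close> are the indices 1, 2, 3, where for
  \<open>k = 2\<close> there is no third index and \<open>t\<close> is unconstrained. \<open>dense\<close> and \<open>center\<close> say that the elementary maps with their factors
  in \<open>sl\<^sub>k\<close>, or with both equal to the identity, come from \<open>U(L)\<close>. The preimages are quantified over: by
  \<open>kernel\<close> all preimages of an endomorphism act on \<open>R\<close> in the same way.
\<close>

locale matrix_identities = sl_module scale act
  for scale :: "'a::field_char_0 \<Rightarrow> 'r::ring \<Rightarrow> 'r"
    and act :: "('a, 'n::finite) der \<Rightarrow> 'r \<Rightarrow> 'r" +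
  fixes p q t :: 'n
  assumes scale_mult_left: "scale c r * s = scale c (r * s)"
    and scale_mult_right: "r * scale c s = scale c (r * s)"
    and act_mult: "act D (r * s) = act D r * s + r * act D s"
    and pq: "p \<noteq> q" and pqt: "CARD('n) \<ge> 3 \<Longrightarrow> t \<noteq> p \<and> t \<noteq> q"
    and kernel: "(\<And>A. mat_act u A = 0) \<Longrightarrow> ue_rep scale act u r = 0"
    and dense: "is_functional (l :: 'a^'n^'n \<Rightarrow> 'a) \<Longrightarrow> \<exists>u. \<forall>A. mat_act u A = mat_scale (l A) (traceless_part m)"
    and center: "\<exists>u. \<forall>A. mat_act u A = mat_scale (trace A / of_nat CARD('n)) (mat 1 :: 'a^'n^'n)"
    and quadratic: "\<And>\<gamma> \<alpha> \<beta>' \<beta> r s.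
      (\<And>A. mat_act \<gamma> A = mat_scale (trace A / of_nat CARD('n)) (mat 1)) \<Longrightarrow>
      (\<And>A. mat_act \<alpha> A = mat_scale (A $ p $ q) (munit p q)) \<Longrightarrow>
      (\<And>A. mat_act \<beta>' A = mat_scale (A $ p $ q)
        (munit q p + (if CARD('n) \<ge> 3 then munit t p else 0))) \<Longrightarrow>
      (\<And>A. mat_act \<beta> A = mat_scale (A $ p $ q) (munit q p)) \<Longrightarrow>
      commutator (ue_rep scale act \<gamma> r) (ue_rep scale act \<gamma> s + ue_rep scale act \<alpha> s)
        + ue_rep scale act \<alpha> r * ue_rep scale act \<beta>' s
        - ue_rep scale act \<alpha> s * ue_rep scale act \<beta> r = 0"
begin

abbreviation U :: "('a, 'n) uea \<Rightarrow> 'r \<Rightarrow> 'r" where "U \<equiv> ue_rep scale act"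

lemma U_eqI: "(\<And>A. mat_act u A = mat_act v A) \<Longrightarrow> U u r = U v r"
  using kernel[of "u - v" r] by (simp add: ue_rep_more mat_module.ue_rep_more)

lemma U_combination:
  assumes "\<And>A. mat_act u A = mat_act v A + mat_act w A"
  shows "U u r = U v r + U w r"
  using U_eqI[of u "v + w" r] assms by (simp add: ue_rep_simps mat_rep.ue_rep_simps)

text \<open>
  The image of \<open>r\<close> under the rank-one endomorphism \<open>A \<mapsto> l(A) m\<close> of \<open>sl\<^sub>k\<close>. For fixed \<open>r\<close> and \<open>l\<close> this is
  an equivariant function of \<open>m\<close>; in the matrix algebra itself it is \<open>l(r) m\<close>.
\<close>

definition coef :: "('a^'n^'n \<Rightarrow> 'a) \<Rightarrow> 'r \<Rightarrow> 'a^'n^'n \<Rightarrow> 'r" where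
  "coef l r m = U (SOME u. \<forall>A. mat_act u A = mat_scale (l A) (traceless_part m)) r"

definition inv_part :: "'r \<Rightarrow> 'r" where
  "inv_part r = U (SOME u. \<forall>A. mat_act u A = mat_scale (trace A / of_nat CARD('n)) (mat 1)) r"

lemma coef_eq:
  assumes "\<And>A. mat_act u A = mat_scale (l A) (traceless_part m)"
  shows "coef l r m = U u r"
proof -
  have "\<forall>A. mat_act (SOME u. \<forall>A. mat_act u A = mat_scale (l A) (traceless_part m)) A =
      mat_scale (l A) (traceless_part m)"
    by (rule someI[of "\<lambda>u. \<forall>A. mat_act u A = mat_scale (l A) (traceless_part m)" u]) (use assms in simp)
  then show ?thesis unfolding coef_def by (intro U_eqI) (simp add: assms)
qed

lemma inv_part_eq:
  assumes "\<And>A. mat_act u A = mat_scale (trace A / of_nat CARD('n)) (mat 1)"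
  shows "inv_part r = U u r"
proof -
  have "\<forall>A. mat_act (SOME u. \<forall>A. mat_act u A = mat_scale (trace A / of_nat CARD('n)) (mat 1)) A =
      mat_scale (trace A / of_nat CARD('n)) (mat 1 :: 'a^'n^'n)"
    by (rule someI_ex[OF center])
  then show ?thesis unfolding inv_part_def by (intro U_eqI) (simp add: assms)
qed

lemma traceless_part_linear:
  "traceless_part (A + B) = traceless_part A + traceless_part B"
  "traceless_part (mat_scale c A) = mat_scale c (traceless_part A)"
  "traceless_part (mat 1 :: 'a^'n^'n) = 0"
  "traceless_part (der_apply D A) = der_apply D A"
  "der_apply D (traceless_part A) = der_apply D A"
  for A B :: "'a^'n^'n"
  by (simp_all add: traceless_part_def trace_simps mat.scale_right_diff_distrib mat.scale_left_distrib
      add_divide_distrib trace_der_apply der_apply_simps)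

lemma traceless_part_id: "trace A = 0 \<Longrightarrow> traceless_part A = A" for A :: "'a^'n^'n"
  by (simp add: traceless_part_def)

lemma coef_equivariant:
  assumes l: "is_functional l"
  shows "equivariant (coef l r)"
  unfolding equivariant_def
proof (intro conjI allI)
  fix A B c D
  obtain u where u: "\<And>X. mat_act u X = mat_scale (l X) (traceless_part A)" using dense[OF l] by blast
  obtain v where v: "\<And>X. mat_act v X = mat_scale (l X) (traceless_part B)" using dense[OF l] by blast
  show "coef l r (A + B) = coef l r A + coef l r B"
    unfolding coef_eq[OF u] coef_eq[OF v] ue_rep_simps(1)[symmetric]
    by (rule coef_eq) (simp add: mat_rep.ue_rep_simps u v traceless_part_linear mat.scale_right_distrib)
  show "coef l r (mat_scale c A) = scale c (coef l r A)"
    unfolding coef_eq[OF u] ue_rep_simps(2)[symmetric]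
    by (rule coef_eq) (simp add: mat_rep.ue_rep_simps u traceless_part_linear mult.commute)
  have "coef l r (der_apply D A) = U (ue_of D * u) r"
    by (rule coef_eq) (simp add: mat_rep.ue_rep_simps u traceless_part_linear der_apply_simps)
  then show "act D (coef l r A) = coef l r (der_apply D A)"
    by (simp add: coef_eq[OF u] ue_rep_simps)
qed

lemma coef_linear:
  assumes l: "is_functional l" and l': "is_functional l'"
  shows "coef (\<lambda>A. l A + l' A) r m = coef l r m + coef l' r m"
    and "coef (\<lambda>A. l A - l' A) r m = coef l r m - coef l' r m"
    and "coef (\<lambda>A. c * l A) r m = scale c (coef l r m)"
    and "coef l (scale c r) m = scale c (coef l r m)"
    and "coef l 0 m = 0"
    and "coef (\<lambda>_. 0) r m = 0"
proof -
  obtain u where u: "\<And>X. mat_act u X = mat_scale (l X) (traceless_part m)" using dense[OF l] by blast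
  obtain v where v: "\<And>X. mat_act v X = mat_scale (l' X) (traceless_part m)" using dense[OF l'] by blast
  note simps = mat_rep.ue_rep_simps mat_module.ue_rep_more u v
  show "coef (\<lambda>A. l A + l' A) r m = coef l r m + coef l' r m"
    unfolding coef_eq[OF u] coef_eq[OF v] ue_rep_simps(1)[symmetric]
    by (rule coef_eq) (simp add: simps mat.scale_left_distrib)
  show "coef (\<lambda>A. l A - l' A) r m = coef l r m - coef l' r m"
    unfolding coef_eq[OF u] coef_eq[OF v] ue_rep_more(1)[symmetric]
    by (rule coef_eq) (simp add: simps mat.scale_left_diff_distrib)
  show "coef (\<lambda>A. c * l A) r m = scale c (coef l r m)"
    unfolding coef_eq[OF u] ue_rep_simps(2)[symmetric]
    by (rule coef_eq) (simp add: simps)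
  show "coef l (scale c r) m = scale c (coef l r m)" "coef l 0 m = 0"
    by (simp_all add: coef_eq[OF u] ue_rep_simps ue_rep_more)
  have "coef (\<lambda>_. 0) r m = U 0 r" by (rule coef_eq) (simp add: simps)
  then show "coef (\<lambda>_. 0) r m = 0" by (simp add: ue_rep_more)
qed

lemma coef_act:
  assumes l: "is_functional l"
  shows "coef l (act D r) m = coef (\<lambda>A. l (der_apply D A)) r m"
proof -
  obtain u where u: "\<And>X. mat_act u X = mat_scale (l X) (traceless_part m)" using dense[OF l] by blast
  have "coef (\<lambda>A. l (der_apply D A)) r m = U (u * ue_of D) r"
    by (rule coef_eq) (simp add: mat_rep.ue_rep_simps u)
  then show ?thesis by (simp add: coef_eq[OF u] ue_rep_simps)
qed

lemma coef_traceless_part: "coef l r (traceless_part m) = coef l r m"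
  by (simp add: coef_def traceless_part_id)

lemma coef_mat_one: "is_functional l \<Longrightarrow> coef l r (mat 1) = 0"
  using coef_traceless_part[of l r "mat 1"] equivariantD(4)[OF coef_equivariant, of l r]
  by (simp add: traceless_part_linear)

abbreviation entry :: "'n \<Rightarrow> 'n \<Rightarrow> 'a^'n^'n \<Rightarrow> 'a"
  where "entry i j A \<equiv> traceless_part A $ i $ j"

lemma entry_functional: "is_functional (entry i j)"
  by (simp add: is_functional_def traceless_part_linear)

text \<open>
  The identity map of \<open>M\<^sub>k(F)\<close> is a sum of rank-one maps. So each element of \<open>R\<close> is an invariant plus values of
  equivariant maps, and relations only have to be proved for those.
\<close>

lemma expansion: "r = inv_part r + (\<Sum>i\<in>UNIV. \<Sum>j\<in>UNIV. coef (entry i j) r (munit i j))"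
proof -
  obtain \<gamma> :: "('a, 'n) uea" where \<gamma>: "\<And>A. mat_act \<gamma> A = mat_scale (trace A / of_nat CARD('n)) (mat 1 :: 'a^'n^'n)"
    using center by blast
  have "\<forall>i j. \<exists>u. \<forall>A. mat_act u A = mat_scale (entry i j A) (traceless_part (munit i j))"
    using dense[OF entry_functional] by blast
  then obtain u where u: "\<And>i j A. mat_act (u i j) A = mat_scale (entry i j A) (traceless_part (munit i j))"
    by metis
  have sum_tp: "traceless_part (\<Sum>x\<in>S. f x) = (\<Sum>x\<in>S. traceless_part (f x))" for f :: "'n \<Rightarrow> 'a^'n^'n" and S
    by (induction S rule: infinite_finite_induct)
      (simp_all add: traceless_part_linear traceless_part_id trace_def)
  have "mat_act (\<Sum>i\<in>UNIV. \<Sum>j\<in>UNIV. u i j) A = traceless_part A" for A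
  proof -
    have "mat_act (\<Sum>i\<in>UNIV. \<Sum>j\<in>UNIV. u i j) A =
        traceless_part (\<Sum>i\<in>UNIV. \<Sum>j\<in>UNIV. mat_scale (entry i j A) (munit i j))"
      by (simp add: mat_module.ue_rep_more u sum_tp traceless_part_linear)
    then show ?thesis
      by (simp add: matrix_expansion[symmetric] traceless_part_id)
  qed
  then have "U 1 r = U \<gamma> r + U (\<Sum>i\<in>UNIV. \<Sum>j\<in>UNIV. u i j) r"
    by (intro U_combination) (simp add: \<gamma> mat_rep.ue_rep_simps traceless_part_def)
  then show ?thesis
    by (simp add: inv_part_eq[OF \<gamma>] coef_eq[OF u] ue_rep_simps ue_rep_more)
qed

definition invariant :: "'r \<Rightarrow> bool" where "invariant r \<longleftrightarrow> (\<forall>D. act D r = 0)"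

lemma invariant_inv_part: "invariant (inv_part r)"
proof -
  obtain \<gamma> :: "('a, 'n) uea" where \<gamma>: "\<And>A. mat_act \<gamma> A = mat_scale (trace A / of_nat CARD('n)) (mat 1 :: 'a^'n^'n)"
    using center by blast
  have "U (ue_of D * \<gamma>) r = 0" for D
    by (rule kernel) (simp add: mat_rep.ue_rep_simps \<gamma> der_apply_simps)
  then show ?thesis by (simp add: invariant_def inv_part_eq[OF \<gamma>] ue_rep_simps)
qed

lemma inv_part_act: "inv_part (act D r) = 0"
proof -
  obtain \<gamma> :: "('a, 'n) uea" where \<gamma>: "\<And>A. mat_act \<gamma> A = mat_scale (trace A / of_nat CARD('n)) (mat 1 :: 'a^'n^'n)"
    using center by blast
  have "U (\<gamma> * ue_of D) r = 0"
    by (rule kernel) (simp add: mat_rep.ue_rep_simps \<gamma> trace_der_apply)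
  then show ?thesis by (simp add: inv_part_eq[OF \<gamma>] ue_rep_simps)
qed

lemma scalar_map_equivariant:
  "invariant \<kappa> \<Longrightarrow> equivariant (\<lambda>A. scale (trace A) \<kappa>)"
  by (simp add: equivariant_def trace_simps scale_left_distrib act_scale_right invariant_def
      trace_der_apply)

lemma U_invariant:
  assumes "invariant \<kappa>" "mat_act u (mat 1) = mat_scale c (mat 1)"
  shows "U u \<kappa> = scale c \<kappa>"
proof -
  have "U u (scale (of_nat CARD('n)) \<kappa>) = scale (of_nat CARD('n) * c) \<kappa>"
    using equivariant_ue_rep[OF scalar_map_equivariant[OF assms(1)], of u "mat 1"] assms(2)
    by (simp add: trace_simps mult.commute)
  then have "scale (of_nat CARD('n)) (U u \<kappa>) = scale (of_nat CARD('n)) (scale c \<kappa>)"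
    by (simp add: ue_rep_simps)
  then show ?thesis by (subst (asm) scale_cancel_left) auto
qed

lemma equivariant_combine:
  assumes "equivariant \<xi>" "equivariant \<eta>"
  shows "equivariant (\<lambda>A. \<xi> A + \<eta> A)" "equivariant (\<lambda>A. scale c (\<xi> A))"
    "invariant \<kappa> \<Longrightarrow> equivariant (\<lambda>A. \<xi> A * \<kappa>)" "invariant \<kappa> \<Longrightarrow> equivariant (\<lambda>A. \<kappa> * \<xi> A)"
  by (simp_all add: equivariant_def equivariantD[OF assms(1)] equivariantD[OF assms(2)] act_add_right
      scale_right_distrib act_scale_right act_mult invariant_def scale_mult_left scale_mult_right
      distrib_left distrib_right algebra_simps)

text \<open>
  Exponents as in the quadratic identity; \<open>dense\<close> and \<open>center\<close> provide them.
\<close>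

lemma relation_elements:
  obtains \<gamma> \<alpha> \<beta>' \<beta> :: "('a, 'n) uea" where
    "\<And>A. mat_act \<gamma> A = mat_scale (trace A / of_nat CARD('n)) (mat 1)"
    "\<And>A. mat_act \<alpha> A = mat_scale (A $ p $ q) (munit p q)"
    "\<And>A. mat_act \<beta>' A = mat_scale (A $ p $ q) (munit q p + (if CARD('n) \<ge> 3 then munit t p else 0))"
    "\<And>A. mat_act \<beta> A = mat_scale (A $ p $ q) (munit q p)"
proof -
  have l: "is_functional (\<lambda>A. A $ p $ q)" using pq by (simp add: is_functional_def mat_def)
  have tr: "traceless_part X = X" if "trace X = 0" for X :: "'a^'n^'n"
    using that by (rule traceless_part_id)
  have t: "trace (munit q p + (if CARD('n) \<ge> 3 then munit t p else 0) :: 'a^'n^'n) = 0"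
    using pq pqt by (auto simp: trace_simps trace_munit trace_def[of 0])
  have trace_off: "trace (munit p q :: 'a^'n^'n) = 0" "trace (munit q p :: 'a^'n^'n) = 0"
    using pq by (simp_all add: trace_munit)
  have ex: "\<exists>u. \<forall>A. mat_act u A = mat_scale (A $ p $ q) X" if "trace X = 0" for X :: "'a^'n^'n"
    using dense[OF l, of X] by (simp add: tr[OF that])
  obtain \<gamma> :: "('a, 'n) uea" where \<gamma>: "\<And>A. mat_act \<gamma> A = mat_scale (trace A / of_nat CARD('n)) (mat 1 :: 'a^'n^'n)"
    using center by blast
  obtain \<alpha> :: "('a, 'n) uea" where \<alpha>: "\<And>A. mat_act \<alpha> A = mat_scale (A $ p $ q) (munit p q)"
    using ex[OF trace_off(1)] by blast
  obtain \<beta> :: "('a, 'n) uea" where \<beta>: "\<And>A. mat_act \<beta> A = mat_scale (A $ p $ q) (munit q p)"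
    using ex[OF trace_off(2)] by blast
  obtain \<beta>' :: "('a, 'n) uea" where \<beta>': "\<And>A. mat_act \<beta>' A =
      mat_scale (A $ p $ q) (munit q p + (if CARD('n) \<ge> 3 then munit t p else 0))"
    using ex[OF t] by blast
  show ?thesis by (rule that[OF \<gamma> \<alpha> \<beta>' \<beta>])
qed

text \<open>
  For an invariant \<open>r\<close> the terms of the quadratic identity outside the commutator vanish, since \<open>e\<^sub>p\<^sub>q\<close>-exponents
  kill \<open>r\<close>. What remains says that \<open>r\<close> commutes with invariants and with the values of equivariant maps at \<open>e\<^sub>p\<^sub>q\<close>,
  and the latter spread over all traceless matrices.
\<close>

lemma invariant_central:
  assumes \<kappa>: "invariant \<kappa>"
  shows "\<kappa> * s = s * \<kappa>"
proof -
  obtain \<gamma> \<alpha> \<beta>' \<beta> :: "('a, 'n) uea" where el: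
    "\<And>A. mat_act \<gamma> A = mat_scale (trace A / of_nat CARD('n)) (mat 1)"
    "\<And>A. mat_act \<alpha> A = mat_scale (A $ p $ q) (munit p q)"
    "\<And>A. mat_act \<beta>' A = mat_scale (A $ p $ q) (munit q p + (if CARD('n) \<ge> 3 then munit t p else 0))"
    "\<And>A. mat_act \<beta> A = mat_scale (A $ p $ q) (munit q p)"
    by (rule relation_elements) (rule that)
  have inv: "U \<gamma> \<kappa> = \<kappa>" "U \<alpha> \<kappa> = 0" "U \<beta> \<kappa> = 0" if "invariant \<kappa>" for \<kappa>
    using U_invariant[OF that, of \<gamma> 1] U_invariant[OF that, of \<alpha> 0] U_invariant[OF that, of \<beta> 0] pq
    by (simp_all add: el trace_simps) (simp_all add: mat_def)
  have comm: "\<kappa> * (U \<gamma> s + U \<alpha> s) = (U \<gamma> s + U \<alpha> s) * \<kappa>" for s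
    using quadratic[OF el, of \<kappa> s] by (simp add: inv[OF \<kappa>] commutator_def)
  have c1: "\<kappa> * inv_part s = inv_part s * \<kappa>" for s
    using comm[of "inv_part s"] by (simp add: inv[OF invariant_inv_part])
  have c2: "\<kappa> * U \<alpha> s = U \<alpha> s * \<kappa>" for s
    using comm[of s] c1[of s] by (simp add: inv_part_eq[OF el(1)] distrib_left distrib_right)
  have c3: "\<kappa> * \<xi> A = \<xi> A * \<kappa>" if \<xi>: "equivariant \<xi>" and "trace A = 0" for \<xi> A
  proof (rule equivariant_eq_on_traceless[of "\<lambda>A. \<kappa> * \<xi> A" "\<lambda>A. \<xi> A * \<kappa>", OF _ _ _ pq that(2)])
    show "\<kappa> * \<xi> (munit p q) = \<xi> (munit p q) * \<kappa>"
      using c2[of "\<xi> (munit p q)"] by (simp add: equivariant_ue_rep[OF \<xi>] el(2) munit_nth)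
  qed (rule equivariant_combine[OF \<xi> \<xi>] \<kappa>)+
  have c4: "\<kappa> * coef (entry i j) s (munit i j) = coef (entry i j) s (munit i j) * \<kappa>" for i j
    using c3[OF coef_equivariant[OF entry_functional], of "traceless_part (munit i j)" i j s]
    by (simp add: coef_traceless_part)
  show ?thesis
    by (subst (1 2) expansion[of s])
      (simp add: distrib_left distrib_right sum_distrib_left sum_distrib_right c1 c4)
qed

lemma entry_diag_bracket:
  "entry r s (der_apply (ad (munit a a)) A) = ((if r = a then 1 else 0) - (if s = a then 1 else 0)) * entry r s A"
proof -
  have "entry r s A = A $ r $ s" if "r \<noteq> s"
    using that by (simp add: traceless_part_def mat_def)
  moreover have "entry r s (der_apply (ad (munit a a)) A) = der_apply (ad (munit a a)) A $ r $ s"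
    by (simp only: traceless_part_linear)
  ultimately show ?thesis
    by (cases "r = s") (auto simp: ad.rep_eq munit_mult_nth)
qed

text \<open>
  A rank-one map with functional of weight \<open>\<epsilon>\<^sub>i - \<epsilon>\<^sub>j\<close> kills vectors of any other weight.
\<close>

lemma coef_weight:
  assumes r: "\<And>a. act (ad (munit a a)) r = scale (w a) r"
    and neq: "\<exists>a. (if i = a then 1 else 0) - (if j = a then 1 else 0) \<noteq> w a"
  shows "coef (entry i j) r m = 0"
proof -
  obtain a where a: "(if i = a then 1 else 0) - (if j = a then 1 else 0) \<noteq> w a" using neq by blast
  have "scale (w a) (coef (entry i j) r m) = coef (entry i j) (act (ad (munit a a)) r) m"
    by (simp add: r coef_linear[OF entry_functional entry_functional])
  also have "\<dots> = scale ((if i = a then 1 else 0) - (if j = a then 1 else 0)) (coef (entry i j) r m)"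
    by (simp only: coef_act[OF entry_functional] entry_diag_bracket
        coef_linear(3)[OF entry_functional entry_functional])
  finally show ?thesis using a by (simp only: scale_cancel_right) auto
qed

text \<open>
  In the expansion of a vector whose weight is a root only one term survives.
\<close>

lemma root_vector:
  assumes r: "\<And>a. act (ad (munit a a)) r = scale ((if a = i then 1 else 0) - (if a = j then 1 else 0)) r"
    and ij: "i \<noteq> j"
  shows "r = coef (entry i j) r (munit i j)"
proof -
  have "inv_part r = 0"
    using inv_part_act[of "ad (munit i i)" r] ij by (simp add: r)
  moreover have "coef (entry k l) r m = 0" if "(k, l) \<noteq> (i, j)" for k l m
  proof (rule coef_weight[OF r])
    show "\<exists>a. (if k = a then 1 else 0) - (if l = a then 1 else 0) \<noteq>
        ((if a = i then 1 else 0) - (if a = j then 1 else 0) :: 'a)"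
    proof (cases "k = i")
      case True
      then show ?thesis using that ij by (intro exI[of _ j]) auto
    next
      case False
      then show ?thesis using ij by (intro exI[of _ i]) auto
    qed
  qed
  then have "(\<Sum>k\<in>UNIV. \<Sum>l\<in>UNIV. coef (entry k l) r (munit k l)) =
      (\<Sum>k\<in>UNIV. \<Sum>l\<in>UNIV. if l = j then (if k = i then coef (entry i j) r (munit i j) else 0) else 0)"
    by (intro sum.cong) auto
  ultimately show ?thesis using expansion[of r] by simp
qed

text \<open>
  In the expansion of a vector of weight zero the diagonal coefficients survive. Being annihilated by the root
  vectors off row and column \<open>p\<close> makes the ones at \<open>i \<noteq> p\<close> equal to a single map \<open>\<tau>\<close>, and their sum is zero
  because traceless matrices have traceless diagonals; so \<open>c\<close> is an invariant plus a multiple of \<open>\<tau> e\<^sub>p\<^sub>p\<close>.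
\<close>

lemma diagonal_vector:
  assumes diag: "\<And>a. act (ad (munit a a)) c = 0"
    and off: "\<And>i j. i \<noteq> j \<Longrightarrow> i \<noteq> p \<Longrightarrow> j \<noteq> p \<Longrightarrow> act (ad (munit i j)) c = 0"
  obtains \<zeta> where "equivariant \<zeta>" "\<zeta> (munit p p) = c"
proof -
  let ?F = "\<lambda>i j. coef (entry i j) c"
  define \<tau> where "\<tau> = ?F q q"
  have \<tau>: "equivariant \<tau>" unfolding \<tau>_def by (rule coef_equivariant[OF entry_functional])
  have F0: "?F i j m = 0" if "i \<noteq> j" for i j m
    by (rule coef_weight[where w = "\<lambda>_. 0"]) (use diag that in \<open>auto intro: exI[of _ i]\<close>)
  have eq: "?F i i m = \<tau> m" if "i \<noteq> p" for i m
  proof (cases "i = q")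
    case False
    have "entry i q (der_apply (ad (munit i q)) A) = entry q q A - entry i i A" for A
      unfolding traceless_part_linear(4)
      by (simp add: ad.rep_eq munit_mult_nth traceless_part_def mat_def)
    then have "?F q q m - ?F i i m = coef (entry i q) (act (ad (munit i q)) c) m"
      by (simp only: coef_act[OF entry_functional] coef_linear(2)[OF entry_functional entry_functional])
    also have "\<dots> = 0"
      using off[of i q] False that pq by (simp add: coef_linear(5)[OF entry_functional entry_functional])
    finally show ?thesis by (simp add: \<tau>_def)
  qed (simp add: \<tau>_def)
  have sum_coef: "coef (\<lambda>A. \<Sum>i\<in>S. entry i i A) c m = (\<Sum>i\<in>S. ?F i i m)" if "finite S" for S m
    using that
  proof induction
    case (insert i S)
    have "is_functional (\<lambda>A. \<Sum>i\<in>S. entry i i A)"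
      by (simp add: is_functional_def traceless_part_linear sum.distrib sum_distrib_left)
    then show ?case using insert coef_linear(1)[OF entry_functional, of _ i i c m] by simp
  qed (simp add: coef_linear(6)[OF entry_functional entry_functional])
  have "(\<Sum>i\<in>UNIV. ?F i i m) = 0" for m
  proof -
    have "(\<Sum>i\<in>UNIV. entry i i A) = 0" for A
      using trace_traceless_part[of A] by (simp add: trace_def)
    then show ?thesis
      using sum_coef[of UNIV m] by (simp add: coef_linear(6)[OF entry_functional entry_functional])
  qed
  then have Fp: "?F p p m = scale (- (of_nat CARD('n) - 1)) (\<tau> m)" for m
  proof -
    have "0 = ?F p p m + (\<Sum>i\<in>UNIV - {p}. ?F i i m)"
      using \<open>(\<Sum>i\<in>UNIV. ?F i i m) = 0\<close> by (simp add: sum.remove[of UNIV p])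
    also have "(\<Sum>i\<in>UNIV - {p}. ?F i i m) = (\<Sum>i\<in>UNIV - {p}. \<tau> m)"
      by (intro sum.cong) (auto simp: eq)
    also have "\<dots> = scale (of_nat CARD('n) - 1) (\<tau> m)"
      by (simp add: sum_constant_scale card_Diff_singleton of_nat_diff Suc_leI)
    finally have "?F p p m = - scale (of_nat CARD('n) - 1) (\<tau> m)"
      by (metis eq_neg_iff_add_eq_0)
    then show ?thesis by (simp only: scale_minus_left)
  qed
  have "(\<Sum>i\<in>UNIV. \<Sum>j\<in>UNIV. ?F i j (munit i j)) = (\<Sum>i\<in>UNIV. \<Sum>j\<in>UNIV. if j = i then ?F i i (munit i i) else 0)"
    by (intro sum.cong) (auto simp: F0)
  also have "\<dots> = ?F p p (munit p p) + (\<Sum>i\<in>UNIV - {p}. ?F i i (munit i i))"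
    by (simp add: sum.remove[of UNIV p])
  also have "(\<Sum>i\<in>UNIV - {p}. ?F i i (munit i i)) = (\<Sum>i\<in>UNIV - {p}. \<tau> (munit i i))"
    by (intro sum.cong) (auto simp: eq)
  also have "\<dots> = \<tau> (mat 1) - \<tau> (munit p p)"
    by (simp add: mat_one_expansion equivariantD[OF \<tau>] sum.remove[of UNIV p])
  also have "\<tau> (mat 1) = 0" unfolding \<tau>_def by (rule coef_mat_one[OF entry_functional])
  finally have "c = inv_part c + scale (- of_nat CARD('n)) (\<tau> (munit p p))"
    using expansion[of c] by (simp add: Fp scale_left_diff_distrib scale_minus_left)
  moreover have "equivariant (\<lambda>A. scale (trace A) (inv_part c) + scale (- of_nat CARD('n)) (\<tau> A))"
    by (rule equivariant_combine(1)[OF scalar_map_equivariant[OF invariant_inv_part]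
          equivariant_combine(2)[OF \<tau> \<tau>]])
  ultimately show ?thesis using that by (simp add: trace_munit)
qed

lemma ad_munit: "der_apply (ad (munit a b)) (munit c d) =
    (if b = c then munit a d else 0) - (if d = a then munit c b else (0 :: 'a^'n^'n))"
  by (simp add: ad.rep_eq munit_mult)

lemma act_bracket_ad: "act (ad A) (act (ad B) r) = act (ad B) (act (ad A) r) + act (ad (A ** B - B ** A)) r"
  using act_bracket[of "ad A" "ad B" r] by (simp add: der_bracket_ad ad.rep_eq)

lemma act_zero_right [simp]: "act D 0 = 0"
  using act_add_right[of D 0 0] by simp

lemma act_ad_linear:
  "act (ad (A + B)) r = act (ad A) r + act (ad B) r"
  "act (ad (A - B)) r = act (ad A) r - act (ad B) r" "act (ad 0) r = 0"
proof -
  show "act (ad (A + B)) r = act (ad A) r + act (ad B) r" for A B by (simp add: ad_linear act_add_left)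
  from this[of "A - B" B] show "act (ad (A - B)) r = act (ad A) r - act (ad B) r" by simp
  show "act (ad 0) r = 0" using act_scale_left[of 0 "ad 0" r] by (simp add: ad_linear)
qed

lemma act_product:
  assumes "equivariant \<xi>" "equivariant \<eta>"
  shows "act D (\<xi> A * \<eta> B) = \<xi> (der_apply D A) * \<eta> B + \<xi> A * \<eta> (der_apply D B)"
  by (simp add: act_mult equivariantD[OF assms(1)] equivariantD[OF assms(2)])

text \<open>
  Applied to values of equivariant maps, the quadratic identity reads
  \<open>\<xi>(e\<^sub>p\<^sub>q) \<eta>(e\<^sub>q\<^sub>p + e\<^sub>t\<^sub>p) = \<eta>(e\<^sub>p\<^sub>q) \<xi>(e\<^sub>q\<^sub>p)\<close>. Its summands have two different weights, which the derivation
  of \<open>e\<^sub>q\<^sub>q\<close> separates.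
\<close>

lemma basic_relations:
  assumes \<xi>: "equivariant \<xi>" and \<eta>: "equivariant \<eta>"
  shows "\<xi> (munit p q) * \<eta> (munit q p) = \<eta> (munit p q) * \<xi> (munit q p)"
    and "CARD('n) \<ge> 3 \<Longrightarrow> \<xi> (munit p q) * \<eta> (munit t p) = 0"
proof -
  obtain \<gamma> \<alpha> \<beta>' \<beta> :: "('a, 'n) uea" where el:
    "\<And>A. mat_act \<gamma> A = mat_scale (trace A / of_nat CARD('n)) (mat 1)"
    "\<And>A. mat_act \<alpha> A = mat_scale (A $ p $ q) (munit p q)"
    "\<And>A. mat_act \<beta>' A = mat_scale (A $ p $ q) (munit q p + (if CARD('n) \<ge> 3 then munit t p else 0))"
    "\<And>A. mat_act \<beta> A = mat_scale (A $ p $ q) (munit q p)"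
    by (rule relation_elements) (rule that)
  have rel: "\<xi> (munit p q) * \<eta> (munit q p + (if CARD('n) \<ge> 3 then munit t p else 0)) -
      \<eta> (munit p q) * \<xi> (munit q p) = 0"
    using quadratic[OF el, of "\<xi> (munit p q)" "\<eta> (munit p q)"] pq
    by (simp add: equivariant_ue_rep[OF \<xi>] equivariant_ue_rep[OF \<eta>] el munit_nth trace_munit
        equivariantD(4)[OF \<xi>] equivariantD(4)[OF \<eta>] commutator_def)
  show zero: "\<xi> (munit p q) * \<eta> (munit t p) = 0" if card: "CARD('n) \<ge> 3"
  proof -
    have "act (ad (munit q q)) (\<xi> (munit p q) * \<eta> (munit q p + munit t p) - \<eta> (munit p q) * \<xi> (munit q p)) = 0"
      using rel card by simp
    moreover have "act D (r - s) = act D r - act D s" for D r s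
      using act_add_right[of D "r - s" s] by simp
    ultimately show ?thesis
      using pq pqt[OF card] by (auto simp: act_add_right act_product[OF \<xi> \<eta>] act_product[OF \<eta> \<xi>] der_apply_simps
          ad_munit equivariantD(4,6)[OF \<xi>] equivariantD(4,6)[OF \<eta>] equivariantD(1)[OF \<eta>] distrib_left)
  qed
  show "\<xi> (munit p q) * \<eta> (munit q p) = \<eta> (munit p q) * \<xi> (munit q p)"
    using rel zero by (auto simp: equivariantD(1,4)[OF \<eta>] distrib_left split: if_splits)
qed

text \<open>
  The element \<open>c = \<xi>(e\<^sub>p\<^sub>q) \<eta>(e\<^sub>q\<^sub>p)\<close> should be \<open>\<zeta>(e\<^sub>p\<^sub>p)\<close>, so it has to have the stabilizer of \<open>e\<^sub>p\<^sub>p\<close>. The only case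
  not evident from the relations is that of \<open>e\<^sub>q\<^sub>j\<close>: there \<open>r = e\<^sub>q\<^sub>j c\<close> would be a root vector killed by
  \<open>e\<^sub>j\<^sub>q\<close>, but root vectors are values of equivariant maps, and \<open>e\<^sub>q\<^sub>j\<close> is not killed by \<open>ad e\<^sub>j\<^sub>q\<close>;
  so \<open>r = 0\<close>.
\<close>

lemma corner_product:
  assumes \<xi>: "equivariant \<xi>" and \<eta>: "equivariant \<eta>"
  obtains \<zeta> where "equivariant \<zeta>" "\<zeta> (munit p p) = \<xi> (munit p q) * \<eta> (munit q p)"
proof -
  define c where "c = \<xi> (munit p q) * \<eta> (munit q p)"
  note br = act_product[OF \<xi> \<eta>] ad_munit equivariantD(4,6)[OF \<xi>] equivariantD(4,6)[OF \<eta>]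
  have diag: "act (ad (munit a a)) c = 0" for a
    using pq by (auto simp: c_def br)
  have zero: "\<xi> (munit p q) * \<eta> (munit i p) = 0" if "i \<noteq> p" "i \<noteq> q" for i
  proof -
    have "card {p, q, i} \<le> CARD('n)" by (rule card_mono) auto
    then have card: "CARD('n) \<ge> 3" using that pq by auto
    show ?thesis
    proof (cases "i = t")
      case False
      have "act (ad (munit i t)) (\<xi> (munit p q) * \<eta> (munit t p)) = \<xi> (munit p q) * \<eta> (munit i p)"
        using pqt[OF card] that by (auto simp: br)
      then show ?thesis using basic_relations(2)[OF \<xi> \<eta> card] by simp
    qed (use basic_relations(2)[OF \<xi> \<eta> card] in simp)
  qed
  have col: "act (ad (munit i q)) c = 0" if "i \<noteq> p" "i \<noteq> q" for i
    using zero[OF that] that pq by (auto simp: c_def br)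
  have row: "act (ad (munit q j)) c = 0" if j: "j \<noteq> p" "j \<noteq> q" for j
  proof -
    define r where "r = act (ad (munit q j)) c"
    have w: "act (ad (munit a a)) r = scale ((if a = q then 1 else 0) - (if a = j then 1 else 0)) r" for a
    proof -
      have "act (ad (munit a a)) r = act (ad (munit a a ** munit q j - munit q j ** munit a a)) c"
        unfolding r_def act_bracket_ad[of "munit a a"] diag by simp
      moreover have "munit a a ** munit q j - munit q j ** munit a a =
          mat_scale ((if a = q then 1 else 0) - (if a = j then 1 else 0)) (munit q j :: 'a^'n^'n)"
        using j by (auto simp: munit_mult)
      ultimately show ?thesis by (simp only: ad_linear(3) act_scale_left r_def)
    qed
    have low: "act (ad (munit j q)) r = 0"
    proof -
      have "act (ad (munit j q)) r = act (ad (munit q j)) (act (ad (munit j q)) c)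
          + act (ad (munit j j - munit q q)) c"
        unfolding r_def act_bracket_ad[of "munit j q"] by (simp add: munit_mult)
      then show ?thesis by (simp add: col[OF j] act_ad_linear diag)
    qed
    define \<psi> where "\<psi> = coef (entry q j) r"
    have \<psi>: "equivariant \<psi>" unfolding \<psi>_def by (rule coef_equivariant[OF entry_functional])
    have r: "r = \<psi> (munit q j)" unfolding \<psi>_def using j by (intro root_vector[OF w]) auto
    have "\<psi> (munit j j - munit q q) = 0"
      using low j unfolding r by (simp add: equivariantD(3)[OF \<psi>] ad_munit)
    moreover have "der_apply (ad (munit q j)) (munit j j - munit q q) = mat_scale 2 (munit q j :: 'a^'n^'n)"
      using j by (simp add: ad_munit der_apply_simps) (simp add: vec_eq_iff)
    then have "scale 2 (\<psi> (munit q j)) = act (ad (munit q j)) (\<psi> (munit j j - munit q q))"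
      by (simp only: equivariantD(2,3)[OF \<psi>])
    ultimately have "scale 2 (\<psi> (munit q j)) = 0" by simp
    then show ?thesis using r by (simp add: r_def)
  qed
  have "act (ad (munit i j)) c = 0" if "i \<noteq> j" "i \<noteq> p" "j \<noteq> p" for i j
  proof (cases "j = q")
    case True
    then show ?thesis using col that by simp
  next
    case jq: False
    show ?thesis
    proof (cases "i = q")
      case True
      then show ?thesis using row jq that by simp
    next
      case False
      then show ?thesis using jq that by (auto simp: c_def br)
    qed
  qed
  then obtain \<zeta> where "equivariant \<zeta>" "\<zeta> (munit p p) = c"
    using diagonal_vector[OF diag] by metis
  then show ?thesis using that by (simp add: c_def)
qed

text \<open>
  Both sides are equivariant in the pair \<open>(A, B)\<close>. The centralizer of \<open>e\<^sub>p\<^sub>q\<close> spreads the equation from \<open>B = e\<^sub>q\<^sub>p\<close>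
  to all \<open>B\<close>; then all of \<open>L\<close> spreads it from \<open>A = e\<^sub>p\<^sub>q\<close> to all \<open>A\<close>.
\<close>

lemma product_determined:
  assumes \<xi>: "equivariant \<xi>" and \<eta>: "equivariant \<eta>" and \<zeta>: "equivariant \<zeta>"
    and c: "\<zeta> (munit p p) = \<xi> (munit p q) * \<eta> (munit q p)"
    and tr: "trace A = 0" "trace B = 0"
  shows "\<xi> A * \<eta> B = \<zeta> (A ** B)"
proof -
  let ?T = "{B. \<xi> (munit p q) * \<eta> B = \<zeta> (munit p q ** B)}"
  note eD = equivariantD[OF \<xi>] equivariantD[OF \<eta>] equivariantD[OF \<zeta>]
  have T: "mat.subspace ?T"
    by (simp add: mat.subspace_def eD mat_mult_bilinear distrib_left scale_mult_right)
  have step: "der_apply (ad X) B \<in> ?T" if "B \<in> ?T" "X ** munit p q = munit p q ** X" for X B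
  proof -
    have "\<xi> (munit p q) * \<eta> (der_apply (ad X) B) = act (ad X) (\<xi> (munit p q) * \<eta> B)"
      using that(2) by (simp add: act_product[OF \<xi> \<eta>] ad.rep_eq[of X] eD)
    also have "\<dots> = \<zeta> (der_apply (ad X) (munit p q ** B))" using that(1) by (simp add: eD)
    also have "der_apply (ad X) (munit p q ** B) = munit p q ** der_apply (ad X) B"
      using that(2) by (simp add: der_apply_simps(3)) (simp add: ad.rep_eq mat_mult_bilinear)
    finally show ?thesis by simp
  qed
  have br: "(if b = i then munit a j else 0) - (if j = a then munit i b else 0) \<in> ?T"
    if "munit i j \<in> ?T" "b \<noteq> p" "a \<noteq> q" for a b i j
    using step[OF that(1), of "munit a b"] that by (simp add: munit_mult ad_munit)
  note sub = mat.subspace_neg[OF T] mat.subspace_diff[OF T] mat.subspace_add[OF T]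
    mat.subspace_scale[OF T]
  have qp: "munit q p \<in> ?T" using c by (simp add: munit_mult)
  have qj: "munit q j \<in> ?T" if "j \<noteq> q" for j
  proof (cases "j = p")
    case False
    then show ?thesis using sub(1)[OF br[OF qp, of j p]] that pq by (simp split: if_splits)
  qed (use qp in simp)
  have ip: "munit i p \<in> ?T" if "i \<noteq> p" for i
  proof (cases "i = q")
    case False
    then show ?thesis using br[OF qp, of q i] that pq by (simp split: if_splits)
  qed (use qp in simp)
  have h: "munit p p - munit q q \<in> ?T" using br[OF qp, of q p] pq by simp
  have pq': "munit p q \<in> ?T"
  proof -
    have "der_apply (ad (munit p q)) (munit p p - munit q q) = mat_scale (- 2) (munit p q :: 'a^'n^'n)"
      using pq by (simp add: der_apply_simps ad_munit) (simp add: vec_eq_iff)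
    then have "mat_scale (- 2) (munit p q) \<in> ?T" using step[OF h, of "munit p q"] by simp
    from sub(4)[OF this, of "- (1 / 2)"] show ?thesis by simp
  qed
  have pj: "munit p j \<in> ?T" if "j \<noteq> p" for j
  proof (cases "j = q")
    case False
    have "der_apply (ad (munit p j)) (munit p p - munit q q) = - (munit p j :: 'a^'n^'n)"
      using pq that False by (simp add: der_apply_simps ad_munit)
    then have "- munit p j \<in> ?T"
      using step[OF h, of "munit p j"] that pq by (simp add: munit_mult)
    from sub(1)[OF this] show ?thesis by simp
  qed (use pq' in simp)
  have off: "munit i j \<in> ?T" if "i \<noteq> j" for i j
  proof (cases "i = q \<or> i = p \<or> j = p")
    case True
    then consider "i = q" | "i = p" | "j = p" by blast
    then show ?thesis by cases (use qj[of j] pj[of j] ip[of i] that in simp_all)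
  next
    case False
    then show ?thesis using sub(1)[OF br[OF ip, of i j p]] that pq by (simp split: if_splits)
  qed
  have diag: "munit a a - munit p p \<in> ?T" for a
  proof (cases "a = p")
    case ap: False
    show ?thesis
    proof (cases "a = q")
      case True
      then show ?thesis using sub(1)[OF h] by simp
    next
      case False
      then show ?thesis using sub(1)[OF br[OF ip[OF ap], of a p]] ap pq by simp
    qed
  qed (use mat.subspace_0[OF T] in simp)
  have first: "\<xi> (munit p q) * \<eta> B = \<zeta> (munit p q ** B)" if "trace B = 0" for B
    using traceless_in_span[OF T off diag that] by simp
  let ?S = "{A. \<forall>B. trace B = 0 \<longrightarrow> \<xi> A * \<eta> B = \<zeta> (A ** B)}"
  have "A \<in> ?S"
  proof (rule traceless_in_bracket_closed[OF _ _ _ pq tr(1)])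
    show "mat.subspace ?S"
      by (simp add: mat.subspace_def eD mat_mult_bilinear distrib_right scale_mult_left)
    show "munit p q \<in> ?S" using first by simp
    fix A D assume A: "A \<in> ?S"
    show "der_apply D A \<in> ?S"
    proof (simp, intro allI impI)
      fix B :: "'a^'n^'n" assume B: "trace B = 0"
      have "\<xi> (der_apply D A) * \<eta> B = act D (\<xi> A * \<eta> B) - \<xi> A * \<eta> (der_apply D B)"
        by (simp add: act_product[OF \<xi> \<eta>])
      also have "\<dots> = \<zeta> (der_apply D (A ** B)) - \<zeta> (A ** der_apply D B)"
        using A B by (simp add: eD trace_der_apply)
      also have "\<dots> = \<zeta> (der_apply D A ** B)"
        by (simp add: der_apply_simps(3) eD)
      finally show "\<xi> (der_apply D A) * \<eta> B = \<zeta> (der_apply D A ** B)" .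
    qed
  qed
  then show ?thesis using tr(2) by simp
qed

text \<open>
  The products of values of \<open>\<xi>\<close> and \<open>\<eta>\<close> at traceless matrices are those of commuting scalars times matrices. At the
  identity matrix this can fail: the values there are invariants, which the relations do not tie to those of \<open>\<zeta>\<close>.
\<close>

definition product_of :: "('a^'n^'n \<Rightarrow> 'r) \<Rightarrow> ('a^'n^'n \<Rightarrow> 'r) \<Rightarrow> ('a^'n^'n \<Rightarrow> 'r) \<Rightarrow> bool" where
  "product_of \<xi> \<eta> \<zeta> \<longleftrightarrow> equivariant \<xi> \<and> equivariant \<eta> \<and> equivariant \<zeta> \<and>
     (\<forall>A B. trace A = 0 \<longrightarrow> trace B = 0 \<longrightarrow> \<xi> A * \<eta> B = \<zeta> (A ** B) \<and> \<eta> A * \<xi> B = \<zeta> (A ** B))"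

lemma product_exists:
  assumes "equivariant \<xi>" "equivariant \<eta>"
  obtains \<zeta> where "product_of \<xi> \<eta> \<zeta>"
proof -
  obtain \<zeta> where \<zeta>: "equivariant \<zeta>" "\<zeta> (munit p p) = \<xi> (munit p q) * \<eta> (munit q p)"
    using corner_product[OF assms] by blast
  have "\<zeta> (munit p p) = \<eta> (munit p q) * \<xi> (munit q p)"
    using \<zeta>(2) basic_relations(1)[OF assms] by simp
  then have "product_of \<xi> \<eta> \<zeta>"
    using product_determined[OF assms \<zeta>] product_determined[OF assms(2,1) \<zeta>(1)] assms \<zeta>(1)
    by (simp add: product_of_def)
  then show ?thesis by (rule that)
qed

text \<open>
  If \<open>Z\<close> is itself a product, its values at the identity matrix are multiplied according to the same rule.
  Associativity of \<open>\<xi> \<eta> \<kappa>\<close>, evaluated at \<open>e\<^sub>p\<^sub>q, h, e\<^sub>q\<^sub>p\<close> and at \<open>e\<^sub>p\<^sub>q, e\<^sub>q\<^sub>p, h\<close> for \<open>h = e\<^sub>p\<^sub>p - e\<^sub>q\<^sub>q\<close>, gives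
  \<open>Z(e\<^sub>p\<^sub>p) \<kappa>(h) = \<omega>(e\<^sub>p\<^sub>p)\<close>, an instance whose first argument has non-zero trace.
\<close>

lemma composite_product:
  assumes Z: "product_of \<xi> \<eta> Z" and \<kappa>: "equivariant \<kappa>"
    and \<omega>: "product_of Z \<kappa> \<omega>" and B: "trace B = 0"
  shows "Z A * \<kappa> B = \<omega> (A ** B)"
proof -
  from Z have eq: "equivariant \<xi>" "equivariant \<eta>" "equivariant Z" by (auto simp: product_of_def)
  have \<omega>': "equivariant \<omega>" using \<omega> by (simp add: product_of_def)
  obtain W where W: "product_of \<eta> \<kappa> W" using product_exists[OF eq(2) \<kappa>] by blast
  then have eW: "equivariant W" by (simp add: product_of_def)
  obtain \<omega>2 where \<omega>2: "product_of \<xi> W \<omega>2" using product_exists[OF eq(1) eW] by blast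
  have m: "\<xi> A * \<eta> B = Z (A ** B)" "Z A * \<kappa> B = \<omega> (A ** B)" "\<eta> A * \<kappa> B = W (A ** B)"
    "\<xi> A * W B = \<omega>2 (A ** B)" if "trace A = 0" "trace B = 0" for A B
    using Z \<omega> W \<omega>2 that by (auto simp: product_of_def)
  let ?h = "munit p p - munit q q :: 'a^'n^'n" and ?e = "munit p q :: 'a^'n^'n" and ?f = "munit q p :: 'a^'n^'n"
  have tr: "trace ?h = 0" "trace ?e = 0" "trace ?f = 0"
    using pq by (simp_all add: trace_simps trace_munit)
  have he: "?e ** ?h = - ?e" "?h ** ?f = - ?f" "?f ** ?h = ?f" "?e ** ?f = munit p p" "munit p p ** ?h = munit p p"
    using pq by (simp_all add: mat_mult_bilinear munit_mult)
  have "\<xi> ?e * \<eta> ?h * \<kappa> ?f = \<xi> ?e * (\<eta> ?h * \<kappa> ?f)" by (simp add: mult.assoc)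
  then have "\<omega> (munit p p) = \<omega>2 (munit p p)"
    by (simp add: m tr he equivariantD(6)[OF eq(3)] equivariantD(6)[OF eW])
  moreover have "\<xi> ?e * \<eta> ?f * \<kappa> ?h = \<xi> ?e * (\<eta> ?f * \<kappa> ?h)" by (simp add: mult.assoc)
  ultimately have Zpp: "Z (munit p p) * \<kappa> ?h = \<omega> (munit p p)"
    by (simp add: m tr he)
  let ?k = "1 / of_nat CARD('n) :: 'a"
  have pp: "munit p p = traceless_part (munit p p) + mat_scale ?k (mat 1 :: 'a^'n^'n)"
    by (simp add: traceless_part_def trace_munit)
  have "Z (munit p p) * \<kappa> ?h = \<omega> (traceless_part (munit p p) ** ?h) + scale ?k (Z (mat 1) * \<kappa> ?h)"
    by (subst pp) (simp add: equivariantD[OF eq(3)] distrib_right m tr scale_mult_left)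
  moreover have "\<omega> (munit p p ** ?h) = \<omega> (traceless_part (munit p p) ** ?h) + scale ?k (\<omega> ?h)"
    by (subst pp) (simp add: equivariantD[OF \<omega>'] mat_mult_bilinear(1,3))
  ultimately have "scale ?k (Z (mat 1) * \<kappa> ?h) = scale ?k (\<omega> ?h)"
    using Zpp he by simp
  then have Zh: "Z (mat 1) * \<kappa> ?h = \<omega> ?h" by (subst (asm) scale_cancel_left) auto
  have inv: "invariant (Z (mat 1))"
    by (simp add: invariant_def equivariantD[OF eq(3)])
  have eZ: "equivariant (\<lambda>B. Z (mat 1) * \<kappa> B)" by (rule equivariant_combine(4)[OF \<kappa> \<kappa> inv])
  have one: "Z (mat 1) * \<kappa> B = \<omega> B"
  proof (rule equivariant_eq_on_traceless[OF eZ \<omega>' _ pq B])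
    have "der_apply (ad ?e) ?h = mat_scale (- 2) ?e"
      using pq by (simp add: der_apply_simps ad_munit) (simp add: vec_eq_iff)
    then have "scale (- 2) (Z (mat 1) * \<kappa> ?e) = act (ad ?e) (Z (mat 1) * \<kappa> ?h)"
      by (simp only: equivariantD(3)[OF eZ] equivariantD(2)[OF eZ])
    also have "\<dots> = scale (- 2) (\<omega> ?e)"
      using \<open>der_apply (ad ?e) ?h = mat_scale (- 2) ?e\<close>
      by (simp only: Zh equivariantD(3)[OF \<omega>'] equivariantD(2)[OF \<omega>'])
    finally show "Z (mat 1) * \<kappa> ?e = \<omega> ?e" by (subst (asm) scale_cancel_left) auto
  qed
  show ?thesis
    by (subst (1 2) traceless_part_plus[of A])
      (simp add: equivariantD[OF eq(3)] equivariantD[OF \<omega>'] distrib_right m B scale_mult_left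
        mat_mult_bilinear(1,3) one)
qed

end

section \<open>Coordinates with respect to the basis of matrices\<close>

lemma munit_inj: "munit i j = (munit i' j' :: 'a::field^'n^'n) \<longleftrightarrow> i = i' \<and> j = j'"
proof
  assume eq: "munit i j = (munit i' j' :: 'a^'n^'n)"
  have "(munit i j :: 'a^'n^'n) $ i $ j = 1" by (simp add: munit_nth)
  then have "(munit i' j' :: 'a^'n^'n) $ i $ j = 1" unfolding eq .
  then show "i = i' \<and> j = j'" by (simp add: munit_nth split: if_splits)
qed simp

lemma munit_basis:
  "mat.independent (range (case_prod munit) :: ('a::field^'n^'n) set)"
  "mat.span (range (case_prod munit) :: ('a::field^'n^'n) set) = UNIV"
  "card (range (case_prod munit) :: ('a::field^'n^'n) set) = CARD('n)^2"
proof -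
  have inj: "inj (case_prod munit :: 'n \<times> 'n \<Rightarrow> 'a^'n^'n)"
    by (auto simp: inj_def munit_inj)
  show "mat.independent (range (case_prod munit) :: ('a^'n^'n) set)"
  proof (rule mat.independent_if_scalars_zero)
    fix f :: "'a^'n^'n \<Rightarrow> 'a" and x :: "'a^'n^'n"
    assume eq: "(\<Sum>x\<in>range (case_prod munit). mat_scale (f x) x) = 0" and x: "x \<in> range (case_prod munit)"
    have "(\<Sum>x\<in>range (case_prod munit). mat_scale (f x) x) =
        (\<Sum>x\<in>UNIV. mat_scale (f (case_prod munit x)) (case_prod munit x))"
      by (simp only: sum.reindex[OF inj] o_def)
    also have "\<dots> = (\<Sum>i\<in>UNIV. \<Sum>j\<in>UNIV. mat_scale ((\<chi> i j. f (munit i j)) $ i $ j) (munit i j))"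
      by (simp add: sum.cartesian_product split_def)
    also have "\<dots> = (\<chi> i j. f (munit i j))" by (rule matrix_expansion[symmetric])
    finally have "(\<chi> i j. f (munit i j)) = 0" using eq by simp
    then show "f x = 0" using x by (auto simp: vec_eq_iff)
  qed simp
  have "A \<in> mat.span (range (case_prod munit))" for A :: "'a^'n^'n"
    by (subst matrix_expansion[of A])
      (intro mat.span_sum mat.span_scale mat.span_base, auto)
  then show "mat.span (range (case_prod munit) :: ('a^'n^'n) set) = UNIV" by auto
  show "card (range (case_prod munit) :: ('a^'n^'n) set) = CARD('n)^2"
    using inj by (simp add: card_image power2_eq_square)
qed

lemma sl_basis_traceless: "a \<in> sl_basis \<Longrightarrow> trace a = (0 :: 'a::field)"
  for a :: "('a::field, 'n::{finite, linorder}) sqmat"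
  by (auto simp: sl_basis_def mat_unit_munit cartan_def trace_simps trace_munit idx_eq_iff)

lemma finite_mat_basis: "finite (mat_basis :: ('a::field, 'n::{finite, linorder}) sqmat set)"
  and card_mat_basis_le: "card (mat_basis :: ('a::field, 'n::{finite, linorder}) sqmat set) \<le> CARD('n)^2"
proof -
  let ?k = "CARD('n)" and ?I = "{1..CARD('n)}"
  let ?P = "?I \<times> ?I - (\<lambda>i. (i, i)) ` ?I"
  let ?O = "{mat_unit i j :: ('a, 'n) sqmat | i j. i \<in> ?I \<and> j \<in> ?I \<and> i \<noteq> j}"
  have O: "?O = case_prod mat_unit ` ?P" by (auto simp: image_iff) blast
  have "card ?P = ?k * ?k - ?k"
    by (subst card_Diff_subset) (auto simp: card_image inj_on_def)
  moreover have "card (case_prod mat_unit ` ?P :: ('a, 'n) sqmat set) \<le> card ?P"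
    by (rule card_image_le) simp
  ultimately have "card ?O \<le> ?k * ?k - ?k" unfolding O by simp
  moreover have "card (cartan ` {1..<?k} :: ('a, 'n) sqmat set) \<le> ?k - 1"
    using card_image_le[of "{1..<?k}" cartan] by simp
  moreover have "card (mat_basis :: ('a, 'n) sqmat set) \<le> Suc (card ?O + card (cartan ` {1..<?k} :: ('a, 'n) sqmat set))"
    unfolding mat_basis_def sl_basis_def
    by (rule order_trans[OF card_insert_le_m1]) (auto intro: card_Un_le simp: le_SucI)
  moreover have "?k \<ge> 1" "?k \<le> ?k * ?k" by (simp_all add: Suc_le_eq)
  ultimately show "card (mat_basis :: ('a, 'n) sqmat set) \<le> ?k^2"
    unfolding power2_eq_square by arith
  show "finite (mat_basis :: ('a, 'n) sqmat set)"
    unfolding mat_basis_def sl_basis_def O by simp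
qed

text \<open>
  Spanning and the count below give linear independence, as the dimension is \<open>k\<^sup>2\<close>.
\<close>

lemma span_mat_basis: "mat.span mat_basis = (UNIV :: ('a::field_char_0, 'n::{finite, linorder}) sqmat set)"
proof -
  let ?S = "mat.span mat_basis :: ('a, 'n) sqmat set"
  have img: "(idx :: nat \<Rightarrow> 'n) ` {1..CARD('n)} = UNIV"
    using bij_betw_idx[where 'n = 'n] by (simp add: bij_betw_def)
  have off: "munit a b \<in> ?S" if "a \<noteq> b" for a b
  proof -
    obtain i j where "a = idx i" "i \<in> {1..CARD('n)}" "b = idx j" "j \<in> {1..CARD('n)}"
      using img by (metis UNIV_I imageE)
    then have "munit a b \<in> (mat_basis :: ('a, 'n) sqmat set)"
      using that by (auto simp: mat_basis_def sl_basis_def mat_unit_munit)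
    then show ?thesis by (rule mat.span_base)
  qed
  have step: "munit (idx (Suc l)) (idx (Suc l)) - munit (idx 1) (idx 1) \<in> ?S" if "Suc l \<le> CARD('n)" for l
    using that
  proof (induction l)
    case 0
    then show ?case by (simp add: mat.span_zero)
  next
    case (Suc l)
    have "cartan (Suc l) \<in> (mat_basis :: ('a, 'n) sqmat set)"
      using Suc.prems by (auto simp: mat_basis_def sl_basis_def)
    then have "cartan (Suc l) \<in> ?S" by (rule mat.span_base)
    from mat.span_diff[OF Suc.IH this] show ?case
      using Suc.prems by (simp add: cartan_def mat_unit_munit)
  qed
  have diag: "munit a a - munit (idx 1) (idx 1) \<in> ?S" for a
  proof -
    obtain i where i: "a = idx i" "i \<in> {1..CARD('n)}" using img by (metis UNIV_I imageE)
    then show ?thesis using step[of "i - 1"] by simp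
  qed
  have "A \<in> ?S" for A
  proof -
    have "traceless_part A \<in> ?S"
      by (rule traceless_in_span[OF mat.subspace_span off diag]) simp_all
    moreover have "mat 1 \<in> ?S" by (rule mat.span_base) (simp add: mat_basis_def)
    ultimately show ?thesis
      by (subst traceless_part_plus[of A]) (intro mat.span_add mat.span_scale)
  qed
  then show ?thesis by auto
qed

lemma independent_mat_basis: "mat.independent (mat_basis :: ('a::field_char_0, 'n::{finite, linorder}) sqmat set)"
  and card_mat_basis: "card (mat_basis :: ('a::field_char_0, 'n::{finite, linorder}) sqmat set) = CARD('n)^2"
proof -
  interpret finite_dimensional_vector_space mat_scale "range (case_prod munit) :: ('a, 'n) sqmat set"
    by standard (simp_all add: munit_basis)
  have dim: "mat.dim (UNIV :: ('a, 'n) sqmat set) = CARD('n)^2"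
    using dim_eq_card[of "range (case_prod munit)" UNIV] munit_basis by simp
  show ind: "mat.independent (mat_basis :: ('a, 'n) sqmat set)"
  proof (rule card_le_dim_spanning[of _ UNIV])
    show "card (mat_basis :: ('a, 'n) sqmat set) \<le> mat.dim (UNIV :: ('a, 'n) sqmat set)"
      unfolding dim by (rule card_mat_basis_le)
  qed (simp_all add: span_mat_basis finite_mat_basis)
  have "mat.dim (UNIV :: ('a, 'n) sqmat set) = card (mat_basis :: ('a, 'n) sqmat set)"
    by (rule mat.dim_eq_card[OF _ ind]) (simp only: span_mat_basis mat.span_UNIV)
  then show "card (mat_basis :: ('a, 'n) sqmat set) = CARD('n)^2" by (simp only: dim)
qed

lemma mat_one_notin_sl_basis: "mat 1 \<notin> (sl_basis :: ('a::field_char_0, 'n::{finite, linorder}) sqmat set)"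
proof
  assume "mat 1 \<in> (sl_basis :: ('a, 'n) sqmat set)"
  then have "trace (mat 1 :: ('a, 'n) sqmat) = 0" by (rule sl_basis_traceless)
  then show False by (simp add: trace_simps)
qed

lemma card_sl_basis: "card (sl_basis :: ('a::field_char_0, 'n::{finite, linorder}) sqmat set) = CARD('n)^2 - 1"
  using card_mat_basis[where 'a = 'a and 'n = 'n] mat_one_notin_sl_basis[where 'a = 'a and 'n = 'n]
    finite_mat_basis[where 'a = 'a and 'n = 'n]
  by (simp add: mat_basis_def)

definition mat_coord :: "('a::field_char_0, 'n::{finite, linorder}) sqmat \<Rightarrow> ('a, 'n) sqmat \<Rightarrow> 'a"
  where "mat_coord a A = mat.representation mat_basis A a"

lemma mat_coord_simps:
  fixes A B :: "('a::field_char_0, 'n::{finite, linorder}) sqmat"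
  shows "mat_coord a (A + B) = mat_coord a A + mat_coord a B"
    "mat_coord a (mat_scale c A) = c * mat_coord a A"
    "m \<in> mat_basis \<Longrightarrow> mat_coord a m = (if a = m then 1 else 0)"
    "mat_coord a 0 = 0"
    "(\<Sum>a\<in>mat_basis. mat_scale (mat_coord a A) a) = A"
  using independent_mat_basis[where 'a = 'a and 'n = 'n] span_mat_basis[where 'a = 'a and 'n = 'n]
    finite_mat_basis[where 'a = 'a and 'n = 'n]
  by (simp_all add: mat_coord_def mat.representation_add mat.representation_scale
      mat.representation_basis mat.representation_zero mat.sum_representation_eq)

lemma mat_coord_sum: "mat_coord a (\<Sum>i\<in>I. f i) = (\<Sum>i\<in>I. mat_coord a (f i))"
  by (induction I rule: infinite_finite_induct) (simp_all add: mat_coord_simps)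

lemma functional_coord_eq:
  fixes l :: "('a::field_char_0, 'n::{finite, linorder}) sqmat \<Rightarrow> 'a"
  assumes "\<And>A B. l (A + B) = l A + l B" "\<And>c A. l (mat_scale c A) = c * l A"
  shows "l A = (\<Sum>a\<in>mat_basis. mat_coord a A * l a)"
proof -
  have zero: "l 0 = 0" using assms(2)[of 0 0] by simp
  have sum: "l (\<Sum>i\<in>I. f i) = (\<Sum>i\<in>I. l (f i))" for f :: "('a, 'n) sqmat \<Rightarrow> ('a, 'n) sqmat" and I
    by (induction I rule: infinite_finite_induct) (simp_all add: assms zero)
  have "l A = l (\<Sum>a\<in>mat_basis. mat_scale (mat_coord a A) a)" by (simp add: mat_coord_simps)
  then show ?thesis by (simp add: sum assms)
qed

lemma functional_eq_coord:
  fixes l :: "('a::field_char_0, 'n::{finite, linorder}) sqmat \<Rightarrow> 'a"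
  assumes "\<And>A B. l (A + B) = l A + l B" "\<And>c A. l (mat_scale c A) = c * l A"
    and "\<And>m. m \<in> mat_basis \<Longrightarrow> l m = (if m = a then 1 else 0)" "a \<in> mat_basis"
  shows "mat_coord a A = l A"
proof -
  have "l A = (\<Sum>m\<in>mat_basis. mat_coord m A * (if m = a then 1 else 0))"
    unfolding functional_coord_eq[OF assms(1,2), of A] by (intro sum.cong) (simp_all add: assms(3))
  also have "\<dots> = (\<Sum>m\<in>mat_basis. if m = a then mat_coord a A else 0)"
    by (intro sum.cong) auto
  also have "\<dots> = mat_coord a A" using assms(4) by (simp add: finite_mat_basis)
  finally show ?thesis by simp
qed

lemma mat_coord_one: "mat_coord (mat 1) A = trace A / of_nat CARD('n)"
  for A :: "('a::field_char_0, 'n::{finite, linorder}) sqmat"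
  by (rule functional_eq_coord)
    (auto simp: trace_simps add_divide_distrib mat_basis_def sl_basis_traceless)

lemma mat_coord_off_diagonal:
  fixes A :: "('a::field_char_0, 'n::{finite, linorder}) sqmat"
  assumes "i \<in> {1..CARD('n)}" "j \<in> {1..CARD('n)}" "i \<noteq> j"
  shows "mat_coord (mat_unit i j) A = A $ idx i $ idx j"
proof (rule functional_eq_coord)
  show in_basis: "mat_unit i j \<in> (mat_basis :: ('a, 'n) sqmat set)"
    using assms by (auto simp: mat_basis_def sl_basis_def)
  fix m :: "('a, 'n) sqmat" assume m: "m \<in> mat_basis"
  have neq: "(idx i :: 'n) \<noteq> idx j" using assms by (simp add: idx_eq_iff)
  consider "m = mat 1" | i' j' where "m = mat_unit i' j'" "i' \<in> {1..CARD('n)}" "j' \<in> {1..CARD('n)}"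
    | l where "l \<in> {1..<CARD('n)}" "m = cartan l"
    using m by (auto simp: mat_basis_def sl_basis_def)
  then show "m $ idx i $ idx j = (if m = mat_unit i j then 1 else 0)"
  proof cases
    case 1
    then have "m $ idx i $ idx j = 0" using neq by (simp add: mat_def)
    moreover from this have "m \<noteq> mat_unit i j" by (auto simp: mat_unit_munit munit_nth)
    ultimately show ?thesis by simp
  next
    case 2
    then show ?thesis using assms by (auto simp: mat_unit_munit munit_nth munit_inj idx_eq_iff)
  next
    case 3
    then have "m $ idx i $ idx j = 0" using neq by (auto simp: cartan_def mat_unit_munit munit_nth)
    moreover from this have "m \<noteq> mat_unit i j" by (auto simp: mat_unit_munit munit_nth)
    ultimately show ?thesis by simp
  qed
qed auto

lemma elementary_map_eq:
  fixes f :: "('a::field_char_0, 'n::{finite, linorder}) sqmat \<Rightarrow> ('a, 'n) sqmat"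
  assumes f: "is_elementary_map a b f" and a: "a \<in> mat_basis"
  shows "f A = mat_scale (mat_coord a A) b"
proof -
  have lin: "f (A + B) = f A + f B" "f (mat_scale c A) = mat_scale c (f A)" for A B c
    using f by (auto simp: is_elementary_map_def mat_linear_iff)
  have zero: "f 0 = 0" using lin(2)[of 0 0] by simp
  have sum: "f (\<Sum>i\<in>I. g i) = (\<Sum>i\<in>I. f (g i))" for g :: "('a, 'n) sqmat \<Rightarrow> ('a, 'n) sqmat" and I
    by (induction I rule: infinite_finite_induct) (simp_all add: lin zero)
  have "f A = (\<Sum>m\<in>mat_basis. mat_scale (mat_coord m A) (f m))"
    by (subst mat_coord_simps(5)[of A, symmetric]) (simp only: sum lin)
  also have "\<dots> = (\<Sum>m\<in>mat_basis. if m = a then mat_scale (mat_coord a A) b else 0)"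
    using f by (intro sum.cong) (auto simp: is_elementary_map_def)
  also have "\<dots> = mat_scale (mat_coord a A) b" using a by (simp add: finite_mat_basis)
  finally show ?thesis .
qed

section \<open>The relatively free algebra of the two identities\<close>

definition quadratic_identity ::
  "('a, 'n) uea \<Rightarrow> ('a, 'n) uea \<Rightarrow> ('a, 'n) uea \<Rightarrow> ('a, 'n) uea \<Rightarrow> nat \<Rightarrow> nat \<Rightarrow> ('a::field, 'n::finite) lpoly"
  where "quadratic_identity \<gamma> \<alpha> \<beta>' \<beta> x y = commutator (lp_var x \<gamma>) (lp_var y (\<gamma> + \<alpha>))
    + lp_var x \<alpha> * lp_var y \<beta>' - lp_var y \<alpha> * lp_var x \<beta>"

text \<open>
  Modulo the identities in one variable only the action of an exponent matters, so it is the action that is prescribed.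
\<close>

definition quadratic_exponents ::
  "('a::field_char_0, 'n::{finite, linorder}) uea \<Rightarrow> ('a, 'n) uea \<Rightarrow> ('a, 'n) uea \<Rightarrow> ('a, 'n) uea \<Rightarrow> bool"
  where "quadratic_exponents \<gamma> \<alpha> \<beta>' \<beta> \<longleftrightarrow>
    (\<forall>A. mat_act \<gamma> A = mat_scale (trace A / of_nat CARD('n)) (mat 1)) \<and>
    (\<forall>A. mat_act \<alpha> A = mat_scale (A $ idx 1 $ idx 2) (munit (idx 1) (idx 2))) \<and>
    (\<forall>A. mat_act \<beta>' A = mat_scale (A $ idx 1 $ idx 2)
      (munit (idx 2) (idx 1) + (if CARD('n) \<ge> 3 then munit (idx 3) (idx 1) else 0))) \<and>
    (\<forall>A. mat_act \<beta> A = mat_scale (A $ idx 1 $ idx 2) (munit (idx 2) (idx 1)))"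

text \<open>
  All exponents and all pairs of variables are admitted, so that the quotient below depends neither on the choice of the
  \<open>\<rho>\<close> nor on \<open>x\<close> and \<open>y\<close>; the specialization to the given generators is made at the end.
\<close>

definition matrix_relations :: "('a::field_char_0, 'n::{finite, linorder}) lpoly set" where
  "matrix_relations = {lp_var i u | i u. \<forall>A. mat_act u A = 0} \<union>
     {quadratic_identity \<gamma> \<alpha> \<beta>' \<beta> i j | \<gamma> \<alpha> \<beta>' \<beta> i j. quadratic_exponents \<gamma> \<alpha> \<beta>' \<beta> \<and> i \<noteq> j}"

lemma TL_ideal_matrix_relations: "TL_ideal (TL_ideal_generated matrix_relations)"
  by (rule TL_ideal_generated)

lemma TL_ideal_equivp: "TL_ideal I \<Longrightarrow> equivp (\<lambda>f g. f - g \<in> I)"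
proof (intro equivpI reflpI sympI transpI)
  assume I: "TL_ideal I"
  show "f - f \<in> I" for f using TL_idealD(1)[OF I] by simp
  show "g - f \<in> I" if "f - g \<in> I" for f g using TL_idealD(4)[OF I that] by simp
  show "f - h \<in> I" if "f - g \<in> I" "g - h \<in> I" for f g h using TL_idealD(2)[OF I that] by simp
qed

quotient_type (overloaded) ('a, 'n) relatively_free = "('a::field_char_0, 'n::{finite, linorder}) lpoly" /
  "\<lambda>f g. f - g \<in> TL_ideal_generated matrix_relations"
  by (rule TL_ideal_equivp[OF TL_ideal_matrix_relations])

instantiation relatively_free :: (field_char_0, "{finite, linorder}") ring
begin

lift_definition zero_relatively_free :: "('a, 'b) relatively_free" is 0 .
lift_definition plus_relatively_free ::
  "('a, 'b) relatively_free \<Rightarrow> ('a, 'b) relatively_free \<Rightarrow> ('a, 'b) relatively_free" is "(+)"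
  by (drule (1) TL_idealD(2)[OF TL_ideal_matrix_relations]) (simp add: algebra_simps)
lift_definition minus_relatively_free ::
  "('a, 'b) relatively_free \<Rightarrow> ('a, 'b) relatively_free \<Rightarrow> ('a, 'b) relatively_free" is "(-)"
  by (drule (1) TL_idealD(3)[OF TL_ideal_matrix_relations]) (simp add: algebra_simps)
lift_definition uminus_relatively_free :: "('a, 'b) relatively_free \<Rightarrow> ('a, 'b) relatively_free" is "uminus"
  by (drule TL_idealD(4)[OF TL_ideal_matrix_relations]) simp
lift_definition times_relatively_free ::
  "('a, 'b) relatively_free \<Rightarrow> ('a, 'b) relatively_free \<Rightarrow> ('a, 'b) relatively_free" is "(*)"
  by (rule TL_ideal_cong_mult[OF TL_ideal_matrix_relations])

instance
  by standard (transfer; simp add: algebra_simps TL_idealD(1)[OF TL_ideal_matrix_relations])+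

end

lift_definition rf_scale :: "'a::field_char_0 \<Rightarrow> ('a, 'n::{finite, linorder}) relatively_free \<Rightarrow> ('a, 'n) relatively_free"
  is lp_scale
  by (drule TL_idealD(5)[OF TL_ideal_matrix_relations]) (simp add: lp.scale_right_diff_distrib)

lift_definition rf_deriv ::
  "('a::field_char_0, 'n::{finite, linorder}) der \<Rightarrow> ('a, 'n) relatively_free \<Rightarrow> ('a, 'n) relatively_free"
  is lp_deriv
proof -
  fix D :: "('a, 'n) der" and f g :: "('a, 'n) lpoly"
  assume "f - g \<in> TL_ideal_generated matrix_relations"
  from TL_idealD(8)[OF TL_ideal_matrix_relations this, of D]
  show "lp_deriv D f - lp_deriv D g \<in> TL_ideal_generated matrix_relations"
    using lp_deriv_add[of D "f - g" g] by (simp add: algebra_simps)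
qed

interpretation rf_module: sl_module rf_scale rf_deriv
proof (unfold_locales; transfer)
qed (simp_all add: lp.scale_right_distrib lp.scale_left_distrib lp_deriv_add lp_deriv_scale
    lp_rep.act_add_left lp_rep.act_scale_left lp_rep.act_bracket TL_idealD(1)[OF TL_ideal_matrix_relations])

abbreviation rf_class :: "('a::field_char_0, 'n::{finite, linorder}) lpoly \<Rightarrow> ('a, 'n) relatively_free"
  where "rf_class \<equiv> abs_relatively_free"

lemma rf_class_simps:
  "rf_class (f + g) = rf_class f + rf_class g" "rf_class (f - g) = rf_class f - rf_class g"
  "rf_class (f * g) = rf_class f * rf_class g" "rf_class (lp_scale c f) = rf_scale c (rf_class f)"
  "rf_class (lp_deriv D f) = rf_deriv D (rf_class f)"
  by (simp_all add: plus_relatively_free.abs_eq minus_relatively_free.abs_eq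
      times_relatively_free.abs_eq rf_scale.abs_eq rf_deriv.abs_eq)

lemma rf_class_act: "rf_class (lp_act u f) = ue_rep rf_scale rf_deriv u (rf_class f)"
  by (induction u arbitrary: f rule: uea_induct)
    (simp_all add: lp_rep.ue_rep_simps rf_module.ue_rep_simps rf_class_simps ue_E_def)

lemma rf_class_eq_0: "rf_class f = 0 \<longleftrightarrow> f \<in> TL_ideal_generated matrix_relations"
  by (simp add: zero_relatively_free_def relatively_free.abs_eq_iff)

lemma rf_class_surj: obtains f where "r = rf_class f"
  by (metis Quotient_abs_rep[OF Quotient_relatively_free])

text \<open>
  Elements of the quotient are classes of polynomials, and these can be substituted for the variables of the relations.
\<close>

lemma rf_matrix_identities:
  fixes \<rho> :: "('a::field_char_0, 'n::{finite, linorder}) sqmat \<Rightarrow> ('a, 'n) sqmat \<Rightarrow> ('a, 'n) uea"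
  assumes card: "CARD('n) \<ge> 2"
    and \<rho>: "\<And>a b. a \<in> sl_basis \<Longrightarrow> b \<in> sl_basis \<Longrightarrow> is_elementary_map a b (mat_act (\<rho> a b))"
    and \<gamma>: "is_elementary_map (mat 1) (mat 1) (mat_act (\<rho> (mat 1) (mat 1)))"
  shows "matrix_identities rf_scale (rf_deriv :: ('a, 'n) der \<Rightarrow> _) (idx 1) (idx 2) (idx 3)"
proof (unfold_locales, goal_cases)
  case (1 c r s)
  show ?case by transfer (simp add: lp_scale_mult_left TL_idealD(1)[OF TL_ideal_matrix_relations])
next
  case (2 r c s)
  show ?case by transfer (simp add: lp_scale_mult_right TL_idealD(1)[OF TL_ideal_matrix_relations])
next
  case (3 D r s)
  show ?case by transfer (simp add: lp_deriv_mult TL_idealD(1)[OF TL_ideal_matrix_relations])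
next
  case 4
  show ?case using card by (rule idx_neq)
next
  case 5
  then show ?case using idx_eq_iff[of 3 1, where 'n = 'n] idx_eq_iff[of 3 2, where 'n = 'n] by simp
next
  case (6 u r)
  obtain f where f: "r = rf_class f" by (rule rf_class_surj)
  have "lp_var 0 u \<in> TL_ideal_generated matrix_relations"
    using 6 by (intro TL_ideal_generated_base) (auto simp: matrix_relations_def)
  from TL_ideal_endo[OF TL_ideal_matrix_relations this, of "\<lambda>_. f"]
  show ?case by (simp add: f rf_class_act[symmetric] rf_class_eq_0 lp_endo_simps)
next
  case (7 l m)
  then have lin: "\<And>A B. l (A + B) = l A + l B" "\<And>c A. l (mat_scale c A) = c * l A" "l (mat 1) = 0"
    by (auto simp: is_functional_def)
  have basis: "(\<Sum>a\<in>mat_basis. f a) = f (mat 1) + (\<Sum>a\<in>sl_basis. f a)"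
    for f :: "('a, 'n) sqmat \<Rightarrow> 'c::comm_monoid_add"
    using finite_mat_basis[where 'a = 'a and 'n = 'n] mat_one_notin_sl_basis[where 'a = 'a and 'n = 'n]
    by (simp add: mat_basis_def)
  define u where "u = (\<Sum>a\<in>sl_basis. \<Sum>b\<in>sl_basis. ue_scale (l a * mat_coord b (traceless_part m)) (\<rho> a b))"
  have act: "mat_act (\<rho> a b) A = mat_scale (mat_coord a A) b" if "a \<in> sl_basis" "b \<in> sl_basis" for a b A
    using elementary_map_eq[OF \<rho>[OF that]] that by (simp add: mat_basis_def)
  have "mat_act u A = mat_scale (l A) (traceless_part m)" for A
  proof -
    have "mat_act u A = (\<Sum>a\<in>sl_basis. \<Sum>b\<in>sl_basis.
        mat_scale (mat_coord a A * l a) (mat_scale (mat_coord b (traceless_part m)) b))"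
      unfolding u_def mat_module.ue_rep_more
      by (intro sum.cong refl) (simp add: mat_rep.ue_rep_simps act mult_ac)
    also have "\<dots> = mat_scale (\<Sum>a\<in>sl_basis. mat_coord a A * l a)
        (\<Sum>b\<in>sl_basis. mat_scale (mat_coord b (traceless_part m)) b)"
      unfolding mat.scale_sum_left unfolding mat.scale_sum_right by (rule refl)
    also have "(\<Sum>a\<in>sl_basis. mat_coord a A * l a) = l A"
      using functional_coord_eq[OF lin(1,2), of A] by (simp add: basis lin(3))
    also have "(\<Sum>b\<in>sl_basis. mat_scale (mat_coord b (traceless_part m)) b) = traceless_part m"
      using mat_coord_simps(5)[of "traceless_part m"] by (simp add: basis mat_coord_one)
    finally show ?thesis .
  qed
  then show ?case by blast
next
  case 8
  show ?case
    using elementary_map_eq[OF \<gamma>] by (intro exI[of _ "\<rho> (mat 1) (mat 1)"]) (simp add: mat_basis_def mat_coord_one)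
next
  case (9 \<gamma> \<alpha> \<beta>' \<beta> r s)
  obtain f where f: "r = rf_class f" by (rule rf_class_surj)
  obtain g where g: "s = rf_class g" by (rule rf_class_surj)
  have "quadratic_identity \<gamma> \<alpha> \<beta>' \<beta> 0 1 \<in> TL_ideal_generated matrix_relations"
  proof (rule TL_ideal_generated_base)
    have "quadratic_exponents \<gamma> \<alpha> \<beta>' \<beta>" using 9 by (simp add: quadratic_exponents_def)
    then show "quadratic_identity \<gamma> \<alpha> \<beta>' \<beta> 0 1 \<in> matrix_relations"
      unfolding matrix_relations_def using zero_neq_one[where 'a = nat] by blast
  qed
  from TL_ideal_endo[OF TL_ideal_matrix_relations this, of "\<lambda>i. if i = 0 then f else g"]
  have "rf_class (lp_endo (\<lambda>i. if i = 0 then f else g) (quadratic_identity \<gamma> \<alpha> \<beta>' \<beta> 0 1)) = 0"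
    by (simp add: rf_class_eq_0)
  moreover have "lp_endo s (f - g) = lp_endo s f - lp_endo s g" for s and f g :: "('a, 'n) lpoly"
    using lp_endo_simps(1)[of s "f - g" g] by (simp add: algebra_simps)
  ultimately show ?case
    by (simp add: quadratic_identity_def commutator_def lp_endo_simps rf_class_simps rf_class_act f g
        lp_rep.ue_rep_simps)
qed

section \<open>Normal forms of L-polynomials\<close>

text \<open>
  Artin's argument for the independence of characters: if \<open>v\<close> occurs in \<open>M\<close> and \<open>M0\<close> with different multiplicities,
  doubling \<open>y v\<close> and subtracting a multiple of the original relation removes the term of \<open>M0\<close> but not that of \<open>M\<close>.
  The powers of 2 are distinct because the characteristic is 0.
\<close>

lemma monomials_independent:
  fixes c :: "'v multiset \<Rightarrow> 'a::field_char_0"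
  assumes "finite S" and "\<And>y. (\<Sum>M\<in>S. c M * (\<Prod>v\<in>#M. y v)) = 0"
  shows "\<forall>M\<in>S. c M = 0"
  using assms
proof (induction S arbitrary: c rule: finite_induct)
  case (insert M0 S)
  have "c M = 0" if M: "M \<in> S" for M
  proof -
    have "M \<noteq> M0" using M insert.hyps by auto
    then obtain v where v: "count M v \<noteq> count M0 v" by (auto simp: multiset_eq_iff)
    have upd: "(\<Prod>w\<in>#N. (y(v := 2 * y v)) w) = 2 ^ count N v * (\<Prod>w\<in>#N. y w)" for N and y :: "'v \<Rightarrow> 'a"
      by (induction N) auto
    define c' where "c' N = c N * (2 ^ count N v - 2 ^ count M0 v)" for N
    have "(\<Sum>N\<in>S. c' N * (\<Prod>w\<in>#N. y w)) = 0" for y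
    proof -
      have "(\<Sum>N\<in>insert M0 S. c' N * (\<Prod>w\<in>#N. y w)) =
          (\<Sum>N\<in>insert M0 S. c N * (\<Prod>w\<in>#N. (y(v := 2 * y v)) w)) -
          2 ^ count M0 v * (\<Sum>N\<in>insert M0 S. c N * (\<Prod>w\<in>#N. y w))"
        unfolding upd by (simp add: c'_def sum_distrib_left sum_subtractf algebra_simps)
      also have "\<dots> = 0" by (simp only: insert.prems) simp
      finally show ?thesis using insert.hyps by (simp add: c'_def)
    qed
    from insert.IH[OF this] M have "c' M = 0" by blast
    moreover have "(2 :: 'a) ^ count M v \<noteq> 2 ^ count M0 v"
    proof
      assume "(2 :: 'a) ^ count M v = 2 ^ count M0 v"
      then have "(of_nat (2 ^ count M v) :: 'a) = of_nat (2 ^ count M0 v)" by simp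
      then have "(2 :: nat) ^ count M v = 2 ^ count M0 v" by (simp only: of_nat_eq_iff)
      then show False using v by simp
    qed
    ultimately show ?thesis by (simp add: c'_def)
  qed
  moreover from this have "c M0 = 0"
    using insert.prems[of "\<lambda>_. 1"] insert.hyps by simp
  ultimately show ?case by blast
qed auto

lemma sum_list_group:
  assumes "finite S" "g ` set ts \<subseteq> S"
  shows "(\<Sum>t\<leftarrow>ts. f t) = (\<Sum>M\<in>S. \<Sum>t\<leftarrow>filter (\<lambda>t. g t = M) ts. f t)"
  using assms(2)
proof (induction ts)
  case (Cons t ts)
  have "(\<Sum>M\<in>S. \<Sum>s\<leftarrow>filter (\<lambda>t. g t = M) (t # ts). f s) =
      (\<Sum>M\<in>S. (if M = g t then f t else 0) + (\<Sum>s\<leftarrow>filter (\<lambda>t. g t = M) ts. f s))"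
    by (intro sum.cong) auto
  then show ?case using Cons assms(1) by (simp add: sum.distrib)
qed simp

lemma word_monomials_independent:
  fixes c :: "'t \<Rightarrow> 'a::field_char_0"
  assumes "\<And>y. (\<Sum>t\<leftarrow>ts. c t * (\<Prod>v\<leftarrow>w t. y v)) = 0"
  shows "(\<Sum>t\<leftarrow>filter (\<lambda>t. mset (w t) = M) ts. c t) = 0"
proof -
  let ?S = "insert M ((\<lambda>t. mset (w t)) ` set ts)"
  have "(\<Sum>N\<in>?S. (\<Sum>t\<leftarrow>filter (\<lambda>t. mset (w t) = N) ts. c t) * (\<Prod>v\<in>#N. y v)) = 0" for y
  proof -
    have "(\<Sum>t\<leftarrow>filter (\<lambda>t. mset (w t) = N) ts. c t * (\<Prod>v\<leftarrow>w t. y v)) =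
        (\<Sum>t\<leftarrow>filter (\<lambda>t. mset (w t) = N) ts. c t) * (\<Prod>v\<in>#N. y v)" for N
      by (induction ts) (auto simp: distrib_right simp flip: prod_mset_prod_list)
    then show ?thesis
      using assms[of y] sum_list_group[of ?S "\<lambda>t. mset (w t)" ts "\<lambda>t. c t * (\<Prod>v\<leftarrow>w t. y v)"]
      by auto
  qed
  from monomials_independent[OF _ this] show ?thesis by auto
qed

text \<open>
  Bringing one entry to the front, step by step, reduces any rearrangement to transpositions of the first two entries.
\<close>

lemma mset_eq_swap_induct:
  assumes refl: "\<And>xs. R xs xs" and trans: "\<And>xs ys zs. R xs ys \<Longrightarrow> R ys zs \<Longrightarrow> R xs zs"
    and cons: "\<And>x xs ys. R xs ys \<Longrightarrow> R (x # xs) (x # ys)"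
    and swap: "\<And>x y xs. R (x # y # xs) (y # x # xs)"
  shows "mset xs = mset ys \<Longrightarrow> R xs ys"
proof (induction xs arbitrary: ys)
  case (Cons x xs)
  have front: "R (x # as @ bs) (as @ x # bs)" for as bs
  proof (induction as)
    case (Cons a as)
    then show ?case using trans[OF swap cons] by simp
  qed (simp add: refl)
  have "x \<in> set ys" using Cons.prems by (metis list.set_intros(1) set_mset_mset)
  then obtain as bs where ys: "ys = as @ x # bs" by (meson split_list)
  then have "mset xs = mset (as @ bs)" using Cons.prems by simp
  then show ?case unfolding ys using trans[OF cons[OF Cons.IH] front] by simp
qed (simp add: refl)

text \<open>
  The span of all products of \<open>n\<close> traceless matrices. These are the matrices that can occur next to a monomial with \<open>n\<close>
  coordinates of traceless parts.
\<close>

definition degree_part :: "nat \<Rightarrow> ('a::field_char_0^'n^'n) set" where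
  "degree_part n = (if n = 0 then range (\<lambda>c. mat_scale c (mat 1))
     else if n = 1 then {A. trace A = 0} else UNIV)"

lemma degree_part_simps:
  "A \<in> degree_part 0 \<longleftrightarrow> (\<exists>c. A = mat_scale c (mat 1))"
  "A \<in> degree_part (Suc 0) \<longleftrightarrow> trace A = 0"
  "n \<ge> 2 \<Longrightarrow> A \<in> degree_part n"
  by (auto simp: degree_part_def)

lemma traceless_in_degree_part: "trace A = 0 \<Longrightarrow> n \<ge> 1 \<Longrightarrow> A \<in> degree_part n"
  by (auto simp: degree_part_def)

lemma subspace_degree_part: "mat.subspace (degree_part n)"
proof -
  have "\<exists>d. mat_scale c (mat 1) + mat_scale c' (mat 1) = mat_scale d (mat 1 :: 'a^'n^'n)" for c c' :: 'a
    by (rule exI[of _ "c + c'"]) (simp add: mat.scale_left_distrib)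
  then show ?thesis
    by (auto simp: mat.subspace_def degree_part_def trace_simps trace_def[of 0] image_iff intro: exI[of _ 0])
qed

text \<open>
  For \<open>n \<ge> 1\<close> and \<open>d = 1\<close>: each unit \<open>e\<^sub>i\<^sub>j\<close> is a product of two traceless matrices.
\<close>

lemma degree_part_products:
  fixes S :: "('a::field_char_0^'n^'n) set" and p q :: 'n
  assumes pq: "p \<noteq> q" and S: "mat.subspace S" and d: "d \<le> 1"
    and prod: "\<And>A B. A \<in> degree_part n \<Longrightarrow> B \<in> degree_part d \<Longrightarrow> A ** B \<in> S"
    and C: "C \<in> degree_part (n + d)"
  shows "C \<in> S"
proof (cases "d = 0")
  case True
  have "mat 1 \<in> (degree_part 0 :: ('a^'n^'n) set)"
    by (auto simp: degree_part_simps intro: exI[of _ 1])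
  then show ?thesis using prod[of C "mat 1"] C True by simp
next
  case False
  then have d1: "d = 1" using d by simp
  show ?thesis
  proof (cases "n = 0")
    case True
    have "mat 1 \<in> (degree_part 0 :: ('a^'n^'n) set)"
      by (auto simp: degree_part_simps intro: exI[of _ 1])
    then show ?thesis using prod[of "mat 1" C] C True d1 by simp
  next
    case False
    have prod': "A ** B \<in> S" if "trace A = 0" "trace B = 0" for A B
      using that False d1 by (intro prod traceless_in_degree_part) auto
    have "munit i j \<in> S" for i j
    proof (cases "i = j")
      case True
      obtain l where "l \<noteq> i" using pq by metis
      then show ?thesis using prod'[of "munit i l" "munit l i"] True
        by (simp add: munit_mult trace_munit)
    next
      case False
      then show ?thesis using prod'[of "munit i j" "munit j j - munit i i"]
        by (simp add: munit_mult trace_munit trace_simps mat_mult_bilinear)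
    qed
    then show ?thesis
      by (subst matrix_expansion[of C]) (intro mat.subspace_sum[OF S] mat.subspace_scale[OF S])
  qed
qed

lemma degree_part_mult:
  assumes "A \<in> degree_part m" "B \<in> degree_part n"
  shows "A ** B \<in> degree_part (m + n)"
  using assms subspace_degree_part[of "m + n", THEN mat.subspace_scale]
  by (cases "m = 0"; cases "n = 0")
    (auto simp: degree_part_simps mat_mult_bilinear intro: degree_part_simps(3))

text \<open>
  The letter \<open>(i, a)\<close> stands for the coordinate at the basis element \<open>a\<close> of the value of the variable \<open>x\<^sub>i\<close>.
\<close>

type_synonym ('a, 'n) letter = "nat \<times> ('a, 'n) sqmat"

definition letter_degree :: "('a::field_char_0, 'n::{finite, linorder}) letter \<Rightarrow> nat"
  where "letter_degree v = (if snd v = mat 1 then 0 else 1)"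

definition word_degree :: "('a::field_char_0, 'n::{finite, linorder}) letter list \<Rightarrow> nat"
  where "word_degree ws = (\<Sum>v\<leftarrow>ws. letter_degree v)"

definition monomial :: "('a::field_char_0, 'n::{finite, linorder}) letter list \<Rightarrow> (nat \<Rightarrow> ('a, 'n) sqmat) \<Rightarrow> 'a"
  where "monomial ws b = (\<Prod>(i, a)\<leftarrow>ws. mat_coord a (b i))"

lemma word_degree_simps [simp]:
  "word_degree [] = 0" "word_degree (v # ws) = letter_degree v + word_degree ws"
  by (simp_all add: word_degree_def)

lemma monomial_simps [simp]:
  "monomial [] b = 1" "monomial (v # ws) b = mat_coord (snd v) (b (fst v)) * monomial ws b"
  by (simp_all add: monomial_def split_def)

definition valid_word :: "('a::field_char_0, 'n::{finite, linorder}) letter list \<Rightarrow> bool"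
  where "valid_word ws \<longleftrightarrow> snd ` set ws \<subseteq> mat_basis"

lemma valid_word_simps [simp]:
  "valid_word []" "valid_word (v # ws) \<longleftrightarrow> snd v \<in> mat_basis \<and> valid_word ws"
  by (auto simp: valid_word_def)

text \<open>
  A homomorphism \<open>h\<close> from the free \<open>L\<close>-algebra to an algebra satisfying the two identities. The aim is that \<open>h\<close>
  kills all identities of the matrix algebra.
\<close>

locale matrix_variety = matrix_identities scale act p q t
  for scale :: "'a::field_char_0 \<Rightarrow> 'r::ring \<Rightarrow> 'r"
    and act :: "('a, 'n::{finite, linorder}) der \<Rightarrow> 'r \<Rightarrow> 'r" and p q t +
  fixes h :: "('a, 'n) lpoly \<Rightarrow> 'r"
  assumes h_simps: "h (f + g) = h f + h g" "h (f * g) = h f * h g" "h (lp_scale c f) = scale c (h f)"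
    "h (lp_act u f) = U u (h f)"
begin

abbreviation var :: "nat \<Rightarrow> 'r" where "var i \<equiv> h (lp_var i 1)"

text \<open>
  The equivariant map that plays the role of \<open>A \<mapsto> v A\<close> for a scalar letter \<open>v\<close>. For the coordinate at the identity
  matrix it carries the invariant part at \<open>A = 1\<close> and vanishes on traceless matrices.
\<close>

definition letter_map :: "('a, 'n) letter \<Rightarrow> ('a, 'n) sqmat \<Rightarrow> 'r" where
  "letter_map v = (if snd v = mat 1 then (\<lambda>A. scale (trace A / of_nat CARD('n)) (inv_part (var (fst v))))
     else coef (mat_coord (snd v)) (var (fst v)))"

lemma coord_functional:
  assumes "a \<in> mat_basis" "a \<noteq> mat 1" shows "is_functional (mat_coord a)"
  using mat_coord_simps(3)[of "mat 1" a] assms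
  by (auto simp: is_functional_def mat_coord_simps(1,2) mat_basis_def)

lemma letter_map_equivariant:
  assumes "snd v \<in> mat_basis"
  shows "equivariant (letter_map v)"
proof (cases "snd v = mat 1")
  case True
  then have "letter_map v = (\<lambda>A. scale (1 / of_nat CARD('n)) (scale (trace A) (inv_part (var (fst v)))))"
    by (simp add: letter_map_def fun_eq_iff)
  then show ?thesis
    by (simp only:) (rule equivariant_combine(2)[OF scalar_map_equivariant[OF invariant_inv_part]
        scalar_map_equivariant[OF invariant_inv_part]])
next
  case False
  then show ?thesis using coef_equivariant[OF coord_functional[OF assms False]] by (simp add: letter_map_def)
qed

text \<open>
  The same decomposition, along the basis with respect to which elementary maps are defined.
\<close>

lemma expansion_basis: "r = inv_part r + (\<Sum>a\<in>sl_basis. coef (mat_coord a) r a)"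
proof -
  obtain \<gamma> :: "('a, 'n) uea" where \<gamma>: "\<And>A. mat_act \<gamma> A = mat_scale (trace A / of_nat CARD('n)) (mat 1)"
    using center by blast
  have "\<exists>u :: ('a, 'n) uea. \<forall>A. mat_act u A = mat_scale (mat_coord a A) (traceless_part a)"
    if "a \<in> sl_basis" for a
    using that mat_one_notin_sl_basis by (intro dense coord_functional) (auto simp: mat_basis_def)
  then obtain u :: "('a, 'n) sqmat \<Rightarrow> ('a, 'n) uea" where u: "\<And>a A. a \<in> sl_basis \<Longrightarrow> mat_act (u a) A = mat_scale (mat_coord a A) (traceless_part a)"
    by metis
  have "mat_act (\<Sum>a\<in>sl_basis. u a) A = traceless_part A" for A
  proof -
    have "mat_act (\<Sum>a\<in>sl_basis. u a) A = (\<Sum>a\<in>sl_basis. mat_scale (mat_coord a A) a)"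
      unfolding mat_module.ue_rep_more
      by (intro sum.cong refl) (simp add: u traceless_part_id sl_basis_traceless)
    also have "\<dots> = A - mat_scale (mat_coord (mat 1) A) (mat 1)"
    proof -
      have "finite (sl_basis :: ('a, 'n) sqmat set)"
        using finite_mat_basis[where 'a = 'a and 'n = 'n] by (simp add: mat_basis_def)
      then have "A = mat_scale (mat_coord (mat 1) A) (mat 1) + (\<Sum>a\<in>sl_basis. mat_scale (mat_coord a A) a)"
        using mat_coord_simps(5)[of A] mat_one_notin_sl_basis[where 'a = 'a and 'n = 'n]
        by (simp add: mat_basis_def)
      then show ?thesis by (simp add: algebra_simps)
    qed
    finally show ?thesis by (simp add: mat_coord_one traceless_part_def)
  qed
  then have "U 1 r = U \<gamma> r + U (\<Sum>a\<in>sl_basis. u a) r"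
    by (intro U_combination) (simp add: \<gamma> mat_rep.ue_rep_simps traceless_part_def)
  also have "U (\<Sum>a\<in>sl_basis. u a) r = (\<Sum>a\<in>sl_basis. coef (mat_coord a) r a)"
    unfolding ue_rep_more by (intro sum.cong refl coef_eq[symmetric]) (simp add: u)
  finally show ?thesis by (simp add: inv_part_eq[OF \<gamma>] ue_rep_simps)
qed

lemma variable_expansion: "h (lp_var i u) = (\<Sum>a\<in>mat_basis. letter_map (i, a) (mat_act u a))"
proof -
  have fin: "finite (sl_basis :: ('a, 'n) sqmat set)"
    using finite_mat_basis[where 'a = 'a and 'n = 'n] by (simp add: mat_basis_def)
  have "var i = (\<Sum>a\<in>mat_basis. letter_map (i, a) a)"
  proof -
    have "(\<Sum>a\<in>sl_basis. letter_map (i, a) a) = (\<Sum>a\<in>sl_basis. coef (mat_coord a) (var i) a)"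
      using mat_one_notin_sl_basis by (intro sum.cong refl) (auto simp: letter_map_def)
    then show ?thesis
      using expansion_basis[of "var i"] fin mat_one_notin_sl_basis[where 'a = 'a and 'n = 'n]
      by (simp add: mat_basis_def) (simp add: letter_map_def trace_simps)
  qed
  moreover have "h (lp_var i u) = U u (var i)"
    using h_simps(4)[of u "lp_var i 1"] by (simp add: lp_act_var)
  ultimately have "h (lp_var i u) = (\<Sum>a\<in>mat_basis. U u (letter_map (i, a) a))"
    by (simp add: ue_rep_more)
  then show ?thesis
    by (simp add: equivariant_ue_rep[OF letter_map_equivariant])
qed

text \<open>
  Only for a word of positive degree and a traceless letter
  is it the product of the two maps; in the other cases one factor is an invariant, and only its value at the identity
  matrix enters.
\<close>

definition extend_map :: "nat \<Rightarrow> (('a, 'n) sqmat \<Rightarrow> 'r) \<Rightarrow> ('a, 'n) letter \<Rightarrow> ('a, 'n) sqmat \<Rightarrow> 'r" where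
  "extend_map n Z v = (if snd v = mat 1 then (\<lambda>A. Z A * letter_map v (mat 1))
     else if n = 0 then (\<lambda>A. Z (mat 1) * letter_map v A)
     else (SOME \<omega>. product_of Z (letter_map v) \<omega>))"

text \<open>
  The equivariant map that plays the role of \<open>A \<mapsto> v\<^sub>n \<cdots> v\<^sub>1 A\<close>. Words grow at the front while the matrix factors of a
  product grow on the right. The empty word gets a default value, as the algebras have no unit.
\<close>

fun word_map :: "('a, 'n) letter list \<Rightarrow> ('a, 'n) sqmat \<Rightarrow> 'r" where
  "word_map [] = (\<lambda>_. 0)"
| "word_map [v] = letter_map v"
| "word_map (v # w # ws) = extend_map (word_degree (w # ws)) (word_map (w # ws)) v"

lemma letter_map_one_invariant:
  assumes "snd v = mat 1" shows "invariant (letter_map v (mat 1))"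
  using assms invariant_inv_part by (simp add: letter_map_def trace_simps)

lemma equivariant_one_invariant: "equivariant Z \<Longrightarrow> invariant (Z (mat 1))"
  by (simp add: invariant_def equivariantD)

lemma product_of_extend:
  assumes "equivariant Z" "snd v \<in> mat_basis" "snd v \<noteq> mat 1" "n \<noteq> 0"
  shows "product_of Z (letter_map v) (extend_map n Z v)"
proof -
  have "\<exists>\<omega>. product_of Z (letter_map v) \<omega>"
    using product_exists[OF assms(1) letter_map_equivariant[OF assms(2)]] by blast
  from someI_ex[OF this] show ?thesis using assms by (simp add: extend_map_def)
qed

lemma product_of_central:
  assumes Z: "product_of \<xi> \<eta> Z" and \<kappa>: "invariant \<kappa>"
  shows "product_of \<xi> (\<lambda>A. \<eta> A * \<kappa>) (\<lambda>A. Z A * \<kappa>)"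
proof -
  from Z have eq: "equivariant \<xi>" "equivariant \<eta>" "equivariant Z" by (auto simp: product_of_def)
  have "\<xi> A * (\<eta> B * \<kappa>) = Z (A ** B) * \<kappa> \<and> \<eta> A * \<kappa> * \<xi> B = Z (A ** B) * \<kappa>"
    if "trace A = 0" "trace B = 0" for A B
  proof -
    have "\<xi> A * \<eta> B = Z (A ** B)" "\<eta> A * \<xi> B = Z (A ** B)" using Z that by (auto simp: product_of_def)
    moreover have "\<kappa> * \<xi> B = \<xi> B * \<kappa>" by (rule invariant_central[OF \<kappa>])
    ultimately show ?thesis by (metis mult.assoc)
  qed
  then show ?thesis
    using eq equivariant_combine(3)[OF eq(2) eq(2) \<kappa>] equivariant_combine(3)[OF eq(3) eq(3) \<kappa>]
    by (simp add: product_of_def)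
qed

lemma word_map_properties:
  assumes "valid_word ws" "ws \<noteq> []"
  shows "equivariant (word_map ws) \<and> (word_degree ws \<ge> 2 \<longrightarrow> (\<exists>\<xi> \<eta>. product_of \<xi> \<eta> (word_map ws)))"
  using assms
proof (induction ws rule: word_map.induct)
  case (2 v)
  then show ?case using letter_map_equivariant[of v] by (simp add: letter_degree_def)
next
  case (3 v w ws)
  let ?Z = "word_map (w # ws)"
  have Z: "equivariant ?Z" "word_degree (w # ws) \<ge> 2 \<Longrightarrow> \<exists>\<xi> \<eta>. product_of \<xi> \<eta> ?Z"
    using 3 by auto
  have v: "snd v \<in> mat_basis" using 3 by simp
  consider "snd v = mat 1" | "snd v \<noteq> mat 1" "word_degree (w # ws) = 0" | "snd v \<noteq> mat 1" "word_degree (w # ws) \<noteq> 0"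
    by blast
  then show ?case
  proof cases
    case 1
    have "equivariant (\<lambda>A. ?Z A * letter_map v (mat 1))"
      by (rule equivariant_combine(3)[OF Z(1) Z(1) letter_map_one_invariant[OF 1]])
    moreover have "\<exists>\<xi> \<eta>. product_of \<xi> \<eta> (\<lambda>A. ?Z A * letter_map v (mat 1))" if "word_degree (v # w # ws) \<ge> 2"
      using that Z(2) product_of_central[OF _ letter_map_one_invariant[OF 1]] 1
      by (simp add: letter_degree_def) blast
    ultimately show ?thesis using 1 by (simp add: extend_map_def)
  next
    case 2
    have "equivariant (\<lambda>A. ?Z (mat 1) * letter_map v A)"
      using letter_map_equivariant[OF v] equivariant_one_invariant[OF Z(1)]
      by (intro equivariant_combine(4))
    then show ?thesis using 2 by (simp add: extend_map_def letter_degree_def)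
  next
    case 3
    from product_of_extend[OF Z(1) v 3] show ?thesis
      by (simp only: word_map.simps) (auto simp: product_of_def)
  qed
qed simp

text \<open>
  In degree at least 2 the word map is itself a product, and \<open>composite_product\<close> covers matrices of non-zero trace; in
  degree 1 these do not occur.
\<close>

lemma word_map_step:
  assumes valid: "valid_word (v # ws)" "ws \<noteq> []"
    and A: "A \<in> degree_part (word_degree ws)" and B: "B \<in> degree_part (letter_degree v)"
  shows "word_map ws A * letter_map v B = word_map (v # ws) (A ** B)"
proof -
  have Z: "equivariant (word_map ws)" "word_degree ws \<ge> 2 \<Longrightarrow> \<exists>\<xi> \<eta>. product_of \<xi> \<eta> (word_map ws)"
    using word_map_properties[of ws] valid by auto
  have v: "snd v \<in> mat_basis" using valid by simp
  note L = letter_map_equivariant[OF v]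
  have unfold: "word_map (v # ws) = extend_map (word_degree ws) (word_map ws) v"
    using valid(2) by (cases ws) auto
  consider "snd v = mat 1" | "snd v \<noteq> mat 1" "word_degree ws = 0" | "snd v \<noteq> mat 1" "word_degree ws = 1"
    | "snd v \<noteq> mat 1" "word_degree ws \<ge> 2" by linarith
  then show ?thesis
  proof cases
    case 1
    then obtain c where "B = mat_scale c (mat 1)" using B by (auto simp: letter_degree_def degree_part_simps)
    then show ?thesis unfolding unfold
      by (simp add: extend_map_def 1 equivariantD(2)[OF L] equivariantD(2)[OF Z(1)] mat_mult_bilinear
          scale_mult_left scale_mult_right)
  next
    case 2
    then obtain c where "A = mat_scale c (mat 1)" using A by (auto simp: degree_part_simps)
    then show ?thesis unfolding unfold
      by (simp add: extend_map_def 2 equivariantD(2)[OF L] equivariantD(2)[OF Z(1)]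
          scale_mult_left scale_mult_right)
  next
    case 3
    have "product_of (word_map ws) (letter_map v) (word_map (v # ws))"
      unfolding unfold by (rule product_of_extend[OF Z(1) v]) (use 3 in simp_all)
    then show ?thesis using A B 3
      by (simp add: product_of_def degree_part_simps letter_degree_def)
  next
    case 4
    have pr: "product_of (word_map ws) (letter_map v) (word_map (v # ws))"
      unfolding unfold by (rule product_of_extend[OF Z(1) v]) (use 4 in simp_all)
    obtain \<xi> \<eta> where "product_of \<xi> \<eta> (word_map ws)" using Z(2) 4 by blast
    from composite_product[OF this L pr] show ?thesis
      using B 4 by (simp add: degree_part_simps letter_degree_def)
  qed
qed

lemma equivariant_eq_on_products:
  assumes Z: "equivariant Z" and Z': "equivariant Z'" and d: "d \<le> 1"
    and eq: "\<And>A B. A \<in> degree_part n \<Longrightarrow> B \<in> degree_part d \<Longrightarrow> Z (A ** B) = Z' (A ** B)"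
    and C: "C \<in> degree_part (n + d)"
  shows "Z C = Z' C"
proof -
  have "C \<in> {C. Z C = Z' C}"
    by (rule degree_part_products[OF pq _ d _ C])
      (auto simp: mat.subspace_def equivariantD[OF Z] equivariantD[OF Z'] eq)
  then show ?thesis by simp
qed

lemma letter_degree_le_1: "letter_degree v \<le> 1" by (simp add: letter_degree_def)

text \<open>
  The induction over transpositions needs a transitive relation, so validity and the equality of multisets are part of
  it.
\<close>

definition word_equiv :: "('a, 'n) letter list \<Rightarrow> ('a, 'n) letter list \<Rightarrow> bool" where
  "word_equiv ws ws' \<longleftrightarrow> (valid_word ws \<longrightarrow> mset ws = mset ws' \<and>
     (\<forall>A\<in>degree_part (word_degree ws). word_map ws A = word_map ws' A))"

lemma word_degree_mset: "mset ws = mset ws' \<Longrightarrow> word_degree ws = word_degree ws'"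
  unfolding word_degree_def by (metis mset_map sum_mset_sum_list)

lemma valid_word_mset: "mset ws = mset ws' \<Longrightarrow> valid_word ws \<longleftrightarrow> valid_word ws'"
  unfolding valid_word_def by (metis set_mset_mset)

text \<open>
  Two traceless letters can be exchanged because \<open>product_of\<close> is symmetric; the value of a letter at the identity matrix
  is central.
\<close>

lemma letter_products_commute:
  assumes "snd u \<in> mat_basis" "snd v \<in> mat_basis"
    and B: "B \<in> degree_part (letter_degree v)" and C: "C \<in> degree_part (letter_degree u)"
  obtains B' C' where "B' \<in> degree_part (letter_degree u)" "C' \<in> degree_part (letter_degree v)"
    "letter_map v B * letter_map u C = letter_map u B' * letter_map v C'" "B ** C = B' ** C'"
proof -
  note L = letter_map_equivariant[OF assms(1)] letter_map_equivariant[OF assms(2)]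
  consider "snd u = mat 1" | "snd v = mat 1" | "snd u \<noteq> mat 1" "snd v \<noteq> mat 1" by blast
  then show ?thesis
  proof cases
    case 1
    then obtain c where c: "C = mat_scale c (mat 1)" using C by (auto simp: letter_degree_def degree_part_simps)
    have "letter_map v B * letter_map u C = letter_map u C * letter_map v B"
      using invariant_central[OF letter_map_one_invariant[OF 1], of "letter_map v B"]
      by (simp add: c equivariantD(2)[OF L(1)] scale_mult_left scale_mult_right)
    then show ?thesis using that[OF C B] by (simp add: c mat_mult_bilinear)
  next
    case 2
    then obtain c where c: "B = mat_scale c (mat 1)" using B by (auto simp: letter_degree_def degree_part_simps)
    have "letter_map v B * letter_map u C = letter_map u C * letter_map v B"
      using invariant_central[OF letter_map_one_invariant[OF 2], of "letter_map u C"]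
      by (simp add: c equivariantD(2)[OF L(2)] scale_mult_left scale_mult_right)
    then show ?thesis using that[OF C B] by (simp add: c mat_mult_bilinear)
  next
    case 3
    then have tr: "trace B = 0" "trace C = 0" using B C by (simp_all add: letter_degree_def degree_part_simps)
    obtain \<zeta> where "product_of (letter_map v) (letter_map u) \<zeta>" using product_exists[OF L(2,1)] by blast
    then have "letter_map v B * letter_map u C = letter_map u B * letter_map v C"
      using tr by (simp add: product_of_def)
    then show ?thesis using that[of B C] tr 3 by (simp add: letter_degree_def degree_part_simps)
  qed
qed

text \<open>
  A matrix of the degree of the whole word is a sum of products with one factor for \<open>ws\<close> and one for each of the two
  letters, and the values of the two letters can be exchanged.
\<close>

lemma word_map_swap_letters: "word_equiv (u # v # ws) (v # u # ws)"
  unfolding word_equiv_def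
proof (intro impI conjI ballI)
  assume valid: "valid_word (u # v # ws)"
  then have uv: "snd u \<in> mat_basis" "snd v \<in> mat_basis" by auto
  have eq: "equivariant (word_map (u # v # ws))" "equivariant (word_map (v # u # ws))"
    using word_map_properties[of "u # v # ws"] word_map_properties[of "v # u # ws"] valid by auto
  have two: "word_map (u # v # ws) (A ** (B ** C)) = word_map (v # u # ws) (A ** (B ** C))"
    if A: "A \<in> degree_part (word_degree ws)" and B: "B \<in> degree_part (letter_degree v)"
      and C: "C \<in> degree_part (letter_degree u)" for A B C
  proof -
    obtain B' C' where sw: "B' \<in> degree_part (letter_degree u)" "C' \<in> degree_part (letter_degree v)"
      "letter_map v B * letter_map u C = letter_map u B' * letter_map v C'" "B ** C = B' ** C'"
      by (rule letter_products_commute[OF uv B C])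
    show ?thesis
    proof (cases "ws = []")
      case True
      then obtain c where c: "A = mat_scale c (mat 1)" using A by (auto simp: degree_part_simps)
      have "word_map (u # v # ws) (B ** C) = letter_map v B * letter_map u C"
        using word_map_step[of u "[v]" B C] valid B C True by (simp del: word_map.simps(3))
      moreover have "word_map (v # u # ws) (B' ** C') = letter_map u B' * letter_map v C'"
        using word_map_step[of v "[u]" B' C'] valid sw True by (simp del: word_map.simps(3))
      ultimately show ?thesis
        using sw by (simp add: c mat_mult_bilinear equivariantD(2)[OF eq(1)] equivariantD(2)[OF eq(2)]
            del: word_map.simps)
    next
      case False
      have "word_map (u # v # ws) (A ** B ** C) = word_map ws A * letter_map v B * letter_map u C"
        using valid False A B C degree_part_mult[OF A B]
        by (simp add: word_map_step[symmetric] add.commute del: word_map.simps)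
      also have "\<dots> = word_map ws A * letter_map u B' * letter_map v C'"
        using sw(3) by (simp add: mult.assoc)
      also have "\<dots> = word_map (v # u # ws) (A ** B' ** C')"
        using valid False A sw(1,2) degree_part_mult[OF A sw(1)]
        by (simp add: word_map_step[symmetric] add.commute del: word_map.simps)
      finally show ?thesis using sw(4) by (simp flip: matrix_mul_assoc)
    qed
  qed
  fix M :: "('a, 'n) sqmat" assume M: "M \<in> degree_part (word_degree (u # v # ws))"
  show "word_map (u # v # ws) M = word_map (v # u # ws) M"
  proof (rule equivariant_eq_on_products[OF eq letter_degree_le_1])
    show "M \<in> degree_part ((word_degree ws + letter_degree v) + letter_degree u)" using M by (simp add: ac_simps)
    fix X C :: "('a, 'n) sqmat"
    assume X: "X \<in> degree_part (word_degree ws + letter_degree v)" and C: "C \<in> degree_part (letter_degree u)"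
    have "X \<in> {X. word_map (u # v # ws) (X ** C) = word_map (v # u # ws) (X ** C)}"
      by (rule degree_part_products[OF pq _ letter_degree_le_1 _ X])
        (auto simp: mat.subspace_def equivariantD[OF eq(1)] equivariantD[OF eq(2)] mat_mult_bilinear
          two[OF _ _ C] simp flip: matrix_mul_assoc simp del: word_map.simps)
    then show "word_map (u # v # ws) (X ** C) = word_map (v # u # ws) (X ** C)" by simp
  qed
qed simp

lemma word_map_cons_cong:
  assumes "word_equiv ws ws'" shows "word_equiv (v # ws) (v # ws')"
  unfolding word_equiv_def
proof (intro impI conjI ballI)
  assume valid: "valid_word (v # ws)"
  then have eqv: "mset ws = mset ws'" "\<And>A. A \<in> degree_part (word_degree ws) \<Longrightarrow> word_map ws A = word_map ws' A"
    using assms by (auto simp: word_equiv_def)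
  show "mset (v # ws) = mset (v # ws')" using eqv by simp
  fix M :: "('a, 'n) sqmat" assume M: "M \<in> degree_part (word_degree (v # ws))"
  show "word_map (v # ws) M = word_map (v # ws') M"
  proof (cases "ws = []")
    case False
    then have False': "ws' \<noteq> []" using eqv by auto
    have valid': "valid_word (v # ws')" using valid valid_word_mset[OF eqv(1)] by simp
    have eq: "equivariant (word_map (v # ws))" "equivariant (word_map (v # ws'))"
      using word_map_properties[of "v # ws"] word_map_properties[of "v # ws'"] valid valid' by blast+
    show ?thesis
    proof (rule equivariant_eq_on_products[OF eq letter_degree_le_1])
      show "M \<in> degree_part (word_degree ws + letter_degree v)" using M by (simp add: ac_simps)
      fix A B :: "('a, 'n) sqmat"
      assume AB: "A \<in> degree_part (word_degree ws)" "B \<in> degree_part (letter_degree v)"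
      have "word_map (v # ws) (A ** B) = word_map ws A * letter_map v B"
        by (rule word_map_step[OF valid False AB, symmetric])
      also have "\<dots> = word_map (v # ws') (A ** B)"
        using word_map_step[OF valid' False' _ AB(2)] AB(1) word_degree_mset[OF eqv(1)] by (simp add: eqv(2))
      finally show "word_map (v # ws) (A ** B) = word_map (v # ws') (A ** B)" .
    qed
  qed (use eqv in simp)
qed

text \<open>
  The letters behave like commuting scalars.
\<close>

lemma word_map_mset:
  assumes "mset ws = mset ws'" "valid_word ws" "A \<in> degree_part (word_degree ws)"
  shows "word_map ws A = word_map ws' A"
proof -
  have "word_equiv ws ws'"
  proof (rule mset_eq_swap_induct[OF _ _ _ _ assms(1)])
    show "word_equiv xs zs" if "word_equiv xs ys" "word_equiv ys zs" for xs ys zs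
      using that unfolding word_equiv_def by (metis valid_word_mset word_degree_mset)
    show "word_equiv xs xs" for xs by (simp add: word_equiv_def)
    show "word_equiv (v # xs) (v # ys)" if "word_equiv xs ys" for v xs ys
      using that by (rule word_map_cons_cong)
    show "word_equiv (u # v # xs) (v # u # xs)" for u v xs by (rule word_map_swap_letters)
  qed
  then show ?thesis using assms by (simp add: word_equiv_def)
qed

lemma sum_list_concat_map:
  "sum_list (map F (concat (map G ts))) = (\<Sum>t\<leftarrow>ts. sum_list (map F (G t)))"
  by (induction ts) auto

text \<open>
  \<open>f\<close> is evaluated by one and the same list of words and matrices in \<open>R\<close> and in the matrix algebra, with words
  from \<open>\<Omega>\<close>. Lists rather than sets allow repeated terms.
\<close>

definition represented :: "('a, 'n) letter list set \<Rightarrow> ('a, 'n) lpoly \<Rightarrow> bool" where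
  "represented \<Omega> f \<longleftrightarrow> (\<exists>ts. (\<forall>(ws, m)\<in>set ts. ws \<in> \<Omega> \<and> ws \<noteq> [] \<and> valid_word ws \<and> m \<in> degree_part (word_degree ws)) \<and>
     h f = (\<Sum>(ws, m)\<leftarrow>ts. word_map ws m) \<and>
     (\<forall>b. lp_subst b f = (\<Sum>(ws, m)\<leftarrow>ts. mat_scale (monomial ws b) m)))"

lemma represented_mono: "represented \<Omega> f \<Longrightarrow> \<Omega> \<subseteq> \<Omega>' \<Longrightarrow> represented \<Omega>' f"
  unfolding represented_def by (elim exE, rule exI) (auto split: prod.splits)

lemma represented_add:
  assumes "represented \<Omega> f" "represented \<Omega> g"
  shows "represented \<Omega> (f + g)"
proof -
  from assms obtain ts us where
    "\<forall>(ws, m)\<in>set ts. ws \<in> \<Omega> \<and> ws \<noteq> [] \<and> valid_word ws \<and> m \<in> degree_part (word_degree ws)"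
    "h f = (\<Sum>(ws, m)\<leftarrow>ts. word_map ws m)" "\<forall>b. lp_subst b f = (\<Sum>(ws, m)\<leftarrow>ts. mat_scale (monomial ws b) m)"
    "\<forall>(ws, m)\<in>set us. ws \<in> \<Omega> \<and> ws \<noteq> [] \<and> valid_word ws \<and> m \<in> degree_part (word_degree ws)"
    "h g = (\<Sum>(ws, m)\<leftarrow>us. word_map ws m)" "\<forall>b. lp_subst b g = (\<Sum>(ws, m)\<leftarrow>us. mat_scale (monomial ws b) m)"
    unfolding represented_def by blast
  then show ?thesis
    unfolding represented_def by (intro exI[of _ "ts @ us"]) (auto simp: h_simps lp_subst_simps)
qed

lemma mat_basis_list: obtains as where "set as = (mat_basis :: ('a, 'n) sqmat set)" "distinct as"
  using finite_distinct_list[OF finite_mat_basis] by metis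

lemma mat_act_degree_part:
  fixes a :: "('a, 'n) sqmat"
  assumes "a \<in> mat_basis"
  shows "mat_scale c (mat_act u a) \<in> degree_part (letter_degree (i, a))"
proof (cases "a = mat 1")
  case True
  obtain d where "mat_act u (mat 1) = mat_scale d (mat 1 :: ('a, 'n) sqmat)" using mat_act_mat_one by blast
  then show ?thesis using True by (simp add: letter_degree_def degree_part_simps exI[of _ "c * d"])
next
  case False
  then have "a \<in> sl_basis" using assms by (simp add: mat_basis_def)
  then have "trace a = 0" by (rule sl_basis_traceless)
  then show ?thesis using False by (simp add: letter_degree_def degree_part_simps trace_simps trace_mat_act)
qed

lemma subst_variable_expansion:
  "lp_subst b (lp_scale c (lp_var i u)) = (\<Sum>a\<in>mat_basis. mat_scale (mat_coord a (b i)) (mat_scale c (mat_act u a)))"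
proof -
  have "mat_act u (b i) = mat_act u (\<Sum>a\<in>mat_basis. mat_scale (mat_coord a (b i)) a)"
    by (simp add: mat_coord_simps)
  then show ?thesis
    by (simp add: lp_subst_simps mat_module.ue_rep_more mat_rep.ue_rep_simps mat.scale_sum_right mult.commute)
qed

lemma h_variable_expansion:
  "h (lp_scale c (lp_var i u)) = (\<Sum>a\<in>mat_basis. letter_map (i, a) (mat_scale c (mat_act u a)))"
  by (simp add: h_simps variable_expansion scale_sum_right equivariantD(2)[OF letter_map_equivariant])

lemma represented_variable: "represented {[(i, a)] | a. True} (lp_scale c (lp_var i u))"
proof -
  obtain as where as: "set as = (mat_basis :: ('a, 'n) sqmat set)" "distinct as" by (rule mat_basis_list)
  have sum: "(\<Sum>a\<in>mat_basis. F a) = (\<Sum>a\<leftarrow>as. F a)" for F :: "('a, 'n) sqmat \<Rightarrow> 'c::comm_monoid_add"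
    using as by (simp add: sum.distinct_set_conv_list[symmetric])
  show ?thesis
    unfolding represented_def h_variable_expansion subst_variable_expansion sum
    using mat_act_degree_part
    by (intro exI[of _ "map (\<lambda>a. ([(i, a)], mat_scale c (mat_act u a))) as"])
      (auto simp: comp_def as)
qed

text \<open>
  Multiply the list of \<open>f\<close> with the expansion of the variable, term by term.
\<close>

lemma represented_mult_variable:
  assumes "represented \<Omega> f"
  shows "represented {(i, a) # ws | a ws. ws \<in> \<Omega>} (f * lp_scale c (lp_var i u))"
proof -
  obtain as where as: "set as = (mat_basis :: ('a, 'n) sqmat set)" "distinct as" by (rule mat_basis_list)
  have sum: "(\<Sum>a\<in>mat_basis. F a) = (\<Sum>a\<leftarrow>as. F a)" for F :: "('a, 'n) sqmat \<Rightarrow> 'c::comm_monoid_add"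
    using as by (simp add: sum.distinct_set_conv_list[symmetric])
  from assms obtain ts where ts:
    "\<forall>(ws, m)\<in>set ts. ws \<in> \<Omega> \<and> ws \<noteq> [] \<and> valid_word ws \<and> m \<in> degree_part (word_degree ws)"
    "h f = (\<Sum>(ws, m)\<leftarrow>ts. word_map ws m)" "\<And>b. lp_subst b f = (\<Sum>(ws, m)\<leftarrow>ts. mat_scale (monomial ws b) m)"
    unfolding represented_def by blast
  let ?B = "\<lambda>a. mat_scale c (mat_act u a)"
  define G where "G t = map (\<lambda>a. ((i, a) # fst t, snd t ** ?B a)) as" for t :: "('a, 'n) letter list \<times> ('a, 'n) sqmat"
  have valid: "\<forall>(ws, m)\<in>set (concat (map G ts)). ws \<in> {(i, a) # ws | a ws. ws \<in> \<Omega>} \<and> ws \<noteq> [] \<and> valid_word ws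
      \<and> m \<in> degree_part (word_degree ws)"
  proof -
    have "m ** ?B a \<in> degree_part (letter_degree (i, a) + word_degree ws)"
      if "(ws, m) \<in> set ts" "a \<in> mat_basis" for ws m a
      using degree_part_mult[of m "word_degree ws" "?B a" "letter_degree (i, a)"] ts(1) that mat_act_degree_part[of a c u i]
      by (auto simp: add.commute)
    then show ?thesis using ts(1) by (fastforce simp: G_def as)
  qed
  have "h (f * lp_scale c (lp_var i u)) = (\<Sum>t\<leftarrow>ts. word_map (fst t) (snd t) * (\<Sum>a\<leftarrow>as. letter_map (i, a) (?B a)))"
    by (simp only: h_simps(2) ts(2) h_variable_expansion sum sum_list_mult_const split_def)
  also have "\<dots> = (\<Sum>t\<leftarrow>ts. \<Sum>a\<leftarrow>as. word_map (fst t) (snd t) * letter_map (i, a) (?B a))"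
    by (simp only: sum_list_const_mult)
  also have "\<dots> = (\<Sum>t\<leftarrow>ts. \<Sum>a\<leftarrow>as. word_map ((i, a) # fst t) (snd t ** ?B a))"
  proof (intro arg_cong[of _ _ sum_list] map_cong refl)
    fix t a assume "t \<in> set ts" "a \<in> set as"
    then show "word_map (fst t) (snd t) * letter_map (i, a) (?B a) = word_map ((i, a) # fst t) (snd t ** ?B a)"
      using ts(1) as mat_act_degree_part[of a c u i] by (intro word_map_step) auto
  qed
  also have "\<dots> = (\<Sum>(ws, m)\<leftarrow>concat (map G ts). word_map ws m)"
    by (simp add: sum_list_concat_map G_def comp_def split_def)
  finally have h: "h (f * lp_scale c (lp_var i u)) = (\<Sum>(ws, m)\<leftarrow>concat (map G ts). word_map ws m)" .
  have mult: "(\<Sum>t\<leftarrow>us. F t) ** X = (\<Sum>t\<leftarrow>us. F t ** X)" "X ** (\<Sum>a\<leftarrow>bs. K a) = (\<Sum>a\<leftarrow>bs. X ** K a)"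
    for us :: "'u list" and bs :: "'v list" and X :: "('a, 'n) sqmat"
      and F :: "'u \<Rightarrow> ('a, 'n) sqmat" and K :: "'v \<Rightarrow> ('a, 'n) sqmat"
    by (induction us, simp_all add: mat_mult_bilinear) (induction bs, simp_all add: mat_mult_bilinear)
  have "lp_subst b (f * lp_scale c (lp_var i u)) = (\<Sum>(ws, m)\<leftarrow>concat (map G ts). mat_scale (monomial ws b) m)" for b
  proof -
    have prod: "(\<Sum>t\<leftarrow>us. F t) ** (\<Sum>a\<leftarrow>bs. K a) = (\<Sum>t\<leftarrow>us. \<Sum>a\<leftarrow>bs. F t ** K a)"
      for us :: "'u list" and bs :: "'v list" and F :: "'u \<Rightarrow> ('a, 'n) sqmat" and K :: "'v \<Rightarrow> ('a, 'n) sqmat"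
      unfolding mult(1) unfolding mult(2) by (rule refl)
    show ?thesis
      unfolding lp_subst_simps(2) ts(3) subst_variable_expansion sum split_def prod
      by (simp add: sum_list_concat_map G_def comp_def split_def mat_mult_bilinear mult_ac)
  qed
  then show ?thesis unfolding represented_def using valid h by blast
qed

lemma represented_all: "represented UNIV f"
proof -
  have "represented UNIV f \<and> (\<forall>g. represented UNIV g \<longrightarrow> represented UNIV (g * f))"
  proof (induction f rule: lpoly_induct)
    case (var i u c)
    have "represented UNIV (g * lp_scale c (lp_var i u))" if "represented UNIV g" for g
      by (rule represented_mono[OF represented_mult_variable[OF that] subset_UNIV])
    then show ?case using represented_mono[OF represented_variable subset_UNIV] by simp
  next
    case (add f g)
    then show ?case by (auto simp: distrib_left intro: represented_add)
  next
    case (mult f g)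
    then show ?case by (auto simp flip: mult.assoc)
  qed
  then show ?thesis ..
qed

lemma coordinates_free:
  fixes y :: "('a, 'n) letter \<Rightarrow> 'a"
  obtains b :: "nat \<Rightarrow> ('a, 'n) sqmat" where "\<And>i a. a \<in> mat_basis \<Longrightarrow> mat_coord a (b i) = y (i, a)"
proof
  show "mat_coord a (\<Sum>m\<in>mat_basis. mat_scale (y (i, m)) m) = y (i, a)" if "a \<in> mat_basis" for i a
    using that by (simp add: mat_coord_sum mat_coord_simps finite_mat_basis if_distrib cong: if_cong)
qed

text \<open>
  If a list of words vanishes for all matrices then, monomials in independent coordinates being independent, the matrices
  of the words with the same letters sum to zero. The word map depends only on the letters, so it can be taken out of
  that sum.
\<close>

lemma vanishing_representation:
  assumes "\<forall>(ws, m)\<in>set ts. ws \<noteq> [] \<and> valid_word ws \<and> m \<in> degree_part (word_degree ws)"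
    and "\<And>b. (\<Sum>(ws, m)\<leftarrow>ts. mat_scale (monomial ws b) m) = (0 :: ('a, 'n) sqmat)"
  shows "(\<Sum>(ws, m)\<leftarrow>ts. word_map ws m) = 0"
proof -
  have group: "(\<Sum>s\<leftarrow>filter (\<lambda>s. mset (fst s) = M) ts. snd s) = 0" for M
  proof -
    have "(\<Sum>s\<leftarrow>filter (\<lambda>s. mset (fst s) = M) ts. snd s $ k $ l) = 0" for k l
    proof (rule word_monomials_independent)
      fix y :: "('a, 'n) letter \<Rightarrow> 'a"
      obtain b :: "nat \<Rightarrow> ('a, 'n) sqmat" where b: "\<And>i a. a \<in> mat_basis \<Longrightarrow> mat_coord a (b i) = y (i, a)"
        by (rule coordinates_free[of y]) (rule that)
      have mono: "monomial ws b = (\<Prod>v\<leftarrow>ws. y v)" if "valid_word ws" for ws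
        using that by (induction ws) (auto simp: b)
      have nth: "(\<Sum>s\<leftarrow>us. F s) $ k $ l = (\<Sum>s\<leftarrow>us. F s $ k $ l)" for us :: "'u list" and F :: "'u \<Rightarrow> ('a, 'n) sqmat"
        by (induction us) auto
      have "(\<Sum>s\<leftarrow>ts. snd s $ k $ l * (\<Prod>v\<leftarrow>fst s. y v)) = (\<Sum>s\<leftarrow>ts. mat_scale (monomial (fst s) b) (snd s) $ k $ l)"
        using assms(1) by (intro arg_cong[of _ _ sum_list] map_cong refl) (auto simp: mono)
      also have "\<dots> = (\<Sum>(ws, m)\<leftarrow>ts. mat_scale (monomial ws b) m) $ k $ l"
        by (simp add: nth split_def)
      finally show "(\<Sum>s\<leftarrow>ts. snd s $ k $ l * (\<Prod>v\<leftarrow>fst s. y v)) = 0" by (simp add: assms(2))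
    qed
    moreover have "(\<Sum>s\<leftarrow>us. snd s) $ k $ l = (\<Sum>s\<leftarrow>us. snd s $ k $ l)" for us :: "(('a, 'n) letter list \<times> ('a, 'n) sqmat) list" and k l
      by (induction us) auto
    ultimately show ?thesis by (simp add: vec_eq_iff)
  qed
  have "(\<Sum>s\<leftarrow>filter (\<lambda>s. mset (fst s) = M) ts. word_map (fst s) (snd s)) = 0" for M
  proof (cases "filter (\<lambda>s. mset (fst s) = M) ts")
    case (Cons s0 rest)
    let ?us = "filter (\<lambda>s. mset (fst s) = M) ts"
    have "s0 \<in> set ?us" unfolding Cons by simp
    then have s0: "s0 \<in> set ts" "mset (fst s0) = M" by auto
    have eq: "equivariant (word_map (fst s0))" using word_map_properties[of "fst s0"] assms(1) s0 by auto
    have "(\<Sum>s\<leftarrow>?us. word_map (fst s) (snd s)) = (\<Sum>s\<leftarrow>?us. word_map (fst s0) (snd s))"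
      using assms(1) s0 by (intro arg_cong[of _ _ sum_list] map_cong refl word_map_mset) auto
    also have "\<dots> = word_map (fst s0) (\<Sum>s\<leftarrow>?us. snd s)"
    proof -
      have "(\<Sum>s\<leftarrow>us. word_map (fst s0) (snd s)) = word_map (fst s0) (\<Sum>s\<leftarrow>us. snd s)"
        for us :: "(('a, 'n) letter list \<times> ('a, 'n) sqmat) list"
        by (induction us) (simp_all add: equivariantD[OF eq])
      then show ?thesis .
    qed
    finally show ?thesis by (simp only: group equivariantD(4)[OF eq])
  qed simp
  then show ?thesis
    using sum_list_group[of "(\<lambda>s. mset (fst s)) ` set ts" "\<lambda>s. mset (fst s)" ts "\<lambda>s. word_map (fst s) (snd s)"]
    by (simp add: split_def)
qed

theorem identity_vanishes:
  assumes "f \<in> Id_L" shows "h f = 0"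
proof -
  obtain ts where ts: "\<forall>(ws, m)\<in>set ts. ws \<in> UNIV \<and> ws \<noteq> [] \<and> valid_word ws \<and> m \<in> degree_part (word_degree ws)"
    "h f = (\<Sum>(ws, m)\<leftarrow>ts. word_map ws m)" "\<And>b. lp_subst b f = (\<Sum>(ws, m)\<leftarrow>ts. mat_scale (monomial ws b) m)"
    using represented_all[of f] unfolding represented_def by blast
  have "(\<Sum>(ws, m)\<leftarrow>ts. mat_scale (monomial ws b) m) = 0" for b
    using assms ts(3)[of b] by (simp add: Id_L_def)
  then show ?thesis unfolding ts(2) using ts(1) by (intro vanishing_representation) auto
qed

end

section \<open>Codimensions\<close>

text \<open>
  \<^const>\<open>quotient_dim\<close> refers to an arbitrary basis of the quotient. A linear map \<open>\<Phi>\<close> with kernel \<open>W\<close> on \<open>V\<close>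
  transports it to an ordinary vector space, where bases of the same span have the same cardinality.
\<close>

lemma quotient_dim_eq_card:
  fixes sc :: "'a::field \<Rightarrow> 'v::ab_group_add \<Rightarrow> 'v" and sc' :: "'a \<Rightarrow> 'w::ab_group_add \<Rightarrow> 'w"
    and e :: "'x \<Rightarrow> 'w"
  assumes "vector_space sc" "vector_space sc'"
    and \<Phi>: "\<And>u v. \<Phi> (u + v) = \<Phi> u + \<Phi> v" "\<And>c v. \<Phi> (sc c v) = sc' c (\<Phi> v)"
    and V: "module.subspace sc V" and W: "\<And>v. v \<in> V \<Longrightarrow> v \<in> W \<longleftrightarrow> \<Phi> v = 0"
    and X: "finite X" "\<And>x. x \<in> X \<Longrightarrow> e x \<in> \<Phi> ` V"
    and ind: "\<And>c x. (\<Sum>x\<in>X. sc' (c x) (e x)) = 0 \<Longrightarrow> x \<in> X \<Longrightarrow> c x = 0"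
    and span: "\<And>v. v \<in> V \<Longrightarrow> \<exists>c. \<Phi> v = (\<Sum>x\<in>X. sc' (c x) (e x))"
  shows "quotient_dim sc V W = card X"
proof -
  interpret v: vector_space sc by fact
  interpret w: vector_space sc' by fact
  have \<Phi>0: "\<Phi> 0 = 0" using \<Phi>(1)[of 0 0] by simp
  have \<Phi>diff: "\<Phi> (u - v) = \<Phi> u - \<Phi> v" for u v using \<Phi>(1)[of "u - v" v] by (simp add: algebra_simps)
  have \<Phi>sum: "\<Phi> (\<Sum>i\<in>I. sc (c i) (g i)) = (\<Sum>i\<in>I. sc' (c i) (\<Phi> (g i)))" for I :: "'i set" and c g
    by (induction I rule: infinite_finite_induct) (simp_all add: \<Phi> \<Phi>0)
  have Vsum: "(\<Sum>i\<in>I. sc (c i) (g i)) \<in> V" if "\<And>i. i \<in> I \<Longrightarrow> g i \<in> V" for I :: "'i set" and c g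
    using that by (intro v.subspace_sum[OF V] v.subspace_scale[OF V])
  have inj: "inj_on e X"
  proof (rule inj_onI)
    fix x y assume xy: "x \<in> X" "y \<in> X" "e x = e y"
    show "x = y"
    proof (rule ccontr)
      assume neq: "x \<noteq> y"
      have "(\<Sum>z\<in>X. sc' ((if z = x then 1 else 0) - (if z = y then 1 else 0)) (e z)) =
          (\<Sum>z\<in>X. (if z = x then e x else 0) - (if z = y then e y else 0))"
        by (intro sum.cong) (auto simp: w.scale_left_diff_distrib)
      also have "\<dots> = 0" using xy X(1) by (simp add: sum_subtractf)
      finally show False
        using ind[of "\<lambda>z. (if z = x then 1 else 0) - (if z = y then 1 else 0)" x] xy neq by simp
    qed
  qed
  have indB: "w.independent (e ` X)"
  proof (rule w.independent_if_scalars_zero)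
    fix f x assume "(\<Sum>x\<in>e ` X. sc' (f x) x) = 0" "x \<in> e ` X"
    then show "f x = 0" using ind[of "\<lambda>x. f (e x)"] by (auto simp: sum.reindex[OF inj])
  qed (use X in simp)
  have "\<forall>x\<in>X. \<exists>v. v \<in> V \<and> \<Phi> v = e x" using X(2) by (auto simp: image_iff eq_commute)
  from bchoice[OF this] obtain g where g: "\<And>x. x \<in> X \<Longrightarrow> g x \<in> V \<and> \<Phi> (g x) = e x" by blast
  have ginj: "inj_on g X"
  proof (rule inj_onI)
    fix x y assume xy: "x \<in> X" "y \<in> X" "g x = g y"
    then have "e x = e y" using g[OF xy(1)] g[OF xy(2)] by simp
    then show "x = y" using inj xy by (simp add: inj_on_def)
  qed
  have "basis_modulo sc V W (g ` X)"
    unfolding basis_modulo_def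
  proof (intro conjI allI impI ballI)
    show "g ` X \<subseteq> V" using g by auto
  next
    fix A c a assume A: "finite A" "A \<subseteq> g ` X" "(\<Sum>a\<in>A. sc (c a) a) \<in> W" "a \<in> A"
    obtain X0 where X0: "X0 \<subseteq> X" "A = g ` X0" using A(2) by (metis subset_imageE)
    have "A \<subseteq> V" using A(2) g by auto
    then have "\<Phi> (\<Sum>a\<in>A. sc (c a) a) = 0" using A(3) W Vsum[of A "\<lambda>a. a" c] by auto
    then have "(\<Sum>x\<in>X0. sc' (c (g x)) (e x)) = 0"
      using g X0 inj_on_subset[OF ginj X0(1)] by (simp add: \<Phi>sum sum.reindex subset_iff)
    moreover have "(\<Sum>x\<in>X. sc' (if x \<in> X0 then c (g x) else 0) (e x)) = (\<Sum>x\<in>X0. sc' (c (g x)) (e x))"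
      using X0(1) X(1) by (intro sum.mono_neutral_cong_right) auto
    ultimately have "\<And>x. x \<in> X \<Longrightarrow> (if x \<in> X0 then c (g x) else 0) = 0"
      using ind[of "\<lambda>x. if x \<in> X0 then c (g x) else 0"] by simp
    then show "c a = 0" using A(4) X0 by (metis imageE subsetD)
  next
    fix v assume v: "v \<in> V"
    obtain c where c: "\<Phi> v = (\<Sum>x\<in>X. sc' (c x) (e x))" using span[OF v] by blast
    define c' where "c' a = c (the_inv_into X g a)" for a
    have "(\<Sum>a\<in>g ` X. sc (c' a) a) = (\<Sum>x\<in>X. sc (c x) (g x))"
      by (simp add: sum.reindex[OF ginj] c'_def the_inv_into_f_f[OF ginj])
    moreover have "v - (\<Sum>x\<in>X. sc (c x) (g x)) \<in> V"
      using v g by (intro v.subspace_diff[OF V] Vsum) auto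
    moreover have "\<Phi> (v - (\<Sum>x\<in>X. sc (c x) (g x))) = 0"
      using g by (simp add: \<Phi>diff \<Phi>sum c)
    ultimately show "\<exists>A c. finite A \<and> A \<subseteq> g ` X \<and> v - (\<Sum>a\<in>A. sc (c a) a) \<in> W"
      using W X(1) by (intro exI[of _ "g ` X"] exI[of _ c']) auto
  qed
  then have "basis_modulo sc V W (SOME B. basis_modulo sc V W B)" by (rule someI)
  then obtain D where D: "D = (SOME B. basis_modulo sc V W B)" "basis_modulo sc V W D" by blast
  note D' = D(2)[unfolded basis_modulo_def]
  have DV: "D \<subseteq> V" and Dind: "\<And>A c. finite A \<Longrightarrow> A \<subseteq> D \<Longrightarrow> (\<Sum>a\<in>A. sc (c a) a) \<in> W \<Longrightarrow> \<forall>a\<in>A. c a = 0"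
    and Dspan: "\<And>v. v \<in> V \<Longrightarrow> \<exists>A c. finite A \<and> A \<subseteq> D \<and> v - (\<Sum>a\<in>A. sc (c a) a) \<in> W"
    using D'[THEN conjunct1] D'[THEN conjunct2, THEN conjunct1] D'[THEN conjunct2, THEN conjunct2] by simp_all
  have Dinj: "inj_on \<Phi> D"
  proof (rule inj_onI)
    fix a b assume ab: "a \<in> D" "b \<in> D" "\<Phi> a = \<Phi> b"
    show "a = b"
    proof (rule ccontr)
      assume neq: "a \<noteq> b"
      define c where "c z = (if z = a then 1 else - 1 :: 'a)" for z
      have "(\<Sum>z\<in>{a, b}. sc (c z) z) = a - b" using neq by (simp add: c_def)
      moreover have "a - b \<in> W" using ab W[OF v.subspace_diff[OF V]] subsetD[OF DV] by (simp add: \<Phi>diff)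
      ultimately have "c a = 0" using Dind[of "{a, b}" c] ab by auto
      then show False by (simp add: c_def)
    qed
  qed
  have "w.independent (\<Phi> ` D)"
    unfolding w.independent_explicit_finite_subsets
  proof (intro allI impI ballI)
    fix S u s assume S: "S \<subseteq> \<Phi> ` D" "finite S" "(\<Sum>v\<in>S. sc' (u v) v) = 0" "s \<in> S"
    obtain D0 where D0: "D0 \<subseteq> D" "finite D0" "S = \<Phi> ` D0" using S(1,2) by (metis finite_subset_image)
    have "\<Phi> (\<Sum>d\<in>D0. sc (u (\<Phi> d)) d) = 0"
      using S(3) D0 inj_on_subset[OF Dinj D0(1)] by (simp add: \<Phi>sum sum.reindex)
    moreover have "(\<Sum>d\<in>D0. sc (u (\<Phi> d)) d) \<in> V" using D0 DV by (intro Vsum) auto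
    ultimately have "(\<Sum>d\<in>D0. sc (u (\<Phi> d)) d) \<in> W" using W by simp
    from Dind[OF D0(2,1) this] show "u s = 0" using S(4) D0(3) by auto
  qed
  moreover have "w.span (\<Phi> ` D) = w.span (e ` X)"
  proof
    have "\<Phi> d \<in> w.span (e ` X)" if d: "d \<in> D" for d
    proof -
      obtain c where c: "\<Phi> d = (\<Sum>x\<in>X. sc' (c x) (e x))" using span[OF subsetD[OF DV d]] by blast
      show ?thesis unfolding c by (intro w.span_sum w.span_scale w.span_base imageI)
    qed
    then show "w.span (\<Phi> ` D) \<subseteq> w.span (e ` X)" by (intro w.span_minimal w.subspace_span) auto
    have "e x \<in> w.span (\<Phi> ` D)" if x: "x \<in> X" for x
    proof -
      obtain A c where A: "finite A" "A \<subseteq> D" "g x - (\<Sum>a\<in>A. sc (c a) a) \<in> W" using Dspan[of "g x"] g[OF x] by blast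
      have "g x - (\<Sum>a\<in>A. sc (c a) a) \<in> V"
        using A(2) DV g[OF x] by (intro v.subspace_diff[OF V] Vsum) auto
      then have ex: "e x = (\<Sum>a\<in>A. sc' (c a) (\<Phi> a))"
        using A(3) W g[OF x] by (simp add: \<Phi>diff \<Phi>sum)
      show ?thesis unfolding ex using A(2) by (intro w.span_sum w.span_scale w.span_base) blast
    qed
    then show "w.span (e ` X) \<subseteq> w.span (\<Phi> ` D)" by (intro w.span_minimal w.subspace_span) auto
  qed
  ultimately have "card (\<Phi> ` D) = card (e ` X)"
    using w.dim_eq_card[of "\<Phi> ` D" "e ` X"] w.dim_eq_card_independent[OF indB] by simp
  then have "card D = card X" using card_image[OF Dinj] card_image[OF inj] by simp
  then show ?thesis by (simp add: quotient_dim_def D(1))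
qed

text \<open>
  Unlike the generators of \<^const>\<open>multilinear\<close>, these products admit an induction.
\<close>

inductive index_product :: "nat list \<Rightarrow> ('a::field, 'n::finite) lpoly \<Rightarrow> bool" where
  single: "index_product [i] (lp_var i u)"
| snoc: "index_product js f \<Longrightarrow> index_product (js @ [i]) (f * lp_var i u)"

lemma generator_index_product:
  assumes "m \<ge> 1"
  shows "index_product (map \<sigma> [1..<Suc m])
    (foldl (*) (lp_var (\<sigma> 1) (u 1)) (map (\<lambda>i. lp_var (\<sigma> i) (u i)) [2..<Suc m]))"
  using assms
proof (induction m rule: dec_induct)
  case base
  show ?case using index_product.single by simp
next
  case (step m)
  have "[1..<Suc (Suc m)] = [1..<Suc m] @ [Suc m]" "[2..<Suc (Suc m)] = [2..<Suc m] @ [Suc m]"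
    using step.hyps by simp_all
  then show ?case using index_product.snoc[OF step.IH, of "\<sigma> (Suc m)" "u (Suc m)"] by simp
qed

lemma index_product_generator:
  assumes "m \<ge> 1" "index_product [1..<Suc m] f"
  shows "\<exists>u. f = foldl (*) (lp_var 1 (u 1)) (map (\<lambda>i. lp_var i (u i)) [2..<Suc m])"
  using assms
proof (induction m arbitrary: f rule: dec_induct)
  case base
  have "\<not> index_product [] g" for g :: "('a, 'b) lpoly" by (auto elim: index_product.cases)
  with base obtain u where "f = lp_var 1 u" by (auto elim: index_product.cases)
  then show ?case by (intro exI[of _ "\<lambda>_. u"]) simp
next
  case (step m)
  have eq: "[1..<Suc (Suc m)] = [1..<Suc m] @ [Suc m]" and "[2..<Suc (Suc m)] = [2..<Suc m] @ [Suc m]"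
    using step.hyps by simp_all
  have ne: "[1..<Suc m] \<noteq> []" using step.hyps by simp
  from step.prems obtain g v where g: "index_product [1..<Suc m] g" "f = g * lp_var (Suc m) v"
    unfolding eq by (cases rule: index_product.cases) (use ne in auto)
  obtain u where u: "g = foldl (*) (lp_var 1 (u 1)) (map (\<lambda>i. lp_var i (u i)) [2..<Suc m])"
    using step.IH[OF g(1)] by blast
  have later: "map (\<lambda>i. lp_var i ((u(Suc m := v)) i)) [2..<Suc m] = map (\<lambda>i. lp_var i (u i)) [2..<Suc m]"
    by (intro map_cong refl) auto
  have first: "(u(Suc m := v)) 1 = u 1" using step.hyps by auto
  have "f = foldl (*) (lp_var 1 ((u(Suc m := v)) 1)) (map (\<lambda>i. lp_var i ((u(Suc m := v)) i)) [2..<Suc (Suc m)])"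
    unfolding g(2) u \<open>[2..<Suc (Suc m)] = _\<close> map_append foldl_append later first by simp
  then show ?case by blast
qed

lemma multilinear_index_product:
  "n \<ge> 1 \<Longrightarrow> index_product [1..<Suc n] f \<Longrightarrow> f \<in> multilinear n"
  using index_product_generator[of n f] unfolding multilinear_def
  by (intro lp.span_base) (auto intro!: exI[of _ id] permutes_id)

lemma span_index_product_mult:
  assumes "f \<in> lp.span {g. index_product js g}"
  shows "f * lp_var i u \<in> lp.span {g. index_product (js @ [i]) g}"
  using assms
proof (induction rule: lp.span_induct_alt)
  case (step c g f)
  have "lp_scale c (g * lp_var i u) \<in> lp.span {g. index_product (js @ [i]) g}"
    using step.hyps by (intro lp.span_scale lp.span_base) (simp add: index_product.snoc)
  then show ?case using step.IH by (simp add: distrib_right lp_scale_mult_left lp.span_add)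
qed (simp add: lp.span_zero)

lemma monomial_mset: "monomial ws b = monomial ws' b" if "mset ws = mset ws'"
proof -
  have "monomial us b = (\<Prod>v\<in>#mset us. mat_coord (snd v) (b (fst v)))" for us
    by (induction us) simp_all
  then show ?thesis using that by simp
qed

lemma monomial_snoc: "monomial (ws @ [v]) b = monomial ws b * mat_coord (snd v) (b (fst v))"
  by (simp add: monomial_def split_def)

lemma word_degree_snoc: "word_degree (ws @ [v]) = word_degree ws + letter_degree v"
  by (simp add: word_degree_def)

context matrix_variety
begin

lemma coordinate_operator:
  fixes B :: "('a, 'n) sqmat"
  assumes a: "a \<in> mat_basis" and B: "B \<in> degree_part (letter_degree (i, a))"
  shows "\<exists>u :: ('a, 'n) uea. \<forall>A. mat_act u A = mat_scale (mat_coord a A) B"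
proof (cases "a = mat 1")
  case True
  then obtain c where c: "B = mat_scale c (mat 1)" using B by (auto simp: letter_degree_def degree_part_simps)
  obtain \<gamma> :: "('a, 'n) uea" where \<gamma>: "\<And>A. mat_act \<gamma> A = mat_scale (trace A / of_nat CARD('n)) (mat 1)"
    using center by blast
  show ?thesis
    by (rule exI[of _ "ue_scale c \<gamma>"]) (simp add: True c \<gamma> mat_rep.ue_rep_simps mat_coord_one mult.commute)
next
  case False
  then have "trace B = 0" using B by (simp add: letter_degree_def degree_part_simps)
  then show ?thesis using dense[OF coord_functional[OF a False], of B] by (simp add: traceless_part_id)
qed

text \<open>
  A letter times a matrix of its degree is the value of a variable with a suitable exponent, and products of such
  matrices exhaust the part of the respective degree.
\<close>

lemma monomial_realized:
  fixes ls :: "('a, 'n) letter list"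
  assumes "ls \<noteq> []" "valid_word ls" "M \<in> degree_part (word_degree ls)"
  shows "\<exists>f\<in>lp.span {g. index_product (map fst ls) g}. \<forall>b. lp_subst b f = mat_scale (monomial ls b) M"
  using assms
proof (induction ls arbitrary: M rule: rev_induct)
  case (snoc v ls)
  obtain i a where v: "v = (i, a)" by (cases v)
  have a: "a \<in> mat_basis" and valid: "valid_word ls" using snoc.prems(2) by (auto simp: v valid_word_def)
  show ?case
  proof (cases "ls = []")
    case True
    then have "M \<in> degree_part (letter_degree (i, a))" using snoc.prems(3) by (simp add: v)
    from coordinate_operator[OF a this] obtain u :: "('a, 'n) uea" where
      u: "\<And>A. mat_act u A = mat_scale (mat_coord a A) M" by blast
    have "lp_var i u \<in> lp.span {g. index_product [i] g}"
      by (intro lp.span_base) (simp add: index_product.single)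
    then show ?thesis using True by (intro bexI[of _ "lp_var i u"]) (simp_all add: v lp_subst_simps u)
  next
    case False
    let ?P = "lp.span {g. index_product (map fst (ls @ [v])) g} :: ('a, 'n) lpoly set"
    let ?S = "{M. \<exists>f\<in>?P. \<forall>b. lp_subst b f = mat_scale (monomial (ls @ [v]) b) M}"
    have "M \<in> ?S"
    proof (rule degree_part_products[OF pq _ letter_degree_le_1])
      show "M \<in> degree_part (word_degree ls + letter_degree v)"
        using snoc.prems(3) by (simp only: word_degree_snoc)
      show "mat.subspace ?S"
      proof (rule mat.subspaceI)
        show "0 \<in> ?S" by (auto intro!: bexI[of _ 0] simp: lp_subst_more lp.span_zero)
        fix A B assume "A \<in> ?S" "B \<in> ?S"
        then obtain f g where "f \<in> ?P" "g \<in> ?P" "\<forall>b. lp_subst b f = mat_scale (monomial (ls @ [v]) b) A"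
          "\<forall>b. lp_subst b g = mat_scale (monomial (ls @ [v]) b) B" by blast
        then show "A + B \<in> ?S"
          by (auto intro!: bexI[of _ "f + g"] simp: lp_subst_simps mat.scale_right_distrib lp.span_add)
      next
        fix c A assume "A \<in> ?S"
        then obtain f where "f \<in> ?P" "\<forall>b. lp_subst b f = mat_scale (monomial (ls @ [v]) b) A" by blast
        then show "mat_scale c A \<in> ?S"
          by (auto intro!: bexI[of _ "lp_scale c f"] simp: lp_subst_simps lp.span_scale mult.commute)
      qed
      fix A B :: "('a, 'n) sqmat"
      assume A: "A \<in> degree_part (word_degree ls)" and B: "B \<in> degree_part (letter_degree v)"
      obtain f where f: "f \<in> lp.span {g. index_product (map fst ls) g}"
        "\<And>b. lp_subst b f = mat_scale (monomial ls b) A"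
        using snoc.IH[OF False valid A] by blast
      obtain u :: "('a, 'n) uea" where u: "\<And>A. mat_act u A = mat_scale (mat_coord a A) B"
        using coordinate_operator[OF a, of B i] B v by blast
      have "f * lp_var i u \<in> ?P" using span_index_product_mult[OF f(1)] by (simp add: v)
      then show "A ** B \<in> ?S"
        by (intro CollectI bexI[of _ "f * lp_var i u"])
          (simp_all add: lp_subst_simps f(2) u mat_mult_bilinear monomial_snoc v mult.commute)
    qed
    then show ?thesis by simp
  qed
qed simp

lemma represented_index_product: "index_product is f \<Longrightarrow> represented {ws. map fst ws = rev is} f"
proof (induction rule: index_product.induct)
  case (single i u)
  show ?case
  proof (rule represented_mono)
    show "represented {[(i, a)] | a. True} (lp_var i u)" using represented_variable[of i 1 u] by simp
  qed auto
next
  case (snoc js f i u)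
  show ?case
  proof (rule represented_mono)
    show "represented {(i, a) # ws | a ws. ws \<in> {ws. map fst ws = rev js}} (f * lp_var i u)"
      using represented_mult_variable[OF snoc.IH, of i 1 u] by simp
  qed auto
qed

end

text \<open>
  Counting starts at 1, like the variables of \<^const>\<open>multilinear\<close>.
\<close>

definition label :: "('a, 'n) sqmat list \<Rightarrow> ('a::field_char_0, 'n::{finite, linorder}) letter list"
  where "label xs = zip [1..<Suc (length xs)] xs"

definition basis_words :: "nat \<Rightarrow> ('a::field_char_0, 'n::{finite, linorder}) sqmat list set"
  where "basis_words n = {xs. set xs \<subseteq> mat_basis \<and> length xs = n}"

definition degree_basis :: "nat \<Rightarrow> ('a::field_char_0, 'n::{finite, linorder}) sqmat set"
  where "degree_basis d = (if d = 0 then {mat 1} else if d = 1 then sl_basis else mat_basis)"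

text \<open>
  Indexes a basis of the multilinear polynomials modulo identities: a monomial in the coordinates of \<open>x\<^sub>1, \<dots>, x\<^sub>n\<close>,
  one for each variable, times a basis matrix from the part of its degree.
\<close>

definition normal_monomials :: "nat \<Rightarrow> (('a, 'n) sqmat list \<times> ('a::field_char_0, 'n::{finite, linorder}) sqmat) set"
  where "normal_monomials n = (SIGMA xs : basis_words n. degree_basis (word_degree (label xs)))"

lemma finite_basis_words: "finite (basis_words n)"
  unfolding basis_words_def by (rule finite_lists_length_eq[OF finite_mat_basis])

lemma degree_basis_subset: "degree_basis d \<subseteq> mat_basis"
  by (auto simp: degree_basis_def mat_basis_def)

lemma finite_degree_basis: "finite (degree_basis d)"
  by (rule finite_subset[OF degree_basis_subset finite_mat_basis])

lemma finite_normal_monomials: "finite (normal_monomials n)"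
  unfolding normal_monomials_def by (intro finite_SigmaI finite_basis_words finite_degree_basis)

lemma degree_basis_degree_part: "m \<in> degree_basis d \<Longrightarrow> m \<in> degree_part d"
  using mat.scale_one[of "mat 1 :: ('a::field_char_0, 'n::{finite, linorder}) sqmat"]
  by (auto simp: degree_basis_def degree_part_def sl_basis_traceless image_iff intro: exI[of _ 1] split: if_splits)

lemma degree_basis_expansion:
  assumes M: "M \<in> degree_part d"
  shows "(\<Sum>m\<in>degree_basis d. mat_scale (mat_coord m M) m) = M"
proof -
  have "mat_coord m M = 0" if m: "m \<in> mat_basis - degree_basis d" for m
  proof -
    have "mat 1 \<in> (mat_basis :: ('a, 'b) sqmat set)" by (simp add: mat_basis_def)
    then show ?thesis
      using m M by (auto simp: degree_basis_def degree_part_def mat_coord_simps mat_coord_one mat_basis_def split: if_splits)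
  qed
  then have "(\<Sum>m\<in>degree_basis d. mat_scale (mat_coord m M) m) = (\<Sum>m\<in>mat_basis. mat_scale (mat_coord m M) m)"
    by (intro sum.mono_neutral_left finite_mat_basis degree_basis_subset) auto
  then show ?thesis by (simp add: mat_coord_simps)
qed

lemma label_facts:
  "map fst (label xs) = [1..<Suc (length xs)]" "map snd (label xs) = xs"
  "valid_word (label xs) \<longleftrightarrow> set xs \<subseteq> mat_basis" "label xs = [] \<longleftrightarrow> xs = []"
proof -
  show *: "map fst (label xs) = [1..<Suc (length xs)]" "map snd (label xs) = xs"
    by (simp_all add: label_def del: upt_Suc)
  have "snd ` set (label xs) = set xs" using arg_cong[OF *(2), of set] by simp
  then show "valid_word (label xs) \<longleftrightarrow> set xs \<subseteq> mat_basis" by (simp add: valid_word_def)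
  show "label xs = [] \<longleftrightarrow> xs = []" using *(2) by (metis list.map_disc_iff)
qed

lemma mset_label_inject:
  assumes "mset (label xs) = mset (label ys)" shows "xs = ys"
proof -
  have len: "length xs = length ys"
    using arg_cong[OF assms, of size] by (simp add: label_def del: upt_Suc)
  have set: "set (label xs) = set (label ys)" using arg_cong[OF assms, of set_mset] by simp
  show ?thesis
  proof (rule nth_equalityI[OF len])
    fix i assume i: "i < length xs"
    then have "(Suc i, xs ! i) \<in> set (label xs)"
      unfolding label_def set_zip by (auto intro!: exI[of _ i] simp del: upt_Suc)
    then have "(Suc i, xs ! i) \<in> set (label ys)" by (simp only: set)
    then show "xs ! i = ys ! i" unfolding label_def set_zip by (auto simp del: upt_Suc)
  qed
qed

text \<open>
  Sorting the letters by their variables brings a multilinear word into the form \<^const>\<open>label\<close>.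
\<close>

lemma word_is_labelled:
  assumes "mset (map fst ws) = mset [1..<Suc n]" "valid_word ws"
  shows "\<exists>xs\<in>basis_words n. mset ws = mset (label xs)"
proof -
  let ?ws = "sort_key fst ws"
  have "sort [1..<Suc n] = map fst ?ws"
  proof (rule properties_for_sort)
    show "mset (map fst ?ws) = mset [1..<Suc n]" using assms(1) by (simp only: mset_map mset_sort)
  qed simp
  then have "map fst ?ws = sort [1..<Suc n]" by (rule sym)
  also have "sort [1..<Suc n] = [1..<Suc n]" by (simp add: sorted_sort_id del: upt_Suc)
  finally have fst: "map fst ?ws = [1..<Suc n]" .
  have len: "length ws = n" using arg_cong[OF fst, of length] by simp
  have "label (map snd ?ws) = zip (map fst ?ws) (map snd ?ws)" by (simp add: label_def fst len del: upt_Suc)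
  also have "\<dots> = ?ws" by (rule zip_map_fst_snd)
  finally have "mset ws = mset (label (map snd ?ws))" by simp
  moreover have "map snd ?ws \<in> basis_words n" using assms(2) len by (simp add: basis_words_def valid_word_def)
  ultimately show ?thesis by blast
qed

lemma permuted_indices:
  assumes "\<sigma> permutes {1..n}" shows "mset (map \<sigma> [1..<Suc n]) = mset [1..<Suc n]"
proof -
  have "mset (map \<sigma> [1..<Suc n]) = image_mset \<sigma> (mset_set {1..n})"
    by (simp only: mset_map mset_upt atLeastLessThanSuc_atLeastAtMost)
  also have "\<dots> = mset_set {1..n}"
    by (simp only: image_mset_mset_set[OF permutes_inj_on[OF assms]] permutes_image[OF assms])
  finally show ?thesis by (simp only: mset_upt atLeastLessThanSuc_atLeastAtMost)
qed

context matrix_variety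
begin

lemma normal_monomials_span:
  fixes ts :: "(('a, 'n) letter list \<times> ('a, 'n) sqmat) list"
  assumes "\<forall>(ws, m)\<in>set ts. mset (map fst ws) = mset [1..<Suc n] \<and> valid_word ws \<and> m \<in> degree_part (word_degree ws)"
  shows "\<exists>c. \<forall>b. (\<Sum>(ws, m)\<leftarrow>ts. mat_scale (monomial ws b) m) =
    (\<Sum>x\<in>normal_monomials n. mat_scale (c x * monomial (label (fst x)) b) (snd x :: ('a, 'n) sqmat))"
  using assms
proof (induction ts)
  case Nil
  show ?case by (rule exI[of _ "\<lambda>_. 0"]) simp
next
  case (Cons t ts)
  obtain ws m where t: "t = (ws, m)" by (cases t)
  from Cons obtain c where c: "\<And>b. (\<Sum>(ws, m)\<leftarrow>ts. mat_scale (monomial ws b) m) =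
    (\<Sum>x\<in>normal_monomials n. mat_scale (c x * monomial (label (fst x)) b) (snd x :: ('a, 'n) sqmat))" by auto
  obtain xs where xs: "xs \<in> basis_words n" "mset ws = mset (label xs)"
    using word_is_labelled[of ws n] Cons.prems t by auto
  let ?D = "degree_basis (word_degree (label xs)) :: ('a, 'n) sqmat set"
  have m: "m \<in> degree_part (word_degree (label xs))"
    using Cons.prems t word_degree_mset[OF xs(2)] by simp
  define d where "d x = (if fst x = xs then mat_coord (snd x) m else 0)" for x :: "('a, 'n) sqmat list \<times> ('a, 'n) sqmat"
  have "mat_scale (monomial ws b) m =
      (\<Sum>x\<in>normal_monomials n. mat_scale (d x * monomial (label (fst x)) b) (snd x))" for b
  proof -
    have "(\<Sum>x\<in>normal_monomials n. mat_scale (d x * monomial (label (fst x)) b) (snd x)) =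
        (\<Sum>ys\<in>basis_words n. \<Sum>k\<in>degree_basis (word_degree (label ys)). mat_scale (d (ys, k) * monomial (label ys) b) k)"
      unfolding normal_monomials_def
      by (subst sum.Sigma) (simp_all add: finite_basis_words finite_degree_basis split_def)
    also have "\<dots> = (\<Sum>ys\<in>basis_words n. if ys = xs then \<Sum>k\<in>?D. mat_scale (mat_coord k m * monomial (label xs) b) k else 0)"
      by (intro sum.cong refl) (simp add: d_def)
    also have "\<dots> = (\<Sum>k\<in>?D. mat_scale (mat_coord k m * monomial (label xs) b) k)"
      using xs(1) by (simp add: finite_basis_words)
    also have "\<dots> = mat_scale (monomial (label xs) b) (\<Sum>k\<in>?D. mat_scale (mat_coord k m) k)"
      by (simp add: mat.scale_sum_right mult.commute)
    also have "\<dots> = mat_scale (monomial ws b) m"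
      by (simp add: degree_basis_expansion[OF m] monomial_mset[OF xs(2)])
    finally show ?thesis by simp
  qed
  then show ?case
    by (intro exI[of _ "\<lambda>x. d x + c x"]) (simp add: t c distrib_right mat.scale_left_distrib sum.distrib)
qed

lemma normal_monomials_independent:
  fixes x :: "('a, 'n) sqmat list \<times> ('a, 'n) sqmat"
  assumes zero: "\<And>b. (\<Sum>x\<in>normal_monomials n. mat_scale (c x * monomial (label (fst x)) b) (snd x)) = (0 :: ('a, 'n) sqmat)"
    and x: "x \<in> normal_monomials n"
  shows "c x = 0"
proof -
  obtain xs m where xm: "x = (xs, m)" by (cases x)
  obtain ts :: "(('a, 'n) sqmat list \<times> ('a, 'n) sqmat) list" where ts: "set ts = normal_monomials n" "distinct ts"
    using finite_distinct_list[OF finite_normal_monomials] by blast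
  have sum: "(\<Sum>s\<leftarrow>ts. F s) = (\<Sum>s\<in>normal_monomials n. F s)" for F :: "_ \<Rightarrow> 'a"
    using sum.distinct_set_conv_list[OF ts(2), of F] ts(1) by simp
  let ?c = "\<lambda>s. c s * (if snd s = m then 1 else 0)"
  have "(\<Sum>s\<leftarrow>ts. ?c s * (\<Prod>v\<leftarrow>label (fst s). y v)) = 0" for y :: "('a, 'n) letter \<Rightarrow> 'a"
  proof -
    obtain b :: "nat \<Rightarrow> ('a, 'n) sqmat" where b: "\<And>i a. a \<in> mat_basis \<Longrightarrow> mat_coord a (b i) = y (i, a)"
      by (rule coordinates_free[of y]) (rule that)
    have mono: "monomial ws b = (\<Prod>v\<leftarrow>ws. y v)" if "valid_word ws" for ws
      using that by (induction ws) (auto simp: b)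
    have "?c s * (\<Prod>v\<leftarrow>label (fst s). y v) = mat_coord m (mat_scale (c s * monomial (label (fst s)) b) (snd s))"
      if s: "s \<in> normal_monomials n" for s
    proof -
      have "valid_word (label (fst s))" "snd s \<in> mat_basis"
        using s subsetD[OF degree_basis_subset] by (fastforce simp: normal_monomials_def basis_words_def label_facts)+
      then show ?thesis by (simp add: mono mat_coord_simps)
    qed
    then have "(\<Sum>s\<leftarrow>ts. ?c s * (\<Prod>v\<leftarrow>label (fst s). y v)) =
        mat_coord m (\<Sum>x\<in>normal_monomials n. mat_scale (c x * monomial (label (fst x)) b) (snd x))"
      unfolding sum mat_coord_sum by (intro sum.cong refl) blast
    then show ?thesis by (simp add: zero mat_coord_simps)
  qed
  from word_monomials_independent[OF this, of "mset (label xs)"]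
  have "(\<Sum>s\<leftarrow>filter (\<lambda>s. mset (label (fst s)) = mset (label xs)) ts. ?c s) = 0" .
  also have "(\<Sum>s\<leftarrow>filter (\<lambda>s. mset (label (fst s)) = mset (label xs)) ts. ?c s) =
      (\<Sum>s\<leftarrow>ts. if s = x then c x else 0)"
  proof -
    have "(\<Sum>s\<leftarrow>filter (\<lambda>s. mset (label (fst s)) = mset (label xs)) us. ?c s) =
      (\<Sum>s\<leftarrow>us. if s = x then c x else 0)" for us
      by (induction us) (use mset_label_inject in \<open>auto simp: xm\<close>)
    then show ?thesis .
  qed
  also have "\<dots> = c x" unfolding sum using x by (simp add: finite_normal_monomials)
  finally show ?thesis .
qed

text \<open>
  The normal monomials are realized by polynomials in \<^const>\<open>multilinear\<close>; their independence is that of monomials in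
  the coordinates, and every multilinear polynomial evaluates to a combination of them.
\<close>

theorem codimension_eq_card:
  assumes n: "n \<ge> 1" and kernel': "\<And>f. h f = 0 \<Longrightarrow> f \<in> Id_L"
  shows "codimension (Id_L :: ('a, 'n) lpoly set) n = card (normal_monomials n :: (('a, 'n) sqmat list \<times> _) set)"
proof -
  let ?X = "normal_monomials n :: (('a, 'n) sqmat list \<times> ('a, 'n) sqmat) set"
  have "\<exists>f\<in>multilinear n. \<forall>b. lp_subst b f = mat_scale (monomial (label (fst x)) b) (snd x)" if "x \<in> ?X" for x
  proof -
    have x: "set (fst x) \<subseteq> mat_basis" "length (fst x) = n" "snd x \<in> degree_part (word_degree (label (fst x)))"
      using that degree_basis_degree_part by (auto simp: normal_monomials_def basis_words_def)
    have "label (fst x) \<noteq> []" "valid_word (label (fst x))" using x(1,2) n by (auto simp: label_facts)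
    from monomial_realized[OF this x(3)] obtain f where
      f: "f \<in> lp.span {g. index_product [1..<Suc n] g}" "\<And>b. lp_subst b f = mat_scale (monomial (label (fst x)) b) (snd x)"
      unfolding label_facts(1) x(2) by blast
    have "lp.span {g. index_product [1..<Suc n] g} \<subseteq> multilinear n"
    proof (rule lp.span_minimal)
      show "{g. index_product [1..<Suc n] g} \<subseteq> multilinear n" using multilinear_index_product[OF n] by blast
    qed (simp only: multilinear_def lp.subspace_span)
    then show ?thesis using f by blast
  qed
  then obtain F where F: "\<And>x. x \<in> ?X \<Longrightarrow> F x \<in> multilinear n"
    "\<And>x b. x \<in> ?X \<Longrightarrow> lp_subst b (F x) = mat_scale (monomial (label (fst x)) b) (snd x)"
    by metis
  have hsum: "h (\<Sum>x\<in>X. lp_scale (c x) (G x)) = (\<Sum>x\<in>X. scale (c x) (h (G x)))" for X :: "'z set" and c G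
  proof -
    have "h 0 = 0" using h_simps(3)[of 0 0] by simp
    then show ?thesis by (induction X rule: infinite_finite_induct) (simp_all add: h_simps)
  qed
  have lsum: "lp_subst b (\<Sum>x\<in>X. lp_scale (c x) (G x)) = (\<Sum>x\<in>X. mat_scale (c x) (lp_subst b (G x)))" for X :: "'z set" and c G b
    by (induction X rule: infinite_finite_induct) (simp_all add: lp_subst_simps lp_subst_more)
  show ?thesis
    unfolding codimension_def
  proof (rule quotient_dim_eq_card[where \<Phi> = h and sc' = scale and e = "\<lambda>x. h (F x)"])
    show "vector_space lp_scale" "vector_space scale" by (rule lp.vector_space_axioms, rule vector_space_axioms)
    show "lp.subspace (multilinear n)" unfolding multilinear_def by (rule lp.subspace_span)
    show "v \<in> multilinear n \<Longrightarrow> v \<in> multilinear n \<inter> Id_L \<longleftrightarrow> h v = 0" for v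
      using identity_vanishes kernel' by blast
    show "finite ?X" by (rule finite_normal_monomials)
    show "x \<in> ?X \<Longrightarrow> h (F x) \<in> h ` multilinear n" for x using F(1) by blast
  next
    fix c x assume zero: "(\<Sum>x\<in>?X. scale (c x) (h (F x))) = 0" and x: "x \<in> ?X"
    then have "(\<Sum>x\<in>?X. lp_scale (c x) (F x)) \<in> Id_L" by (intro kernel') (simp add: hsum)
    then have "(\<Sum>x\<in>?X. mat_scale (c x) (lp_subst b (F x))) = 0" for b by (simp add: Id_L_def lsum)
    then show "c x = 0" by (intro normal_monomials_independent[OF _ x]) (simp add: F(2))
  next
    fix v :: "('a, 'n) lpoly" assume "v \<in> multilinear n"
    then have "\<exists>c. \<forall>b. lp_subst b v = (\<Sum>x\<in>?X. mat_scale (c x * monomial (label (fst x)) b) (snd x))"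
      unfolding multilinear_def
    proof (induction rule: lp.span_induct_alt)
      case base
      show ?case by (rule exI[of _ "\<lambda>_. 0"]) (simp add: lp_subst_more)
    next
      case (step a g v)
      from step.hyps obtain \<sigma> u where \<sigma>: "\<sigma> permutes {1..n}"
        and g: "g = foldl (*) (lp_var (\<sigma> 1) (u 1)) (map (\<lambda>i. lp_var (\<sigma> i) (u i)) [2..<Suc n])" by blast
      have "index_product (map \<sigma> [1..<Suc n]) g" unfolding g by (rule generator_index_product[OF n])
      from represented_index_product[OF this] obtain ts where
        ts: "\<forall>(ws, m)\<in>set ts. ws \<in> {ws. map fst ws = rev (map \<sigma> [1..<Suc n])} \<and> ws \<noteq> [] \<and> valid_word ws \<and> m \<in> degree_part (word_degree ws)"
        and tsub: "\<And>b. lp_subst b g = (\<Sum>(ws, m)\<leftarrow>ts. mat_scale (monomial ws b) m)"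
        unfolding represented_def by blast
      have "mset (map fst ws) = mset [1..<Suc n]" if "map fst ws = rev (map \<sigma> [1..<Suc n])" for ws :: "('a, 'n) letter list"
        unfolding that mset_rev by (rule permuted_indices[OF \<sigma>])
      with ts have "\<forall>(ws, m)\<in>set ts. mset (map fst ws) = mset [1..<Suc n] \<and> valid_word ws \<and> m \<in> degree_part (word_degree ws)"
        by blast
      from normal_monomials_span[OF this] obtain c where
        c: "\<And>b. lp_subst b g = (\<Sum>x\<in>?X. mat_scale (c x * monomial (label (fst x)) b) (snd x))" unfolding tsub by blast
      from step.IH obtain d where
        d: "\<And>b. lp_subst b v = (\<Sum>x\<in>?X. mat_scale (d x * monomial (label (fst x)) b) (snd x))" by blast
      show ?case
        by (rule exI[of _ "\<lambda>x. a * c x + d x"])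
          (simp add: lp_subst_simps c d distrib_right mat.scale_left_distrib sum.distrib mat.scale_sum_right mult.assoc)
    qed
    then obtain c where c: "\<And>b. lp_subst b v = (\<Sum>x\<in>?X. mat_scale (c x * monomial (label (fst x)) b) (snd x))" by blast
    have "v - (\<Sum>x\<in>?X. lp_scale (c x) (F x)) \<in> Id_L" by (simp add: Id_L_def lp_subst_more lsum c F(2))
    from identity_vanishes[OF this] have "h (v - (\<Sum>x\<in>?X. lp_scale (c x) (F x))) = 0" .
    then have "h v = h (\<Sum>x\<in>?X. lp_scale (c x) (F x))"
      using h_simps(1)[of "v - (\<Sum>x\<in>?X. lp_scale (c x) (F x))" "\<Sum>x\<in>?X. lp_scale (c x) (F x)"] by simp
    then show "\<exists>c. h v = (\<Sum>x\<in>?X. scale (c x) (h (F x)))" unfolding hsum by blast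
  qed (simp_all add: h_simps)
qed

end

lemma word_degree_label: "word_degree (label xs) = (\<Sum>a\<leftarrow>xs. if a = mat 1 then 0 else 1)"
proof -
  have "word_degree ws = (\<Sum>a\<leftarrow>map snd ws. if a = mat 1 then 0 else 1)" for ws :: "('a, 'b) letter list"
    by (induction ws) (simp_all add: letter_degree_def)
  then show ?thesis by (simp only: label_facts)
qed

text \<open>
  There are \<open>(k\<^sup>2)^n\<close> words. A word admits \<open>k\<^sup>2\<close> matrices, except that the one word of degree 0 admits only one and the
  \<open>n (k\<^sup>2 - 1)\<close> words of degree 1 only \<open>k\<^sup>2 - 1\<close>.
\<close>

lemma card_normal_monomials:
  "int (card (normal_monomials n :: (('a::field_char_0, 'n::{finite, linorder}) sqmat list \<times> _) set)) =
    int CARD('n) ^ (2 * (n + 1)) - (int CARD('n) ^ 2 - 1) * (int n + 1)"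
proof -
  let ?k = "int CARD('n) ^ 2"
  let ?B = "mat_basis :: ('a, 'n) sqmat set"
  define deg where "deg xs = word_degree (label xs)" for xs :: "('a, 'n) sqmat list"
  define count where "count n d = (\<Sum>xs\<in>basis_words n. if deg xs = d then 1 else 0 :: int)" for n d
  have deg: "deg [] = 0" "deg (a # xs) = (if a = mat 1 then 0 else 1) + deg xs" for a xs
    by (simp_all add: deg_def word_degree_label)
  have kcard: "int (card ?B) = ?k" by (simp add: card_mat_basis)
  have "CARD('n) ^ 2 \<ge> 1" by (simp add: Suc_le_eq)
  then have slcard: "int (card (sl_basis :: ('a, 'n) sqmat set)) = ?k - 1" by (simp add: card_sl_basis of_nat_diff)
  have finsl: "finite (sl_basis :: ('a, 'n) sqmat set)"
    using finite_mat_basis[where 'a = 'a and 'n = 'n] by (simp add: mat_basis_def)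
  have zero_words: "basis_words 0 = {[] :: ('a, 'n) sqmat list}" by (auto simp: basis_words_def)
  have step: "(\<Sum>xs\<in>basis_words (Suc n). F xs) = (\<Sum>xs\<in>basis_words n. F (mat 1 # xs)) +
      (\<Sum>a\<in>sl_basis. \<Sum>xs\<in>basis_words n. F (a # xs))" for F :: "('a, 'n) sqmat list \<Rightarrow> int" and n
  proof -
    have "basis_words (Suc n) = (\<lambda>(a, xs). a # xs) ` (?B \<times> basis_words n)"
      by (auto simp: basis_words_def length_Suc_conv image_iff)
    then have "(\<Sum>xs\<in>basis_words (Suc n). F xs) = (\<Sum>(a, xs)\<in>?B \<times> basis_words n. F (a # xs))"
      by (simp add: sum.reindex inj_on_def split_def)
    also have "\<dots> = (\<Sum>a\<in>?B. \<Sum>xs\<in>basis_words n. F (a # xs))" by (rule sum.cartesian_product[symmetric])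
    finally show ?thesis
      using finsl mat_one_notin_sl_basis[where 'a = 'a and 'n = 'n] by (simp add: mat_basis_def)
  qed
  have neq: "a \<noteq> mat 1" if "a \<in> sl_basis" for a :: "('a, 'n) sqmat"
    using that mat_one_notin_sl_basis by blast
  have count0: "count n 0 = 1" for n
  proof (induction n)
    case (Suc n)
    have "(\<Sum>a\<in>sl_basis. \<Sum>xs\<in>basis_words n. if deg (a # xs) = 0 then 1 else 0 :: int) = 0"
      by (intro sum.neutral ballI) (simp add: deg neq)
    then show ?case using Suc by (simp add: count_def step deg)
  qed (simp add: count_def zero_words deg)
  have count1: "count n 1 = int n * (?k - 1)" for n
  proof (induction n)
    case (Suc n)
    have "(\<Sum>a\<in>sl_basis. \<Sum>xs\<in>basis_words n. if deg (a # xs) = 1 then 1 else 0 :: int) = (\<Sum>a\<in>(sl_basis :: ('a, 'n) sqmat set). 1)"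
      using count0[of n] by (intro sum.cong refl) (simp add: count_def deg neq)
    then show ?case using Suc by (simp add: count_def step deg slcard algebra_simps)
  qed (simp add: count_def zero_words deg)
  have "int (card (degree_basis (deg xs) :: ('a, 'n) sqmat set)) =
      ?k - (?k - 1) * (if deg xs = 0 then 1 else 0) - (if deg xs = 1 then 1 else 0)" for xs
    by (simp add: degree_basis_def kcard slcard)
  then have "int (card (normal_monomials n :: (('a, 'n) sqmat list \<times> _) set)) =
      (\<Sum>xs\<in>(basis_words n :: ('a, 'n) sqmat list set). ?k - (?k - 1) * (if deg xs = 0 then 1 else 0) - (if deg xs = 1 then 1 else 0))"
    unfolding normal_monomials_def by (simp add: card_SigmaI finite_basis_words finite_degree_basis deg_def)
  also have "\<dots> = ?k * int (card (basis_words n :: ('a, 'n) sqmat list set)) - (?k - 1) * count n 0 - count n 1"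
    by (simp only: sum_subtractf count_def sum_distrib_left) simp
  also have "int (card (basis_words n :: ('a, 'n) sqmat list set)) = ?k ^ n"
    by (simp add: basis_words_def card_lists_length_eq[OF finite_mat_basis] kcard)
  finally show ?thesis
    unfolding count0 count1 by (simp add: power_mult power_add algebra_simps power2_eq_square)
qed

section \<open>The generators of the ideal of identities\<close>

text \<open>
  Scalar matrices drop out of the commutator, and \<open>e\<^sub>1\<^sub>2 (e\<^sub>2\<^sub>1 + e\<^sub>3\<^sub>1) = e\<^sub>1\<^sub>1 = e\<^sub>1\<^sub>2 e\<^sub>2\<^sub>1\<close>.
\<close>

lemma quadratic_identity_in_Id_L:
  fixes \<gamma> :: "('a::field_char_0, 'n::{finite, linorder}) uea"
  assumes card: "CARD('n) \<ge> 2" and q: "quadratic_exponents \<gamma> \<alpha> \<beta>' \<beta>"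
  shows "quadratic_identity \<gamma> \<alpha> \<beta>' \<beta> i j \<in> Id_L"
proof -
  have neq: "(idx 2 :: 'n) \<noteq> idx 3" if "CARD('n) \<ge> 3"
    using that idx_eq_iff[of 2 3, where 'n = 'n] by simp
  note act = q[unfolded quadratic_exponents_def]
  have "lp_subst b (quadratic_identity \<gamma> \<alpha> \<beta>' \<beta> i j) = 0" for b
    unfolding quadratic_identity_def commutator_def lp_subst_simps lp_subst_more mat_rep.ue_rep_simps
    using neq by (simp add: act mat_mult_bilinear munit_mult mat.scale_right_distrib mult.commute)
  then show ?thesis by (simp add: Id_L_def)
qed

lemma matrix_relations_identities:
  assumes "CARD('n) \<ge> 2"
  shows "TL_ideal_generated matrix_relations \<subseteq> (Id_L :: ('a::field_char_0, 'n::{finite, linorder}) lpoly set)"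
proof (rule TL_ideal_generated_least[OF TL_ideal_Id_L])
  show "matrix_relations \<subseteq> (Id_L :: ('a, 'n) lpoly set)"
    using quadratic_identity_in_Id_L[OF assms, where 'a = 'a] by (auto simp: matrix_relations_def Id_L_def lp_subst_simps)
qed

text \<open>
  Substitution changes the variables, and exponents with the same action differ by one that acts as zero.
\<close>

lemma TL_ideal_contains_matrix_relations:
  fixes I :: "('a::field_char_0, 'n::{finite, linorder}) lpoly set"
  assumes I: "TL_ideal I" and zero: "\<And>i u. (\<And>A. mat_act u A = 0) \<Longrightarrow> lp_var i u \<in> I"
    and xy: "x \<noteq> y" and q: "quadratic_exponents \<gamma> \<alpha> \<beta>' \<beta>" "quadratic_identity \<gamma> \<alpha> \<beta>' \<beta> x y \<in> I"
  shows "matrix_relations \<subseteq> I"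
proof -
  have "quadratic_identity \<gamma>1 \<alpha>1 \<beta>1' \<beta>1 i j \<in> I" if q1: "quadratic_exponents \<gamma>1 \<alpha>1 \<beta>1' \<beta>1" for \<gamma>1 \<alpha>1 \<beta>1' \<beta>1 i j
  proof -
    have diff: "lp_endo s (f - g) = lp_endo s f - lp_endo s g" for s and f g :: "('a, 'n) lpoly"
      using lp_endo_simps(1)[of s "f - g" g] by (simp add: algebra_simps)
    have "lp_endo (\<lambda>v. if v = x then lp_var i 1 else lp_var j 1) (quadratic_identity \<gamma> \<alpha> \<beta>' \<beta> x y) =
        quadratic_identity \<gamma> \<alpha> \<beta>' \<beta> i j"
      using xy by (simp add: quadratic_identity_def commutator_def lp_endo_simps diff lp_act_var)
    then have ij: "quadratic_identity \<gamma> \<alpha> \<beta>' \<beta> i j \<in> I" using TL_ideal_endo[OF I q(2)] by metis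
    have var: "lp_var l u - lp_var l v \<in> I" if "\<And>A. mat_act u A = mat_act v A" for l u v
    proof -
      have "lp_var l (u - v) \<in> I" by (rule zero) (simp add: mat_module.ue_rep_more that)
      then show ?thesis using lp_var_add[of l "u - v" v] by (simp add: algebra_simps)
    qed
    have sum: "(f + g) - (f' + g') \<in> I" if "f - f' \<in> I" "g - g' \<in> I" for f f' g g'
      using TL_idealD(2)[OF I that] by (simp add: algebra_simps)
    have dif: "(f - g) - (f' - g') \<in> I" if "f - f' \<in> I" "g - g' \<in> I" for f f' g g'
      using TL_idealD(3)[OF I that] by (simp add: algebra_simps)
    have eq: "mat_act \<gamma>1 A = mat_act \<gamma> A" "mat_act \<alpha>1 A = mat_act \<alpha> A"
      "mat_act \<beta>1' A = mat_act \<beta>' A" "mat_act \<beta>1 A = mat_act \<beta> A" for A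
      using q(1) q1 by (simp_all add: quadratic_exponents_def)
    have "quadratic_identity \<gamma>1 \<alpha>1 \<beta>1' \<beta>1 i j - quadratic_identity \<gamma> \<alpha> \<beta>' \<beta> i j \<in> I"
      unfolding quadratic_identity_def commutator_def
      by (intro sum dif TL_ideal_cong_mult[OF I] var) (simp_all only: eq mat_rep.ue_rep_simps)
    from TL_idealD(2)[OF I this ij] show ?thesis by simp
  qed
  then show ?thesis using zero by (auto simp: matrix_relations_def)
qed

lemma quadratic_exponents_elementary:
  fixes \<rho> :: "('a::field_char_0, 'n::{finite, linorder}) sqmat \<Rightarrow> ('a, 'n) sqmat \<Rightarrow> ('a, 'n) uea"
  assumes card: "CARD('n) \<ge> 2"
    and \<rho>: "\<And>a b. a \<in> sl_basis \<Longrightarrow> b \<in> sl_basis \<Longrightarrow> is_elementary_map a b (mat_act (\<rho> a b))"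
    and \<gamma>: "is_elementary_map (mat 1) (mat 1) (mat_act (\<rho> (mat 1) (mat 1)))"
  shows "quadratic_exponents (\<rho> (mat 1) (mat 1)) (\<rho> (mat_unit 1 2) (mat_unit 1 2))
    (\<rho> (mat_unit 1 2) (mat_unit 2 1) + (if CARD('n) \<ge> 3 then \<rho> (mat_unit 1 2) (mat_unit 3 1) else 0))
    (\<rho> (mat_unit 1 2) (mat_unit 2 1))"
proof -
  have unit: "mat_unit i j \<in> (sl_basis :: ('a, 'n) sqmat set)"
    if "i \<in> {1..CARD('n)}" "j \<in> {1..CARD('n)}" "i \<noteq> j" for i j
    using that by (auto simp: sl_basis_def)
  have coord: "mat_coord (munit (idx 1) (idx 2)) A = A $ idx 1 $ idx 2" for A :: "('a, 'n) sqmat"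
    using mat_coord_off_diagonal[of 1 2 A] card by (simp add: mat_unit_munit del: One_nat_def)
  have act: "mat_act (\<rho> (mat_unit 1 2) (mat_unit i 1)) A = mat_scale (A $ idx 1 $ idx 2) (munit (idx i) (idx 1))"
    if "i \<in> {2..CARD('n)}" for i A
    using that card elementary_map_eq[OF \<rho>[OF unit[of 1 2] unit[of i 1]], of A] unit[of 1 2]
    by (simp add: coord mat_basis_def mat_unit_munit del: One_nat_def)
  have "mat_act (\<rho> (mat_unit 1 2) (mat_unit 1 2)) A = mat_scale (A $ idx 1 $ idx 2) (munit (idx 1) (idx 2))" for A
    using card elementary_map_eq[OF \<rho>[OF unit[of 1 2] unit[of 1 2]], of A] unit[of 1 2]
    by (simp add: coord mat_basis_def mat_unit_munit del: One_nat_def)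
  moreover have "mat_act (\<rho> (mat 1) (mat 1)) A = mat_scale (trace A / of_nat CARD('n)) (mat 1)" for A
    using elementary_map_eq[OF \<gamma>] by (simp add: mat_basis_def mat_coord_one)
  ultimately show ?thesis
    unfolding quadratic_exponents_def using act[of 2] act[of 3] card
    by (simp add: mat_rep.ue_rep_simps mat.scale_right_distrib mat_module.ue_rep_more del: One_nat_def)
qed

lemma generators_span_matrix_relations:
  fixes \<rho> :: "('a::field_char_0, 'n::{finite, linorder}) sqmat \<Rightarrow> ('a, 'n) sqmat \<Rightarrow> ('a, 'n) uea"
    and \<gamma> :: "('a, 'n) uea"
  assumes card: "CARD('n) \<ge> 2" and xy: "x \<noteq> y" and q: "quadratic_exponents \<gamma> \<alpha> \<beta>' \<beta>"
  shows "TL_ideal_generated {lp_var x z_elem, quadratic_identity \<gamma> \<alpha> \<beta>' \<beta> x y} =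
    TL_ideal_generated (matrix_relations :: ('a, 'n) lpoly set)" (is "?T = _")
proof (intro antisym TL_ideal_generated_least TL_ideal_generated)
  have "lp_var x z_elem \<in> (matrix_relations :: ('a, 'n) lpoly set)"
    using z_elem_acts_zero[OF card] by (auto simp: matrix_relations_def)
  moreover have "quadratic_identity \<gamma> \<alpha> \<beta>' \<beta> x y \<in> matrix_relations"
    using q xy by (auto simp: matrix_relations_def)
  ultimately show "{lp_var x z_elem, quadratic_identity \<gamma> \<alpha> \<beta>' \<beta> x y} \<subseteq> TL_ideal_generated matrix_relations"
    by (simp add: TL_ideal_generated_base)
  show "matrix_relations \<subseteq> ?T"
  proof (rule TL_ideal_contains_matrix_relations[OF TL_ideal_generated _ xy q])
    have z: "lp_var x z_elem \<in> ?T" by (rule TL_ideal_generated_base) simp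
    fix i and u :: "('a, 'n) uea" assume "\<And>A. mat_act u A = 0"
    then have "u \<in> two_sided_ideal {z_elem}" by (rule kernel_generated_by_z[OF card])
    then show "lp_var i u \<in> ?T"
      by (rule TL_ideal_exponents[OF TL_ideal_generated z])
  qed (simp add: TL_ideal_generated_base)
qed

theorem theorem4p3p1:
  fixes \<rho> :: "('a::field_char_0, 'n::{finite, linorder}) sqmat \<Rightarrow> ('a, 'n) sqmat \<Rightarrow> ('a, 'n) uea"
    and x y :: nat
  assumes "CARD('n) \<ge> 2" and "x \<noteq> y"
    and "\<And>a b. a \<in> sl_basis \<Longrightarrow> b \<in> sl_basis \<Longrightarrow> is_elementary_map a b (mat_act (\<rho> a b))"
    and "is_elementary_map (mat 1) (mat 1) (mat_act (\<rho> (mat 1) (mat 1)))"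
  shows
    "(let e = mat_unit; g = mat 1;
          \<rho>' = \<rho> (e 1 2) (e 2 1) + (if CARD('n) \<ge> 3 then \<rho> (e 1 2) (e 3 1) else 0)
      in TL_ideal_generated
           {lp_var x z_elem,
            commutator (lp_var x (\<rho> g g)) (lp_var y (\<rho> g g + \<rho> (e 1 2) (e 1 2)))
              + lp_var x (\<rho> (e 1 2) (e 1 2)) * lp_var y \<rho>'
              - lp_var y (\<rho> (e 1 2) (e 1 2)) * lp_var x (\<rho> (e 1 2) (e 2 1))}
         = (Id_L :: ('a, 'n) lpoly set)) \<and>
     (\<forall>n\<ge>1. int (codimension (Id_L :: ('a, 'n) lpoly set) n) =
        int CARD('n) ^ (2 * (n + 1)) - (int CARD('n) ^ 2 - 1) * (int n + 1))"
proof -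
  let ?T = "TL_ideal_generated matrix_relations :: ('a, 'n) lpoly set"
  note q = quadratic_exponents_elementary[OF assms(1,3,4)]
  interpret matrix_identities rf_scale "rf_deriv :: ('a, 'n) der \<Rightarrow> _" "idx 1" "idx 2" "idx 3"
    by (rule rf_matrix_identities[OF assms(1,3,4)])
  interpret rf: matrix_variety rf_scale "rf_deriv :: ('a, 'n) der \<Rightarrow> _" "idx 1" "idx 2" "idx 3" rf_class
    by unfold_locales (simp_all add: rf_class_simps rf_class_act)
  have ker: "f \<in> Id_L" if "rf_class f = 0" for f :: "('a, 'n) lpoly"
    using that matrix_relations_identities[OF assms(1), where 'a = 'a] by (auto simp: rf_class_eq_0)
  have "Id_L \<subseteq> ?T" using rf.identity_vanishes by (auto simp: rf_class_eq_0)
  then have "?T = Id_L" using matrix_relations_identities[OF assms(1)] by blast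
  then have "TL_ideal_generated {lp_var x z_elem, quadratic_identity (\<rho> (mat 1) (mat 1))
      (\<rho> (mat_unit 1 2) (mat_unit 1 2))
      (\<rho> (mat_unit 1 2) (mat_unit 2 1) + (if CARD('n) \<ge> 3 then \<rho> (mat_unit 1 2) (mat_unit 3 1) else 0))
      (\<rho> (mat_unit 1 2) (mat_unit 2 1)) x y} = Id_L"
    using generators_span_matrix_relations[OF assms(1,2) q] by simp
  moreover have "int (codimension (Id_L :: ('a, 'n) lpoly set) n) =
      int CARD('n) ^ (2 * (n + 1)) - (int CARD('n) ^ 2 - 1) * (int n + 1)" if "n \<ge> 1" for n
  proof -
    have "codimension (Id_L :: ('a, 'n) lpoly set) n =
        card (normal_monomials n :: (('a, 'n) sqmat list \<times> ('a, 'n) sqmat) set)"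
      by (rule rf.codimension_eq_card[OF that]) (erule ker)
    then show ?thesis by (simp only: card_normal_monomials)
  qed
  ultimately show ?thesis unfolding Let_def quadratic_identity_def by blast
qed

end
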